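(* Let $\mathfrak g,\mathfrak g^\theta$ be an irreducible symmetric pair and let $B\in\mathcal B$. The map $\mathcal X(u)\mapsto\mathcal P_B(u)$ ($u\in\check U^B$) defines an algebra isomorphism from $\mathcal X(\check U^B)$ onto $\mathcal P_B(\check U^B)$. Moreover, the kernel of both $\mathcal X$ and $\mathcal P_B$ upon restriction to $\check U^B$ is equal to $\check U^B\cap(B\check T_\Theta)_+\check U$.
   Context: **Lie theory.** $\mathfrak g=\mathfrak n^-\oplus\mathfrak h\oplus\mathfrak n^+$ is a complex semisimple Lie algebra with Chevalley generators $e_i,f_i$, root system $\Delta$, simple roots $\pi=\{\alpha_1,\dots,\alpha_n\}$, Weyl group $W$, and Cartan inner product $(\ ,\ )$ (with $(\alpha_i,\alpha_i)/2$ coprime positive integers on each simple factor). For a root system $\Phi$ (or its set of simple roots), $Q(\Phi),Q^+(\Phi),P(\Phi),P^+(\Phi)$ denote the root lattice, the $\mathbf N$-span of positive roots, the weight lattice and the dominant integral weights. $\theta$ is a (nontrivial) involution of $\mathfrak g$, maximally split: $\theta(\mathfrak h)=\mathfrak h$; writing $\Theta$ for the induced involution of $\mathfrak h^*$, if $\Theta(\alpha_i)=\alpha_i$ then $\theta(e_i)=e_i$, $\theta(f_i)=f_i$; otherwise $\theta(e_i)$ (resp. $\theta(f_i)$) is a nonzero root vector in $\mathfrak n^-$ (resp. $\mathfrak n^+$). The pair is irreducible: $\mathfrak g$ is not a direct sum of two nonzero $\theta$-stable semisimple subalgebras. Set $\tilde\alpha=(\alpha-\Theta(\alpha))/2$ for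 $\alpha\in\mathfrak h^*$. The restricted root system is $\Sigma=\{\tilde\alpha\mid\alpha\in\Delta,\Theta(\alpha)\ne\alpha\}$ (possibly nonreduced, type BC), with Weyl group $W_\Theta$; $P(\Sigma)$ is the set of $\lambda$ in the span of $\Sigma$ with $2(\lambda,\beta)/(\beta,\beta)\in\mathbf Z$ for all $\beta\in\Sigma$; $P(2\Sigma)=2P(\Sigma)$, $P^+(2\Sigma)=2P^+(\Sigma)$. $\pi_\Theta=\{\alpha_i\mid\Theta(\alpha_i)=\alpha_i\}$. There is a permutation $\mathrm p$ of $\{1,\dots,n\}$, inducing a diagram automorphism, with $\Theta(-\alpha_i)-\alpha_{\mathrm p(i)}\in Q^+(\pi_\Theta)$ for $\alpha_i\notin\pi_\Theta$. $\pi^*=\{\alpha_i\in\pi\setminus\pi_\Theta\mid i\le\mathrm p(i)\}$. **Quantum group.** $\mathcal C$ is the algebraic closure of (the fraction field of) the group algebra of $\{q^r\mid r\in\mathbf Q\}$ over $\mathbf C$; $\mathcal R\subset\mathcal C$ is the real closure of the analogous algebra over $\mathbf R$ (an ordered field as for $\mathbf R(q)$). $U=U_q(\mathfrak g)$ is the $\mathcal C$-Hopf algebra with generators $x_i,y_i,t_i^{\pm1}$, relations: the $t_i^{\pm1}$ commute, $t_ix_jt_i^{-1}=q^{(\alpha_i,\alpha_j)}x_j$, $t_iy_jt_i^{-1}=q^{-(\alpha_i,\alpha_j)}y_j$, $x_iy_j-y_jx_i=\delta_{ij}(t_i-t_i^{-1})/(q_i-q_i^{-1})$ with $q_i=q^{(\alpha_i,\alpha_i)/2}$,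 and the quantum Serre relations; $\Delta(x_i)=x_i\otimes1+t_i\otimes x_i$, $\Delta(y_i)=y_i\otimes t_i^{-1}+1\otimes y_i$, $\Delta(t_i)=t_i\otimes t_i$; antipode $\sigma$, counit $\epsilon$. $T=\langle t_i\rangle$, $\tau:Q(\pi)\to T$ is the isomorphism $\tau(\alpha_i)=t_i$. $U^+$ is generated by the $x_i$. $\check U$ is the extension of $U$ obtained by enlarging $T$ to $\check T=\tau(P(\pi))$, with $\tau(\gamma)s\tau(-\gamma)=q^{(\gamma,\beta)}s$ for $s$ of weight $\beta$; further enlarging to $\tau(\mu/2)$, $\mu\in P(\pi)$, is done the same way. $(\mathrm{ad}\,a)b=\sum a_{(1)}b\sigma(a_{(2)})$, $(\mathrm{ad}_r a)b=\sum\sigma(a_{(1)})ba_{(2)}$. A subscript $+$ on a subalgebra denotes its intersection with the kernel of the counit. $z^\lambda$ is the character of $\check U^0=\mathcal C[\check T]$ (and of $\mathcal C[\check{\mathcal A}]$) with $z^\lambda(\tau(\gamma))=q^{(\lambda,\gamma)}$. **The family $\mathcal B$.** $\mathcal M$ is the subalgebra generated by $x_i,y_i,t_i^{\pm1}$, $\alpha_i\in\pi_\Theta$; $\mathcal M^+=\mathcal M\cap U^+$; $T_\Theta=\{\tau(\mu)\mid\mu\in Q(\pi),\Theta(\mu)=\mu\}$. For $\alpha_i\in\pi\setminus\pi_\Theta$ let $\tilde\theta(y_i)$ be the nonzero element of weight $\Theta(-\alpha_i)$ in $(\mathrm{ad}_r\mathcal M^+)(t_{\mathrm p(i)}^{-1}x_{\mathrm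 p(i)})$ obtained by applying to $t_{\mathrm p(i)}^{-1}x_{\mathrm p(i)}$ successively $\mathrm{ad}_r$ of the divided powers $x_{j_r}^{(m_r)},\dots,x_{j_1}^{(m_1)}$ along a reduced expression $s_{j_1}\cdots s_{j_r}$ of the longest element of the Weyl group of $\pi_\Theta$ ($m_k=-2(\alpha_{j_k},s_{j_{k+1}}\cdots s_{j_r}\alpha_{\mathrm p(i)})/(\alpha_{j_k},\alpha_{j_k})$); it is the value at $y_i$ of the lift of $\theta$ to $U$, it equals $t_{\mathrm p(i)}^{-1}x_{\mathrm p(i)}$ when $\Theta(-\alpha_i)=\alpha_{\mathrm p(i)}$, and otherwise rescaling it by a nonzero element of $\mathcal R$ does not affect $\mathcal B$. Let $\mathcal S$ be the set of $\alpha_i\in\pi^*$ with $\Theta(\alpha_i)=-\alpha_i$ and $(\alpha_i,\alpha_j)/(\alpha_j,\alpha_j)\in\mathbf Z$ whenever $\Theta(\alpha_j)=-\alpha_j$; let $\mathcal D=\{\alpha_i\in\pi^*\mid i\ne\mathrm p(i),(\alpha_i,\Theta(\alpha_i))\ne0\}$; $\mathcal S\cup\mathcal D$ has at most one element. For $s,d\in\mathcal C$, $d\neq 0$, let $B_{\theta,s,d}$ be the subalgebra of $U$ generated by $\mathcal M$, $T_\Theta$ and $B_i=y_it_i+d_i\tilde\theta(y_i)t_i+s_it_i$, $\alpha_i\in\pi\setminus\pi_\Theta$, with $s_i=s$ if $\alpha_i\in\mathcal S$, $s_i=0$ otherwise, $d_i=d$ if $\alpha_i\in\mathcal D$, $d_i=1$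 otherwise. Let $\mathbf H$ be the group of Hopf algebra automorphisms of $U$ fixing $T$ elementwise. $\mathcal B$ is the union of the $\mathbf H$-orbits of: $B_{\theta,0,1}$ if $\mathcal S\cup\mathcal D=\emptyset$; all $B_{\theta,s,1}$, $s\in\mathcal R$, if $\mathcal S\ne\emptyset$; all $B_{\theta,0,d}$, $0\ne d\in\mathcal R$, if $\mathcal D\ne\emptyset$. $\check U^B=\{u\in\check U\mid(\mathrm{ad}_rb)u=\epsilon(b)u\ \forall b\in B\}$ (equivalently the centralizer of $B$ in $\check U$). **Harish-Chandra map.** $N^+$ is the subalgebra of $U^+$ generated by $(\mathrm{ad}\,\mathcal M^+)\mathcal C[x_i\mid\alpha_i\notin\pi_\Theta]$. $\check{\mathcal A}=\{\tau(\tilde\mu)\mid\mu\in P(\pi)\}$, $\check T_\Theta=\{\tau(\frac12(\mu+\Theta(\mu)))\mid\mu\in P(\pi)\}$, $\mathcal A=\{\tau(2\mu)\mid\mu\in P(\Sigma)\}$. One has $\check U\subseteq((B\check T_\Theta)_+\check U+N^+_+\check{\mathcal A})\oplus\mathcal C[\check{\mathcal A}]$ (inside the extension by the $\tau(\mu/2)$), and $\mathcal P_B:\check U\to\mathcal C[\check{\mathcal A}]$ is the resulting projection; it is an algebra homomorphism on $\check U^B$. **Radial component map.** For an additive group $H$ of weights, $\mathcal C[H]$ is the group algebra spanned by $z^\lambda$, $\lambda\in H$. $\mathcal C[Q(\Sigma)]\mathcal A$ is the algebra of operators acting on the right on $\mathcal C[P(\Sigma)]$ generated by right multiplications by $\mathcal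 C[Q(\Sigma)]$ and the operators $z^\lambda*\tau(\mu)=q^{(\lambda,\mu)}z^\lambda$, $\tau(\mu)\in\mathcal A$; $\mathcal C(Q(\Sigma))\mathcal A$ is its localization at $\mathcal C[Q(\Sigma)]\setminus\{0\}$ (acting on the right on the fraction field of $\mathcal C[P(\Sigma)]$), with $W_\Theta$ acting by $w\tau(\beta)=\tau(w\beta)$, $w(z^\mu)=z^{w\mu}$. Let $L(\lambda)$ be the simple $U$-module of highest weight $\lambda$. Fix $B'\in\mathcal B$ and, for each $\lambda\in P^+(2\Sigma)$, a basis vector $g_\lambda$ of the one-dimensional space of left $B'$- and right $B$-invariants in $L(\lambda)\otimes L(\lambda)^*$, viewed as functions on $\check U$ (so $g_\lambda(bu)=\epsilon(b)g_\lambda(u)$ for $b\in B$ and $g_\lambda(ub')=\epsilon(b')g_\lambda(u)$ for $b'\in B'$); let $\varphi_\lambda\in\mathcal C[P(2\Sigma)]$ be its restriction to $\check U^0$, where $B'$ is chosen so that all $\varphi_\lambda$ are $W_\Theta$-invariant. The radial component map $\mathcal X:\check U^B\to(\mathcal C(Q(\Sigma))\mathcal A)^{W_\Theta}$ is the algebra homomorphism with $\varphi_\lambda*\mathcal X(c)=z^\lambda(\mathcal P_B(c))\varphi_\lambda$ and $g_\lambda(c\tau(\beta))=(\varphi_\lambda*\mathcal X(c))(\tau(\beta))$ for all $c\in\check U^B$, $\lambda\in P^+(2\Sigma)$, $\tau(\beta)\in\mathcal A$. *)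

theory Defs
  imports
    Complex_Main
    "HOL-Library.Poly_Mapping"
    "HOL-Computational_Algebra.Fraction_Field"
    "HOL-Algebra.Algebraic_Closure_Type"
begin

section \<open>The ground field\<close>

text \<open>
  \<open>cc\<close> is the algebraic closure of the fraction field of the group algebra over the complex
  numbers of the group of all \<open>q\<^sup>r\<close>, \<open>r\<close> rational; the basis element \<open>single r 1\<close> of
  \<open>rat \<Rightarrow>\<^sub>0 complex\<close> is \<open>q\<^sup>r\<close>.
\<close>

type_synonym cc = "(rat \<Rightarrow>\<^sub>0 complex) fract alg_closure"

definition qpow :: "rat \<Rightarrow> cc" where
  "qpow r = to_ac (Fract (Poly_Mapping.single r 1) 1)"

definition ccst :: "complex \<Rightarrow> cc" where
  "ccst z = to_ac (Fract (Poly_Mapping.single 0 z) 1)"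

text \<open>
  A real closure, inside \<open>cc\<close>, of the fraction field of the group algebra of the \<open>q\<^sup>r\<close> over the
  real numbers: a real closed subfield containing that algebra.  Algebraicity over it is
  automatic, because all of \<open>cc\<close> is algebraic over it.  The ordering is the unique one of the real
  closed field (the nonzero squares are positive); it makes every \<open>q\<^sup>r = (q\<^sup>r\<^sup>/\<^sup>2)\<^sup>2\<close> positive.
\<close>

definition is_real_closure :: "cc set \<Rightarrow> bool" where
  "is_real_closure R \<longleftrightarrow>
     1 \<in> R \<and> (\<forall>a\<in>R. \<forall>b\<in>R. a - b \<in> R \<and> a * b \<in> R) \<and> (\<forall>a\<in>R. inverse a \<in> R) \<and>
     (\<forall>r. qpow r \<in> R) \<and> (\<forall>t. ccst (complex_of_real t) \<in> R) \<and>
     (\<forall>as. set as \<subseteq> R \<longrightarrow> (\<Sum>a\<leftarrow>as. a\<^sup>2) \<noteq> - 1) \<and>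
     (\<forall>a\<in>R. \<exists>b\<in>R. b\<^sup>2 = a \<or> b\<^sup>2 = - a) \<and>
     (\<forall>p. odd (degree p) \<and> (\<forall>i. coeff p i \<in> R) \<longrightarrow> (\<exists>a\<in>R. poly p a = 0))"

definition qint :: "cc \<Rightarrow> nat \<Rightarrow> cc" where
  "qint v m = (v ^ m - inverse v ^ m) / (v - inverse v)"

definition qfact :: "cc \<Rightarrow> nat \<Rightarrow> cc" where
  "qfact v m = (\<Prod>k=1..m. qint v k)"

definition qbinom :: "cc \<Rightarrow> nat \<Rightarrow> nat \<Rightarrow> cc" where
  "qbinom v m k = qfact v m / (qfact v k * qfact v (m - k))"


section \<open>Vector spaces, algebras and Hopf algebras over the ground field\<close>

class cvec = ab_group_add +
  fixes qscale :: "cc \<Rightarrow> 'a \<Rightarrow> 'a" (infixr "*\<^sub>q" 75)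
  assumes qscale_add_right: "c *\<^sub>q (a + b) = c *\<^sub>q a + c *\<^sub>q b"
    and qscale_add_left: "(c + d) *\<^sub>q a = c *\<^sub>q a + d *\<^sub>q a"
    and qscale_qscale: "c *\<^sub>q d *\<^sub>q a = (c * d) *\<^sub>q a"
    and qscale_one: "1 *\<^sub>q a = a"

interpretation cv: vector_space "qscale :: cc \<Rightarrow> 'a \<Rightarrow> 'a::cvec"
  by unfold_locales (simp_all add: qscale_add_right qscale_add_left qscale_qscale qscale_one)

class calg = ring_1 + cvec +
  assumes qscale_mult_left: "(c *\<^sub>q a) * b = c *\<^sub>q (a * b)"
    and qscale_mult_right: "a * (c *\<^sub>q b) = c *\<^sub>q (a * b)"

definition subalg :: "'a::calg set \<Rightarrow> bool" where
  "subalg A \<longleftrightarrow> cv.subspace A \<and> 1 \<in> A \<and> (\<forall>a\<in>A. \<forall>b\<in>A. a * b \<in> A)"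

abbreviation alg_gen :: "'a::calg set \<Rightarrow> 'a set" where
  "alg_gen S \<equiv> subalg hull S"

definition span_prod :: "'a::calg set \<Rightarrow> 'a set \<Rightarrow> 'a set" where
  "span_prod A C = cv.span {a * c | a c. a \<in> A \<and> c \<in> C}"

definition (in cvec) qlin :: "('a \<Rightarrow> 'a) \<Rightarrow> bool" where
  "qlin f \<longleftrightarrow> (\<forall>a b. f (a + b) = f a + f b) \<and> (\<forall>c a. f (c *\<^sub>q a) = c *\<^sub>q f a)"

definition (in cvec) bilin :: "('a \<Rightarrow> 'a \<Rightarrow> 'a) \<Rightarrow> bool" where
  "bilin f \<longleftrightarrow> (\<forall>a. qlin (f a)) \<and> (\<forall>b. qlin (\<lambda>a. f a b))"

definition (in cvec) trilin :: "('a \<Rightarrow> 'a \<Rightarrow> 'a \<Rightarrow> 'a) \<Rightarrow> bool" where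
  "trilin f \<longleftrightarrow> (\<forall>a. bilin (f a)) \<and> (\<forall>b c. qlin (\<lambda>a. f a b c))"

text \<open>
  A list of pairs \<open>[(a\<^sub>1, b\<^sub>1), \<dots>, (a\<^sub>m, b\<^sub>m)]\<close> stands for the tensor
  \<open>a\<^sub>1 \<otimes> b\<^sub>1 + \<dots> + a\<^sub>m \<otimes> b\<^sub>m\<close>.  Two lists give the same tensor iff every bilinear map
  takes the same value on them (bilinear maps with values in the space itself suffice over a
  field).  With this convention Sweedler sums are sums over lists.
\<close>

definition (in cvec) tensor_eq :: "('a \<times> 'a) list \<Rightarrow> ('a \<times> 'a) list \<Rightarrow> bool" where
  "tensor_eq xs ys \<longleftrightarrow>
     (\<forall>f. bilin f \<longrightarrow> (\<Sum>(a, b)\<leftarrow>xs. f a b) = (\<Sum>(a, b)\<leftarrow>ys. f a b))"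

class chopf = calg +
  fixes comul :: "'a \<Rightarrow> ('a \<times> 'a) list"
    and counit :: "'a \<Rightarrow> cc"
    and antipode :: "'a \<Rightarrow> 'a"
  assumes comul_add: "tensor_eq (comul (a + b)) (comul a @ comul b)"
    and comul_scale: "tensor_eq (comul (c *\<^sub>q a)) (map (\<lambda>(u, v). (c *\<^sub>q u, v)) (comul a))"
    and comul_mult: "tensor_eq (comul (a * b))
                       [(u * u', v * v'). (u, v) \<leftarrow> comul a, (u', v') \<leftarrow> comul b]"
    and comul_one: "tensor_eq (comul 1) [(1, 1)]"
    and coassoc: "trilin f \<Longrightarrow>
        (\<Sum>(u, v)\<leftarrow>comul a. \<Sum>(u', u'')\<leftarrow>comul u. f u' u'' v) =
        (\<Sum>(u, v)\<leftarrow>comul a. \<Sum>(v', v'')\<leftarrow>comul v. f u v' v'')"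
    and counit_add: "counit (a + b) = counit a + counit b"
    and counit_scale: "counit (c *\<^sub>q a) = c * counit a"
    and counit_mult: "counit (a * b) = counit a * counit b"
    and counit_one: "counit 1 = 1"
    and counit_left: "(\<Sum>(u, v)\<leftarrow>comul a. counit u *\<^sub>q v) = a"
    and counit_right: "(\<Sum>(u, v)\<leftarrow>comul a. counit v *\<^sub>q u) = a"
    and antipode_add: "antipode (a + b) = antipode a + antipode b"
    and antipode_scale: "antipode (c *\<^sub>q a) = c *\<^sub>q antipode a"
    and antipode_left: "(\<Sum>(u, v)\<leftarrow>comul a. antipode u * v) = counit a *\<^sub>q 1"
    and antipode_right: "(\<Sum>(u, v)\<leftarrow>comul a. u * antipode v) = counit a *\<^sub>q 1"

definition ad :: "'a::chopf \<Rightarrow> 'a \<Rightarrow> 'a" where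
  "ad a b = (\<Sum>(u, v)\<leftarrow>comul a. u * b * antipode v)"

definition adr :: "'a::chopf \<Rightarrow> 'a \<Rightarrow> 'a" where
  "adr a b = (\<Sum>(u, v)\<leftarrow>comul a. antipode u * b * v)"

definition aug :: "'a::chopf set \<Rightarrow> 'a set" where
  "aug A = {a \<in> A. counit a = 0}"


section \<open>Free algebras and presentations\<close>

datatype 'x word = Word (letters: "'x list")

instantiation word :: (type) monoid_add
begin
definition zero_word :: "'a word" where "zero_word = Word []"
definition plus_word :: "'a word \<Rightarrow> 'a word \<Rightarrow> 'a word" where
  "plus_word v w = Word (letters v @ letters w)"
instance by standard (auto simp: zero_word_def plus_word_def)
end

text \<open>The free algebra on \<open>'x\<close> is the monoid algebra of the (additively written) free monoid.\<close>

type_synonym 'x free = "'x word \<Rightarrow>\<^sub>0 cc"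

definition gen :: "'x \<Rightarrow> 'x free" where
  "gen x = Poly_Mapping.single (Word [x]) 1"

definition fconst :: "cc \<Rightarrow> 'x free" where
  "fconst c = Poly_Mapping.single 0 c"

definition feval :: "('x \<Rightarrow> 'a::calg) \<Rightarrow> 'x free \<Rightarrow> 'a" where
  "feval g p = (\<Sum>w\<in>Poly_Mapping.keys p. Poly_Mapping.lookup p w *\<^sub>q prod_list (map g (letters w)))"

definition two_sided_ideal :: "'x free set \<Rightarrow> bool" where
  "two_sided_ideal I \<longleftrightarrow> 0 \<in> I \<and> (\<forall>p\<in>I. \<forall>r\<in>I. p + r \<in> I) \<and> (\<forall>p\<in>I. \<forall>r. p * r \<in> I \<and> r * p \<in> I)"

definition presented_by :: "('x \<Rightarrow> 'a::calg) \<Rightarrow> 'x free set \<Rightarrow> bool" where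
  "presented_by g Rel \<longleftrightarrow> range (feval g) = UNIV \<and> {p. feval g p = 0} = two_sided_ideal hull Rel"


section \<open>Complex Lie algebras\<close>

class complex_lie = ab_group_add +
  fixes lscale :: "complex \<Rightarrow> 'a \<Rightarrow> 'a" (infixr "*\<^sub>l" 75)
    and lie :: "'a \<Rightarrow> 'a \<Rightarrow> 'a"
  assumes lscale_add_right: "c *\<^sub>l (a + b) = c *\<^sub>l a + c *\<^sub>l b"
    and lscale_add_left: "(c + d) *\<^sub>l a = c *\<^sub>l a + d *\<^sub>l a"
    and lscale_lscale: "c *\<^sub>l d *\<^sub>l a = (c * d) *\<^sub>l a"
    and lscale_one: "1 *\<^sub>l a = a"
    and lie_add_left: "lie (a + b) x = lie a x + lie b x"
    and lie_add_right: "lie x (a + b) = lie x a + lie x b"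
    and lie_scale_left: "lie (c *\<^sub>l a) x = c *\<^sub>l lie a x"
    and lie_scale_right: "lie x (c *\<^sub>l a) = c *\<^sub>l lie x a"
    and lie_self: "lie a a = 0"
    and jacobi: "lie a (lie b x) + lie b (lie x a) + lie x (lie a b) = 0"

interpretation lv: vector_space "lscale :: complex \<Rightarrow> 'a \<Rightarrow> 'a::complex_lie"
  by unfold_locales (simp_all add: lscale_add_right lscale_add_left lscale_lscale lscale_one)

definition lie_subalg :: "'g::complex_lie set \<Rightarrow> bool" where
  "lie_subalg S \<longleftrightarrow> lv.subspace S \<and> (\<forall>a\<in>S. \<forall>b\<in>S. lie a b \<in> S)"

definition lie_span :: "'g::complex_lie set \<Rightarrow> 'g set \<Rightarrow> 'g set" where
  "lie_span S T = lv.span {lie a b | a b. a \<in> S \<and> b \<in> T}"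

definition lie_ideal :: "'g::complex_lie set \<Rightarrow> 'g set \<Rightarrow> bool" where
  "lie_ideal I S \<longleftrightarrow> lv.subspace I \<and> I \<subseteq> S \<and> (\<forall>a\<in>S. \<forall>b\<in>I. lie a b \<in> I)"

definition lie_solvable :: "'g::complex_lie set \<Rightarrow> bool" where
  "lie_solvable S \<longleftrightarrow> (\<exists>k. ((\<lambda>T. lie_span T T) ^^ k) S = {0})"

definition lie_nilpotent :: "'g::complex_lie set \<Rightarrow> bool" where
  "lie_nilpotent S \<longleftrightarrow> (\<exists>k. (lie_span S ^^ k) S = {0})"

definition lie_semisimple :: "'g::complex_lie set \<Rightarrow> bool" where
  "lie_semisimple S \<longleftrightarrow> lie_subalg S \<and> (\<forall>I. lie_ideal I S \<and> lie_solvable I \<longrightarrow> I = {0})"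

definition cartan_subalg :: "'g::complex_lie set \<Rightarrow> bool" where
  "cartan_subalg h \<longleftrightarrow> lie_subalg h \<and> lie_nilpotent h \<and> {a. \<forall>b\<in>h. lie a b \<in> h} = h"

definition lie_auto :: "('g::complex_lie \<Rightarrow> 'g) \<Rightarrow> bool" where
  "lie_auto \<theta> \<longleftrightarrow> bij \<theta> \<and> Vector_Spaces.linear (*\<^sub>l) (*\<^sub>l) \<theta> \<and> (\<forall>a b. \<theta> (lie a b) = lie (\<theta> a) (\<theta> b))"

definition root_space :: "'g::complex_lie set \<Rightarrow> ('g \<Rightarrow> complex) \<Rightarrow> 'g set" where
  "root_space h a = {x. \<forall>H\<in>h. lie H x = a H *\<^sub>l x}"


section \<open>Weights\<close>

text \<open>
  \<open>'n\<close> is the index set of the simple roots.  All weights that occur are rational combinations of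
  simple roots; they are represented by their coordinates.  The lexicographic linear order which
  the library puts on \<open>'n wt\<close> has no meaning here: it only provides the type-class instance by
  which group algebras \<open>'n wt \<Rightarrow>\<^sub>0 cc\<close> are integral domains.
\<close>

type_synonym 'n wt = "'n \<Rightarrow>\<^sub>0 rat"

abbreviation crd :: "'n wt \<Rightarrow> 'n \<Rightarrow> rat" where "crd \<equiv> Poly_Mapping.lookup"

definition sr :: "'n \<Rightarrow> 'n wt" where
  "sr i = Poly_Mapping.single i 1"

definition rscale :: "rat \<Rightarrow> 'n wt \<Rightarrow> 'n wt" where
  "rscale r v = Poly_Mapping.map ((*) r) v"

text \<open>
  The data of a symmetric pair: Cartan matrix \<open>a\<^sub>i\<^sub>j = 2(\<alpha>\<^sub>i,\<alpha>\<^sub>j)/(\<alpha>\<^sub>i,\<alpha>\<^sub>i)\<close>, half square lengths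
  \<open>(\<alpha>\<^sub>i,\<alpha>\<^sub>i)/2\<close>, root system, involution \<open>\<Theta>\<close> of the weights, permutation \<open>p\<close>; followed by the
  generators \<open>x\<^sub>i\<close>, \<open>y\<^sub>i\<close> and \<open>\<tau>(v)\<close> of the quantum group.
\<close>

record ('n, 'u) qsp =
  cart :: "'n \<Rightarrow> 'n \<Rightarrow> int"
  half_len :: "'n \<Rightarrow> nat"
  roots :: "'n wt set"
  Th :: "'n wt \<Rightarrow> 'n wt"
  prm :: "'n \<Rightarrow> 'n"
  gx :: "'n \<Rightarrow> 'u"
  gy :: "'n \<Rightarrow> 'u"
  tau :: "'n wt \<Rightarrow> 'u"

text \<open>The Cartan inner product, from \<open>(\<alpha>\<^sub>i,\<alpha>\<^sub>j) = (\<alpha>\<^sub>i,\<alpha>\<^sub>i)/2 * a\<^sub>i\<^sub>j\<close>.\<close>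

definition ip :: "('n::finite, 'u) qsp \<Rightarrow> 'n wt \<Rightarrow> 'n wt \<Rightarrow> rat" where
  "ip D u v = (\<Sum>i\<in>UNIV. \<Sum>j\<in>UNIV. crd u i * crd v j * of_nat (half_len D i) * of_int (cart D i j))"

definition refl :: "('n::finite, 'u) qsp \<Rightarrow> 'n wt \<Rightarrow> 'n wt \<Rightarrow> 'n wt" where
  "refl D b v = v - rscale (2 * ip D v b / ip D b b) b"

definition pos_roots :: "('n, 'u) qsp \<Rightarrow> 'n wt set" where
  "pos_roots D = {v \<in> roots D. \<forall>i. crd v i \<ge> 0}"

text \<open>Index sets of \<open>\<pi>\<^sub>\<Theta>\<close>, \<open>\<pi>\<^sup>*\<close>, \<open>\<S>\<close> and \<open>\<D>\<close>.\<close>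

definition piTh :: "('n, 'u) qsp \<Rightarrow> 'n set" where
  "piTh D = {i. Th D (sr i) = sr i}"

definition pi_star :: "('n::linorder, 'u) qsp \<Rightarrow> 'n set" where
  "pi_star D = {i. i \<notin> piTh D \<and> i \<le> prm D i}"

definition setS :: "('n::{finite,linorder}, 'u) qsp \<Rightarrow> 'n set" where
  "setS D = {i \<in> pi_star D. Th D (sr i) = - sr i \<and>
     (\<forall>j. Th D (sr j) = - sr j \<longrightarrow> ip D (sr i) (sr j) / ip D (sr j) (sr j) \<in> \<int>)}"

definition setD :: "('n::{finite,linorder}, 'u) qsp \<Rightarrow> 'n set" where
  "setD D = {i \<in> pi_star D. i \<noteq> prm D i \<and> ip D (sr i) (Th D (sr i)) \<noteq> 0}"

definition Qpi :: "'n wt set" where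
  "Qpi = {v. \<forall>i. crd v i \<in> \<int>}"

definition Ppi :: "('n::finite, 'u) qsp \<Rightarrow> 'n wt set" where
  "Ppi D = {v. \<forall>i. 2 * ip D v (sr i) / ip D (sr i) (sr i) \<in> \<int>}"

definition QplusTh :: "('n, 'u) qsp \<Rightarrow> 'n wt set" where
  "QplusTh D = {v. (\<forall>i\<in>piTh D. crd v i \<in> \<nat>) \<and> (\<forall>i. i \<notin> piTh D \<longrightarrow> crd v i = 0)}"

definition tilde :: "('n, 'u) qsp \<Rightarrow> 'n wt \<Rightarrow> 'n wt" where
  "tilde D v = rscale (1/2) (v - Th D v)"

definition Sigma_r :: "('n, 'u) qsp \<Rightarrow> 'n wt set" where
  "Sigma_r D = {tilde D v | v. v \<in> roots D \<and> Th D v \<noteq> v}"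

definition Sigma_pos :: "('n, 'u) qsp \<Rightarrow> 'n wt set" where
  "Sigma_pos D = {tilde D v | v. v \<in> pos_roots D \<and> Th D v \<noteq> v}"

definition QSigma :: "('n, 'u) qsp \<Rightarrow> 'n wt set" where
  "QSigma D = {\<Sum>b\<in>Sigma_r D. rscale (of_int (k b)) b | k. True}"

definition PSigma :: "('n::finite, 'u) qsp \<Rightarrow> 'n wt set" where
  "PSigma D = {v. (\<exists>k. v = (\<Sum>b\<in>Sigma_r D. rscale (k b) b)) \<and>
                  (\<forall>b\<in>Sigma_r D. 2 * ip D v b / ip D b b \<in> \<int>)}"

definition PplusSigma :: "('n::finite, 'u) qsp \<Rightarrow> 'n wt set" where
  "PplusSigma D = {v \<in> PSigma D. \<forall>b\<in>Sigma_pos D. ip D v b \<ge> 0}"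

definition P2Sigma :: "('n::finite, 'u) qsp \<Rightarrow> 'n wt set" where
  "P2Sigma D = rscale 2 ` PSigma D"

definition Pplus2Sigma :: "('n::finite, 'u) qsp \<Rightarrow> 'n wt set" where
  "Pplus2Sigma D = rscale 2 ` PplusSigma D"

text \<open>The restricted Weyl group, as a group of transformations of the whole weight space.\<close>

definition WTh :: "('n::finite, 'u) qsp \<Rightarrow> ('n wt \<Rightarrow> 'n wt) set" where
  "WTh D = {foldr (\<lambda>b w. refl D b \<circ> w) bs id | bs. set bs \<subseteq> Sigma_r D}"

definition sword :: "('n::finite, 'u) qsp \<Rightarrow> 'n list \<Rightarrow> 'n wt \<Rightarrow> 'n wt" where
  "sword D js = foldr (\<lambda>j w. refl D (sr j) \<circ> w) js id"

definition reducedTh :: "('n::finite, 'u) qsp \<Rightarrow> 'n list \<Rightarrow> bool" where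
  "reducedTh D js \<longleftrightarrow> set js \<subseteq> piTh D \<and>
     (\<forall>ks. set ks \<subseteq> piTh D \<and> sword D ks = sword D js \<longrightarrow> length js \<le> length ks)"

text \<open>A reduced expression of the longest element of the Weyl group of \<open>\<pi>\<^sub>\<Theta>\<close>.\<close>

definition w0Th :: "('n::finite, 'u) qsp \<Rightarrow> 'n list" where
  "w0Th D = (SOME js. reducedTh D js \<and> (\<forall>ks. reducedTh D ks \<longrightarrow> length ks \<le> length js))"


section \<open>Symmetric pairs\<close>

definition wfun :: "('n::finite \<Rightarrow> 'g \<Rightarrow> complex) \<Rightarrow> 'n wt \<Rightarrow> 'g \<Rightarrow> complex" where
  "wfun \<alpha> v H = (\<Sum>i\<in>UNIV. of_rat (crd v i) * \<alpha> i H)"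

definition lin_on :: "'g::complex_lie set \<Rightarrow> ('g \<Rightarrow> complex) \<Rightarrow> bool" where
  "lin_on h a \<longleftrightarrow> (\<forall>H\<in>h. \<forall>K\<in>h. a (H + K) = a H + a K) \<and> (\<forall>c. \<forall>H\<in>h. a (c *\<^sub>l H) = c * a H)"

definition is_root :: "'g::complex_lie set \<Rightarrow> ('g \<Rightarrow> complex) \<Rightarrow> bool" where
  "is_root h a \<longleftrightarrow> lin_on h a \<and> (\<exists>H\<in>h. a H \<noteq> 0) \<and> root_space h a \<noteq> {0}"

text \<open>
  \<open>\<alpha>\<close> is a base of the root system of the complex semisimple Lie algebra \<open>'g\<close> with respect to its
  Cartan subalgebra \<open>h\<close>, and \<open>e\<close>, \<open>f\<close> are Chevalley generators.
\<close>

definition chevalley ::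
    "'g::complex_lie set \<Rightarrow> ('n::finite \<Rightarrow> 'g \<Rightarrow> complex) \<Rightarrow> ('n \<Rightarrow> 'g) \<Rightarrow> ('n \<Rightarrow> 'g) \<Rightarrow> bool" where
  "chevalley h \<alpha> e f \<longleftrightarrow>
     (\<exists>S::'g set. finite S \<and> lv.span S = UNIV) \<and> lie_semisimple (UNIV :: 'g set) \<and>
     cartan_subalg h \<and>
     (\<forall>i. is_root h (\<alpha> i)) \<and>
     (\<forall>c. (\<forall>H\<in>h. (\<Sum>i\<in>UNIV. c i * \<alpha> i H) = 0) \<longrightarrow> (\<forall>i. c i = 0)) \<and>
     (\<forall>a. is_root h a \<longrightarrow> (\<exists>v. (\<forall>H\<in>h. a H = wfun \<alpha> v H) \<and>
         ((\<forall>i. crd v i \<in> \<nat>) \<or> (\<forall>i. - crd v i \<in> \<nat>)))) \<and>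
     (\<forall>i. e i \<in> root_space h (\<alpha> i) \<and> f i \<in> root_space h (\<lambda>H. - \<alpha> i H) \<and>
          \<alpha> i (lie (e i) (f i)) = 2)"

definition irreducible_pair :: "('g::complex_lie \<Rightarrow> 'g) \<Rightarrow> bool" where
  "irreducible_pair \<theta> \<longleftrightarrow> \<not> (\<exists>S T. lie_semisimple S \<and> lie_semisimple T \<and> S \<noteq> {0} \<and> T \<noteq> {0} \<and>
      \<theta> ` S \<subseteq> S \<and> \<theta> ` T \<subseteq> T \<and> (\<forall>a\<in>S. \<forall>b\<in>T. lie a b = 0) \<and>
      S \<inter> T = {0} \<and> {a + b | a b. a \<in> S \<and> b \<in> T} = UNIV)"

text \<open>
  \<open>\<theta>\<close> is a maximally split involution such that the pair is irreducible, and the first five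
  components of \<open>D\<close> are the data attached to it.
\<close>

definition symmetric_pair ::
    "'g::complex_lie set \<Rightarrow> ('n::{finite,linorder} \<Rightarrow> 'g \<Rightarrow> complex) \<Rightarrow> ('n \<Rightarrow> 'g) \<Rightarrow> ('n \<Rightarrow> 'g) \<Rightarrow>
     ('g \<Rightarrow> 'g) \<Rightarrow> ('n, 'u) qsp \<Rightarrow> bool" where
  "symmetric_pair h \<alpha> e f \<theta> D \<longleftrightarrow>
     chevalley h \<alpha> e f \<and>
     (\<forall>i j. of_int (cart D i j) = \<alpha> j (lie (e i) (f i))) \<and>
     (\<forall>i. half_len D i > 0) \<and>
     (\<forall>i j. int (half_len D i) * cart D i j = int (half_len D j) * cart D j i) \<and>
     (\<forall>i. Gcd (half_len D ` {j. (i, j) \<in> {(k, l). cart D k l \<noteq> 0}\<^sup>*}) = 1) \<and>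
     roots D = {v. is_root h (wfun \<alpha> v)} \<and>
     lie_auto \<theta> \<and> \<theta> \<circ> \<theta> = id \<and> \<theta> \<noteq> id \<and> \<theta> ` h = h \<and>
     (\<forall>v. \<forall>H\<in>h. wfun \<alpha> (Th D v) H = wfun \<alpha> v (\<theta> H)) \<and>
     (\<forall>i. Th D (sr i) = sr i \<longrightarrow> \<theta> (e i) = e i \<and> \<theta> (f i) = f i) \<and>
     (\<forall>i. Th D (sr i) \<noteq> sr i \<longrightarrow>
        (\<exists>b\<in>pos_roots D. \<theta> (e i) \<in> root_space h (wfun \<alpha> (- b)) - {0}) \<and>
        (\<exists>b\<in>pos_roots D. \<theta> (f i) \<in> root_space h (wfun \<alpha> b) - {0})) \<and>
     irreducible_pair \<theta> \<and>
     bij (prm D) \<and> (\<forall>i j. cart D (prm D i) (prm D j) = cart D i j) \<and>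
     (\<forall>i. i \<notin> piTh D \<longrightarrow> Th D (- sr i) - sr (prm D i) \<in> QplusTh D)"


section \<open>The quantized enveloping algebra\<close>

text \<open>
  The ambient type \<open>'u\<close> is the quantized enveloping algebra whose torus consists of all \<open>\<tau>(v)\<close>,
  \<open>v\<close> a rational combination of roots.  \<open>U\<close> is its subalgebra generated by \<open>x\<^sub>i\<close>, \<open>y\<^sub>i\<close> and
  \<open>\<tau>(Q(\<pi>))\<close>; likewise for the extension with \<open>\<tau>(P(\<pi>))\<close>.  The elements \<open>\<tau>(\<mu>/2)\<close>,
  \<open>\<mu> \<in> P(\<pi>)\<close>, belong to the ambient algebra.
\<close>

datatype 'n qgen = GX 'n | GY 'n | GT "'n wt"

definition qroot :: "('n, 'u) qsp \<Rightarrow> 'n \<Rightarrow> cc" where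
  "qroot D i = qpow (of_nat (half_len D i))"

definition serre :: "('n, 'u) qsp \<Rightarrow> 'n qgen \<Rightarrow> 'n qgen \<Rightarrow> 'n \<Rightarrow> 'n \<Rightarrow> 'n qgen free" where
  "serre D a b i j = (let N = nat (1 - cart D i j) in
     \<Sum>m\<le>N. fconst ((- 1) ^ m * qbinom (qroot D i) N m) * gen a ^ (N - m) * gen b * gen a ^ m)"

definition q_relations :: "('n::finite, 'u) qsp \<Rightarrow> 'n qgen free set" where
  "q_relations D =
     {gen (GT 0) - 1} \<union>
     {gen (GT u) * gen (GT v) - gen (GT (u + v)) | u v. True} \<union>
     {gen (GT v) * gen (GX j) - fconst (qpow (ip D v (sr j))) * gen (GX j) * gen (GT v) | v j. True} \<union>
     {gen (GT v) * gen (GY j) - fconst (qpow (- ip D v (sr j))) * gen (GY j) * gen (GT v) | v j. True} \<union>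
     {gen (GX i) * gen (GY j) - gen (GY j) * gen (GX i) -
        (if i = j then fconst (1 / (qroot D i - inverse (qroot D i))) *
                       (gen (GT (sr i)) - gen (GT (- sr i))) else 0) | i j. True} \<union>
     {serre D (GX i) (GX j) i j | i j. i \<noteq> j} \<union>
     {serre D (GY i) (GY j) i j | i j. i \<noteq> j}"

text \<open>Counit and antipode are determined by the comultiplication.\<close>

definition quantum_group :: "('n::finite, 'u::chopf) qsp \<Rightarrow> bool" where
  "quantum_group D \<longleftrightarrow>
     presented_by (case_qgen (gx D) (gy D) (tau D)) (q_relations D) \<and>
     (\<forall>i. tensor_eq (comul (gx D i)) [(gx D i, 1), (tau D (sr i), gx D i)]) \<and>
     (\<forall>i. tensor_eq (comul (gy D i)) [(gy D i, tau D (- sr i)), (1, gy D i)]) \<and>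
     (\<forall>v. tensor_eq (comul (tau D v)) [(tau D v, tau D v)])"

definition Uq :: "('n, 'u::calg) qsp \<Rightarrow> 'u set" where
  "Uq D = alg_gen (range (gx D) \<union> range (gy D) \<union> tau D ` Qpi)"

definition Uch :: "('n::finite, 'u::calg) qsp \<Rightarrow> 'u set" where
  "Uch D = alg_gen (range (gx D) \<union> range (gy D) \<union> tau D ` Ppi D)"

definition Uplus :: "('n, 'u::calg) qsp \<Rightarrow> 'u set" where
  "Uplus D = alg_gen (range (gx D))"

definition Mq :: "('n, 'u::calg) qsp \<Rightarrow> 'u set" where
  "Mq D = alg_gen (gx D ` piTh D \<union> gy D ` piTh D \<union>
                   (\<lambda>i. tau D (sr i)) ` piTh D \<union> (\<lambda>i. tau D (- sr i)) ` piTh D)"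

definition Mplus :: "('n, 'u::calg) qsp \<Rightarrow> 'u set" where
  "Mplus D = Mq D \<inter> Uplus D"

definition TTh :: "('n, 'u) qsp \<Rightarrow> 'u set" where
  "TTh D = tau D ` {v \<in> Qpi. Th D v = v}"


section \<open>The coideal subalgebras\<close>

definition xdiv :: "('n, 'u::calg) qsp \<Rightarrow> 'n \<Rightarrow> nat \<Rightarrow> 'u" where
  "xdiv D j m = (1 / qfact (qroot D j) m) *\<^sub>q gx D j ^ m"

text \<open>
  \<open>ad_divided D b a [j\<^sub>1, \<dots>, j\<^sub>r]\<close> applies the divided powers for \<open>j\<^sub>r\<close>, then \<open>j\<^sub>r\<^sub>-\<^sub>1\<close>, \<open>\<dots>\<close>,
  and finally \<open>j\<^sub>1\<close> to the element \<open>a\<close> of weight \<open>b\<close>.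
\<close>

primrec ad_divided :: "('n::finite, 'u::chopf) qsp \<Rightarrow> 'n wt \<Rightarrow> 'u \<Rightarrow> 'n list \<Rightarrow> 'u" where
  "ad_divided D b a [] = a"
| "ad_divided D b a (j # js) =
     adr (xdiv D j (nat \<lfloor>- 2 * ip D (sr j) (sword D js b) / ip D (sr j) (sr j)\<rfloor>))
         (ad_divided D b a js)"

definition th_y :: "('n::finite, 'u::chopf) qsp \<Rightarrow> 'n \<Rightarrow> 'u" where
  "th_y D i = ad_divided D (sr (prm D i)) (tau D (- sr (prm D i)) * gx D (prm D i)) (w0Th D)"

definition Bgen :: "('n::{finite,linorder}, 'u::chopf) qsp \<Rightarrow> cc \<Rightarrow> cc \<Rightarrow> 'n \<Rightarrow> 'u" where
  "Bgen D s d i = gy D i * tau D (sr i)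
     + (if i \<in> setD D then d else 1) *\<^sub>q (th_y D i * tau D (sr i))
     + (if i \<in> setS D then s else 0) *\<^sub>q tau D (sr i)"

definition Bstd :: "('n::{finite,linorder}, 'u::chopf) qsp \<Rightarrow> cc \<Rightarrow> cc \<Rightarrow> 'u set" where
  "Bstd D s d = alg_gen (Mq D \<union> TTh D \<union> Bgen D s d ` (- piTh D))"

definition HAut :: "('n, 'u::chopf) qsp \<Rightarrow> ('u \<Rightarrow> 'u) set" where
  "HAut D = {\<psi>. bij_betw \<psi> (Uq D) (Uq D) \<and> \<psi> 1 = 1 \<and>
     (\<forall>a\<in>Uq D. \<forall>b\<in>Uq D. \<psi> (a + b) = \<psi> a + \<psi> b \<and> \<psi> (a * b) = \<psi> a * \<psi> b) \<and>
     (\<forall>c. \<forall>a\<in>Uq D. \<psi> (c *\<^sub>q a) = c *\<^sub>q \<psi> a) \<and>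
     (\<forall>a\<in>Uq D. \<forall>xs. set xs \<subseteq> Uq D \<times> Uq D \<and> tensor_eq (comul a) xs \<longrightarrow>
        tensor_eq (comul (\<psi> a)) (map (map_prod \<psi> \<psi>) xs)) \<and>
     (\<forall>a\<in>Uq D. counit (\<psi> a) = counit a \<and> antipode (\<psi> a) = \<psi> (antipode a)) \<and>
     (\<forall>v\<in>Qpi. \<psi> (tau D v) = tau D v)}"

definition Bfam :: "cc set \<Rightarrow> ('n::{finite,linorder}, 'u::chopf) qsp \<Rightarrow> 'u set set" where
  "Bfam R D = {\<psi> ` Bstd D s d | \<psi> s d. \<psi> \<in> HAut D \<and>
     ((setS D \<union> setD D = {} \<and> s = 0 \<and> d = 1) \<or>
      (setS D \<noteq> {} \<and> s \<in> R \<and> d = 1) \<or>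
      (setD D \<noteq> {} \<and> s = 0 \<and> d \<in> R \<and> d \<noteq> 0))}"

definition UB :: "('n::finite, 'u::chopf) qsp \<Rightarrow> 'u set \<Rightarrow> 'u set" where
  "UB D B = {u \<in> Uch D. \<forall>b\<in>B. adr b u = counit b *\<^sub>q u}"


section \<open>The Harish-Chandra map\<close>

definition Nplus :: "('n, 'u::chopf) qsp \<Rightarrow> 'u set" where
  "Nplus D = alg_gen {ad m c | m c. m \<in> Mplus D \<and> c \<in> alg_gen (gx D ` (- piTh D))}"

definition Ach :: "('n::finite, 'u) qsp \<Rightarrow> 'u set" where
  "Ach D = {tau D (tilde D v) | v. v \<in> Ppi D}"

definition TThch :: "('n::finite, 'u) qsp \<Rightarrow> 'u set" where
  "TThch D = {tau D (rscale (1/2) (v + Th D v)) | v. v \<in> Ppi D}"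

text \<open>For subalgebras \<open>B\<close> and \<open>T\<close> that normalize each other, \<open>span_prod B T\<close> is the subalgebra \<open>B T\<close>.\<close>

definition BTplusU :: "('n::finite, 'u::chopf) qsp \<Rightarrow> 'u set \<Rightarrow> 'u set" where
  "BTplusU D B = span_prod (aug (span_prod B (TThch D))) (Uch D)"

definition HC_complement :: "('n::finite, 'u::chopf) qsp \<Rightarrow> 'u set \<Rightarrow> 'u set" where
  "HC_complement D B = {a + b | a b. a \<in> BTplusU D B \<and> b \<in> span_prod (aug (Nplus D)) (Ach D)}"

text \<open>
  \<open>P\<close> is the projection of \<open>Uch D\<close> to the second summand of the direct sum
  \<open>HC_complement D B \<oplus> cv.span (Ach D)\<close>.
\<close>

definition harish_chandra :: "('n::finite, 'u::chopf) qsp \<Rightarrow> 'u set \<Rightarrow> ('u \<Rightarrow> 'u) \<Rightarrow> bool" where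
  "harish_chandra D B P \<longleftrightarrow> HC_complement D B \<inter> cv.span (Ach D) = {0} \<and>
     (\<forall>u\<in>Uch D. P u \<in> cv.span (Ach D) \<and> u - P u \<in> HC_complement D B)"

text \<open>The character \<open>z\<^sup>\<lambda>\<close>, on the span of the torus.\<close>

definition zchar :: "('n::finite, 'u::calg) qsp \<Rightarrow> 'n wt \<Rightarrow> 'u \<Rightarrow> cc" where
  "zchar D \<Lambda> a = (THE c. \<exists>p :: 'n wt \<Rightarrow>\<^sub>0 cc.
     a = (\<Sum>v\<in>Poly_Mapping.keys p. Poly_Mapping.lookup p v *\<^sub>q tau D v) \<and>
     c = (\<Sum>v\<in>Poly_Mapping.keys p. Poly_Mapping.lookup p v * qpow (ip D \<Lambda> v)))"


section \<open>Difference operators on the restricted torus\<close>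

text \<open>
  \<open>single \<mu> 1 :: 'n wt \<Rightarrow>\<^sub>0 cc\<close> is \<open>z\<^sup>\<mu>\<close>, and \<open>galg H\<close> is the group algebra of \<open>H\<close>.
  Fractions are taken in the fraction field of the group algebra of the whole weight space.
\<close>

type_synonym 'n zalg = "'n wt \<Rightarrow>\<^sub>0 cc"
type_synonym 'n zfrac = "('n wt \<Rightarrow>\<^sub>0 cc) fract"

definition galg :: "'n wt set \<Rightarrow> 'n zalg set" where
  "galg H = {p. Poly_Mapping.keys p \<subseteq> H}"

definition gfrac :: "'n::{finite,linorder} wt set \<Rightarrow> 'n zfrac set" where
  "gfrac H = {Fract a b | a b. a \<in> galg H \<and> b \<in> galg H \<and> b \<noteq> 0}"

text \<open>The value of an element of the group algebra at \<open>\<tau>(\<beta>)\<close>.\<close>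

definition zval :: "('n::finite, 'u) qsp \<Rightarrow> 'n zalg \<Rightarrow> 'n wt \<Rightarrow> cc" where
  "zval D p \<beta> = (\<Sum>v\<in>Poly_Mapping.keys p. Poly_Mapping.lookup p v * qpow (ip D v \<beta>))"

definition wact :: "('n wt \<Rightarrow> 'n wt) \<Rightarrow> 'n zalg \<Rightarrow> 'n zalg" where
  "wact w p = (\<Sum>v\<in>Poly_Mapping.keys p. Poly_Mapping.single (w v) (Poly_Mapping.lookup p v))"

definition tact :: "('n::finite, 'u) qsp \<Rightarrow> 'n wt \<Rightarrow> 'n zalg \<Rightarrow> 'n zalg" where
  "tact D \<beta> p = (\<Sum>v\<in>Poly_Mapping.keys p.
     Poly_Mapping.single v (qpow (ip D v \<beta>) * Poly_Mapping.lookup p v))"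

text \<open>For an injective ring endomorphism \<open>\<phi>\<close> the value does not depend on the fraction chosen.\<close>

definition fext :: "('n::{finite,linorder} zalg \<Rightarrow> 'n zalg) \<Rightarrow> 'n zfrac \<Rightarrow> 'n zfrac" where
  "fext \<phi> x = (THE y. \<exists>a b. b \<noteq> 0 \<and> x = Fract a b \<and> y = Fract (\<phi> a) (\<phi> b))"

text \<open>
  Operators act from the right on the fraction field of \<open>galg (PSigma D)\<close>; as functions on the
  type \<open>'n zfrac\<close> they are extended by \<open>0\<close> outside of it.  The product \<open>S T\<close> of two right
  operators is the function \<open>T \<circ> S\<close>.
\<close>

type_synonym 'n rop = "'n zfrac \<Rightarrow> 'n zfrac"

definition rop_add :: "'n::{finite,linorder} rop \<Rightarrow> 'n rop \<Rightarrow> 'n rop" where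
  "rop_add S T = (\<lambda>x. S x + T x)"

definition rop_scale :: "cc \<Rightarrow> 'n::{finite,linorder} rop \<Rightarrow> 'n rop" where
  "rop_scale c S = (\<lambda>x. Fract (Poly_Mapping.single 0 c) 1 * S x)"

definition rop_mult :: "'n::{finite,linorder} rop \<Rightarrow> 'n rop \<Rightarrow> 'n rop" where
  "rop_mult S T = T \<circ> S"

definition rop_zero :: "'n::{finite,linorder} rop" where
  "rop_zero = (\<lambda>x. 0)"

definition rop_of :: "('n::{finite,linorder}, 'u) qsp \<Rightarrow> 'n rop \<Rightarrow> 'n rop" where
  "rop_of D S = (\<lambda>x. if x \<in> gfrac (PSigma D) then S x else 0)"

definition rop_one :: "('n::{finite,linorder}, 'u) qsp \<Rightarrow> 'n rop" where
  "rop_one D = rop_of D (\<lambda>x. x)"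

text \<open>
  The localized algebra \<open>\<C>(Q(\<Sigma>))\<A>\<close>, realized faithfully as operators.  It is the algebra
  generated by multiplications with fractions and by \<open>\<tau>(2\<mu>)\<close>, \<open>\<mu> \<in> P(\<Sigma>)\<close>; scalars are among the
  multiplications.
\<close>

inductive_set diffops :: "('n::{finite,linorder}, 'u) qsp \<Rightarrow> 'n rop set"
  for D :: "('n::{finite,linorder}, 'u) qsp" where
  mult_op: "a \<in> gfrac (QSigma D) \<Longrightarrow> rop_of D (\<lambda>x. x * a) \<in> diffops D"
| shift_op: "\<beta> \<in> P2Sigma D \<Longrightarrow> rop_of D (fext (tact D \<beta>)) \<in> diffops D"
| add_op: "S \<in> diffops D \<Longrightarrow> T \<in> diffops D \<Longrightarrow> rop_add S T \<in> diffops D"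
| comp_op: "S \<in> diffops D \<Longrightarrow> T \<in> diffops D \<Longrightarrow> rop_mult S T \<in> diffops D"

text \<open>
  The action of the restricted Weyl group on operators is by conjugation; on generators this is
  \<open>z\<^sup>\<mu> \<mapsto> z\<^sup>w\<^sup>\<mu>\<close> and \<open>\<tau>(\<beta>) \<mapsto> \<tau>(w\<beta>)\<close>.
\<close>

definition wop :: "('n::{finite,linorder}, 'u) qsp \<Rightarrow> ('n wt \<Rightarrow> 'n wt) \<Rightarrow> 'n rop \<Rightarrow> 'n rop" where
  "wop D w S = rop_of D (\<lambda>x. fext (wact w) (S (fext (wact (inv_into UNIV w)) x)))"

definition diffops_inv :: "('n::{finite,linorder}, 'u) qsp \<Rightarrow> 'n rop set" where
  "diffops_inv D = {S \<in> diffops D. \<forall>w\<in>WTh D. wop D w S = S}"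


section \<open>Simple modules and zonal spherical functions\<close>

text \<open>
  The simple highest weight module \<open>L(\<lambda>)\<close>, on a subspace \<open>V\<close> of \<open>'v\<close>; \<open>\<tau>(\<gamma>)\<close>,
  \<open>\<gamma> \<in> P(\<pi>)\<close>, acts on the vectors of weight \<open>\<mu>\<close> by \<open>q\<^sup>(\<^sup>\<mu>\<^sup>,\<^sup>\<gamma>\<^sup>)\<close>, which is fixed by its action on
  the highest weight vector.  Simplicity is as a \<open>U\<close>-module.
\<close>

definition simple_hw_module ::
    "('n::finite, 'u::calg) qsp \<Rightarrow> 'n wt \<Rightarrow> 'v::cvec set \<Rightarrow> ('u \<Rightarrow> 'v \<Rightarrow> 'v) \<Rightarrow> bool" where
  "simple_hw_module D \<Lambda> V act \<longleftrightarrow>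
     cv.subspace V \<and>
     (\<forall>u\<in>Uch D. \<forall>v\<in>V. act u v \<in> V) \<and>
     (\<forall>u\<in>Uch D. \<forall>v\<in>V. \<forall>w\<in>V. act u (v + w) = act u v + act u w) \<and>
     (\<forall>u\<in>Uch D. \<forall>c. \<forall>v\<in>V. act u (c *\<^sub>q v) = c *\<^sub>q act u v \<and> act (c *\<^sub>q u) v = c *\<^sub>q act u v) \<and>
     (\<forall>u\<in>Uch D. \<forall>u'\<in>Uch D. \<forall>v\<in>V. act (u + u') v = act u v + act u' v \<and>
                                       act (u * u') v = act u (act u' v)) \<and>
     (\<forall>v\<in>V. act 1 v = v) \<and>
     (\<forall>W. cv.subspace W \<and> W \<subseteq> V \<and> (\<forall>u\<in>Uq D. \<forall>v\<in>W. act u v \<in> W) \<longrightarrow> W = {0} \<or> W = V) \<and>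
     (\<exists>v\<in>V. v \<noteq> 0 \<and> (\<forall>i. act (gx D i) v = 0) \<and>
        (\<forall>\<gamma>\<in>Ppi D. act (tau D \<gamma>) v = qpow (ip D \<Lambda> \<gamma>) *\<^sub>q v))"

text \<open>
  \<open>L(\<lambda>) \<otimes> L(\<lambda>)\<^sup>*\<close> as the space of matrix coefficients: functions on \<open>Uch D\<close>, extended by \<open>0\<close>.
\<close>

definition mat_coeffs ::
    "('n::finite, 'u::calg) qsp \<Rightarrow> 'v::cvec set \<Rightarrow> ('u \<Rightarrow> 'v \<Rightarrow> 'v) \<Rightarrow> ('u \<Rightarrow> cc) set" where
  "mat_coeffs D V act = {(\<lambda>u. if u \<in> Uch D then (\<Sum>(v, \<xi>)\<leftarrow>vs. \<xi> (act u v)) else 0) | vs.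
     \<forall>(v, \<xi>)\<in>set vs. v \<in> V \<and> Vector_Spaces.linear (*\<^sub>q) (*) \<xi>}"

definition biinvariants ::
    "('n::finite, 'u::chopf) qsp \<Rightarrow> 'u set \<Rightarrow> 'u set \<Rightarrow> 'v::cvec set \<Rightarrow> ('u \<Rightarrow> 'v \<Rightarrow> 'v) \<Rightarrow>
     ('u \<Rightarrow> cc) set" where
  "biinvariants D B B' V act = {g \<in> mat_coeffs D V act.
     (\<forall>b\<in>B. \<forall>u\<in>Uch D. g (b * u) = counit b * g u) \<and>
     (\<forall>b\<in>B'. \<forall>u\<in>Uch D. g (u * b) = counit b * g u)}"

text \<open>
  For each \<open>\<lambda> \<in> P\<^sup>+(2\<Sigma>)\<close>, \<open>g \<lambda>\<close> spans the biinvariants of \<open>L(\<lambda>)\<close>, and the \<open>W\<^sub>\<Theta>\<close>-invariant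
  \<open>\<phi> \<lambda>\<close> is its restriction to the torus.
\<close>

definition zonal_family ::
    "('n::{finite,linorder}, 'u::chopf) qsp \<Rightarrow> 'u set \<Rightarrow> 'u set \<Rightarrow>
     ('n wt \<Rightarrow> 'v::cvec set) \<Rightarrow> ('n wt \<Rightarrow> 'u \<Rightarrow> 'v \<Rightarrow> 'v) \<Rightarrow>
     ('n wt \<Rightarrow> 'u \<Rightarrow> cc) \<Rightarrow> ('n wt \<Rightarrow> 'n zalg) \<Rightarrow> bool" where
  "zonal_family D B B' V act g \<phi> \<longleftrightarrow> (\<forall>\<Lambda>\<in>Pplus2Sigma D.
     simple_hw_module D \<Lambda> (V \<Lambda>) (act \<Lambda>) \<and>
     g \<Lambda> \<noteq> (\<lambda>u. 0) \<and> biinvariants D B B' (V \<Lambda>) (act \<Lambda>) = {(\<lambda>u. c * g \<Lambda> u) | c. True} \<and>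
     \<phi> \<Lambda> \<in> galg (P2Sigma D) \<and> (\<forall>\<gamma>\<in>Ppi D. g \<Lambda> (tau D \<gamma>) = zval D (\<phi> \<Lambda>) \<gamma>) \<and>
     (\<forall>w\<in>WTh D. wact w (\<phi> \<Lambda>) = \<phi> \<Lambda>))"


section \<open>The radial component map\<close>

text \<open>
  The conditions determine \<open>\<X>\<close> on \<open>UB D B\<close>.  In the last one \<open>\<psi>\<close> is the element
  \<open>\<phi>\<^sub>\<lambda> * \<X>(c)\<close> of the group algebra, which can be evaluated at the torus.
\<close>

definition radial_component ::
    "('n::{finite,linorder}, 'u::chopf) qsp \<Rightarrow> 'u set \<Rightarrow> ('u \<Rightarrow> 'u) \<Rightarrow>
     ('n wt \<Rightarrow> 'u \<Rightarrow> cc) \<Rightarrow> ('n wt \<Rightarrow> 'n zalg) \<Rightarrow> ('u \<Rightarrow> 'n rop) \<Rightarrow> bool" where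
  "radial_component D B P g \<phi> \<X> \<longleftrightarrow>
     (\<forall>c\<in>UB D B. \<X> c \<in> diffops_inv D) \<and>
     (\<forall>c\<in>UB D B. \<forall>c'\<in>UB D B. \<X> (c + c') = rop_add (\<X> c) (\<X> c') \<and>
                                 \<X> (c * c') = rop_mult (\<X> c) (\<X> c')) \<and>
     (\<forall>k. \<forall>c\<in>UB D B. \<X> (k *\<^sub>q c) = rop_scale k (\<X> c)) \<and> \<X> 1 = rop_one D \<and>
     (\<forall>c\<in>UB D B. \<forall>\<Lambda>\<in>Pplus2Sigma D.
        \<X> c (Fract (\<phi> \<Lambda>) 1) = Fract (Poly_Mapping.single 0 (zchar D \<Lambda> (P c)) * \<phi> \<Lambda>) 1 \<and>
        (\<exists>\<psi>\<in>galg (PSigma D). \<X> c (Fract (\<phi> \<Lambda>) 1) = Fract \<psi> 1 \<and>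
           (\<forall>\<beta>\<in>P2Sigma D. g \<Lambda> (c * tau D \<beta>) = zval D \<psi> \<beta>)))"

definition rop_alg_iso ::
    "('n::{finite,linorder}, 'u::calg) qsp \<Rightarrow> ('n rop \<Rightarrow> 'u) \<Rightarrow> 'n rop set \<Rightarrow> 'u set \<Rightarrow> bool" where
  "rop_alg_iso D \<Psi> S A \<longleftrightarrow> bij_betw \<Psi> S A \<and> \<Psi> (rop_one D) = 1 \<and>
     (\<forall>x\<in>S. \<forall>y\<in>S. \<Psi> (rop_add x y) = \<Psi> x + \<Psi> y \<and> \<Psi> (rop_mult x y) = \<Psi> x * \<Psi> y) \<and>
     (\<forall>c. \<forall>x\<in>S. \<Psi> (rop_scale c x) = c *\<^sub>q \<Psi> x)"

end

(*
  For \<lambda> in P^+(2\<Sigma>), every nonzero vector of L(\<lambda>) invariant under an algebra of the family has a nonzero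
  component of highest weight. So g_\<lambda>(u) = \<xi>(u v') with a B-invariant functional \<xi>, nonzero on the
  highest weight vector, and a B'-invariant vector v'. An element c of the centralizer of B acts on \<xi> by
  the scalar z^\<lambda>(P_B(c)), and \<phi>_\<lambda> has leading exponent \<lambda>. Hence P_B is multiplicative and,
  by Dedekind's independence of characters, X(c) = 0 iff all z^\<lambda>(P_B(c)) vanish iff P_B(c) = 0.
  If P_B(c) = 0, write c = a + b with a in (BT)_+ U and b in N^+_+ A. Then \<xi>(b L(\<lambda>)) = 0 for all
  \<lambda>. In the lowest degree in the x_i and at the lowest torus exponent, these values are skew derivations
  of b in the free algebra, and their joint kernel is generated by the Serre relations, so b = 0.
*)

theory Submission
  imports Defs
begin

text \<open>Weights are ordered lexicographically by their coordinates. Nonzero vectors with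
  nonnegative coordinates are positive in this order, so it refines the dominance order, and top
  components and leading exponents can be chosen as maxima. The Lie algebra supplies the root
  combinatorics and the inclusion of Q(\<Sigma>) in P(\<Sigma>), which keeps multiplication by
  C(Q(\<Sigma>)) inside the field on which the operators act; the delicate point is that
  2(b,\<Theta> b)/(\<Theta> b,\<Theta> b) is never -1. An invariant vector has a highest weight
  component because \<theta>~(y_i) is the part of B_i of positive weight: on the top component it
  acts, up to scalars, as powers x_j^m applied after x_p(i), and these are injective since each
  x_j^m carries the sl2-weight -m to m. P_B has values involving half weights tau(\<mu>/2), so
  L(\<lambda>) is made a module over the whole ambient algebra by means of the presentation. Orbits
  under H are absorbed by twisting the action. The vanishing of b relies on N^+ being constant for
  the derivations of \<pi>_\<Theta>, where restricted exponents carry no information.\<close>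

abbreviation "lookup \<equiv> Poly_Mapping.lookup"
abbreviation "keys \<equiv> Poly_Mapping.keys"
abbreviation "single \<equiv> Poly_Mapping.single"

section \<open>Powers of q and independence of characters\<close>

lemma qpow_0 [simp]: "qpow 0 = 1"
  by (simp add: qpow_def One_fract_def[symmetric])

lemma qpow_add: "qpow (r + s) = qpow r * qpow s"
  by (simp add: qpow_def mult_single flip: to_ac_mult)

lemma qpow_eq_1_iff: "qpow r = 1 \<longleftrightarrow> r = 0"
proof
  assume "qpow r = 1"
  hence "Fract (single r (1::complex)) 1 = 1"
    unfolding qpow_def by (metis to_ac_1 to_ac_eq_iff)
  hence "single r (1::complex) = single 0 1"
    by (simp add: One_fract_def eq_fract)
  hence "lookup (single r (1::complex)) 0 = 1" by simp
  thus "r = 0" by (simp add: lookup_single when_def split: if_splits)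
qed simp

lemma qpow_nonzero [simp]: "qpow r \<noteq> 0"
  using qpow_add[of r "- r"] by auto

lemma qpow_minus: "qpow (- r) = inverse (qpow r)"
  using qpow_add[of r "- r"] by (simp add: inverse_unique)

lemma qpow_diff: "qpow (r - s) = qpow r / qpow s"
  using qpow_add[of r "- s"] by (simp add: qpow_minus divide_inverse)

lemma qpow_eq_iff: "qpow r = qpow s \<longleftrightarrow> r = s"
proof -
  have "qpow r = qpow s \<longleftrightarrow> qpow (r - s) = 1" by (simp add: qpow_diff)
  thus ?thesis by (simp add: qpow_eq_1_iff)
qed

lemma qpow_power: "qpow r ^ n = qpow (of_nat n * r)"
  by (induction n) (simp_all add: qpow_add ring_distribs)

text \<open>Translating the relation by y and subtracting \<open>\<chi> j y\<close> times the
  relation removes the term j. The domain is only an additively closed set because dominant weights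
  form a monoid, not a group.\<close>

lemma characters_independent:
  fixes \<chi> :: "'i => 'm::plus => 'k::field"
  assumes "finite I"
    and L: "\<And>x y. x \<in> L ==> y \<in> L ==> x + y \<in> L"
    and "\<And>i x y. i \<in> I ==> x \<in> L ==> y \<in> L ==> \<chi> i (x + y) = \<chi> i x * \<chi> i y"
    and "\<And>i. i \<in> I ==> \<exists>x\<in>L. \<chi> i x \<noteq> 0"
    and "\<And>i j. i \<in> I ==> j \<in> I ==> i \<noteq> j ==> \<exists>x\<in>L. \<chi> i x \<noteq> \<chi> j x"
    and "\<And>x. x \<in> L ==> (\<Sum>i\<in>I. c i * \<chi> i x) = 0" and "i \<in> I"
  shows "c i = 0"
  using assms(1,3-)
proof (induction I arbitrary: c i rule: finite_induct)
  case (insert j I)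
  have 0: "c k = 0" if "k \<in> I" for k
  proof -
    obtain y where y: "y \<in> L" "\<chi> k y \<noteq> \<chi> j y"
      using insert.prems(3)[of k j] insert.hyps(2) \<open>k \<in> I\<close> by auto
    have s: "(\<Sum>i\<in>I. (c i * (\<chi> i y - \<chi> j y)) * \<chi> i x) = 0" if x: "x \<in> L" for x
    proof -
      have "(\<Sum>i\<in>insert j I. c i * \<chi> i (x + y)) = 0" "(\<Sum>i\<in>insert j I. c i * \<chi> i x) = 0"
        using insert.prems(4) L x y by blast+
      hence "(\<Sum>i\<in>insert j I. c i * \<chi> i (x + y)) - \<chi> j y * (\<Sum>i\<in>insert j I. c i * \<chi> i x) = 0"
        by simp
      also have "(\<Sum>i\<in>insert j I. c i * \<chi> i (x + y)) = (\<Sum>i\<in>insert j I. c i * (\<chi> i x * \<chi> i y))"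
        using insert.prems(1) x y by (intro sum.cong) auto
      finally have "(\<Sum>i\<in>insert j I. c i * (\<chi> i x * \<chi> i y) - \<chi> j y * (c i * \<chi> i x)) = 0"
        by (simp add: sum_subtractf sum_distrib_left)
      thus ?thesis using insert.hyps by (simp add: algebra_simps)
    qed
    have "c k * (\<chi> k y - \<chi> j y) = 0"
      by (rule insert.IH[of "\<lambda>i. c i * (\<chi> i y - \<chi> j y)"])
        (use insert.prems s \<open>k \<in> I\<close> in auto)
    thus ?thesis using y by simp
  qed
  obtain x where x: "x \<in> L" "\<chi> j x \<noteq> 0" using insert.prems(2) by auto
  have "(\<Sum>i\<in>insert j I. c i * \<chi> i x) = 0" using insert.prems(4) x by blast
  hence "c j * \<chi> j x = 0" using insert.hyps 0 by simp
  thus ?case using x 0 insert.prems(5) by auto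
qed simp

text \<open>The same elimination, with \<open>T y\<close> in place of a translation. Additivity of
  the operators is asked only on V, since a module action is specified only on its carrier.\<close>

lemma (in vector_space) eigenvectors_independent:
  assumes "finite I" and V: "subspace V"
    and "\<And>x v w. x \<in> L ==> v \<in> V ==> w \<in> V ==> T x (v + w) = T x v + T x w"
    and "\<And>x c v. x \<in> L ==> v \<in> V ==> T x (scale c v) = scale c (T x v)"
    and "\<And>i. i \<in> I ==> w i \<in> V"
    and "\<And>i x. i \<in> I ==> x \<in> L ==> T x (w i) = scale (\<chi> i x) (w i)"
    and "\<And>i j. i \<in> I ==> j \<in> I ==> i \<noteq> j ==> \<exists>x\<in>L. \<chi> i x \<noteq> \<chi> j x"
    and "(\<Sum>i\<in>I. w i) = 0" and "i \<in> I"
  shows "w i = 0"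
  using assms(1,5-)
proof (induction I arbitrary: w i rule: finite_induct)
  case (insert j I)
  have T0: "T x 0 = 0" if "x \<in> L" for x
    using assms(4)[OF that subspace_0[OF V], of 0] by simp
  have Ts: "T x (sum w F) = (\<Sum>i\<in>F. T x (w i))" if "finite F" "x \<in> L" "F \<subseteq> insert j I" for F x
    using that
  proof (induction F rule: finite_induct)
    case (insert k F)
    have "w k \<in> V" "sum w F \<in> V" using insert.prems \<open>\<And>i. i \<in> _ ==> w i \<in> V\<close>
      by (auto intro!: subspace_sum[OF V])
    thus ?case using insert assms(3) by auto
  qed (simp add: T0)
  have 0: "w k = 0" if "k \<in> I" for k
  proof -
    obtain y where y: "y \<in> L" "\<chi> k y \<noteq> \<chi> j y"
      using insert.prems(3)[of k j] insert.hyps(2) \<open>k \<in> I\<close> by auto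
    define w' where "w' = (\<lambda>i. scale (\<chi> i y - \<chi> j y) (w i))"
    have "T y (sum w (insert j I)) = 0" using insert.prems(4) T0 y by simp
    hence "(\<Sum>i\<in>insert j I. scale (\<chi> i y) (w i)) = 0"
      using Ts[of "insert j I" y] insert.hyps(1) y insert.prems(2) by simp
    moreover have "scale (\<chi> j y) (\<Sum>i\<in>insert j I. w i) = 0" using insert.prems(4) by simp
    ultimately have "(\<Sum>i\<in>insert j I. scale (\<chi> i y) (w i) - scale (\<chi> j y) (w i)) = 0"
      by (simp only: sum_subtractf scale_sum_right diff_0_right)
    hence "(\<Sum>i\<in>I. w' i) = 0"
      using insert.hyps unfolding w'_def by (simp add: scale_left_diff_distrib)
    moreover have "w' i \<in> V" if "i \<in> I" for i
      using insert.prems(1) that V by (auto simp: w'_def subspace_scale)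
    moreover have "T x (w' i) = scale (\<chi> i x) (w' i)" if "i \<in> I" "x \<in> L" for i x
      using insert.prems(1,2) that assms(4) by (simp add: w'_def mult.commute)
    ultimately have "w' k = 0"
      using insert.IH[of w' k] insert.prems(3) \<open>k \<in> I\<close> by auto
    thus ?thesis using y by (simp add: w'_def)
  qed
  have "w j = 0" using insert.prems(4) insert.hyps 0 by simp
  thus ?case using 0 insert.prems(5) by auto
qed simp

section \<open>Finitely supported functions\<close>

lemma pm_sum_singles:
  fixes p :: "'k \<Rightarrow>\<^sub>0 'c::comm_monoid_add"
  shows "(\<Sum>k\<in>keys p. single k (lookup p k)) = p"
proof (rule poly_mapping_eqI)
  fix k
  have "lookup (\<Sum>k\<in>keys p. single k (lookup p k)) k
      = (\<Sum>j\<in>keys p. if j = k then lookup p j else 0)"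
    by (simp add: lookup_sum lookup_single when_def)
  also have "\<dots> = lookup p k" by (simp add: sum.delta in_keys_iff)
  finally show "lookup (\<Sum>k\<in>keys p.
      single k (lookup p k)) k = lookup p k" .
qed

lemma pm_induct [case_names zero single add]:
  fixes p :: "'k \<Rightarrow>\<^sub>0 'c::comm_monoid_add"
  assumes "P 0" "\<And>k c. P (single k c)" "\<And>p r. P p ==> P r ==> P (p + r)"
  shows "P p"
proof -
  have "P (\<Sum>k\<in>K. single k (lookup p k))" if "finite K" for K
    using that by (induction K rule: finite_induct) (auto intro: assms)
  from this[of "keys p"] show ?thesis by (simp add: pm_sum_singles)
qed

text \<open>\<open>h\<close> may depend on the coefficient in any additive way.\<close>

definition pmext :: "('k => 'c => 'b) => ('k \<Rightarrow>\<^sub>0 'c::zero) => 'b::comm_monoid_add" where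
  "pmext h p = (\<Sum>k\<in>keys p. h k (lookup p k))"

lemma pmext_0 [simp]: "pmext h 0 = 0"
  by (simp add: pmext_def)

lemma pmext_single: "h k 0 = 0 ==> pmext h (single k c) = h k c"
  by (cases "c = 0") (simp_all add: pmext_def)

lemma pmext_add:
  fixes h :: "'k => 'c::comm_monoid_add => 'b::comm_monoid_add"
  assumes "\<And>k. h k 0 = 0" "\<And>k c d. h k (c + d) = h k c + h k d"
  shows "pmext h (p + r) = pmext h p + pmext h r"
  unfolding pmext_def by (rule setsum_keys_plus_distrib) (simp_all add: assms)

lemma pm_hom_sum:
  assumes "f 0 = 0" "\<And>p r. f (p + r) = f p + f r"
  shows "f (sum g K) = (\<Sum>k\<in>K. f (g k))"
  using sum_comp_morphism[of f g K, OF assms] by (simp add: o_def)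

lemma lookup_single_times:
  fixes p :: "'k::monoid_add \<Rightarrow>\<^sub>0 'c::semiring_0"
  shows "lookup (single 0 c * p) k = c * lookup p k"
proof (induction p rule: pm_induct)
  case (single k' d)
  then show ?case by (simp add: mult_single lookup_single when_def)
qed (simp_all add: lookup_add ring_distribs)

lemma keys_single_times:
  fixes p :: "'k::monoid_add \<Rightarrow>\<^sub>0 'c::semiring_no_zero_divisors"
  shows "keys (single 0 c * p) \<subseteq> keys p"
  by (auto simp: in_keys_iff lookup_single_times)

text \<open>Only the pair (a, b) can contribute to the exponent a + b. The bounds need not be
  attained; if one is not, both sides vanish.\<close>

lemma lookup_mult_max:
  fixes p r :: "'k::linordered_ab_group_add \<Rightarrow>\<^sub>0 'c::semiring_0"
  assumes "\<And>v. v \<in> keys p ==> v \<le> a" "\<And>v. v \<in> keys r ==> v \<le> b"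
  shows "lookup (p * r) (a + b) = lookup p a * lookup r b"
proof -
  have "p * r = (\<Sum>k\<in>keys p. single k (lookup p k)) *
                (\<Sum>l\<in>keys r. single l (lookup r l))"
    by (simp add: pm_sum_singles)
  also have "\<dots> = (\<Sum>k\<in>keys p. \<Sum>l\<in>keys r.
      single (k + l) (lookup p k * lookup r l))"
    by (simp add: sum_product mult_single)
  finally have "lookup (p * r) (a + b) = (\<Sum>k\<in>keys p. \<Sum>l\<in>keys r.
      lookup p k * lookup r l when k + l = a + b)"
    by (simp add: lookup_sum lookup_single)
  also have "\<dots> = (\<Sum>k\<in>keys p. \<Sum>l\<in>keys r.
      if l = b then (if k = a then lookup p k * lookup r l else 0) else 0)"
  proof (intro sum.cong refl)
    fix k l assume "k \<in> keys p" "l \<in> keys r"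
    hence "k \<le> a" "l \<le> b" using assms by auto
    hence "k + l = a + b \<longleftrightarrow> k = a \<and> l = b"
      by (metis add_le_cancel_left add_mono add.commute add_right_imp_eq antisym)
    thus "(lookup p k * lookup r l when k + l = a + b) =
      (if l = b then (if k = a then lookup p k * lookup r l else 0) else 0)"
      by (auto simp: when_def)
  qed
  also have "\<dots> = lookup p a * lookup r b"
    by (cases "lookup r b = 0") (auto simp: sum.delta in_keys_iff)
  finally show ?thesis .
qed

text \<open>The order compares coordinates lexicographically, and the least index of the support
  decides. Consequently it refines the partial order given by coordinatewise nonnegativity.\<close>

lemma pm_pos:
  fixes v :: "'k::linorder \<Rightarrow>\<^sub>0 'c::linordered_ab_group_add"
  assumes "\<And>i. lookup v i \<ge> 0" "v \<noteq> 0"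
  shows "0 < v"
proof -
  have ne: "keys v \<noteq> {}"
    using assms(2) by (metis pm_sum_singles sum.empty)
  define k where "k = Min (keys v)"
  have k: "k \<in> keys v" using ne by (simp add: k_def)
  have "lookup v k' = 0" if "k' < k" for k'
    using that ne by (metis Min_le finite_keys in_keys_iff k_def not_less)
  thus ?thesis using k assms(1)[of k]
    unfolding less_poly_mapping.rep_eq less_fun_def
    by (intro exI[of _ k]) (auto simp: in_keys_iff order_less_le)
qed

section \<open>Root strings in the Lie algebra\<close>

lemma lie_0 [simp]: "lie 0 x = 0" "lie x 0 = 0" for x :: "'g::complex_lie"
  using lie_add_left[of 0 0 x] lie_add_right[of x 0 0] by simp_all

lemma lie_anti: "lie a b = - lie b a" for a b :: "'g::complex_lie"
proof -
  have "0 = lie (a + b) (a + b)" by (simp only: lie_self)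
  also have "\<dots> = lie a a + lie b a + (lie a b + lie b b)" by (simp only: lie_add_left lie_add_right)
  finally have "lie a b + lie b a = 0" by (simp add: lie_self add.commute)
  thus ?thesis by (simp add: eq_neg_iff_add_eq_0)
qed

lemma lie_derivation: "lie a (lie b x) = lie (lie a b) x + lie b (lie a x)" for a b :: "'g::complex_lie"
proof -
  have "lie a (lie b x) + lie b (lie x a) + lie x (lie a b) = 0" by (rule jacobi)
  moreover have "lie b (lie x a) = - lie b (lie a x)"
    using lie_scale_right[of b "-1" "lie a x"] lie_anti[of x a] by simp
  moreover have "lie x (lie a b) = - lie (lie a b) x" by (rule lie_anti)
  ultimately show ?thesis by (simp add: algebra_simps)
qed

lemma lie_minus [simp]: "lie (- a) b = - lie a b" "lie a (- b) = - lie a b" for a b :: "'g::complex_lie"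
  using lie_scale_left[of "-1" a b] lie_scale_right[of a "-1" b] by simp_all

text \<open>x is a highest weight vector of weight N, so \<open>lie e\<close> sends its (j+1)-st
  descendant to (j+1)(N-j) times the j-th one, and this factor is nonzero for j < N.\<close>

lemma sl2_string:
  fixes e f h0 x :: "'g::complex_lie"
  assumes ef: "lie e f = h0" and hf: "lie h0 f = (-2) *\<^sub>l f"
    and hx: "lie h0 x = of_nat N *\<^sub>l x" and ex: "lie e x = 0" and "x \<noteq> 0" and "j \<le> N"
  shows "(lie f ^^ j) x \<noteq> 0"
proof -
  have h: "lie h0 ((lie f ^^ j) x) = (of_nat N - 2 * of_nat j) *\<^sub>l (lie f ^^ j) x" for j
  proof (induction j)
    case (Suc j)
    have "lie h0 ((lie f ^^ Suc j) x) = lie (lie h0 f) ((lie f ^^ j) x) + lie f (lie h0 ((lie f ^^ j) x))"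
      by (simp add: lie_derivation[of h0 f])
    also have "\<dots> = (of_nat N - 2 * of_nat j) *\<^sub>l (lie f ^^ Suc j) x - 2 *\<^sub>l (lie f ^^ Suc j) x"
      by (simp add: hf Suc lie_scale_left lie_scale_right)
    also have "\<dots> = (of_nat N - 2 * of_nat (Suc j)) *\<^sub>l (lie f ^^ Suc j) x"
      by (simp only: lv.scale_left_diff_distrib[symmetric]) simp
    finally show ?case .
  qed (simp add: hx)
  have e: "lie e ((lie f ^^ Suc j) x) = (of_nat (Suc j) * (of_nat N - of_nat j)) *\<^sub>l (lie f ^^ j) x" for j
  proof (induction j)
    case 0
    show ?case by (simp add: lie_derivation[of e f] ef hx ex)
  next
    case (Suc j)
    have "lie e ((lie f ^^ Suc (Suc j)) x) = lie h0 ((lie f ^^ Suc j) x) + lie f (lie e ((lie f ^^ Suc j) x))"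
      by (simp add: lie_derivation[of e f] ef)
    also have "\<dots> = (of_nat N - 2 * of_nat (Suc j)) *\<^sub>l (lie f ^^ Suc j) x
        + (of_nat (Suc j) * (of_nat N - of_nat j)) *\<^sub>l (lie f ^^ Suc j) x"
      unfolding h Suc by (simp add: lie_scale_right)
    also have "\<dots> = (of_nat (Suc (Suc j)) * (of_nat N - of_nat (Suc j))) *\<^sub>l (lie f ^^ Suc j) x"
      by (simp only: lv.scale_left_distrib[symmetric]) (simp add: algebra_simps)
    finally show ?case .
  qed
  show ?thesis using \<open>j \<le> N\<close>
  proof (induction j)
    case (Suc j)
    have "(of_nat (Suc j) * (of_nat N - of_nat j) :: complex) \<noteq> 0"
      using Suc.prems by (metis Suc_le_lessD mult_eq_0_iff of_nat_Suc of_nat_eq_iff of_nat_neq_0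
          order_less_irrefl right_minus_eq)
    hence "lie e ((lie f ^^ Suc j) x) \<noteq> 0" unfolding e using Suc by simp
    thus ?case by auto
  qed (use \<open>x \<noteq> 0\<close> in simp)
qed

text \<open>The k is the largest with \<open>(lie e ^^ k) z\<close> nonzero. This top vector has
  weight m + 2k, and lowering it m + k times reaches the reflected weight -m.\<close>

lemma sl2_reflect:
  fixes e f h0 z :: "'g::complex_lie"
  assumes "lie e f = h0" "lie h0 f = (-2) *\<^sub>l f" "lie h0 e = 2 *\<^sub>l e"
    and hz: "lie h0 z = of_nat m *\<^sub>l z" and "z \<noteq> 0" and nil: "(lie e ^^ K) z = 0"
  obtains k where "(lie f ^^ (m + k)) ((lie e ^^ k) z) \<noteq> 0"
proof -
  define k where "k = (LEAST k. (lie e ^^ Suc k) z = 0)"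
  obtain K' where "K = Suc K'" using nil \<open>z \<noteq> 0\<close> by (cases K) auto
  hence k: "(lie e ^^ Suc k) z = 0" unfolding k_def using LeastI[of "\<lambda>k. (lie e ^^ Suc k) z = 0" K'] nil by simp
  have nz: "(lie e ^^ k) z \<noteq> 0"
  proof (cases k)
    case (Suc k')
    thus ?thesis using not_less_Least[of k' "\<lambda>k. (lie e ^^ Suc k) z = 0"] unfolding k_def by auto
  qed (use \<open>z \<noteq> 0\<close> in simp)
  have h: "lie h0 ((lie e ^^ j) z) = (of_nat (m + 2 * j)) *\<^sub>l (lie e ^^ j) z" for j
  proof (induction j)
    case (Suc j)
    have "lie h0 ((lie e ^^ Suc j) z) = lie (lie h0 e) ((lie e ^^ j) z) + lie e (lie h0 ((lie e ^^ j) z))"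
      by (simp add: lie_derivation[of h0 e])
    also have "\<dots> = 2 *\<^sub>l (lie e ^^ Suc j) z + of_nat (m + 2 * j) *\<^sub>l (lie e ^^ Suc j) z"
      by (simp add: assms(3) Suc lie_scale_left lie_scale_right)
    also have "\<dots> = of_nat (m + 2 * Suc j) *\<^sub>l (lie e ^^ Suc j) z"
      by (simp only: lv.scale_left_distrib[symmetric]) simp
    finally show ?case .
  qed (simp add: hz)
  have "(lie f ^^ (m + k)) ((lie e ^^ k) z) \<noteq> 0"
    by (rule sl2_string[OF assms(1,2) h]) (use k nz in auto)
  thus ?thesis by (rule that)
qed

section \<open>Weights\<close>

lemma crd_rscale [simp]: "crd (rscale r v) i = r * crd v i"
  by (simp add: rscale_def map.rep_eq when_def)

lemma crd_sr: "crd (sr i) j = (if i = j then 1 else 0)"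
  by (simp add: sr_def lookup_single when_def)

lemma wt_eqI: "(\<And>i. crd u i = crd v i) ==> u = v"
  by (rule poly_mapping_eqI)

lemma rscale_simps [simp]: "rscale 1 v = v" "rscale 0 v = 0" "rscale r 0 = 0"
  "rscale r (rscale s v) = rscale (r * s) v" "rscale (-1) v = - v" "rscale (- r) v = - rscale r v"
  "rscale r (- v) = - rscale r v"
  by (auto intro!: wt_eqI)

lemma rscale_distribs: "rscale (r + s) v = rscale r v + rscale s v" "rscale r (u + v) = rscale r u + rscale r v"
  "rscale (r - s) v = rscale r v - rscale s v" "rscale r (u - v) = rscale r u - rscale r v"
  by (auto intro!: wt_eqI simp: lookup_add lookup_minus algebra_simps)

lemma wt_expand: "v = (\<Sum>i\<in>UNIV. rscale (crd v i) (sr i))" for v :: "'n::finite wt"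
  by (rule wt_eqI) (simp add: lookup_sum crd_sr sum.delta' if_distrib cong: if_cong)

lemma rscale_eq_0_iff [simp]: "rscale r v = 0 \<longleftrightarrow> r = 0 \<or> v = 0"
  by (auto simp: poly_mapping_eq_iff fun_eq_iff)

lemma sr_nonzero [simp]: "sr i \<noteq> 0"
  by (metis crd_sr lookup_zero zero_neq_one)

lemma ip_add_left: "ip D (u + v) w = ip D u w + ip D v w"
  and ip_add_right: "ip D w (u + v) = ip D w u + ip D w v"
  by (simp_all add: ip_def lookup_add ring_distribs sum.distrib)

lemma ip_rscale_left [simp]: "ip D (rscale r u) w = r * ip D u w"
  and ip_rscale_right [simp]: "ip D w (rscale r u) = r * ip D w u"
  by (simp_all add: ip_def sum_distrib_left mult_ac)

lemma ip_zero [simp]: "ip D 0 v = 0" "ip D v 0 = 0"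
  by (simp_all add: ip_def)

lemma ip_minus_left [simp]: "ip D (- u) w = - ip D u w"
  and ip_minus_right [simp]: "ip D w (- u) = - ip D w u"
  using ip_rscale_left[of D "-1" u w] ip_rscale_right[of D w "-1" u] by simp_all

lemma ip_diff_left: "ip D (u - v) w = ip D u w - ip D v w"
  and ip_diff_right: "ip D w (u - v) = ip D w u - ip D w v"
  using ip_add_left[of D u "- v" w] ip_add_right[of D w u "- v"] by simp_all

lemma ip_sum_left: "ip D (\<Sum>i\<in>I. v i) w = (\<Sum>i\<in>I. ip D (v i) w)"
  and ip_sum_right: "ip D w (\<Sum>i\<in>I. v i) = (\<Sum>i\<in>I. ip D w (v i))"
  by (induction I rule: infinite_finite_induct) (simp_all add: ip_add_left ip_add_right)

lemma ip_sr_sr: "ip D (sr i) (sr j) = of_nat (half_len D i) * of_int (cart D i j)"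
proof -
  have e: "(if P then 1 else 0) * (if Q then 1 else 0) * a * b = (if Q then (if P then a * b else 0) else 0)"
    for P Q and a b :: rat by simp
  show ?thesis unfolding ip_def crd_sr e by (simp add: sum.delta')
qed

lemma symmetric_pairD:
  fixes D :: "('n::{finite,linorder}, 'u) qsp"
  assumes "symmetric_pair h \<alpha> e f \<theta> D"
  shows "chevalley h \<alpha> e f" "of_int (cart D i j) = \<alpha> j (lie (e i) (f i))" "half_len D i > 0"
    "int (half_len D i) * cart D i j = int (half_len D j) * cart D j i"
    "roots D = {v. is_root h (wfun \<alpha> v)}" "lie_auto \<theta>" "\<theta> (\<theta> x) = x" "\<theta> ` h = h"
    "H \<in> h ==> wfun \<alpha> (Th D v) H = wfun \<alpha> v (\<theta> H)"
    "i \<notin> piTh D ==> Th D (- sr i) - sr (prm D i) \<in> QplusTh D"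
  using assms unfolding symmetric_pair_def by (auto simp: fun_eq_iff)

lemma chevalleyD:
  fixes h :: "'g::complex_lie set"
  assumes "chevalley h \<alpha> e f"
  shows "\<exists>S::'g set. finite S \<and> lv.span S = UNIV" "cartan_subalg h" "is_root h (\<alpha> i)"
    "(\<And>H. H \<in> h ==> (\<Sum>i\<in>UNIV. c i * \<alpha> i H) = 0) ==> c i = 0"
    "is_root h a ==> \<exists>v. (\<forall>H\<in>h. a H = wfun \<alpha> v H) \<and> ((\<forall>i. crd v i \<in> \<nat>) \<or> (\<forall>i. - crd v i \<in> \<nat>))"
    "e i \<in> root_space h (\<alpha> i)" "f i \<in> root_space h (\<lambda>H. - \<alpha> i H)" "\<alpha> i (lie (e i) (f i)) = 2"
  using assms unfolding chevalley_def by blast+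

interpretation rv: vector_space "rscale :: rat => 'n wt => 'n wt"
  by unfold_locales (auto simp: rscale_distribs)

lemma Nats_nonneg: "x \<in> \<nat> ==> (0::rat) \<le> x"
  by (auto elim: Nats_cases)

lemma refl_add: "refl D b (u + v) = refl D b u + refl D b v"
  by (simp add: refl_def ip_add_left rscale_distribs ring_distribs add_divide_distrib)

lemma refl_rscale: "refl D b (rscale r v) = rscale r (refl D b v)"
  by (simp add: refl_def rscale_distribs mult_ac)

lemma Qpi_simps [simp]: "0 \<in> Qpi" "sr i \<in> Qpi" "- v \<in> Qpi \<longleftrightarrow> v \<in> Qpi"
  "u \<in> Qpi ==> v \<in> Qpi ==> u + v \<in> Qpi" "u \<in> Qpi ==> v \<in> Qpi ==> u - v \<in> Qpi"
  by (auto simp: Qpi_def crd_sr lookup_add lookup_minus)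

locale cartan_weights =
  fixes D :: "('n::{finite,linorder}, 'u) qsp"
  assumes half_len_pos: "half_len D i > 0"
    and cart_sym: "int (half_len D i) * cart D i j = int (half_len D j) * cart D j i"
    and cart_diag: "cart D i i = 2"
begin

lemma ip_comm: "ip D u v = ip D v u"
proof -
  have *: "of_nat (half_len D i) * of_int (cart D i j) = (of_nat (half_len D j) * of_int (cart D j i) :: rat)" for i j
    using arg_cong[OF cart_sym, of "of_int :: int => rat" i j] by simp
  have "ip D u v = (\<Sum>i\<in>UNIV. \<Sum>j\<in>UNIV. crd v j * crd u i * (of_nat (half_len D j) * of_int (cart D j i)))"
    unfolding ip_def *[symmetric] by (simp add: mult_ac)
  thus ?thesis unfolding ip_def by (subst sum.swap) (simp add: mult_ac)
qed

lemma ip_sr_pos: "ip D (sr i) (sr i) > 0"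
  using half_len_pos[of i] by (simp add: ip_sr_sr cart_diag)

lemma cf_sum: "2 * ip D v (sr i) / ip D (sr i) (sr i) = (\<Sum>j\<in>UNIV. crd v j * of_int (cart D i j))"
proof -
  have "ip D v (sr i) = (\<Sum>j\<in>UNIV. crd v j * ip D (sr j) (sr i))"
    by (subst wt_expand[of v]) (simp add: ip_sum_left)
  also have "\<dots> = (\<Sum>j\<in>UNIV. crd v j * (of_nat (half_len D i) * of_int (cart D i j)))"
    by (subst ip_comm) (simp add: ip_sr_sr)
  also have "\<dots> = of_nat (half_len D i) * (\<Sum>j\<in>UNIV. crd v j * of_int (cart D i j))"
    by (simp add: sum_distrib_left mult_ac)
  finally show ?thesis using half_len_pos[of i] by (simp add: ip_sr_sr cart_diag)
qed

lemma refl_sr_sr: "refl D (sr i) (sr j) = sr j - rscale (of_int (cart D i j)) (sr i)"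
proof -
  have "(\<Sum>k\<in>UNIV. crd (sr j) k * of_int (cart D i k)) = (\<Sum>k\<in>UNIV. if j = k then of_int (cart D i k) else 0 :: rat)"
    by (intro sum.cong) (auto simp: crd_sr)
  thus ?thesis unfolding refl_def cf_sum by (simp add: sum.delta')
qed

lemma Qpi_Ppi: "v \<in> Qpi ==> v \<in> Ppi D"
  by (auto simp: Qpi_def Ppi_def cf_sum intro!: Ints_sum Ints_mult)

lemma ip_refl: "ip D b b \<noteq> 0 ==> ip D (refl D b u) (refl D b v) = ip D u v"
  using ip_comm[of b v] by (simp add: refl_def ip_diff_left ip_diff_right field_simps)

lemma refl_refl:
  assumes "ip D b b \<noteq> 0"
  shows "refl D b (refl D b v) = v"
proof -
  define c where "c = 2 * ip D v b / ip D b b"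
  have "2 * ip D (v - rscale c b) b / ip D b b = - c"
    using assms by (simp add: ip_diff_left c_def field_simps)
  thus ?thesis by (simp add: refl_def flip: c_def)
qed

lemma refl_sr_refl [simp]: "refl D (sr i) (refl D (sr i) v) = v"
  using refl_refl[of "sr i" v] ip_sr_pos[of i] by simp

end

section \<open>Reflections of the root system\<close>

lemma lie_diff [simp]: "lie (a - b) x = lie a x - lie b x" "lie x (a - b) = lie x a - lie x b" for a b :: "'g::complex_lie"
  using lie_add_left[of a "- b" x] lie_add_right[of x a "- b"] by simp_all

lemma lie_sum: "lie (\<Sum>i\<in>I. a i) x = (\<Sum>i\<in>I. lie (a i) x)" "lie x (\<Sum>i\<in>I. a i) = (\<Sum>i\<in>I. lie x (a i))"
  for a :: "'i => 'g::complex_lie"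
  by (induction I rule: infinite_finite_induct) (simp_all add: lie_add_left lie_add_right)

lemma lie_funpow_linear:
  fixes a x y :: "'g::complex_lie"
  shows "(lie a ^^ n) 0 = 0" "(lie a ^^ n) (x + y) = (lie a ^^ n) x + (lie a ^^ n) y"
    "(lie a ^^ n) (c *\<^sub>l x) = c *\<^sub>l (lie a ^^ n) x" "(lie a ^^ n) (sum g I) = (\<Sum>i\<in>I. (lie a ^^ n) (g i))"
proof -
  show *: "(lie a ^^ n) 0 = 0" "(lie a ^^ n) (x + y) = (lie a ^^ n) x + (lie a ^^ n) y" for x y
    by (induction n) (simp_all add: lie_add_right)
  show "(lie a ^^ n) (c *\<^sub>l x) = c *\<^sub>l (lie a ^^ n) x" by (induction n) (simp_all add: lie_scale_right)
  show "(lie a ^^ n) (sum g I) = (\<Sum>i\<in>I. (lie a ^^ n) (g i))"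
    by (induction I rule: infinite_finite_induct) (simp_all add: *)
qed

lemma lie_funpow_mono: "(lie a ^^ K) x = 0 ==> K \<le> n ==> (lie a ^^ n) x = 0" for a :: "'g::complex_lie"
proof -
  assume "(lie a ^^ K) x = 0" "K \<le> n"
  moreover have "(lie a ^^ (n - K + K)) x = (lie a ^^ (n - K)) ((lie a ^^ K) x)" by (simp only: funpow_add comp_apply)
  ultimately show ?thesis by (simp add: lie_funpow_linear)
qed

text \<open>Moving an a through a string of b's costs only weight scalars, provided the term where a
  reaches w is killed by the next b. This is weaker than \<open>lie a w = 0\<close>, and the weaker
  form is what \<open>one_dim\<close> needs, where [y, w] lies in h.\<close>

lemma sl2_lower:
  fixes a b w :: "'g::complex_lie"
  assumes d: "\<And>k. lie (lie a b) ((lie b ^^ k) w) = d k *\<^sub>l (lie b ^^ k) w" and 0: "lie b (lie a w) = 0"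
  shows "\<exists>c. (lie a ^^ k) ((lie b ^^ k) w) = c *\<^sub>l w"
proof -
  have step: "\<exists>c. lie a ((lie b ^^ Suc k) w) = c *\<^sub>l (lie b ^^ k) w" for k
  proof (induction k)
    case 0
    have "lie a (lie b w) = d 0 *\<^sub>l w" using lie_derivation[of a b w] d[of 0] \<open>lie b (lie a w) = 0\<close> by simp
    thus ?case by auto
  next
    case (Suc k)
    then obtain c where c: "lie a ((lie b ^^ Suc k) w) = c *\<^sub>l (lie b ^^ k) w" by blast
    have "lie a ((lie b ^^ Suc (Suc k)) w) = lie (lie a b) ((lie b ^^ Suc k) w) + lie b (lie a ((lie b ^^ Suc k) w))"
      using lie_derivation[of a b "(lie b ^^ Suc k) w"] by simp
    also have "\<dots> = (d (Suc k) + c) *\<^sub>l (lie b ^^ Suc k) w"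
      unfolding d c by (simp add: lie_scale_right lv.scale_left_distrib)
    finally show ?case by blast
  qed
  show ?thesis
  proof (induction k)
    case (Suc k)
    then obtain c where c: "(lie a ^^ k) ((lie b ^^ k) w) = c *\<^sub>l w" by blast
    obtain c' where "lie a ((lie b ^^ Suc k) w) = c' *\<^sub>l (lie b ^^ k) w" using step by blast
    hence "(lie a ^^ Suc k) ((lie b ^^ Suc k) w) = (c' * c) *\<^sub>l w"
      by (simp add: funpow_swap1 lie_funpow_linear c flip: lv.scale_scale)
    thus ?case by blast
  qed (auto intro: exI[of _ 1])
qed

definition nilp :: "'g::complex_lie => 'g => bool" where "nilp a x \<longleftrightarrow> (\<exists>K. (lie a ^^ K) x = 0)"

text \<open>exp(ad a) applied to a vector on which ad a is nilpotent; the index set is finite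
  exactly there.\<close>

definition lexp :: "'g::complex_lie => 'g => 'g" where
  "lexp a x = (\<Sum>k | (lie a ^^ k) x \<noteq> 0. (1 / fact k) *\<^sub>l (lie a ^^ k) x)"

lemma lexp_eq: "(lie a ^^ K) x = 0 ==> lexp a x = (\<Sum>k<K. (1 / fact k) *\<^sub>l (lie a ^^ k) x)"
  unfolding lexp_def using lie_funpow_mono[of K a x] by (intro sum.mono_neutral_left) (auto simp: not_le[symmetric])

lemma nilp_add: "nilp a x ==> nilp a y ==> nilp a (x + y)"
proof -
  assume "nilp a x" "nilp a y"
  then obtain K M where "(lie a ^^ K) x = 0" "(lie a ^^ M) y = 0" by (auto simp: nilp_def)
  hence "(lie a ^^ (K + M)) x = 0" "(lie a ^^ (K + M)) y = 0" by (auto intro: lie_funpow_mono)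
  hence "(lie a ^^ (K + M)) (x + y) = 0" by (simp only: lie_funpow_linear add_0)
  thus ?thesis by (auto simp: nilp_def)
qed

lemma nilp_scale: "nilp a x ==> nilp a (c *\<^sub>l x)"
  by (auto simp: nilp_def lie_funpow_linear)

lemma nilp_0 [simp]: "nilp a 0"
  by (auto simp: nilp_def intro: exI[of _ 0])

lemma lexp_linear:
  assumes "nilp a x" "nilp a y"
  shows "lexp a (x + y) = lexp a x + lexp a y" "lexp a (c *\<^sub>l x) = c *\<^sub>l lexp a x"
proof -
  obtain K M where "(lie a ^^ K) x = 0" "(lie a ^^ M) y = 0" using assms by (auto simp: nilp_def)
  hence 0: "(lie a ^^ (K + M)) x = 0" "(lie a ^^ (K + M)) y = 0" by (auto intro: lie_funpow_mono)
  hence 1: "(lie a ^^ (K + M)) (x + y) = 0" "(lie a ^^ (K + M)) (c *\<^sub>l x) = 0" by (simp_all add: lie_funpow_linear)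
  show "lexp a (x + y) = lexp a x + lexp a y"
    unfolding lexp_eq[OF 0(1)] lexp_eq[OF 0(2)] lexp_eq[OF 1(1)]
    by (simp add: lie_funpow_linear lv.scale_right_distrib sum.distrib)
  show "lexp a (c *\<^sub>l x) = c *\<^sub>l lexp a x"
    unfolding lexp_eq[OF 0(1)] lexp_eq[OF 1(2)] by (simp add: lie_funpow_linear lv.scale_sum_right mult.commute)
qed

lemma lie_leibniz:
  fixes a x y :: "'g::complex_lie"
  shows "(lie a ^^ n) (lie x y) = (\<Sum>i\<le>n. of_nat (n choose i) *\<^sub>l lie ((lie a ^^ i) x) ((lie a ^^ (n - i)) y))"
proof (induction n)
  case (Suc n)
  define g where "g i j = lie ((lie a ^^ i) x) ((lie a ^^ j) y)" for i j
  have D: "lie a (g i j) = g (Suc i) j + g i (Suc j)" for i j by (simp add: g_def lie_derivation[of a])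
  have "(lie a ^^ Suc n) (lie x y) = (\<Sum>i\<le>n. of_nat (n choose i) *\<^sub>l g (Suc i) (n - i)) + (\<Sum>i\<le>n. of_nat (n choose i) *\<^sub>l g i (Suc n - i))"
    by (simp add: Suc lie_sum lie_scale_right lv.scale_right_distrib sum.distrib Suc_diff_le flip: D g_def)
      (simp add: D lv.scale_right_distrib sum.distrib Suc_diff_le)
  also have "(\<Sum>i\<le>n. of_nat (n choose i) *\<^sub>l g (Suc i) (n - i)) = (\<Sum>i\<in>{1..Suc n}. of_nat (n choose (i - 1)) *\<^sub>l g i (Suc n - i))"
    by (rule sum.reindex_bij_witness[of _ "\<lambda>i. i - 1" Suc]) auto
  also have "\<dots> = (\<Sum>i\<le>Suc n. (if i = 0 then 0 else of_nat (n choose (i - 1))) *\<^sub>l g i (Suc n - i))"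
    by (rule sum.mono_neutral_cong_left) auto
  also have "(\<Sum>i\<le>n. of_nat (n choose i) *\<^sub>l g i (Suc n - i)) = (\<Sum>i\<le>Suc n. of_nat (n choose i) *\<^sub>l g i (Suc n - i))"
    by (rule sum.mono_neutral_left) auto
  also have "(\<Sum>i\<le>Suc n. (if i = 0 then 0 else of_nat (n choose (i - 1))) *\<^sub>l g i (Suc n - i)) + \<dots> =
      (\<Sum>i\<le>Suc n. of_nat (Suc n choose i) *\<^sub>l g i (Suc n - i))"
    unfolding sum.distrib[symmetric] lv.scale_left_distrib[symmetric]
    by (intro sum.cong refl arg_cong2[where f = lscale]) (auto simp: gr0_conv_Suc choose_reduce_nat)
  finally show ?case by (simp add: g_def)
qed simp

text \<open>The exponential of a derivation is multiplicative: the Leibniz sums fill the triangle i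
  + j < N, and the rest of the square contributes nothing, since N = K + M forces one of the two
  factors to vanish there.\<close>

lemma lexp_lie:
  assumes "nilp a x" "nilp a y"
  shows "lexp a (lie x y) = lie (lexp a x) (lexp a y)"
proof -
  obtain K M where KM: "(lie a ^^ K) x = 0" "(lie a ^^ M) y = 0" using assms by (auto simp: nilp_def)
  define N where "N = K + M"
  define g where "g i j = lie ((1 / fact i) *\<^sub>l (lie a ^^ i) x) ((1 / fact j) *\<^sub>l (lie a ^^ j) y)" for i j
  have x0: "(lie a ^^ i) x = 0" if "K \<le> i" for i by (rule lie_funpow_mono[OF KM(1) that])
  have y0: "(lie a ^^ i) y = 0" if "M \<le> i" for i by (rule lie_funpow_mono[OF KM(2) that])
  have g0: "g i j = 0" if "N \<le> i + j" for i j
  proof (cases "K \<le> i")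
    case False
    hence "M \<le> j" using that by (simp add: N_def)
    thus ?thesis by (simp add: g_def y0)
  qed (simp add: g_def x0)
  have "(lie a ^^ N) (lie x y) = 0"
    unfolding lie_leibniz
  proof (intro sum.neutral ballI)
    fix i assume "i \<in> {..N}"
    hence "K \<le> i \<or> M \<le> N - i" by (auto simp: N_def)
    thus "of_nat (N choose i) *\<^sub>l lie ((lie a ^^ i) x) ((lie a ^^ (N - i)) y) = 0" using x0 y0 by auto
  qed
  hence "lexp a (lie x y) = (\<Sum>n<N. (1 / fact n) *\<^sub>l (lie a ^^ n) (lie x y))" by (rule lexp_eq)
  also have "\<dots> = (\<Sum>n<N. \<Sum>i\<le>n. g i (n - i))"
  proof (intro sum.cong refl)
    fix n
    have "(1 / fact n) *\<^sub>l (of_nat (n choose i) *\<^sub>l lie ((lie a ^^ i) x) ((lie a ^^ (n - i)) y)) = g i (n - i)"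
      if "i \<le> n" for i
      by (simp add: g_def lie_scale_left lie_scale_right binomial_fact[OF that] mult.commute)
    thus "(1 / fact n) *\<^sub>l (lie a ^^ n) (lie x y) = (\<Sum>i\<le>n. g i (n - i))"
      unfolding lie_leibniz lv.scale_sum_right by (intro sum.cong) auto
  qed
  also have "\<dots> = (\<Sum>(i, j)\<in>{(i, j). i + j < N}. g i j)" by (rule sum.triangle_reindex[symmetric])
  also have "\<dots> = (\<Sum>(i, j)\<in>{..<N} \<times> {..<N}. g i j)"
    by (rule sum.mono_neutral_left) (auto intro: g0 simp flip: not_less)
  also have "\<dots> = lie (lexp a x) (lexp a y)"
    unfolding sum.cartesian_product[symmetric] g_def
    by (simp add: lexp_eq[OF x0[of N]] lexp_eq[OF y0[of N]] N_def lie_sum) (rule sum.swap)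
  finally show ?thesis .
qed

text \<open>Apply the last power of ad a that does not kill x: of the whole exponential only its
  constant term survives.\<close>

lemma lexp_eq_0:
  assumes "nilp a x" "lexp a x = 0"
  shows "x = 0"
proof (rule ccontr)
  assume x: "x \<noteq> 0"
  define K where "K = (LEAST K. (lie a ^^ K) x = 0)"
  have K: "(lie a ^^ K) x = 0" unfolding K_def by (rule LeastI_ex) (use assms(1) in \<open>simp add: nilp_def\<close>)
  have "K \<noteq> 0"
  proof
    assume "K = 0"
    thus False using K x by (simp only: funpow_0)
  qed
  then obtain k where k: "K = Suc k" using not0_implies_Suc by blast
  have "(lie a ^^ k) x \<noteq> 0" using not_less_Least[of k "\<lambda>K. (lie a ^^ K) x = 0"] k by (simp add: K_def)
  moreover have "(lie a ^^ k) (lexp a x) = (\<Sum>j<Suc k. if j = 0 then (lie a ^^ k) x else 0)"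
    unfolding lexp_eq[OF K[unfolded k]] lie_funpow_linear
  proof (intro sum.cong refl)
    fix j
    have "(lie a ^^ k) ((lie a ^^ j) x) = (lie a ^^ (k + j)) x" by (simp add: funpow_add)
    moreover have "(lie a ^^ (k + j)) x = 0" if "j > 0" using lie_funpow_mono[OF K, of "k + j"] that by (simp add: k)
    ultimately show "(1 / fact j) *\<^sub>l (lie a ^^ k) ((lie a ^^ j) x) = (if j = 0 then (lie a ^^ k) x else 0)" by simp
  qed
  ultimately show False using assms(2) by (simp add: lie_funpow_linear sum.delta del: sum.lessThan_Suc)
qed

section \<open>Root spaces and sl2-triples of the symmetric pair\<close>

locale sym_pair =
  fixes h :: "'g::complex_lie set" and \<alpha> :: "'n::{finite,linorder} => 'g => complex" and e f :: "'n => 'g"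
    and \<theta> :: "'g => 'g" and D :: "('n, 'u) qsp"
  assumes sp: "symmetric_pair h \<alpha> e f \<theta> D"
begin

lemmas spD = symmetric_pairD[OF sp]
lemmas cD = chevalleyD[OF symmetric_pairD(1)[OF sp]]

sublocale cartan_weights D
proof
  show "half_len D i > 0" "int (half_len D i) * cart D i j = int (half_len D j) * cart D j i" for i j
    by (rule spD)+
  show "cart D i i = 2" for i
  proof -
    have "(of_int (cart D i i) :: complex) = of_int 2" using spD(2)[of i i] cD(8)[of i] by simp
    thus ?thesis by (simp only: of_int_eq_iff)
  qed
qed

definition rsp :: "'n wt => 'g set" where "rsp v = root_space h (wfun \<alpha> v)"

abbreviation cf :: "'n wt => 'n wt => rat" where "cf v b \<equiv> 2 * ip D v b / ip D b b"

lemma rspD: "x \<in> rsp v ==> H \<in> h ==> lie H x = wfun \<alpha> v H *\<^sub>l x"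
  by (simp add: rsp_def root_space_def)

lemma rspI: "(\<And>H. H \<in> h ==> lie H x = wfun \<alpha> v H *\<^sub>l x) ==> x \<in> rsp v"
  by (simp add: rsp_def root_space_def)

lemma h_subspace: "lv.subspace h"
  using cD(2) by (simp add: cartan_subalg_def lie_subalg_def)

lemma wfun_add: "wfun \<alpha> (u + v) H = wfun \<alpha> u H + wfun \<alpha> v H"
  by (simp add: wfun_def lookup_add of_rat_add ring_distribs sum.distrib)

lemma wfun_rscale: "wfun \<alpha> (rscale r v) H = of_rat r * wfun \<alpha> v H"
  by (simp add: wfun_def of_rat_mult sum_distrib_left mult_ac)

lemma wfun_minus: "wfun \<alpha> (- v) H = - wfun \<alpha> v H"
  using wfun_rscale[of "-1" v H] by simp

lemma wfun_diff: "wfun \<alpha> (u - v) H = wfun \<alpha> u H - wfun \<alpha> v H"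
  using wfun_add[of u "- v" H] by (simp add: wfun_minus)

lemma wfun_0: "wfun \<alpha> 0 H = 0"
  by (simp add: wfun_def)

lemma wfun_sr: "wfun \<alpha> (sr i) = \<alpha> i"
proof
  fix H
  have "wfun \<alpha> (sr i) H = (\<Sum>j\<in>UNIV. if i = j then \<alpha> j H else 0)"
    unfolding wfun_def crd_sr by (intro sum.cong) auto
  thus "wfun \<alpha> (sr i) H = \<alpha> i H" by (simp add: sum.delta')
qed

lemma wfun_linear: "H \<in> h ==> K \<in> h ==> wfun \<alpha> v (H + K) = wfun \<alpha> v H + wfun \<alpha> v K"
  "H \<in> h ==> wfun \<alpha> v (c *\<^sub>l H) = c * wfun \<alpha> v H"
proof -
  have lin: "\<alpha> i (H + K) = \<alpha> i H + \<alpha> i K" "\<alpha> i (c *\<^sub>l H) = c * \<alpha> i H" if "H \<in> h" "K \<in> h" for i H K c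
    using cD(3)[of i] that by (auto simp: is_root_def lin_on_def)
  show "H \<in> h ==> K \<in> h ==> wfun \<alpha> v (H + K) = wfun \<alpha> v H + wfun \<alpha> v K"
    by (simp add: wfun_def lin ring_distribs sum.distrib)
  show "H \<in> h ==> wfun \<alpha> v (c *\<^sub>l H) = c * wfun \<alpha> v H"
    by (simp add: wfun_def lin(2)[of _ H] sum_distrib_left mult_ac)
qed

lemma wfun_h_minus: "H \<in> h ==> wfun \<alpha> v (- H) = - wfun \<alpha> v H"
  using wfun_linear(2)[of H v "-1"] by simp

lemma rsp_subspace: "lv.subspace (rsp v)"
  by (auto simp: lv.subspace_def lie_add_right lie_scale_right lv.scale_right_distrib mult.commute
      intro!: rspI dest!: rspD)

lemma rsp_ops: "0 \<in> rsp v" "x \<in> rsp v ==> y \<in> rsp v ==> x + y \<in> rsp v" "x \<in> rsp v ==> c *\<^sub>l x \<in> rsp v"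
  "x \<in> rsp v ==> y \<in> rsp v ==> x - y \<in> rsp v" "x \<in> rsp v ==> - x \<in> rsp v"
  using rsp_subspace[of v] by (simp_all add: lv.subspace_0 lv.subspace_add lv.subspace_scale lv.subspace_diff lv.subspace_neg)

lemma lie_rsp: "y \<in> rsp u ==> z \<in> rsp v ==> lie y z \<in> rsp (u + v)"
proof (rule rspI)
  fix H assume "y \<in> rsp u" "z \<in> rsp v" "H \<in> h"
  moreover have "lie H (lie y z) = lie (lie H y) z + lie y (lie H z)" by (rule lie_derivation)
  ultimately show "lie H (lie y z) = wfun \<alpha> (u + v) H *\<^sub>l lie y z"
    by (simp add: rspD lie_scale_left lie_scale_right wfun_add lv.scale_left_distrib)
qed

text \<open>A Cartan subalgebra is self-normalizing.\<close>

lemma rsp_0: "x \<in> rsp 0 ==> x \<in> h"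
proof -
  assume x: "x \<in> rsp 0"
  have "lie x H \<in> h" if "H \<in> h" for H
    using rspD[OF x that] lie_anti[of x H] lv.subspace_0[OF h_subspace] by (simp add: wfun_0)
  thus "x \<in> h" using cD(2) by (auto simp: cartan_subalg_def)
qed

lemma lie_rsp_0: "y \<in> rsp u ==> z \<in> rsp (- u) ==> lie y z \<in> rsp 0"
  using lie_rsp[of y u z "- u"] by simp

lemma wfun_inj: "(\<And>H. H \<in> h ==> wfun \<alpha> u H = wfun \<alpha> v H) ==> u = v"
proof (rule wt_eqI)
  fix i assume eq: "\<And>H. H \<in> h ==> wfun \<alpha> u H = wfun \<alpha> v H"
  have "(of_rat (crd (u - v) i) :: complex) = 0"
    by (rule cD(4)[of "\<lambda>i. of_rat (crd (u - v) i)"]) (use eq wfun_diff[of u v] in \<open>simp add: wfun_def\<close>)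
  thus "crd u i = crd v i" by (simp add: lookup_minus)
qed

lemma root_iff: "v \<in> roots D \<longleftrightarrow> v \<noteq> 0 \<and> rsp v \<noteq> {0}"
proof -
  have "(\<exists>H\<in>h. wfun \<alpha> v H \<noteq> 0) \<longleftrightarrow> v \<noteq> 0" using wfun_inj[of v 0] by (auto simp: wfun_0)
  moreover have "lin_on h (wfun \<alpha> v)" using wfun_linear by (auto simp: lin_on_def)
  ultimately show ?thesis unfolding spD(5) is_root_def rsp_def by auto
qed

text \<open>Root vectors of distinct weights are eigenvectors of h with distinct characters, hence
  independent, and the Lie algebra has finite dimension.\<close>

lemma finite_roots: "finite (roots D)"
proof -
  define x where "x v = (SOME x. x \<in> rsp v \<and> x \<noteq> 0)" for v
  have x: "x v \<in> rsp v" "x v \<noteq> 0" if "v \<in> roots D" for v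
  proof -
    have "\<exists>y. y \<in> rsp v \<and> y \<noteq> 0" using that rsp_ops(1) unfolding root_iff by blast
    from someI_ex[OF this] show "x v \<in> rsp v" "x v \<noteq> 0" by (auto simp: x_def)
  qed
  have inj: "inj_on x (roots D)"
  proof (rule inj_onI)
    fix u v assume uv: "u \<in> roots D" "v \<in> roots D" "x u = x v"
    show "u = v"
    proof (rule wfun_inj)
      fix H assume "H \<in> h"
      hence "wfun \<alpha> u H *\<^sub>l x v = wfun \<alpha> v H *\<^sub>l x v" using rspD x(1) uv by metis
      thus "wfun \<alpha> u H = wfun \<alpha> v H" using x(2)[OF uv(2)] by simp
    qed
  qed
  have "lv.independent (x ` roots D)"
    unfolding lv.dependent_explicit
  proof (safe)
    fix A c y assume A: "finite A" "A \<subseteq> x ` roots D" "(\<Sum>y\<in>A. c y *\<^sub>l y) = 0" "y \<in> A" "c y \<noteq> 0"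
    obtain I where I: "A = x ` I" "I \<subseteq> roots D" using A(2) by (auto simp: subset_image_iff)
    have injI: "inj_on x I" using inj I(2) by (rule inj_on_subset)
    have finI: "finite I" using A(1) I(1) injI by (simp add: finite_image_iff)
    have s: "(\<Sum>v\<in>I. c (x v) *\<^sub>l x v) = 0" using A(3) injI by (simp add: I(1) sum.reindex o_def)
    obtain v where v: "v \<in> I" "y = x v" using A(4) I by auto
    have "c (x v) *\<^sub>l x v = 0"
    proof (rule lv.eigenvectors_independent[OF finI lv.subspace_UNIV, where L = h and T = lie
          and \<chi> = "wfun \<alpha>" and w = "\<lambda>v. c (x v) *\<^sub>l x v"])
      show "\<exists>H\<in>h. wfun \<alpha> u H \<noteq> wfun \<alpha> v H" if "u \<in> I" "v \<in> I" "u \<noteq> v" for u v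
        using wfun_inj that by blast
    qed (use s v I rspD[OF x(1)] in \<open>auto simp: subset_iff lie_add_right lie_scale_right mult.commute\<close>)
    thus False using x(2)[of v] v I A(5) by auto
  qed
  moreover obtain S :: "'g set" where "finite S" "lv.span S = UNIV" using cD(1) by blast
  ultimately have "finite (x ` roots D)"
    using lv.independent_span_bound[of S "x ` roots D"] by auto
  thus ?thesis using inj by (simp add: finite_image_iff)
qed

lemma root_nz: "x \<in> rsp v ==> x \<noteq> 0 ==> v \<noteq> 0 ==> v \<in> roots D"
  by (auto simp: root_iff)

lemma funpow_rsp: "y \<in> rsp u ==> z \<in> rsp v ==> (lie y ^^ k) z \<in> rsp (v + rscale (of_nat k) u)"
proof (induction k)
  case (Suc k)
  have "u + (v + rscale (of_nat k) u) = v + rscale (of_nat (Suc k)) u" by (simp add: rscale_distribs add_ac)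
  with lie_rsp[OF Suc.prems(1) Suc.IH[OF Suc.prems]] show ?case by (simp only: funpow.simps comp_apply)
qed simp

text \<open>Otherwise all weights v + k u, with k a natural number, would be 0 or roots, giving
  infinitely many roots.\<close>

lemma nilp_rsp:
  assumes y: "y \<in> rsp u" and z: "z \<in> rsp v" and u: "u \<noteq> 0"
  shows "nilp y z"
proof (rule ccontr)
  assume "\<not> nilp y z"
  hence nz: "(lie y ^^ k) z \<noteq> 0" for k by (auto simp: nilp_def)
  have "v + rscale (of_nat k) u \<in> insert 0 (roots D)" for k
    using root_nz[OF funpow_rsp[OF y z, of k] nz] by blast
  hence "range (\<lambda>k::nat. v + rscale (of_nat k) u) \<subseteq> insert 0 (roots D)" by blast
  hence "finite (range (\<lambda>k::nat. v + rscale (of_nat k) u))"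
    using finite_subset finite_roots by (metis finite_insert)
  moreover have "inj (\<lambda>k::nat. v + rscale (of_nat k) u)"
  proof (rule injI)
    fix k l :: nat assume "v + rscale (of_nat k) u = v + rscale (of_nat l) u"
    hence "rscale (of_nat k - of_nat l) u = 0" by (simp add: rscale_distribs)
    thus "k = l" using u by simp
  qed
  ultimately show False using finite_imageD by fastforce
qed

text \<open>An sl2-triple for b whose coroot [x, y] is identified with 2(.,b)/(b,b), bundled with
  integrality and with one-dimensionality of both root spaces. This is the package that simple roots
  have and that the lifted simple reflections transport to all roots.\<close>

definition triple :: "'n wt => 'g => 'g => bool" where
  "triple b x y \<longleftrightarrow> ip D b b \<noteq> 0 \<and> x \<in> rsp b \<and> y \<in> rsp (- b) \<and> (\<forall>v. wfun \<alpha> v (lie x y) = of_rat (cf v b)) \<and>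
    (\<forall>v\<in>Qpi. cf v b \<in> \<int>) \<and> (\<forall>z\<in>rsp b. \<exists>c. z = c *\<^sub>l x) \<and> (\<forall>z\<in>rsp (- b). \<exists>c. z = c *\<^sub>l y)"

lemma tripleD:
  assumes "triple b x y"
  shows "cf b b = 2" "x \<in> rsp b" "y \<in> rsp (- b)" "wfun \<alpha> v (lie x y) = of_rat (cf v b)" "v \<in> Qpi ==> cf v b \<in> \<int>"
    "z \<in> rsp b ==> \<exists>c. z = c *\<^sub>l x" "z \<in> rsp (- b) ==> \<exists>c. z = c *\<^sub>l y" "lie x y \<in> h" "b \<noteq> 0" "ip D b b \<noteq> 0"
  using assms rsp_0[OF lie_rsp_0[of x b y]] by (auto simp: triple_def)

lemma cf_minus: "cf (- v) b = - cf v b" "cf v (- b) = - cf v b"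
  by (simp_all add: ip_comm[of v "- b"] ip_comm[of b v] ip_comm[of b "- b"])

lemma triple_minus: "triple b x y ==> triple (- b) y x"
proof -
  assume t: "triple b x y"
  note tD = tripleD[OF t]
  have "wfun \<alpha> v (lie y x) = of_rat (cf v (- b))" for v
    unfolding cf_minus lie_anti[of y x] wfun_h_minus[OF tD(8)] tD(4) by (simp add: of_rat_minus)
  moreover have "cf v (- b) \<in> \<int>" if "v \<in> Qpi" for v unfolding cf_minus using tD(5)[OF that] by simp
  ultimately show ?thesis using tD by (simp add: triple_def del: times_divide_eq_right)
qed

lemma triple_lie: "triple b x y ==> z \<in> rsp v ==> lie (lie x y) z = of_rat (cf v b) *\<^sub>l z"
  using rspD[of z v "lie x y"] tripleD(4,8) by metis

lemma triple_nonzero: "triple b x y ==> x \<noteq> 0 \<and> y \<noteq> 0"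
proof (rule ccontr)
  assume t: "triple b x y" and "\<not> (x \<noteq> 0 \<and> y \<noteq> 0)"
  hence "lie x y = 0" by auto
  hence "of_rat (cf b b) = (0 :: complex)" using tripleD(4)[OF t, of b] wfun_linear(2)[OF tripleD(8)[OF t], of b 0] by simp
  thus False using tripleD(1)[OF t] by simp
qed

text \<open>Only a triple normalized on \<open>b\<close> itself is needed to see that the root space is a line.\<close>

lemma one_dim:
  assumes x: "x \<in> rsp b" and y: "y \<in> rsp (- b)" and b: "b \<noteq> 0" "wfun \<alpha> b (lie x y) = 2" and z: "z \<in> rsp b"
  shows "\<exists>c. z = c *\<^sub>l x"
proof -
  define H where "H = lie x y"
  have Hh: "H \<in> h" unfolding H_def by (rule rsp_0[OF lie_rsp_0[OF x y]])
  have Kh: "lie y z \<in> h" using rsp_0[OF lie_rsp_0[of y "- b" z]] y z by simp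
  \<comment> \<open>This c makes b vanish on [y, w], so that [y, w], an element of h, commutes with
    both x and y.\<close>
  define c where "c = - wfun \<alpha> b (lie y z) / 2"
  define w where "w = z - c *\<^sub>l x"
  have w: "w \<in> rsp b" unfolding w_def by (intro rsp_ops z x)
  have yw: "lie y w = lie y z + c *\<^sub>l H" by (simp add: w_def lie_scale_right H_def lie_anti[of y x])
  have ywh: "lie y w \<in> h" unfolding yw by (intro lv.subspace_add[OF h_subspace] lv.subspace_scale[OF h_subspace] Hh Kh)
  have "wfun \<alpha> b (lie y w) = 0"
    unfolding yw wfun_linear(1)[OF Kh lv.subspace_scale[OF h_subspace Hh]] wfun_linear(2)[OF Hh]
    using b(2) by (simp add: c_def H_def)
  hence 0: "lie x (lie y w) = 0" "lie y (lie y w) = 0"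
    using rspD[OF x ywh] rspD[OF y ywh] lie_anti[of x "lie y w"] lie_anti[of y "lie y w"] by (simp_all add: wfun_minus)
  have HX: "lie H v = wfun \<alpha> u H *\<^sub>l v" if "v \<in> rsp u" for v u by (rule rspD[OF that Hh])
  have low: "\<exists>d. (lie y ^^ k) ((lie x ^^ k) w) = d *\<^sub>l w" for k
  proof (rule sl2_lower[where d = "\<lambda>k. - wfun \<alpha> (b + rscale (of_nat k) b) H"])
    show "lie (lie y x) ((lie x ^^ k) w) = - wfun \<alpha> (b + rscale (of_nat k) b) H *\<^sub>l (lie x ^^ k) w" for k
      using HX[OF funpow_rsp[OF x w, of k]] by (simp add: lie_anti[of y x] H_def)
  qed (rule 0)
  have k0: "(lie y ^^ (2 + k)) ((lie x ^^ k) w) = 0" for k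
  proof -
    obtain d where "(lie y ^^ k) ((lie x ^^ k) w) = d *\<^sub>l w" using low by blast
    thus ?thesis unfolding funpow_add comp_apply using 0(2) by (simp add: eval_nat_numeral lie_scale_right)
  qed
  \<comment> \<open>A nonzero w of weight 2 would be reflected to weight -2 with a nonzero result,
    which \<open>k0\<close> excludes.\<close>
  have "w = 0"
  proof (rule ccontr)
    assume "w \<noteq> 0"
    moreover obtain K where "(lie x ^^ K) w = 0" using nilp_rsp[OF x w b(1)] by (auto simp: nilp_def)
    moreover have "lie H y = (-2) *\<^sub>l y" "lie H x = 2 *\<^sub>l x" "lie H w = of_nat 2 *\<^sub>l w"
      using HX[OF y] HX[OF x] HX[OF w] b(2) by (simp_all add: wfun_minus H_def)
    ultimately obtain k where "(lie y ^^ (2 + k)) ((lie x ^^ k) w) \<noteq> 0"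
      using sl2_reflect[of x y H w 2] unfolding H_def by blast
    thus False using k0 by blast
  qed
  thus ?thesis by (auto simp: w_def)
qed

lemma triple_simple: "triple (sr i) (e i) (f i)"
proof -
  have eR: "e i \<in> rsp (sr i)" using cD(6) by (simp add: rsp_def wfun_sr)
  have fR: "f i \<in> rsp (- sr i)"
  proof -
    have "wfun \<alpha> (- sr i) = (\<lambda>H. - \<alpha> i H)" by (auto simp: wfun_minus wfun_sr)
    thus ?thesis using cD(7) by (simp add: rsp_def)
  qed
  have H: "wfun \<alpha> v (lie (e i) (f i)) = of_rat (cf v (sr i))" for v
    unfolding cf_sum by (simp add: wfun_def of_rat_sum of_rat_mult flip: spD(2))
  have h2: "wfun \<alpha> (sr i) (lie (e i) (f i)) = 2" by (simp add: wfun_sr cD(8))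
  have "wfun \<alpha> (- sr i) (lie (f i) (e i)) = 2"
    using h2 lie_anti[of "f i" "e i"] wfun_h_minus[OF rsp_0[OF lie_rsp_0[OF eR fR]]] by (simp add: wfun_minus)
  hence "\<exists>c. z = c *\<^sub>l f i" if "z \<in> rsp (- sr i)" for z
    using one_dim[OF fR _ _ _ that] eR by simp
  moreover have "\<exists>c. z = c *\<^sub>l e i" if "z \<in> rsp (sr i)" for z by (rule one_dim[OF eR fR sr_nonzero h2 that])
  moreover have "cf v (sr i) \<in> \<int>" if "v \<in> Qpi" for v using Qpi_Ppi[OF that] by (simp add: Ppi_def)
  ultimately show ?thesis using H eR fR ip_sr_pos[of i] by (simp add: triple_def)
qed

text \<open>If x killed z, every \<open>(lie x ^^ k) ((lie y ^^ k) z)\<close> would be a multiple of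
  z and so die under one more x. But z has weight -m < 0, and reflecting it with x and y exchanged
  takes m further steps to a nonzero vector.\<close>

lemma triple_bracket:
  assumes t: "triple b x y" and z: "z \<in> rsp v" "z \<noteq> 0" and neg: "cf v b < 0" and v: "v \<in> Qpi"
  shows "lie x z \<noteq> 0"
proof
  assume 0: "lie x z = 0"
  obtain m' :: int where "cf v b = of_int m'" using tripleD(5)[OF t v] by (auto elim: Ints_cases)
  define m where "m = nat (- m')"
  have m: "cf v b = - of_nat m" "m > 0" using neg \<open>cf v b = _\<close> by (auto simp: m_def)
  note tD = tripleD[OF t]
  have c: "\<exists>d. (lie x ^^ k) ((lie y ^^ k) z) = d *\<^sub>l z" for k
  proof (rule sl2_lower[where d = "\<lambda>k. of_rat (cf (v + rscale (of_nat k) (- b)) b)"])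
    show "lie (lie x y) ((lie y ^^ k) z) = of_rat (cf (v + rscale (of_nat k) (- b)) b) *\<^sub>l (lie y ^^ k) z" for k
      by (rule triple_lie[OF t funpow_rsp[OF tD(3) z(1)]])
  qed (simp add: 0)
  obtain K where K: "(lie y ^^ K) z = 0" using nilp_rsp[OF tD(3) z(1)] tD(9) by (auto simp: nilp_def)
  have "lie (- lie x y) y = 2 *\<^sub>l y" "lie (- lie x y) x = (-2) *\<^sub>l x"
    using triple_lie[OF t tD(2)] triple_lie[OF t tD(3)] tD(1) cf_minus(1)[of b b] by (simp_all add: of_rat_minus)
  moreover have "lie (- lie x y) z = of_nat m *\<^sub>l z"
    using triple_lie[OF t z(1)] by (simp only: m(1)) (simp add: of_rat_minus)
  moreover have "lie y x = - lie x y" by (rule lie_anti)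
  ultimately obtain k where k: "(lie x ^^ (m + k)) ((lie y ^^ k) z) \<noteq> 0"
    using sl2_reflect[of y x "- lie x y" z m, OF _ _ _ _ z(2) K] by blast
  obtain m1 where "m = Suc m1" using m(2) by (cases m) auto
  moreover obtain d where "(lie x ^^ k) ((lie y ^^ k) z) = d *\<^sub>l z" using c by blast
  ultimately have "(lie x ^^ (m + k)) ((lie y ^^ k) z) = (lie x ^^ m1) (lie x (d *\<^sub>l z))"
    by (simp add: funpow_add funpow_swap1)
  thus False using k by (simp add: lie_scale_right 0 lie_funpow_linear)
qed

text \<open>Lowering a vector of weight k b towards its reflection passes through the root space of
  b, which is the line of x, and \<open>(lie y ^^ 3) x = 0\<close>. The vector is therefore dead
  after k + j + 2 steps, while the reflection takes 2k + j of them.\<close>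

lemma triple_multiple:
  assumes t: "triple b x y" and k: "k \<ge> 2"
  shows "rscale (of_nat k) b \<notin> roots D"
proof
  assume "rscale (of_nat k) b \<in> roots D"
  then obtain w where w: "w \<in> rsp (rscale (of_nat k) b)" "w \<noteq> 0" using rsp_ops(1) by (auto simp: root_iff)
  note tD = tripleD[OF t]
  have "cf (rscale (of_nat k) b) b = of_nat (2 * k)" using tD(10) by simp
  hence "lie (lie x y) w = of_nat (2 * k) *\<^sub>l w" using triple_lie[OF t w(1)] by (simp only: of_rat_of_nat_eq)
  moreover obtain K where "(lie x ^^ K) w = 0" using nilp_rsp[OF tD(2) w(1) tD(9)] by (auto simp: nilp_def)
  moreover have yx: "lie (lie x y) x = 2 *\<^sub>l x" and yy: "lie (lie x y) y = (-2) *\<^sub>l y"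
    using triple_lie[OF t tD(2)] triple_lie[OF t tD(3)] tD(1) cf_minus(1)[of b b] by (simp_all add: of_rat_minus)
  ultimately obtain j where j: "(lie y ^^ (2 * k + j)) ((lie x ^^ j) w) \<noteq> 0"
    using sl2_reflect[of x y "lie x y" w "2 * k"] w(2) by blast
  have "(lie y ^^ (k + j - 1)) ((lie x ^^ j) w) \<in> rsp (rscale (of_nat k) b + rscale (of_nat j) b + rscale (of_nat (k + j - 1)) (- b))"
    by (rule funpow_rsp[OF tD(3) funpow_rsp[OF tD(2) w(1)]])
  moreover have "rscale (of_nat k) b + rscale (of_nat j) b + rscale (of_nat (k + j - 1)) (- b) = b"
    by (rule wt_eqI) (use k in \<open>simp add: lookup_add of_nat_diff algebra_simps\<close>)
  ultimately obtain c where c: "(lie y ^^ (k + j - 1)) ((lie x ^^ j) w) = c *\<^sub>l x" using tD(6) by metis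
  have "(lie y ^^ 3) x = 0"
  proof -
    have "lie y (lie y x) = (-2) *\<^sub>l y" using yy lie_anti[of y "lie x y"] by (simp add: lie_anti[of y x])
    thus ?thesis by (simp add: eval_nat_numeral lie_scale_right lie_self)
  qed
  hence "(lie y ^^ (3 + (k + j - 1))) ((lie x ^^ j) w) = 0" unfolding funpow_add comp_apply c by (simp add: lie_funpow_linear)
  hence "(lie y ^^ (2 * k + j)) ((lie x ^^ j) w) = 0" by (rule lie_funpow_mono) (use k in simp)
  thus False using j by simp
qed

text \<open>The space on which root vectors are shown to act locally nilpotently. Elements of h are
  handled apart, as \<open>rsp 0\<close> is only known to lie inside h.\<close>

definition rsum :: "'g set" where "rsum = lv.span (\<Union>v. rsp v)"

lemma rsum_ops: "x \<in> rsp v ==> x \<in> rsum" "x \<in> rsum ==> y \<in> rsum ==> x + y \<in> rsum" "x \<in> rsum ==> c *\<^sub>l x \<in> rsum"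
  "(\<And>i. i \<in> I ==> g i \<in> rsum) ==> sum g I \<in> rsum"
  by (auto simp: rsum_def intro: lv.span_base lv.span_add lv.span_scale lv.span_sum)

lemma rsum_lie:
  assumes a: "a \<in> rsp u" and x: "x \<in> rsum"
  shows "lie a x \<in> rsum"
  using x unfolding rsum_def
proof (induction rule: lv.span_induct_alt)
  case (step c x y)
  then obtain v where "x \<in> rsp v" by blast
  from lie_rsp[OF a this] have "lie a x \<in> rsum" by (rule rsum_ops(1))
  thus ?case using step unfolding rsum_def by (simp add: lie_add_right lie_scale_right lv.span_add lv.span_scale)
qed (simp add: lv.span_zero)

lemma nilp_rsum:
  assumes "a \<in> rsp u" "u \<noteq> 0" and "x \<in> rsum"
  shows "nilp a x"
  using assms(3) unfolding rsum_def
proof (induction rule: lv.span_induct_alt)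
  case (step c x y)
  thus ?case using nilp_rsp[OF assms(1) _ assms(2)] by (auto intro: nilp_add nilp_scale)
qed simp

lemma lexp_rsum:
  assumes "a \<in> rsp u" "u \<noteq> 0" "x \<in> rsum"
  shows "lexp a x \<in> rsum"
proof -
  obtain K where K: "(lie a ^^ K) x = 0" using nilp_rsum[OF assms] by (auto simp: nilp_def)
  have "(lie a ^^ k) x \<in> rsum" for k by (induction k) (simp_all add: assms(3) rsum_lie[OF assms(1)])
  hence "(1 / fact k) *\<^sub>l (lie a ^^ k) x \<in> rsum" for k by (rule rsum_ops(3))
  thus ?thesis unfolding lexp_eq[OF K] by (rule rsum_ops(4))
qed

text \<open>The automorphism \<open>exp(e\<^sub>i) exp(-f\<^sub>i) exp(e\<^sub>i)\<close>, a lift of the simple reflection.\<close>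

definition refl_auto :: "'n => 'g => 'g" where
  "refl_auto i x = lexp (e i) (lexp (- f i) (lexp (e i) x))"

context
  fixes i :: 'n
begin

lemma ef_rsp: "e i \<in> rsp (sr i)" "- f i \<in> rsp (- sr i)" "f i \<in> rsp (- sr i)"
  using tripleD(2,3)[OF triple_simple[of i]] by (auto intro: rsp_ops)

lemma ef_h: "lie (e i) (f i) \<in> h"
  by (rule tripleD(8)[OF triple_simple])

lemma ef_weights: "lie (lie (e i) (f i)) (e i) = 2 *\<^sub>l e i" "lie (lie (e i) (f i)) (f i) = (-2) *\<^sub>l f i"
  using triple_lie[OF triple_simple ef_rsp(1)] triple_lie[OF triple_simple ef_rsp(3)] tripleD(1)[OF triple_simple[of i]] cf_minus(1)[of "sr i" "sr i"]
  by (simp_all add: of_rat_minus)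

text \<open>Each of the three exponentials breaks off after at most the quadratic term. The
  nilpotency facts are recorded with the value because they make \<open>lexp_lie\<close> applicable
  to elements of h.\<close>

lemma refl_auto_h:
  assumes H: "H \<in> h"
  defines "t \<equiv> wfun \<alpha> (sr i) H"
  shows "refl_auto i H = H - t *\<^sub>l lie (e i) (f i)" "nilp (e i) H" "nilp (- f i) (lexp (e i) H)"
    "nilp (e i) (lexp (- f i) (lexp (e i) H))"
proof -
  define k where "k = lie (e i) (f i)"
  have 1: "lie (e i) H = - (t *\<^sub>l e i)" "lie (- f i) H = - (t *\<^sub>l f i)"
    using rspD[OF ef_rsp(1) H] rspD[OF ef_rsp(3) H] lie_anti[of "e i" H] lie_anti[of "f i" H] by (simp_all add: t_def wfun_minus)
  have 2: "lie (e i) k = (-2) *\<^sub>l e i" "lie (- f i) k = (-2) *\<^sub>l f i" "lie (- f i) (e i) = k" "lie (e i) (e i) = 0" "lie (- f i) (f i) = 0"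
    using ef_weights lie_anti[of "e i" k] lie_anti[of "f i" k] lie_anti[of "f i" "e i"] by (simp_all add: k_def lie_self)
  have n1: "(lie (e i) ^^ 2) H = 0" by (simp add: eval_nat_numeral 1 2 lie_scale_right)
  have e1: "lexp (e i) H = H - t *\<^sub>l e i" unfolding lexp_eq[OF n1] by (simp add: eval_nat_numeral 1)
  have n2: "(lie (- f i) ^^ 3) (H - t *\<^sub>l e i) = 0"
    by (simp add: eval_nat_numeral 1[unfolded lie_minus] 2[unfolded lie_minus] lie_scale_right)
  have e2: "lexp (- f i) (H - t *\<^sub>l e i) = H - t *\<^sub>l e i - t *\<^sub>l k"
  proof -
    have a1: "lie (- f i) (H - t *\<^sub>l e i) = - (t *\<^sub>l f i) - t *\<^sub>l k"
      by (simp only: lie_diff(2) 1 2 lie_scale_right)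
    have a2: "lie (- f i) (- (t *\<^sub>l f i) - t *\<^sub>l k) = (2 * t) *\<^sub>l f i"
      by (simp only: lie_diff(2) lie_minus(2) 2 lie_scale_right) simp
    define y where "y = H - t *\<^sub>l e i"
    have "lexp (- f i) y = y + lie (- f i) y + (1 / 2) *\<^sub>l lie (- f i) (lie (- f i) y)"
      using lexp_eq[where a = "- f i" and x = y and K = 3] n2 unfolding y_def[symmetric] by (simp add: eval_nat_numeral)
    thus ?thesis unfolding y_def a1 a2 by simp
  qed
  have n3: "(lie (e i) ^^ 2) (H - t *\<^sub>l e i - t *\<^sub>l k) = 0"
    by (simp add: eval_nat_numeral 1 2 lie_scale_right)
  have e3: "lexp (e i) (H - t *\<^sub>l e i - t *\<^sub>l k) = H - t *\<^sub>l k"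
    unfolding lexp_eq[OF n3] by (simp add: eval_nat_numeral 1 2 lie_scale_right) (simp add: algebra_simps flip: lv.scale_left_distrib)
  show "refl_auto i H = H - t *\<^sub>l lie (e i) (f i)" unfolding refl_auto_def e1 e2 e3 by (simp add: k_def)
  show "nilp (e i) H" "nilp (- f i) (lexp (e i) H)" "nilp (e i) (lexp (- f i) (lexp (e i) H))"
    unfolding e1 e2 nilp_def using n1 n2 n3 by blast+
qed

lemma refl_auto_nilp:
  assumes "x \<in> rsum"
  shows "nilp (e i) x" "nilp (- f i) (lexp (e i) x)" "nilp (e i) (lexp (- f i) (lexp (e i) x))"
    "lexp (e i) x \<in> rsum" "lexp (- f i) (lexp (e i) x) \<in> rsum"
proof -
  note a = ef_rsp(1) sr_nonzero and b = ef_rsp(2)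
  have c: "- sr i \<noteq> 0" by simp
  show r1: "lexp (e i) x \<in> rsum" by (rule lexp_rsum[OF a assms])
  show r2: "lexp (- f i) (lexp (e i) x) \<in> rsum" by (rule lexp_rsum[OF b c r1])
  show "nilp (e i) x" "nilp (- f i) (lexp (e i) x)" "nilp (e i) (lexp (- f i) (lexp (e i) x))"
    using nilp_rsum[OF a assms] nilp_rsum[OF b c r1] nilp_rsum[OF a r2] by auto
qed

lemma refl_auto_scale: "x \<in> rsum ==> refl_auto i (c *\<^sub>l x) = c *\<^sub>l refl_auto i x"
  using refl_auto_nilp[of x] nilp_0 by (simp add: refl_auto_def lexp_linear(2)[OF _ nilp_0])

lemma refl_auto_add: "x \<in> rsum ==> y \<in> rsum ==> refl_auto i (x + y) = refl_auto i x + refl_auto i y"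
  using refl_auto_nilp[of x] refl_auto_nilp[of y] by (simp add: refl_auto_def lexp_linear(1))

lemma refl_auto_lie:
  assumes "x \<in> h \<union> rsum" "y \<in> h \<union> rsum"
  shows "refl_auto i (lie x y) = lie (refl_auto i x) (refl_auto i y)"
proof -
  have *: "nilp (e i) x \<and> nilp (- f i) (lexp (e i) x) \<and> nilp (e i) (lexp (- f i) (lexp (e i) x))" if "x \<in> h \<union> rsum" for x
    using that refl_auto_h refl_auto_nilp by blast
  show ?thesis unfolding refl_auto_def using *[OF assms(1)] *[OF assms(2)] by (simp add: lexp_lie)
qed

lemma refl_auto_nonzero: "x \<in> rsum ==> refl_auto i x = 0 ==> x = 0"
  unfolding refl_auto_def using refl_auto_nilp lexp_eq_0 by metis

lemma refl_auto_rsp: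
  assumes x: "x \<in> rsp v"
  shows "refl_auto i x \<in> rsp (refl D (sr i) v)"
proof (rule rspI)
  fix H assume H: "H \<in> h"
  define k where "k = lie (e i) (f i)"
  define t where "t = wfun \<alpha> (sr i) H"
  \<comment> \<open>The reflection of H in \<alpha>_i, chosen so that \<open>refl_auto i\<close>
    maps it to H.\<close>
  define H' where "H' = H + (- t) *\<^sub>l k"
  have kh: "k \<in> h" unfolding k_def by (rule ef_h)
  have sk: "(- t) *\<^sub>l k \<in> h" by (rule lv.subspace_scale[OF h_subspace kh])
  have H': "H' \<in> h" unfolding H'_def by (rule lv.subspace_add[OF h_subspace H sk])
  have w: "wfun \<alpha> u H' = wfun \<alpha> u H - t * of_rat (cf u (sr i))" for u
    unfolding H'_def wfun_linear(1)[OF H sk] wfun_linear(2)[OF kh] unfolding k_def tripleD(4)[OF triple_simple] by simp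
  have "wfun \<alpha> (sr i) H' = - t" unfolding w tripleD(1)[OF triple_simple] by (simp add: t_def)
  hence "refl_auto i H' = H" using refl_auto_h(1)[OF H'] by (simp add: H'_def k_def)
  hence "lie H (refl_auto i x) = refl_auto i (lie H' x)"
    using refl_auto_lie[of H' x] H' rsum_ops(1)[OF x] by simp
  also have "\<dots> = wfun \<alpha> v H' *\<^sub>l refl_auto i x"
    unfolding rspD[OF x H'] by (rule refl_auto_scale[OF rsum_ops(1)[OF x]])
  also have "wfun \<alpha> v H' = wfun \<alpha> (refl D (sr i) v) H"
    unfolding w refl_def wfun_diff wfun_rscale t_def by (simp add: mult.commute)
  finally show "lie H (refl_auto i x) = wfun \<alpha> (refl D (sr i) v) H *\<^sub>l refl_auto i x" .
qed

text \<open>A second application of \<open>refl_auto i\<close> brings both z and the image of x back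
  into the root space of b, which is a line; injectivity carries the resulting linear relation
  back.\<close>

lemma refl_auto_line:
  assumes x: "x \<in> rsp b" "x \<noteq> 0" "\<And>z. z \<in> rsp b ==> \<exists>c. z = c *\<^sub>l x" and z: "z \<in> rsp (refl D (sr i) b)"
  shows "\<exists>c. z = c *\<^sub>l refl_auto i x"
proof -
  let ?N = "refl_auto i"
  have Nx: "?N x \<in> rsum" and zs: "z \<in> rsum" using refl_auto_rsp[OF x(1)] z by (auto intro: rsum_ops(1))
  have "?N z \<in> rsp b" "?N (?N x) \<in> rsp b" using refl_auto_rsp[OF z] refl_auto_rsp[OF refl_auto_rsp[OF x(1)]] by simp_all
  then obtain c d where cd: "?N z = c *\<^sub>l x" "?N (?N x) = d *\<^sub>l x" using x(3) by meson
  have "?N (?N x) \<noteq> 0" using refl_auto_nonzero[OF Nx] refl_auto_nonzero[OF rsum_ops(1)[OF x(1)]] x(2) by blast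
  hence d: "d \<noteq> 0" using cd(2) by auto
  define w where "w = z + (- (c / d)) *\<^sub>l ?N x"
  have w: "w \<in> rsum" unfolding w_def by (intro rsum_ops Nx zs)
  have s: "(- (c / d)) *\<^sub>l ?N x \<in> rsum" by (intro rsum_ops Nx)
  have "?N w = ?N z + ?N ((- (c / d)) *\<^sub>l ?N x)"
    unfolding w_def by (rule refl_auto_add[OF zs s])
  also have "\<dots> = 0" unfolding refl_auto_scale[OF Nx] cd using d by simp
  finally have "w = 0" by (rule refl_auto_nonzero[OF w])
  thus ?thesis by (auto simp: w_def)
qed

end

lemma ip_refl_sr: "ip D (refl D (sr i) u) v = ip D u (refl D (sr i) v)"
  using ip_refl[of "sr i" u "refl D (sr i) v"] ip_sr_pos[of i] by simp

text \<open>The coroot transforms as an element of h, by \<open>refl_auto_h\<close>, and invariance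
  of the form turns this into the reflected Cartan integers.\<close>

lemma triple_refl:
  assumes t: "triple b x y"
  shows "triple (refl D (sr i) b) (refl_auto i x) (refl_auto i y)"
proof -
  let ?N = "refl_auto i" and ?s = "refl D (sr i)"
  note tD = tripleD[OF t]
  have sm: "?s (- b) = - ?s b" using refl_rscale[of D "sr i" "-1" b] by simp
  have sq: "?s v \<in> Qpi" if v: "v \<in> Qpi" for v
  proof -
    obtain k where "cf v (sr i) = of_int k" using tripleD(5)[OF triple_simple[of i] v] by (auto elim: Ints_cases)
    thus ?thesis unfolding refl_def using v by (auto simp: Qpi_def lookup_minus crd_sr)
  qed
  have cs: "cf v (?s b) = cf (?s v) b" for v
    using ip_refl_sr[of i v b] ip_refl_sr[of i b "?s b"] by simp
  have H: "wfun \<alpha> v (lie (?N x) (?N y)) = of_rat (cf v (?s b))" for v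
  proof -
    have "lie (?N x) (?N y) = ?N (lie x y)"
      using refl_auto_lie[of x y] rsum_ops(1)[OF tD(2)] rsum_ops(1)[OF tD(3)] by simp
    also have "\<dots> = lie x y + (- wfun \<alpha> (sr i) (lie x y)) *\<^sub>l lie (e i) (f i)" using refl_auto_h(1)[OF tD(8)] by simp
    finally have "wfun \<alpha> v (lie (?N x) (?N y)) = of_rat (cf v b) - of_rat (cf (sr i) b) * of_rat (cf v (sr i))"
      using wfun_linear(1)[OF tD(8) lv.subspace_scale[OF h_subspace ef_h], of v "- wfun \<alpha> (sr i) (lie x y)"]
      by (simp only: wfun_linear(2)[OF ef_h] tD(4) tripleD(4)[OF triple_simple]) simp
    also have "\<dots> = of_rat (cf (?s v) b)"
      by (simp add: refl_def ip_diff_left of_rat_diff of_rat_mult of_rat_divide diff_divide_distrib mult_ac right_diff_distrib)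
    finally show ?thesis by (simp add: cs)
  qed
  have line1: "\<exists>c. z = c *\<^sub>l ?N x" if "z \<in> rsp (?s b)" for z
    using refl_auto_line[OF tD(2) _ tD(6) that] triple_nonzero[OF t] by blast
  have line2: "\<exists>c. z = c *\<^sub>l ?N y" if "z \<in> rsp (- ?s b)" for z
    using refl_auto_line[OF tD(3) _ tD(7) that[folded sm]] triple_nonzero[OF t] by blast
  have "ip D (?s b) (?s b) \<noteq> 0" using tD(10) ip_refl_sr[of i b "?s b"] by simp
  thus ?thesis
    unfolding triple_def using H line1 line2 refl_auto_rsp[OF tD(2), of i] refl_auto_rsp[OF tD(3), of i] tD(5)[OF sq]
    by (simp add: sm cs del: times_divide_eq_right)
qed

end

lemma common_denominator:
  fixes A :: "rat set"
  assumes "finite A"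
  obtains N :: nat where "N > 0" "\<And>r. r \<in> A ==> of_nat N * r \<in> \<int>"
proof -
  have "\<exists>N::nat. N > 0 \<and> (\<forall>r\<in>A. of_nat N * r \<in> \<int>)"
    using assms
  proof (induction A rule: finite_induct)
    case (insert a A)
    then obtain N :: nat where N: "N > 0" "\<forall>r\<in>A. of_nat N * r \<in> \<int>" by blast
    obtain p q where pq: "quotient_of a = (p, q)" by (cases "quotient_of a")
    hence q: "q > 0" "a = of_int p / of_int q"
      by (auto simp: quotient_of_denom_pos quotient_of_div)
    have "of_nat (N * nat q) * a = of_nat N * of_int p" using q by simp
    hence "of_nat (N * nat q) * a \<in> \<int>" by (metis Ints_mult Ints_of_int Ints_of_nat)
    moreover have "of_nat (N * nat q) * r \<in> \<int>" if "r \<in> A" for r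
    proof -
      have "of_nat (N * nat q) * r = of_nat (nat q) * (of_nat N * r)" by simp
      thus ?thesis using N(2) that by (metis Ints_mult Ints_of_nat)
    qed
    ultimately show ?case using N(1) q(1) by (intro exI[of _ "N * nat q"]) auto
  qed (auto intro: exI[of _ 1])
  thus ?thesis using that by blast
qed

section \<open>Words in the simple reflections and definiteness of the inner product\<close>

lemma sword_Nil [simp]: "sword D [] = id"
  and sword_Cons: "sword D (j # js) v = refl D (sr j) (sword D js v)"
  by (simp_all add: sword_def)

lemma sword_append: "sword D (js @ ks) v = sword D js (sword D ks v)"
  by (induction js) (simp_all add: sword_Cons)

lemma sword_add: "sword D js (u + v) = sword D js u + sword D js v"
  by (induction js) (simp_all add: sword_Cons refl_add)

lemma sword_rscale: "sword D js (rscale r v) = rscale r (sword D js v)"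
  by (induction js) (simp_all add: sword_Cons refl_rscale)

lemma sword_sum: "sword D js (\<Sum>i\<in>I. f i) = (\<Sum>i\<in>I. sword D js (f i))"
proof (induction I rule: infinite_finite_induct)
  case empty
  show ?case using sword_rscale[of D js 0 0] by simp
next
  case (infinite I)
  thus ?case using sword_rscale[of D js 0 0] by simp
qed (simp add: sword_add)

lemma multiple_in_Qpi:
  fixes v :: "'n::finite wt"
  obtains N :: nat where "N > 0" "rscale (of_nat N) v \<in> Qpi"
proof -
  obtain N :: nat where "N > 0" "\<And>r. r \<in> range (crd v) ==> of_nat N * r \<in> \<int>"
    using common_denominator[of "range (crd v)"] by auto
  thus ?thesis by (intro that[of N]) (auto simp: Qpi_def)
qed

text \<open>The combinatorial content of the symmetric pair: all that the quantum part uses about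
  roots and \<Theta>, apart from the inclusion of Q(\<Sigma>) in P(\<Sigma>).\<close>

locale weights = cartan_weights D for D :: "('n::{finite,linorder}, 'u) qsp" +
  assumes finite_roots: "finite (roots D)"
    and sr_root: "sr i \<in> roots D"
    and root_sign: "b \<in> roots D ==> (\<forall>i. crd b i \<in> \<nat>) \<or> (\<forall>i. - crd b i \<in> \<nat>)"
    and refl_root: "b \<in> roots D ==> refl D (sr i) b \<in> roots D"
    and Th_add: "Th D (u + v) = Th D u + Th D v"
    and Th_rscale: "Th D (rscale r v) = rscale r (Th D v)"
    and Th_Th: "Th D (Th D v) = v"
    and Th_prm: "i \<notin> piTh D ==> Th D (- sr i) - sr (prm D i) \<in> QplusTh D"
begin

lemma cart_nonpos:
  assumes "i \<noteq> j"
  shows "cart D i j \<le> 0"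
proof -
  let ?v = "sr j - rscale (of_int (cart D i j)) (sr i)"
  have "?v \<in> roots D" using refl_root[OF sr_root, of i j] by (simp add: refl_sr_sr)
  moreover have "crd ?v j = 1" "crd ?v i = - of_int (cart D i j)"
    using assms by (simp_all add: lookup_minus crd_sr)
  moreover have "(-1::rat) \<notin> \<nat>" using Nats_nonneg[of "-1::rat"] by auto
  ultimately have "- of_int (cart D i j) \<in> (\<nat> :: rat set)"
    using root_sign[of ?v] by metis
  thus ?thesis using Nats_nonneg by fastforce
qed

lemma ip_sr_nonpos: "i \<noteq> j ==> ip D (sr i) (sr j) \<le> 0"
  using cart_nonpos[of i j] by (simp add: ip_sr_sr mult_nonneg_nonpos)

lemma ip_sword: "ip D (sword D js u) (sword D js v) = ip D u v"
proof (induction js)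
  case (Cons j js)
  thus ?case using ip_sr_pos[of j] by (simp add: sword_Cons ip_refl)
qed simp

lemma sword_rev [simp]: "sword D js (sword D (rev js) v) = v" "sword D (rev js) (sword D js v) = v"
  by (induction js arbitrary: v) (simp_all add: sword_Cons sword_append)

lemma sword_root: "b \<in> roots D ==> sword D js b \<in> roots D"
  by (induction js) (simp_all add: sword_Cons refl_root)

lemma finite_swords: "finite (range (sword D))"
proof -
  let ?\<Phi> = "\<lambda>w. (\<lambda>i. w (sr i)) :: 'n => 'n wt"
  have "?\<Phi> ` range (sword D) \<subseteq> PiE UNIV (\<lambda>_. roots D)"
    using sword_root[OF sr_root] by auto
  hence "finite (?\<Phi> ` range (sword D))"
    by (rule finite_subset) (auto intro!: finite_PiE simp: finite_roots)
  moreover have "inj_on ?\<Phi> (range (sword D))"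
  proof (rule inj_onI, safe)
    fix js ks assume eq: "?\<Phi> (sword D js) = ?\<Phi> (sword D ks)"
    show "sword D js = sword D ks"
    proof
      fix v
      have "sword D js v = (\<Sum>i\<in>UNIV. rscale (crd v i) (sword D js (sr i)))" for js
        by (subst wt_expand[of v]) (simp add: sword_sum sword_rscale)
      thus "sword D js v = sword D ks v" using fun_cong[OF eq] by simp
    qed
  qed
  ultimately show ?thesis by (rule finite_imageD)
qed

text \<open>
  Averaging the standard form over the finite Weyl group gives a positive definite invariant form;
  it agrees with the Cartan inner product up to a positive factor on each component.
\<close>

lemma ip_pos:
  assumes "u \<noteq> 0"
  shows "ip D u u > 0"
proof -
  define W where "W = range (sword D)"
  define G :: "'n wt => 'n wt => rat" where "G u v = (\<Sum>w\<in>W. \<Sum>i\<in>UNIV. crd (w u) i * crd (w v) i)" for u v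
  have finW: "finite W" by (simp add: W_def finite_swords)
  have Wadd: "w (u + v) = w u + w v" "w (rscale r u) = rscale r (w u)" if "w \<in> W" for w u v r
    using that by (auto simp: W_def sword_add sword_rscale)
  have Gadd: "G (u + v) x = G u x + G v x" for u v x
    by (simp add: G_def Wadd lookup_add ring_distribs sum.distrib)
  have Gsym: "G u v = G v u" for u v by (simp add: G_def mult.commute)
  have Gscale: "G (rscale r u) x = r * G u x" for r u x
    by (simp add: G_def Wadd sum_distrib_left mult_ac)
  have Gdiff: "G (u - v) x = G u x - G v x" for u v x
    using Gadd[of u "rscale (-1) v" x] Gscale[of "-1" v x] by simp
  have Gz: "G 0 x = 0" for x using Gscale[of 0 0 x] by simp
  have Gsum: "G (\<Sum>i\<in>I. f i) x = (\<Sum>i\<in>I. G (f i) x)" for I :: "'n set" and f x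
    by (induction I rule: infinite_finite_induct) (simp_all add: Gadd Gz)
  have Gpos: "G u u > 0" if u0: "u \<noteq> 0" for u
  proof -
    obtain i where i: "crd u i \<noteq> 0" using u0 by (auto simp: poly_mapping_eq_iff fun_eq_iff)
    have id: "id \<in> W" unfolding W_def by (metis rangeI sword_Nil)
    have nn: "(\<Sum>i\<in>UNIV. crd (w u) i * crd (w u) i) \<ge> 0" for w by (intro sum_nonneg) simp
    have "0 < crd u i * crd u i" using i by (metis not_real_square_gt_zero power2_eq_square zero_less_power2)
    also have "\<dots> \<le> (\<Sum>i\<in>UNIV. crd u i * crd u i)" by (intro member_le_sum) auto
    also have "\<dots> = (\<Sum>i\<in>UNIV. crd (id u) i * crd (id u) i)" by simp
    also have "\<dots> \<le> G u u" unfolding G_def using nn finW id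
      by (intro member_le_sum[of id W "\<lambda>w. \<Sum>i\<in>UNIV. crd (w u) i * crd (w u) i"]) auto
    finally show ?thesis .
  qed
  have Grefl: "G (refl D (sr i) u) (refl D (sr i) v) = G u v" for i u v
  proof -
    have ran: "w \<circ> refl D (sr i) \<in> W" if "w \<in> W" for w
    proof -
      obtain js where "w = sword D js" using \<open>w \<in> W\<close> by (auto simp: W_def)
      hence "w \<circ> refl D (sr i) = sword D (js @ [i])" by (auto simp: sword_append sword_Cons)
      thus ?thesis by (simp add: W_def)
    qed
    have "G u v = (\<Sum>w\<in>W. (\<lambda>w. \<Sum>j\<in>UNIV. crd (w u) j * crd (w v) j) (w \<circ> refl D (sr i)))"
      unfolding G_def
      by (rule sum.reindex_bij_witness[of _ "\<lambda>w. w \<circ> refl D (sr i)" "\<lambda>w. w \<circ> refl D (sr i)"])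
        (use ran in \<open>auto simp: fun_eq_iff\<close>)
    thus ?thesis by (simp add: G_def)
  qed
  have G2: "2 * G v (sr i) = 2 * ip D v (sr i) / ip D (sr i) (sr i) * G (sr i) (sr i)" for v i
  proof -
    have "refl D (sr i) (sr i) = - sr i"
      by (rule wt_eqI) (simp add: refl_sr_sr cart_diag lookup_minus)
    hence "G (refl D (sr i) v) (- sr i) = G v (sr i)" using Grefl[of i v "sr i"] by simp
    moreover have "G x (- sr i) = - G x (sr i)" for x using Gscale[of "-1" "sr i" x] by (simp add: Gsym[of x])
    ultimately show ?thesis by (simp add: refl_def Gdiff Gscale)
  qed
  \<comment> \<open>Invariance gives G the same Cartan integers as \<open>ip\<close>, so the two
    forms differ by the factor \<open>r i\<close> in the slot of \<alpha>_i, and symmetry of both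
    makes simple roots with different factors orthogonal for G. Grouping u by these factors
    diagonalizes the comparison.\<close>
  define r where "r i = ip D (sr i) (sr i) / G (sr i) (sr i)" for i
  have rpos: "r i > 0" for i using ip_sr_pos[of i] Gpos[of "sr i"] by (simp add: r_def)
  have ipG: "ip D v (sr i) = r i * G v (sr i)" for v i
    using G2[of v i] ip_sr_pos[of i] Gpos[of "sr i"] by (simp add: r_def field_simps)
  have G0: "G (sr i) (sr j) = 0" if "r i \<noteq> r j" for i j
    using ipG[of "sr i" j] ipG[of "sr j" i] ip_comm[of "sr i" "sr j"] Gsym[of "sr i" "sr j"] that by auto
  define pr where "pr \<rho> = (\<Sum>i\<in>{i \<in> UNIV. r i = \<rho>}. rscale (crd u i) (sr i))" for \<rho>
  have u: "u = (\<Sum>\<rho>\<in>range r. pr \<rho>)"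
    unfolding pr_def by (subst wt_expand[of u], rule sum.image_gen) simp
  have Gsum2: "G x (\<Sum>i\<in>I. f i) = (\<Sum>i\<in>I. G x (f i))" for I :: "'n set" and f x
    using Gsum[of f I x] by (simp only: Gsym[of x])
  have Gscale2: "G x (rscale r u) = r * G x u" for r u x
    using Gscale[of r u x] by (simp only: Gsym[of x])
  have ippr: "ip D x (pr \<rho>) = \<rho> * G x (pr \<rho>)" for x \<rho>
  proof -
    have "ip D x (pr \<rho>) = (\<Sum>i\<in>{i \<in> UNIV. r i = \<rho>}. crd u i * ip D x (sr i))"
      by (simp add: pr_def ip_sum_right)
    also have "\<dots> = (\<Sum>i\<in>{i \<in> UNIV. r i = \<rho>}. \<rho> * (crd u i * G x (sr i)))"
      by (intro sum.cong refl) (simp add: ipG)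
    finally show ?thesis by (simp add: pr_def Gsum2 Gscale2 sum_distrib_left)
  qed
  have orth: "G (pr \<rho>) (pr \<sigma>) = 0" if "\<rho> \<noteq> \<sigma>" for \<rho> \<sigma>
  proof -
    have "G (pr \<rho>) (pr \<sigma>) = (\<Sum>i\<in>{i \<in> UNIV. r i = \<rho>}. \<Sum>j\<in>{i \<in> UNIV. r i = \<sigma>}.
        crd u i * (crd u j * G (sr i) (sr j)))"
      by (simp only: pr_def Gsum Gscale) (simp only: Gsum2 Gscale2 sum_distrib_left)
    also have "\<dots> = 0" using G0 that by (intro sum.neutral ballI) auto
    finally show ?thesis .
  qed
  have "ip D u u = (\<Sum>\<rho>\<in>range r. \<Sum>\<sigma>\<in>range r. ip D (pr \<sigma>) (pr \<rho>))"
    by (subst (1 2) u) (simp add: ip_sum_left ip_sum_right)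
  also have "\<dots> = (\<Sum>\<rho>\<in>range r. \<Sum>\<sigma>\<in>range r. if \<sigma> = \<rho> then \<rho> * G (pr \<rho>) (pr \<rho>) else 0)"
    by (intro sum.cong refl) (simp add: ippr orth)
  also have "\<dots> = (\<Sum>\<rho>\<in>range r. \<rho> * G (pr \<rho>) (pr \<rho>))"
    by (intro sum.cong refl) (simp add: sum.delta)
  also have "\<dots> > 0"
  proof -
    obtain \<rho> where \<rho>: "\<rho> \<in> range r" "pr \<rho> \<noteq> 0" using u assms by (metis sum.neutral)
    have nn: "\<sigma> * G (pr \<sigma>) (pr \<sigma>) \<ge> 0" if "\<sigma> \<in> range r" for \<sigma>
    proof (cases "pr \<sigma> = 0")
      case True
      thus ?thesis using Gz by simp
    next
      case False
      thus ?thesis using Gpos[OF False] rpos that by (auto intro!: mult_nonneg_nonneg less_imp_le)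
    qed
    have "0 < \<rho> * G (pr \<rho>) (pr \<rho>)" using \<rho> rpos Gpos[of "pr \<rho>"] by auto
    thus ?thesis using nn \<rho>(1) by (intro sum_pos2[of _ \<rho>]) auto
  qed
  finally show ?thesis .
qed

lemma ip_self_eq_0: "ip D u u = 0 \<longleftrightarrow> u = 0"
  using ip_pos[of u] by (cases "u = 0") auto

lemma ip_nondegenerate:
  assumes "\<And>i. ip D v (sr i) = 0"
  shows "v = 0"
proof -
  have "ip D v v = (\<Sum>i\<in>UNIV. crd v i * ip D v (sr i))"
    by (subst (2) wt_expand[of v]) (simp add: ip_sum_right)
  thus ?thesis using assms ip_self_eq_0[of v] by simp
qed

lemma crd_sword_outside:
  assumes "set js \<subseteq> J" "i \<notin> J"
  shows "crd (sword D js v) i = crd v i"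
  using assms by (induction js) (auto simp: sword_Cons refl_def lookup_minus crd_sr)

lemma root_nonneg_or: "b \<in> roots D ==> (\<forall>i. crd b i \<ge> 0) \<or> (\<forall>i. crd b i \<le> 0)"
  using root_sign[of b] Nats_nonneg by (metis neg_0_le_iff_le)

text \<open>The letters of js act on b from left to right. A simple reflection changes a single
  coordinate, so a positive root can turn negative only where all its other coordinates vanish. The
  factor c stays general because multiples of simple roots are not excluded here.\<close>

lemma sign_change:
  assumes "b \<in> roots D" "\<forall>i. crd b i \<ge> 0" "\<not> (\<forall>i. crd (sword D (rev js) b) i \<ge> 0)" "b \<noteq> 0"
  shows "\<exists>xs j ys c. js = xs @ j # ys \<and> c \<noteq> 0 \<and> sword D (rev xs) b = rscale c (sr j)"
  using assms
proof (induction js arbitrary: b)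
  case (Cons j js)
  let ?b = "refl D (sr j) b"
  have b: "?b \<in> roots D" by (rule refl_root[OF Cons.prems(1)])
  have b0: "?b \<noteq> 0" 
  proof
    assume "?b = 0"
    hence "b = refl D (sr j) 0" using refl_sr_refl[of j b] by simp
    thus False using Cons.prems(4) refl_rscale[of D "sr j" 0 0] by simp
  qed
  show ?case
  proof (cases "\<forall>i. crd ?b i \<ge> 0")
    case True
    have "\<not> (\<forall>i. crd (sword D (rev js) ?b) i \<ge> 0)"
      using Cons.prems(3) by (simp add: sword_append sword_Cons)
    from Cons.IH[OF b True this b0] obtain xs k ys c
      where "js = xs @ k # ys" "c \<noteq> 0" "sword D (rev xs) ?b = rscale c (sr k)" by blast
    thus ?thesis
      by (intro exI[of _ "j # xs"] exI[of _ k] exI[of _ ys] exI[of _ c]) (simp add: sword_append sword_Cons)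
  next
    case False
    hence neg: "\<forall>i. crd ?b i \<le> 0" using root_nonneg_or[OF b] by blast
    have "crd b i = 0" if "i \<noteq> j" for i
    proof -
      have "crd ?b i = crd b i" using that by (simp add: refl_def lookup_minus crd_sr)
      thus ?thesis using neg Cons.prems(2) by (metis order_antisym)
    qed
    hence "b = rscale (crd b j) (sr j)" by (intro wt_eqI) (auto simp: crd_sr)
    moreover from this have "crd b j \<noteq> 0" using Cons.prems(4) by (metis rscale_simps(2))
    ultimately show ?thesis
      by (intro exI[of _ "[]"] exI[of _ j] exI[of _ js] exI[of _ "crd b j"]) simp
  qed
qed simp

lemma reducedTh_tl: "reducedTh D (j # js) ==> reducedTh D js"
proof -
  assume r: "reducedTh D (j # js)"
  show "reducedTh D js" unfolding reducedTh_def
  proof (safe)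
    fix ks assume "set ks \<subseteq> piTh D" "sword D ks = sword D js"
    hence "sword D (j # ks) = sword D (j # js)" "set (j # ks) \<subseteq> piTh D"
      using r by (auto simp: fun_eq_iff sword_Cons reducedTh_def)
    hence "length (j # js) \<le> length (j # ks)" using r unfolding reducedTh_def by blast
    thus "length js \<le> length ks" by simp
  qed (use r in \<open>auto simp: reducedTh_def\<close>)
qed

lemma refl_scale_root: "c \<noteq> 0 ==> refl D (rscale c b) = refl D b"
  by (rule ext) (simp add: refl_def)

lemma refl_sword: "refl D (sword D js b) (sword D js v) = sword D js (refl D b v)"
proof -
  have "sword D js (- b) = - sword D js b" for b using sword_rscale[of D js "-1" b] by simp
  hence "sword D js (u - v) = sword D js u - sword D js v" for u v
    using sword_add[of D js u "- v"] by simp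
  thus ?thesis by (simp add: refl_def ip_sword sword_rscale)
qed

text \<open>Exchange argument: a sign change along js happens at a letter j for which \<alpha>_k is
  conjugate to a multiple of \<alpha>_j, so k and j can both be deleted from the word without
  changing the product, against minimality of its length.\<close>

lemma reduced_positive:
  assumes r: "reducedTh D (k # js)"
  shows "crd (sword D (rev js) (sr k)) i \<ge> 0"
proof (rule ccontr)
  assume "\<not> 0 \<le> crd (sword D (rev js) (sr k)) i"
  hence neg: "\<not> (\<forall>i. crd (sword D (rev js) (sr k)) i \<ge> 0)" by blast
  have nn: "\<forall>i. crd (sr k) i \<ge> 0" by (simp add: crd_sr)
  obtain xs j ys c where js: "js = xs @ j # ys" and c: "c \<noteq> 0" "sword D (rev xs) (sr k) = rscale c (sr j)"
    using sign_change[OF sr_root nn neg sr_nonzero] by blast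
  have "refl D (sr j) v = sword D (rev xs) (refl D (sr k) (sword D xs v))" for v
    using refl_sword[of "rev xs" "sr k" "sword D xs v"] c by (simp add: refl_scale_root)
  hence e: "sword D xs (refl D (sr j) v) = refl D (sr k) (sword D xs v)" for v by simp
  have "sword D (xs @ ys) = sword D (k # js)"
  proof
    fix v
    have "sword D (k # js) v = refl D (sr k) (sword D xs (refl D (sr j) (sword D ys v)))"
      by (simp add: js sword_Cons sword_append)
    also have "\<dots> = sword D xs (sword D ys v)" by (simp flip: e)
    finally show "sword D (xs @ ys) v = sword D (k # js) v" by (simp add: sword_append)
  qed
  moreover have "set (xs @ ys) \<subseteq> piTh D" using r by (auto simp: js reducedTh_def)
  ultimately have "length (k # js) \<le> length (xs @ ys)" using r unfolding reducedTh_def by blast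
  thus False by (simp add: js)
qed

text \<open>The conjugated root is positive with support in \<pi>_\<Theta>, so it pairs
  nonpositively with \<alpha>_p. Hence the rounding by \<open>nat\<close> and floor in
  \<open>ad_divided\<close> loses nothing.\<close>

lemma reduced_exponent:
  assumes r: "reducedTh D (k # js)" and p: "p \<notin> piTh D"
  obtains m :: nat where "- 2 * ip D (sr k) (sword D js (sr p)) / ip D (sr k) (sr k) = of_nat m"
proof -
  let ?b = "sword D (rev js) (sr k)"
  have sub: "set js \<subseteq> piTh D" "k \<in> piTh D" using r by (auto simp: reducedTh_def)
  have "ip D (sr k) (sword D js (sr p)) = ip D ?b (sr p)"
    using ip_sword[of js ?b "sr p"] by simp
  also have "\<dots> = (\<Sum>i\<in>UNIV. crd ?b i * ip D (sr i) (sr p))"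
    by (subst wt_expand[of ?b]) (simp add: ip_sum_left)
  also have "\<dots> \<le> 0"
  proof (rule sum_nonpos)
    fix i
    show "crd ?b i * ip D (sr i) (sr p) \<le> 0"
    proof (cases "i = p")
      case True
      hence "crd ?b i = 0" using crd_sword_outside[of "rev js" "piTh D" p "sr k"] sub p by (auto simp: crd_sr)
      thus ?thesis by simp
    qed (use reduced_positive[OF r] ip_sr_nonpos in \<open>auto intro: mult_nonneg_nonpos\<close>)
  qed
  finally have le: "ip D (sr k) (sword D js (sr p)) \<le> 0" .
  have "sword D js (sr p) \<in> roots D" by (rule sword_root[OF sr_root])
  hence "\<forall>i. crd (sword D js (sr p)) i \<in> \<int>"
    using root_sign Nats_subset_Ints by (metis minus_in_Ints_iff subsetD)
  hence "2 * ip D (sword D js (sr p)) (sr k) / ip D (sr k) (sr k) \<in> \<int>"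
    unfolding cf_sum by (auto intro!: Ints_sum Ints_mult)
  then obtain n where n: "2 * ip D (sr k) (sword D js (sr p)) / ip D (sr k) (sr k) = of_int n"
    by (auto elim: Ints_cases simp: ip_comm)
  hence "(of_int n :: rat) \<le> 0" using le ip_sr_pos[of k] by (auto simp: divide_nonpos_pos simp flip: n)
  hence "n \<le> 0" by simp
  hence "- 2 * ip D (sr k) (sword D js (sr p)) / ip D (sr k) (sr k) = of_nat (nat (- n))" using n by simp
  thus ?thesis by (rule that)
qed

text \<open>Justifies the choice in \<open>w0Th\<close>: the length of a reduced word depends only
  on its product, and there are finitely many products, so a longest reduced word exists.\<close>

lemma w0Th_reduced: "reducedTh D (w0Th D)"
proof -
  let ?L = "{length js | js. reducedTh D js}"
  have "?L \<subseteq> (\<lambda>w. LEAST n. \<exists>ks. set ks \<subseteq> piTh D \<and> sword D ks = w \<and> length ks = n) ` range (sword D)"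
  proof safe
    fix js assume r: "reducedTh D js"
    have "(LEAST n. \<exists>ks. set ks \<subseteq> piTh D \<and> sword D ks = sword D js \<and> length ks = n) = length js"
      by (rule Least_equality) (use r in \<open>auto simp: reducedTh_def\<close>)
    thus "length js \<in> (\<lambda>w. LEAST n. \<exists>ks. set ks \<subseteq> piTh D \<and> sword D ks = w \<and> length ks = n) ` range (sword D)"
      by (intro image_eqI[of _ _ "sword D js"]) auto
  qed
  hence fin: "finite ?L" using finite_swords by (metis (no_types, lifting) finite_imageI finite_subset)
  have "reducedTh D []" by (simp add: reducedTh_def)
  hence "?L \<noteq> {}" by auto
  hence "Max ?L \<in> ?L" using fin by (rule Max_in[rotated])
  then obtain js where js: "reducedTh D js" "length js = Max ?L" by auto
  hence "\<exists>js. reducedTh D js \<and> (\<forall>ks. reducedTh D ks \<longrightarrow> length ks \<le> length js)"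
    using fin by (metis (mono_tags, lifting) Max_ge mem_Collect_eq)
  from someI_ex[OF this] show ?thesis unfolding w0Th_def by blast
qed

end

section \<open>Restricted weights and independence of their characters\<close>

context weights begin

lemma Th_minus: "Th D (- v) = - Th D v"
  using Th_rscale[of "-1" v] by simp

lemma Th_diff: "Th D (u - v) = Th D u - Th D v"
  using Th_add[of u "- v"] by (simp add: Th_minus)

lemma Th_0 [simp]: "Th D 0 = 0"
  using Th_rscale[of 0 0] by simp

lemma tilde_add: "tilde D (u + v) = tilde D u + tilde D v"
  by (simp add: tilde_def Th_add rscale_distribs)

lemma tilde_rscale: "tilde D (rscale r v) = rscale r (tilde D v)"
  by (simp add: tilde_def Th_rscale rscale_distribs)

lemma tilde_0 [simp]: "tilde D 0 = 0"
  by (simp add: tilde_def)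

lemma tilde_sum: "tilde D (\<Sum>i\<in>I. f i) = (\<Sum>i\<in>I. tilde D (f i))"
  by (induction I rule: infinite_finite_induct) (simp_all add: tilde_add)

lemma Th_tilde: "Th D (tilde D v) = - tilde D v"
  by (simp add: tilde_def Th_rscale Th_diff Th_Th rscale_distribs)

lemma tilde_anti: "Th D v = - v ==> tilde D v = v"
  by (simp add: tilde_def rscale_distribs flip: rscale_distribs(1))

lemma tilde_piTh: "i \<in> piTh D ==> tilde D (sr i) = 0"
  by (simp add: tilde_def piTh_def)

lemma fixed_plus_tilde: "Th D (rscale (1/2) (v + Th D v)) = rscale (1/2) (v + Th D v)"
  by (simp add: Th_rscale Th_add Th_Th add.commute)

lemma Th_sr:
  assumes "i \<notin> piTh D"
  obtains \<eta> where "Th D (sr i) = - sr (prm D i) - \<eta>" "\<eta> \<in> QplusTh D"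
  using that[of "Th D (- sr i) - sr (prm D i)"] Th_prm[OF assms] by (simp add: Th_minus)

lemma Th_QplusTh:
  assumes "\<eta> \<in> QplusTh D"
  shows "Th D \<eta> = \<eta>"
proof -
  have s: "\<eta> = (\<Sum>i\<in>UNIV. rscale (crd \<eta> i) (sr i))" by (rule wt_expand)
  have Ts: "Th D (\<Sum>i\<in>I. f i) = (\<Sum>i\<in>I. Th D (f i))" for I :: "'n set" and f
    by (induction I rule: infinite_finite_induct) (simp_all add: Th_add)
  have "Th D \<eta> = (\<Sum>i\<in>UNIV. rscale (crd \<eta> i) (Th D (sr i)))"
    by (subst s) (simp add: Ts Th_rscale)
  also have "\<dots> = (\<Sum>i\<in>UNIV. rscale (crd \<eta> i) (sr i))"
    using assms by (intro sum.cong refl) (auto simp: piTh_def QplusTh_def)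
  finally show ?thesis using s by simp
qed

text \<open>Applying \<Theta> to \<Theta>(\<alpha>_i) = -\<alpha>_p(i) - \<eta>, with \<eta> fixed,
  gives the mirrored formula for \<Theta>(\<alpha>_p(i)). The fixed difference is what puts
  tau(\<alpha>_i - \<alpha>_p(i)) into T_\<Theta>.\<close>

lemma prm_notin: "i \<notin> piTh D ==> prm D i \<notin> piTh D"
  and Th_sr_diff: "i \<notin> piTh D ==> Th D (sr i - sr (prm D i)) = sr i - sr (prm D i)"
proof -
  assume i: "i \<notin> piTh D"
  obtain \<eta> where \<eta>: "Th D (sr i) = - sr (prm D i) - \<eta>" "\<eta> \<in> QplusTh D" using Th_sr[OF i] .
  have "sr i = - Th D (sr (prm D i)) - \<eta>"
    using Th_Th[of "sr i"] \<eta> by (simp add: Th_diff Th_minus Th_QplusTh)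
  moreover have "Th D (sr (prm D i)) = - (- Th D (sr (prm D i)) - \<eta>) - \<eta>" by simp
  ultimately have p: "Th D (sr (prm D i)) = - sr i - \<eta>" by metis
  show "Th D (sr i - sr (prm D i)) = sr i - sr (prm D i)" by (simp add: Th_diff \<eta> p)
  show "prm D i \<notin> piTh D"
  proof
    assume "prm D i \<in> piTh D"
    hence "sr (prm D i) = - sr i - \<eta>" using p by (simp add: piTh_def)
    hence "crd (sr (prm D i)) i = - 1 - crd \<eta> i" by (simp add: lookup_minus crd_sr)
    moreover have "crd \<eta> i = 0" using \<eta>(2) i by (auto simp: QplusTh_def)
    ultimately show False by (simp add: crd_sr split: if_splits)
  qed
qed

lemma crd_tilde_sr:
  assumes "i \<notin> piTh D"
  shows "crd (tilde D (sr i)) j \<ge> 0" "crd (tilde D (sr i)) i > 0"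
proof -
  obtain \<eta> where \<eta>: "Th D (sr i) = - sr (prm D i) - \<eta>" "\<eta> \<in> QplusTh D" using Th_sr[OF assms] .
  have nn: "crd \<eta> j \<ge> 0" for j
    using \<eta>(2) Nats_nonneg unfolding QplusTh_def by (cases "j \<in> piTh D") auto
  have e: "crd (tilde D (sr i)) j = 1/2 * (crd (sr i) j + crd (sr (prm D i)) j + crd \<eta> j)" for j
    by (simp add: tilde_def \<eta> lookup_minus lookup_add)
  thus "crd (tilde D (sr i)) j \<ge> 0" "crd (tilde D (sr i)) i > 0"
    unfolding e using nn[of i] nn[of j] by (auto simp: crd_sr)
qed

lemma tilde_sr_pos:
  assumes "i \<notin> piTh D"
  shows "tilde D (sr i) > 0"
proof (rule pm_pos)
  show "tilde D (sr i) \<noteq> 0" using crd_tilde_sr(2)[OF assms] by auto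
qed (rule crd_tilde_sr(1)[OF assms])

lemma finite_Sigma: "finite (Sigma_r D)" "finite (Sigma_pos D)"
proof -
  have "Sigma_r D \<subseteq> tilde D ` roots D" "Sigma_pos D \<subseteq> tilde D ` roots D"
    by (auto simp: Sigma_r_def Sigma_pos_def pos_roots_def)
  thus "finite (Sigma_r D)" "finite (Sigma_pos D)" using finite_roots finite_subset by blast+
qed

lemma anti_span: "v \<in> rv.span (Sigma_r D) \<longleftrightarrow> Th D v = - v"
proof
  assume "v \<in> rv.span (Sigma_r D)"
  thus "Th D v = - v"
  proof (induction rule: rv.span_induct)
    case base
    show ?case by (auto simp: rv.subspace_def Th_add Th_rscale)
  qed (auto simp: Sigma_r_def Th_tilde)
next
  assume "Th D v = - v"
  hence "v = tilde D v" by (simp add: tilde_anti)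
  also have "\<dots> = (\<Sum>i\<in>UNIV. rscale (crd v i) (tilde D (sr i)))"
    by (subst wt_expand[of v]) (simp add: tilde_sum tilde_rscale)
  also have "\<dots> \<in> rv.span (Sigma_r D)"
  proof (intro rv.span_sum rv.span_scale)
    fix i
    show "tilde D (sr i) \<in> rv.span (Sigma_r D)"
    proof (cases "i \<in> piTh D")
      case True
      thus ?thesis by (simp add: tilde_piTh rv.span_zero)
    next
      case False
      hence "tilde D (sr i) \<in> Sigma_r D" using sr_root by (auto simp: Sigma_r_def piTh_def)
      thus ?thesis by (rule rv.span_base)
    qed
  qed
  finally show "v \<in> rv.span (Sigma_r D)" .
qed

lemma span_Sigma: "(\<exists>k. v = (\<Sum>b\<in>Sigma_r D. rscale (k b) b)) \<longleftrightarrow> Th D v = - v"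
  unfolding anti_span[symmetric] rv.span_finite[OF finite_Sigma(1)] by auto

text \<open>Gram-Schmidt: the new generator a is split into its projection a1 and a part a'
  orthogonal to the span of A, and the representing vector is corrected along a' only.\<close>

lemma riesz:
  assumes "finite A" and f: "\<And>u v. f (u + v) = f u + f v" "\<And>r v. f (rscale r v) = r * (f v :: rat)"
  shows "\<exists>y\<in>rv.span A. \<forall>s\<in>rv.span A. ip D y s = f s"
  using assms
proof (induction A arbitrary: f rule: finite_induct)
  case empty
  thus ?case using empty.prems(2)[of 0 0] by (intro bexI[of _ 0]) auto
next
  case (insert a A)
  obtain a1 where a1: "a1 \<in> rv.span A" "\<forall>s\<in>rv.span A. ip D a1 s = ip D a s"
    using insert.IH[of "ip D a"] by (auto simp: ip_add_right)
  obtain y0 where y0: "y0 \<in> rv.span A" "\<forall>s\<in>rv.span A. ip D y0 s = f s"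
    using insert.IH[OF insert.prems] by blast
  define a' where "a' = a - a1"
  have orth: "ip D a' s = 0" "ip D s a' = 0" if "s \<in> rv.span A" for s
    using a1(2) that by (auto simp: a'_def ip_diff_left ip_comm[of s])
  have a1A: "a1 \<in> rv.span (insert a A)" using a1(1) rv.span_mono[of A "insert a A"] by auto
  have a': "a' \<in> rv.span (insert a A)"
    unfolding a'_def by (intro rv.span_diff a1A rv.span_base) simp
  \<comment> \<open>If a' = 0 this division yields 0, and the correction disappears.\<close>
  define c where "c = f a' / ip D a' a'"
  have fa': "ip D (y0 + rscale c a') a' = f a'"
  proof (cases "a' = 0")
    case True
    thus ?thesis using insert.prems(2)[of 0 0] by simp
  next
    case False
    thus ?thesis using orth(2)[OF y0(1)] ip_self_eq_0[of a'] by (simp add: ip_add_left c_def)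
  qed
  have A: "ip D (y0 + rscale c a') s = f s" if "s \<in> rv.span A" for s
    using that y0(2) orth(1) by (simp add: ip_add_left)
  have "ip D (y0 + rscale c a') s = f s" if "s \<in> rv.span (insert a A)" for s
    using that
  proof (induction rule: rv.span_induct)
    case base
    show ?case using insert.prems(2)[of 0 0] by (auto simp: rv.subspace_def ip_add_right insert.prems)
  next
    case (step s)
    show ?case
    proof (cases "s = a")
      case True
      hence "s = a' + a1" by (simp add: a'_def)
      thus ?thesis using fa' A[OF a1(1)] by (simp add: ip_add_right insert.prems)
    next
      case False
      thus ?thesis using step A rv.span_base by auto
    qed
  qed
  moreover have "y0 + rscale c a' \<in> rv.span (insert a A)"
    using y0(1) rv.span_mono[of A "insert a A"] a' by (intro rv.span_add rv.span_scale) auto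
  ultimately show ?case by blast
qed

lemma P2Sigma_anti: "v \<in> P2Sigma D ==> Th D v = - v"
  and PSigma_anti: "v \<in> PSigma D ==> Th D v = - v"
  by (auto simp: P2Sigma_def PSigma_def span_Sigma Th_rscale)

lemma PSigma_add: "u \<in> PSigma D ==> v \<in> PSigma D ==> u + v \<in> PSigma D"
  unfolding PSigma_def span_Sigma
  by (auto simp: Th_add ip_add_left ring_distribs add_divide_distrib)

lemma PSigma_0 [simp]: "0 \<in> PSigma D"
  unfolding PSigma_def span_Sigma by simp

lemma P2Sigma_PSigma: "v \<in> P2Sigma D ==> v \<in> PSigma D"
proof -
  assume "v \<in> P2Sigma D"
  then obtain u where "u \<in> PSigma D" "v = rscale 2 u" by (auto simp: P2Sigma_def)
  moreover have "rscale 2 u = u + u" by (simp add: rscale_distribs(1)[of 1 1, simplified])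
  ultimately show ?thesis using PSigma_add by simp
qed

lemma Pplus2Sigma_add: "u \<in> Pplus2Sigma D ==> v \<in> Pplus2Sigma D ==> u + v \<in> Pplus2Sigma D"
proof -
  assume "u \<in> Pplus2Sigma D" "v \<in> Pplus2Sigma D"
  then obtain a b where ab: "a \<in> PplusSigma D" "b \<in> PplusSigma D" "u = rscale 2 a" "v = rscale 2 b"
    by (auto simp: Pplus2Sigma_def)
  hence "a + b \<in> PplusSigma D" by (auto simp: PplusSigma_def PSigma_add ip_add_left)
  thus ?thesis using ab by (auto simp: Pplus2Sigma_def image_iff rscale_distribs intro!: bexI[of _ "a + b"])
qed

text \<open>Only finitely many restricted roots impose integrality conditions, so a common
  denominator exists; the factor 2 leads from P(\<Sigma>) to P(2\<Sigma>).\<close>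

lemma Pplus2Sigma_multiple:
  assumes "Th D v = - v" "\<And>b. b \<in> Sigma_pos D ==> ip D v b \<ge> 0"
  obtains N :: nat where "N > 0" "rscale (of_nat N) v \<in> Pplus2Sigma D"
proof -
  obtain N :: nat where N: "N > 0" "\<And>r. r \<in> (\<lambda>b. 2 * ip D v b / ip D b b) ` Sigma_r D ==> of_nat N * r \<in> \<int>"
    using common_denominator[OF finite_imageI[OF finite_Sigma(1)]] by metis
  have "of_nat N * (2 * ip D v b / ip D b b) \<in> \<int>" if "b \<in> Sigma_r D" for b using N(2) that by blast
  hence "rscale (of_nat N) v \<in> PplusSigma D"
    unfolding PplusSigma_def PSigma_def span_Sigma using assms by (auto simp: Th_rscale mult_ac)
  hence "rscale 2 (rscale (of_nat N) v) \<in> Pplus2Sigma D" unfolding Pplus2Sigma_def by (rule imageI)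
  thus ?thesis using N(1) by (intro that[of "2 * N"]) auto
qed

text \<open>The vector v0 representing the coordinate sum is strictly dominant, since restricted
  positive roots have nonnegative coordinates. If it happens to be orthogonal to \<gamma>, then K v0
  + \<gamma> is still dominant for large K and pairs with \<gamma> to (\<gamma>,\<gamma>).\<close>

lemma Pplus2Sigma_separates:
  assumes "Th D \<gamma> = - \<gamma>" "\<gamma> \<noteq> 0"
  shows "\<exists>M\<in>Pplus2Sigma D. ip D M \<gamma> \<noteq> 0"
proof -
  define f where "f v = (\<Sum>i\<in>UNIV. crd v i)" for v :: "'n wt"
  have "f (u + v) = f u + f v" "f (rscale r v) = r * f v" for u v r
    by (simp_all add: f_def lookup_add sum.distrib sum_distrib_left)
  from riesz[OF finite_Sigma(1), of f, OF this]
  obtain v0 where v0: "v0 \<in> rv.span (Sigma_r D)" "\<forall>s\<in>rv.span (Sigma_r D). ip D v0 s = f s"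
    by blast
  have pos: "ip D v0 b > 0" if b: "b \<in> Sigma_pos D" for b
  proof -
    obtain v where v: "b = tilde D v" "\<forall>i. crd v i \<ge> 0" "Th D v \<noteq> v"
      using b by (auto simp: Sigma_pos_def pos_roots_def)
    have "b = (\<Sum>i\<in>UNIV. rscale (crd v i) (tilde D (sr i)))"
      unfolding v(1) by (subst wt_expand[of v]) (simp add: tilde_sum tilde_rscale)
    hence "crd b j = (\<Sum>i\<in>UNIV. crd v i * crd (tilde D (sr i)) j)" for j by (simp add: lookup_sum)
    moreover have "crd (tilde D (sr i)) j \<ge> 0" for i j
      using crd_tilde_sr(1)[of i j] tilde_piTh[of i] by (cases "i \<in> piTh D") auto
    ultimately have nn: "crd b j \<ge> 0" for j using v(2) by (auto intro!: sum_nonneg)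
    have "b \<noteq> 0" using v(1,3) by (auto simp: tilde_def)
    then obtain j where j: "crd b j \<noteq> 0" by (auto simp: poly_mapping_eq_iff fun_eq_iff)
    have "0 < crd b j" using j nn[of j] by simp
    also have "\<dots> \<le> f b" unfolding f_def using nn by (intro member_le_sum) auto
    finally have "f b > 0" .
    moreover have "b \<in> rv.span (Sigma_r D)" unfolding anti_span v(1) by (rule Th_tilde)
    ultimately show ?thesis using v0(2) by simp
  qed
  have anti0: "Th D v0 = - v0" using v0(1) by (simp add: anti_span)
  show ?thesis
  proof (cases "ip D v0 \<gamma> = 0")
    case False
    obtain N :: nat where "N > 0" "rscale (of_nat N) v0 \<in> Pplus2Sigma D"
      using Pplus2Sigma_multiple[OF anti0] pos less_imp_le by metis
    thus ?thesis using False by (intro bexI[of _ "rscale (of_nat N) v0"]) auto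
  next
    case True
    define K where "K = (\<Sum>b\<in>Sigma_pos D. \<bar>ip D \<gamma> b\<bar> / ip D v0 b)"
    define u where "u = rscale K v0 + \<gamma>"
    have "ip D u b \<ge> 0" if b: "b \<in> Sigma_pos D" for b
    proof -
      have "\<bar>ip D \<gamma> b\<bar> / ip D v0 b \<le> K"
        unfolding K_def using pos finite_Sigma(2) b
        by (intro member_le_sum[of b _ "\<lambda>b. \<bar>ip D \<gamma> b\<bar> / ip D v0 b"]) (auto intro!: divide_nonneg_pos)
      hence "\<bar>ip D \<gamma> b\<bar> \<le> K * ip D v0 b" using pos[OF b] by (simp add: field_simps)
      thus ?thesis by (simp add: u_def ip_add_left)
    qed
    moreover have "Th D u = - u" by (simp add: u_def Th_add Th_rscale anti0 assms(1))
    ultimately obtain N :: nat where N: "N > 0" "rscale (of_nat N) u \<in> Pplus2Sigma D"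
      using Pplus2Sigma_multiple by metis
    have "ip D u \<gamma> \<noteq> 0" using True ip_self_eq_0[of \<gamma>] assms(2) by (simp add: u_def ip_add_left)
    thus ?thesis using N by (intro bexI[of _ "rscale (of_nat N) u"]) auto
  qed
qed

text \<open>Distinct exponents in the -1 eigenspace of \<Theta> give distinct characters of the
  monoid of dominant weights, because q^r = 1 only for r = 0.\<close>

lemma qchars_independent:
  assumes "finite \<Gamma>" "\<And>\<gamma>. \<gamma> \<in> \<Gamma> ==> Th D \<gamma> = - \<gamma>"
    and "\<And>M. M \<in> Pplus2Sigma D ==> (\<Sum>\<gamma>\<in>\<Gamma>. c \<gamma> * qpow (ip D M \<gamma>)) = 0" and "\<gamma> \<in> \<Gamma>"
  shows "c \<gamma> = 0"
proof (rule characters_independent[where L = "Pplus2Sigma D" and I = \<Gamma>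
      and \<chi> = "\<lambda>\<gamma> M. qpow (ip D M \<gamma>)"])
  obtain N :: nat where "rscale (of_nat N) 0 \<in> Pplus2Sigma D"
    using Pplus2Sigma_multiple[of 0] by auto
  thus "\<exists>M\<in>Pplus2Sigma D. qpow (ip D M \<gamma>) \<noteq> 0" for \<gamma> by auto
  show "\<exists>M\<in>Pplus2Sigma D. qpow (ip D M \<gamma>) \<noteq> qpow (ip D M \<gamma>')"
    if "\<gamma> \<in> \<Gamma>" "\<gamma>' \<in> \<Gamma>" "\<gamma> \<noteq> \<gamma>'" for \<gamma> \<gamma>'
    using Pplus2Sigma_separates[of "\<gamma> - \<gamma>'"] that assms(2)
    by (auto simp: Th_diff ip_diff_right qpow_eq_iff)
qed (use assms in \<open>auto simp: Pplus2Sigma_add ip_add_left qpow_add\<close>)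

lemma qchars_Qpi_independent:
  assumes "finite \<Gamma>" and "\<And>\<beta>. \<beta> \<in> Qpi ==> (\<Sum>\<gamma>\<in>\<Gamma>. c \<gamma> * qpow (ip D \<gamma> \<beta>)) = 0" and "\<gamma> \<in> \<Gamma>"
  shows "c \<gamma> = 0"
proof (rule characters_independent[where L = Qpi and I = \<Gamma> and \<chi> = "\<lambda>\<gamma> \<beta>. qpow (ip D \<gamma> \<beta>)"])
  show "\<exists>x\<in>Qpi. qpow (ip D \<gamma> x) \<noteq> 0" for \<gamma> by (intro bexI[of _ 0]) auto
  show "\<exists>\<beta>\<in>Qpi. qpow (ip D \<gamma> \<beta>) \<noteq> qpow (ip D \<gamma>' \<beta>)" if "\<gamma> \<noteq> \<gamma>'" for \<gamma> \<gamma>'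
    using ip_nondegenerate[of "\<gamma> - \<gamma>'"] that
    by (metis Qpi_simps(2) eq_iff_diff_eq_0 ip_diff_left qpow_eq_iff)
qed (use assms in \<open>auto simp: ip_add_right qpow_add\<close>)

end

section \<open>The restricted root system\<close>

context sym_pair begin

sublocale weights D
proof
  have \<theta>h: "\<theta> H \<in> h" if "H \<in> h" for H using spD(8) that by blast
  show "finite (roots D)" by (rule finite_roots)
  show "i \<notin> piTh D ==> Th D (- sr i) - sr (prm D i) \<in> QplusTh D" for i by (rule spD)
  show "Th D (u + v) = Th D u + Th D v" "Th D (rscale r v) = rscale r (Th D v)" "Th D (Th D v) = v" for u v r
    by (rule wfun_inj, simp add: spD wfun_add wfun_rscale \<theta>h)+
  show "sr i \<in> roots D" for i
    unfolding spD(5) using cD(3)[of i] wfun_sr by simp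
  show "(\<forall>i. crd b i \<in> \<nat>) \<or> (\<forall>i. - crd b i \<in> \<nat>)" if b: "b \<in> roots D" for b
  proof -
    obtain v where v: "\<forall>H\<in>h. wfun \<alpha> b H = wfun \<alpha> v H" "(\<forall>i. crd v i \<in> \<nat>) \<or> (\<forall>i. - crd v i \<in> \<nat>)"
      using cD(5)[of "wfun \<alpha> b"] b unfolding spD(5) mem_Collect_eq by metis
    have "b = v" by (rule wfun_inj) (use v(1) in blast)
    thus ?thesis using v(2) by blast
  qed
  show "refl D (sr i) b \<in> roots D" if b: "b \<in> roots D" for b i
  proof -
    obtain x where x: "x \<in> rsp b" "x \<noteq> 0" "b \<noteq> 0" using b rsp_ops(1) by (auto simp: root_iff)
    have "refl_auto i x \<noteq> 0" using refl_auto_nonzero[OF rsum_ops(1)[OF x(1)]] x(2) by blast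
    moreover have "refl D (sr i) b \<noteq> 0"
    proof
      assume "refl D (sr i) b = 0"
      hence "b = refl D (sr i) 0" using refl_sr_refl[of i b] by simp
      thus False using x(3) refl_rscale[of D "sr i" 0 0] by simp
    qed
    ultimately show ?thesis using root_nz[OF refl_auto_rsp[OF x(1), of i]] by blast
  qed
qed

lemma sum_in_Nats: "(\<And>i. i \<in> I ==> g i \<in> \<nat>) ==> sum g I \<in> (\<nat> :: 'b::semiring_1 set)"
  by (induction I rule: infinite_finite_induct) auto

lemma abs_in_Nats: "x \<in> \<nat> \<or> - x \<in> \<nat> ==> \<bar>x\<bar> \<in> \<nat>" for x :: rat
  using Nats_nonneg[of x] Nats_nonneg[of "- x"] by (auto simp: abs_if)

lemma root_Qpi: "b \<in> roots D ==> b \<in> Qpi"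
proof -
  assume b: "b \<in> roots D"
  have "crd b i \<in> \<nat> \<or> - crd b i \<in> \<nat>" for i using root_sign[OF b] by blast
  hence "crd b i \<in> \<int> \<or> - crd b i \<in> \<int>" for i using Nats_subset_Ints by blast
  thus "b \<in> Qpi" by (simp add: Qpi_def)
qed

lemma Th_sum: "Th D (\<Sum>i\<in>I. v i) = (\<Sum>i\<in>I. Th D (v i))"
  by (induction I rule: infinite_finite_induct) (simp_all add: Th_add)

text \<open>Induction on the sum of the absolute coordinates. Positivity of (b,b) yields an i for
  which the coordinate of b and (b,\<alpha>_i) have the same sign; the reflection in \<alpha>_i
  shrinks that coordinate, unless b is a multiple of \<alpha>_i, hence \<alpha>_i or its negative by
  \<open>triple_multiple\<close>.\<close>

lemma triple_exists:
  assumes b: "b \<in> roots D"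
  shows "\<exists>x y. triple b x y"
proof -
  have "\<exists>x y. triple b x y" if "b \<in> roots D" "(\<Sum>i\<in>UNIV. \<bar>crd b i\<bar>) = of_nat n" for n
    using that
  proof (induction n arbitrary: b rule: less_induct)
    case (less n)
    have bQ: "crd b i \<in> \<int>" for i using root_Qpi[OF less.prems(1)] by (simp add: Qpi_def)
    have b0: "b \<noteq> 0" using less.prems(1) by (simp add: root_iff)
    have "0 < ip D b b" by (rule ip_pos[OF b0])
    also have "ip D b b = (\<Sum>i\<in>UNIV. crd b i * ip D b (sr i))"
      by (subst wt_expand[of b]) (simp add: ip_sum_left ip_comm[of _ b])
    finally have "\<exists>i. 0 < crd b i * ip D b (sr i)" by (meson not_less sum_nonpos)
    then obtain i where i: "0 < crd b i * ip D b (sr i)" ..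
    show ?case
    proof (cases "\<forall>j. j \<noteq> i \<longrightarrow> crd b j = 0")
      case True
      hence bi: "b = rscale (crd b i) (sr i)" by (intro wt_eqI) (auto simp: crd_sr)
      obtain c where c: "crd b i = of_int c" using bQ by (auto elim: Ints_cases)
      have c0: "c \<noteq> 0" using bi b0 c by auto
      have "\<bar>c\<bar> < 2"
      proof (rule ccontr)
        assume "\<not> \<bar>c\<bar> < 2"
        hence k: "nat \<bar>c\<bar> \<ge> 2" by simp
        show False
        proof (cases "c > 0")
          case True
          have "b = rscale (of_nat (nat \<bar>c\<bar>)) (sr i)" using bi True by (simp add: c)
          thus False using triple_multiple[OF triple_simple k, of i] less.prems(1) by simp
        next
          case False
          have "b = rscale (of_nat (nat \<bar>c\<bar>)) (- sr i)" using bi False by (simp add: c)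
          thus False using triple_multiple[OF triple_minus[OF triple_simple] k, of i] less.prems(1) by simp
        qed
      qed
      hence "c = 1 \<or> c = -1" using c0 by linarith
      hence "b = sr i \<or> b = - sr i" using bi c by auto
      thus ?thesis using triple_simple triple_minus[OF triple_simple] by blast
    next
      case False
      then obtain j where j: "j \<noteq> i" "crd b j \<noteq> 0" by blast
      define b' where "b' = refl D (sr i) b"
      have b': "b' \<in> roots D" unfolding b'_def by (rule refl_root[OF less.prems(1)])
      have cb': "crd b' k = crd b k" if "k \<noteq> i" for k using that by (simp add: b'_def refl_def lookup_minus crd_sr)
      have ci: "crd b' i = crd b i - cf b (sr i)" by (simp add: b'_def refl_def lookup_minus crd_sr)
      have cpos: "0 < crd b i * cf b (sr i)" using i ip_sr_pos[of i] by (simp add: zero_less_mult_iff zero_less_divide_iff)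
      \<comment> \<open>The coordinate at j is untouched, so b' has the same sign as b, and the
        coordinate at i moves towards 0 without crossing it.\<close>
      have "\<bar>crd b' i\<bar> < \<bar>crd b i\<bar>"
      proof (cases "\<forall>k. crd b k \<ge> 0")
        case True
        hence "crd b j > 0" using j(2) by (simp add: order.not_eq_order_implies_strict)
        hence "\<forall>k. crd b' k \<ge> 0" using root_nonneg_or[OF b'] cb'[OF j(1)] by (metis not_le)
        hence "crd b' i \<ge> 0" ..
        moreover have "0 < cf b (sr i)" using True[rule_format, of i] cpos unfolding zero_less_mult_iff by linarith
        ultimately show ?thesis using True[rule_format, of i] ci by linarith
      next
        case False
        hence neg: "\<forall>k. crd b k \<le> 0" using root_nonneg_or[OF less.prems(1)] by blast
        hence "crd b j < 0" using j(2) by (simp add: order.not_eq_order_implies_strict)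
        hence "\<forall>k. crd b' k \<le> 0" using root_nonneg_or[OF b'] cb'[OF j(1)] by (metis not_le)
        hence "crd b' i \<le> 0" ..
        moreover have "cf b (sr i) < 0" using neg[rule_format, of i] cpos unfolding zero_less_mult_iff by linarith
        ultimately show ?thesis using neg[rule_format, of i] ci by linarith
      qed
      hence lt: "(\<Sum>k\<in>UNIV. \<bar>crd b' k\<bar>) < (\<Sum>k\<in>UNIV. \<bar>crd b k\<bar>)"
      proof (intro sum_strict_mono_ex1 ballI)
        fix k show "\<bar>crd b' k\<bar> \<le> \<bar>crd b k\<bar>"
          using cb'[of k] \<open>\<bar>crd b' i\<bar> < \<bar>crd b i\<bar>\<close> by (cases "k = i") auto
      qed (use \<open>\<bar>crd b' i\<bar> < \<bar>crd b i\<bar>\<close> in auto)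
      have "(\<Sum>k\<in>UNIV. \<bar>crd b' k\<bar>) \<in> \<nat>"
      proof (intro sum_in_Nats)
        fix k
        have "crd b' k \<in> \<nat> \<or> - crd b' k \<in> \<nat>" using root_sign[OF b'] by blast
        thus "\<bar>crd b' k\<bar> \<in> \<nat>" by (rule abs_in_Nats)
      qed
      then obtain m where m: "(\<Sum>k\<in>UNIV. \<bar>crd b' k\<bar>) = of_nat m" by (auto elim: Nats_cases)
      hence "m < n" using lt less.prems(2) by simp
      from less.IH[OF this b' m] obtain x y where "triple b' x y" by blast
      from triple_refl[OF this, of i] show ?thesis by (auto simp: b'_def)
    qed
  qed
  moreover have "(\<Sum>i\<in>UNIV. \<bar>crd b i\<bar>) \<in> \<nat>"
  proof (intro sum_in_Nats)
    fix k
    have "crd b k \<in> \<nat> \<or> - crd b k \<in> \<nat>" using root_sign[OF b] by blast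
    thus "\<bar>crd b k\<bar> \<in> \<nat>" by (rule abs_in_Nats)
  qed
  ultimately show ?thesis using b by (auto elim: Nats_cases)
qed

section \<open>The action of \<theta> on root spaces and integrality of the restricted roots\<close>

lemma theta: "\<theta> (x + y) = \<theta> x + \<theta> y" "\<theta> (c *\<^sub>l x) = c *\<^sub>l \<theta> x" "\<theta> (lie x y) = lie (\<theta> x) (\<theta> y)" "\<theta> (- x) = - \<theta> x" "\<theta> 0 = 0"
proof -
  have "Vector_Spaces.linear (*\<^sub>l) (*\<^sub>l) \<theta>" using spD(6) by (simp add: lie_auto_def)
  then interpret l: Vector_Spaces.linear "(*\<^sub>l)" "(*\<^sub>l)" \<theta> .
  show "\<theta> (x + y) = \<theta> x + \<theta> y" "\<theta> (c *\<^sub>l x) = c *\<^sub>l \<theta> x" "\<theta> (- x) = - \<theta> x" "\<theta> 0 = 0"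
    by (rule l.add l.scale l.neg l.zero)+
  show "\<theta> (lie x y) = lie (\<theta> x) (\<theta> y)" using spD(6) by (simp add: lie_auto_def)
qed

lemma theta_h: "H \<in> h ==> \<theta> H \<in> h"
  using spD(8) by blast

lemma theta_rsp:
  assumes "x \<in> rsp v"
  shows "\<theta> x \<in> rsp (Th D v)"
proof (rule rspI)
  fix H assume H: "H \<in> h"
  have "lie H (\<theta> x) = \<theta> (lie (\<theta> H) x)" by (simp add: theta(3) spD(7))
  thus "lie H (\<theta> x) = wfun \<alpha> (Th D v) H *\<^sub>l \<theta> x"
    unfolding rspD[OF assms theta_h[OF H]] spD(9)[OF H] theta(2) .
qed

lemma Th_roots: "b \<in> roots D ==> Th D b \<in> roots D"
proof -
  assume b: "b \<in> roots D"
  then obtain x where x: "x \<in> rsp b" "x \<noteq> 0" "b \<noteq> 0" using rsp_ops(1) by (auto simp: root_iff)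
  have "\<theta> x \<noteq> 0" using x(2) spD(7)[of x] theta(5) by metis
  moreover have "Th D b \<noteq> 0" using x(3) Th_Th[of b] by (metis Th_0)
  ultimately show ?thesis using root_nz[OF theta_rsp[OF x(1)]] by blast
qed

text \<open>\<theta> sends the triple of b into the root lines of \<Theta> b, so the coroots
  correspond up to a factor; evaluating at b, where both Cartan integers are 2, shows that the
  factor is 1.\<close>

lemma cf_Th:
  assumes b: "b \<in> roots D"
  shows "cf (Th D v) (Th D b) = cf v b"
proof -
  obtain x y where t: "triple b x y" using triple_exists[OF b] by blast
  obtain x' y' where t': "triple (Th D b) x' y'" using triple_exists[OF Th_roots[OF b]] by blast
  note tD = tripleD[OF t] and tD' = tripleD[OF t']
  obtain c where c: "\<theta> x = c *\<^sub>l x'" using tD'(6)[OF theta_rsp[OF tD(2)]] by blast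
  obtain d where d: "\<theta> y = d *\<^sub>l y'" using tD'(7) theta_rsp[OF tD(3)] by (auto simp: Th_minus)
  have *: "of_rat (cf v b) = c * d * of_rat (cf (Th D v) (Th D b))" for v
  proof -
    have "\<theta> (lie x y) = (c * d) *\<^sub>l lie x' y'" by (simp add: theta(3) c d lie_scale_left lie_scale_right)
    hence "wfun \<alpha> (Th D v) (\<theta> (lie x y)) = c * d * of_rat (cf (Th D v) (Th D b))"
      by (simp only: wfun_linear(2)[OF tD'(8)] tD'(4))
    moreover have "wfun \<alpha> (Th D v) (\<theta> (lie x y)) = wfun \<alpha> v (lie x y)"
      using spD(9)[OF theta_h[OF tD(8)], of v] by (simp add: spD(7))
    ultimately show ?thesis by (simp only: tD(4))
  qed
  have "c * d = 1" using *[of b] unfolding tD(1) tD'(1) by simp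
  thus ?thesis using *[of v] by (simp only: mult_1 of_rat_eq_iff)
qed

text \<open>Outside \<pi>_\<Theta> every \<Theta>(\<alpha>_j) has nonpositive coordinates, so the
  coordinate at i of \<Theta> v = v is at most 0.\<close>

lemma fixed_support:
  assumes "Th D v = v" "\<And>i. crd v i \<ge> 0" "i \<notin> piTh D"
  shows "crd v i = 0"
proof -
  have le: "crd (Th D (sr j)) i \<le> 0" for j
  proof (cases "j \<in> piTh D")
    case True
    thus ?thesis using assms(3) by (auto simp: piTh_def crd_sr)
  next
    case False
    obtain \<eta> where "Th D (sr j) = - sr (prm D j) - \<eta>" "\<eta> \<in> QplusTh D" using Th_sr[OF False] .
    thus ?thesis using assms(3) by (auto simp: lookup_minus crd_sr QplusTh_def)
  qed
  have "v = (\<Sum>j\<in>UNIV. rscale (crd v j) (Th D (sr j)))"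
    by (subst (1) assms(1)[symmetric], subst (1) wt_expand[of v]) (simp add: Th_sum Th_rscale)
  hence "crd v i = crd (\<Sum>j\<in>UNIV. rscale (crd v j) (Th D (sr j))) i" by simp
  also have "\<dots> = (\<Sum>j\<in>UNIV. crd v j * crd (Th D (sr j)) i)" by (simp add: lookup_sum)
  also have "\<dots> \<le> 0" using le assms(2) by (intro sum_nonpos) (simp add: mult_nonneg_nonpos)
  finally show ?thesis using assms(2)[of i] by simp
qed

text \<open>
  \<open>\<theta>\<close> is the identity on the root spaces of the roots fixed by \<open>\<Theta>\<close>: lower a root vector on which
  it is \<open>-1\<close> by the generators of \<open>\<pi>\<^sub>\<Theta>\<close>, which \<open>\<theta>\<close> fixes.
\<close>

lemma fixed_root_space:
  assumes E: "\<And>j. j \<in> piTh D ==> triple (rscale s (sr j)) (E j) (F j)" "\<And>j. j \<in> piTh D ==> \<theta> (E j) = E j"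
      "\<And>j. j \<in> piTh D ==> \<theta> (F j) = F j" and s: "s * s = 1"
    and z: "z \<in> rsp \<delta>" "\<theta> z = - z" "\<delta> \<noteq> 0" "Th D \<delta> = \<delta>" "\<And>i. s * crd \<delta> i \<in> \<nat>"
  shows "z = 0"
proof -
  have "(\<Sum>i\<in>UNIV. s * crd \<delta> i) \<in> \<nat>" using z(5) by (intro sum_in_Nats)
  then obtain n where "(\<Sum>i\<in>UNIV. s * crd \<delta> i) = of_nat n" by (auto elim: Nats_cases)
  thus ?thesis using z
  proof (induction n arbitrary: z \<delta>)
    case 0
    have "s * crd \<delta> i \<ge> 0" for i using Nats_nonneg[OF 0(6)] .
    hence "s * crd \<delta> i = 0" for i using 0(1) by (auto simp: sum_nonneg_eq_0_iff)
    moreover have "s \<noteq> 0" using s by auto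
    ultimately have "\<delta> = 0" by (intro wt_eqI) auto
    thus ?case using 0(4) by simp
  next
    case (Suc n)
    note IH = Suc.IH and sum = Suc.prems(1) and z = Suc.prems(2-6)
    \<comment> \<open>The sign s is 1 or -1 and treats positive and negative fixed roots alike: v is
      the nonnegative one of \<delta> and its negative.\<close>
    define v where "v = rscale s \<delta>"
    have v: "\<And>i. crd v i \<ge> 0" "Th D v = v" using Nats_nonneg[OF z(5)] z(4) by (simp_all add: v_def Th_rscale)
    have "0 < ip D \<delta> \<delta>" by (rule ip_pos[OF z(3)])
    also have "ip D \<delta> \<delta> = ip D v v" using s by (simp add: v_def ip_comm[of \<delta> "rscale s \<delta>"] mult.assoc[symmetric])
    also have "ip D v v = (\<Sum>i\<in>UNIV. crd v i * ip D v (sr i))"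
      by (subst (2) wt_expand[of v]) (simp add: ip_comm[of v] ip_sum_left)
    finally have "\<exists>j. 0 < crd v j * ip D v (sr j)" by (meson not_less sum_nonpos)
    then obtain j where "0 < crd v j * ip D v (sr j)" ..
    hence j: "0 < crd v j" "0 < ip D v (sr j)" using v(1)[of j] unfolding zero_less_mult_iff by auto
    have jT: "j \<in> piTh D" using fixed_support[OF v(2,1), of j] j(1) by auto
    let ?b = "rscale s (sr j)"
    have crj: "s * crd \<delta> j \<ge> 1" using z(5)[of j] j(1) by (auto elim!: Nats_cases simp: v_def)
    show "z = 0"
    proof (rule ccontr)
      assume z0: "z \<noteq> 0"
      have \<delta>: "\<delta> \<in> roots D" by (rule root_nz[OF z(1) z0 z(3)])
      have "ip D \<delta> ?b = ip D v (sr j)" by (simp add: v_def ip_comm[of \<delta> "rscale s (sr j)"] ip_comm[of "sr j" \<delta>])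
      moreover have "ip D ?b ?b > 0" by (rule ip_pos) (use s in auto)
      ultimately have "cf \<delta> (- ?b) < 0" unfolding cf_minus using j(2) by simp
      hence nz: "lie (F j) z \<noteq> 0"
        by (rule triple_bracket[OF triple_minus[OF E(1)[OF jT]] z(1) z0 _ root_Qpi[OF \<delta>]])
      have Fz: "lie (F j) z \<in> rsp (\<delta> - ?b)" using lie_rsp[OF tripleD(3)[OF E(1)[OF jT]] z(1)] by simp
      have \<theta>F: "\<theta> (lie (F j) z) = - lie (F j) z" by (simp add: theta(3) E(3)[OF jT] z(2))
      show False
      proof (cases "\<delta> = ?b")
        case True
        \<comment> \<open>The descent ends at a simple root of \<pi>_\<Theta> up to sign, whose root
          vector is fixed by \<theta>; being also negated, z vanishes.\<close>
        then obtain c where c: "z = c *\<^sub>l E j" using tripleD(6)[OF E(1)[OF jT]] z(1) by auto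
        have "\<theta> z = z" by (simp add: c theta(2) E(2)[OF jT])
        hence "z + z = 0" using z(2) add.right_inverse[of z] by simp
        hence "2 *\<^sub>l z = 0" using lv.scale_left_distrib[of 1 1 z] by simp
        thus False using z0 by simp
      next
        case False
        have "lie (F j) z = 0"
        proof (rule IH[OF _ Fz \<theta>F])
          show "\<delta> - ?b \<noteq> 0" using False by simp
          show "Th D (\<delta> - ?b) = \<delta> - ?b" using z(4) jT by (simp add: Th_diff Th_rscale piTh_def)
          have c: "s * crd (\<delta> - ?b) i = s * crd \<delta> i - (if i = j then 1 else 0)" for i
            using s by (auto simp: lookup_minus crd_sr right_diff_distrib)
          show "s * crd (\<delta> - ?b) i \<in> \<nat>" for i
          proof (cases "i = j")
            case True
            obtain k where k: "s * crd \<delta> j = of_nat k" using z(5)[of j] by (auto elim: Nats_cases)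
            have "s * crd \<delta> j - 1 = of_nat (k - 1)" using crj by (simp add: k of_nat_diff)
            hence "s * crd \<delta> j - 1 \<in> \<nat>" by simp
            thus ?thesis using True by (simp only: c) simp
          qed (use z(5)[of i] in \<open>simp only: c, simp\<close>)
          show "(\<Sum>i\<in>UNIV. s * crd (\<delta> - ?b) i) = of_nat n"
            using sum by (simp only: c sum_subtractf) simp
        qed
        thus False using nz by simp
      qed
    qed
  qed
qed

lemma theta_piTh: "j \<in> piTh D ==> \<theta> (e j) = e j" "j \<in> piTh D ==> \<theta> (f j) = f j"
  using sp unfolding symmetric_pair_def piTh_def by auto

text \<open>With the value -1, [x, \<theta> x] would be a nonzero vector of weight b + \<Theta> b.
  \<theta> exchanges the two factors and so negates it, which \<open>fixed_root_space\<close>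
  forbids on a root fixed by \<Theta>.\<close>

lemma cf_Th_neq:
  assumes b: "b \<in> roots D"
  shows "cf b (Th D b) \<noteq> -1"
proof
  assume n: "cf b (Th D b) = -1"
  hence n': "cf (Th D b) b = -1" using cf_Th[OF b, of "Th D b"] by (simp add: Th_Th)
  obtain x y where t: "triple b x y" using triple_exists[OF b] by blast
  note tD = tripleD[OF t]
  have x0: "x \<noteq> 0" using triple_nonzero[OF t] by blast
  have \<theta>x: "\<theta> x \<in> rsp (Th D b)" "\<theta> x \<noteq> 0" using theta_rsp[OF tD(2)] x0 spD(7)[of x] theta(5) by metis+
  define z where "z = lie x (\<theta> x)"
  have z0: "z \<noteq> 0"
    unfolding z_def using n' by (intro triple_bracket[OF t \<theta>x _ root_Qpi[OF Th_roots[OF b]]]) linarith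
  have z: "z \<in> rsp (b + Th D b)" unfolding z_def by (rule lie_rsp[OF tD(2) \<theta>x(1)])
  have \<theta>z: "\<theta> z = - z" by (simp add: z_def theta(3) spD(7) lie_anti[of "\<theta> x" x])
  have \<delta>0: "b + Th D b \<noteq> 0"
  proof
    assume "b + Th D b = 0"
    hence "Th D b = - b" by (simp add: add_eq_0_iff)
    hence "cf b (Th D b) = - cf b b" by (simp only: cf_minus)
    thus False using n tD(1) by simp
  qed
  have fixed: "Th D (b + Th D b) = b + Th D b" by (simp add: Th_add Th_Th add.commute)
  have "b + Th D b \<in> roots D" by (rule root_nz[OF z z0 \<delta>0])
  from root_sign[OF this] show False
  proof
    assume s: "\<forall>i. crd (b + Th D b) i \<in> \<nat>"
    have "z = 0"
      by (rule fixed_root_space[where s = 1 and E = e and F = f, OF _ _ _ _ z \<theta>z \<delta>0 fixed])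
        (use triple_simple theta_piTh s in auto)
    thus False using z0 by simp
  next
    assume s: "\<forall>i. - crd (b + Th D b) i \<in> \<nat>"
    have "z = 0"
      by (rule fixed_root_space[where s = "-1" and E = f and F = e, OF _ _ _ _ z \<theta>z \<delta>0 fixed])
        (use triple_minus[OF triple_simple] theta_piTh s in auto)
    thus False using z0 by simp
  qed
qed

text \<open>With n = \<open>cf b (Th D b)\<close> the value is 2(c - d)/(2 - n). Definiteness puts n
  strictly between -2 and 2 unless \<Theta> b = -b, and -1 is excluded, leaving denominators 2 and
  1. For \<Theta> b = -b one has d = -c and n = -2, and the value is c.\<close>

lemma restricted_integral:
  assumes a: "a \<in> roots D" and b: "b \<in> roots D" "Th D b \<noteq> b"
  shows "cf (tilde D a) (tilde D b) \<in> \<int>"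
proof -
  define L where "L = ip D b b"
  define L' where "L' = ip D (Th D b) (Th D b)"
  define n where "n = cf b (Th D b)"
  define c where "c = cf a b"
  define d where "d = cf a (Th D b)"
  have b0: "b \<noteq> 0" "Th D b \<noteq> 0" using b(1) Th_roots[OF b(1)] by (auto simp: root_iff)
  have cbb: "cf b b = 2" using ip_pos[OF b0(1)] by simp
  have L: "L > 0" "L' > 0" unfolding L_def L'_def using b0 by (auto intro: ip_pos)
  have int: "cf v r \<in> \<int>" if "v \<in> roots D" "r \<in> roots D" for v r
    using triple_exists[OF that(2)] tripleD(5)[OF _ root_Qpi[OF that(1)]] by blast
  have Z: "n \<in> \<int>" "c \<in> \<int>" "d \<in> \<int>"
    unfolding n_def c_def d_def using int a b(1) Th_roots[OF b(1)] by blast+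
  have e: "cf (Th D v) (Th D b) = cf v b" "cf (Th D v) b = cf v (Th D b)" for v
    using cf_Th[OF b(1), of v] cf_Th[OF Th_roots[OF b(1)], of v] by (simp_all only: Th_Th)
  have I: "ip D v b = cf v b * L / 2" "ip D v (Th D b) = cf v (Th D b) * L' / 2" for v
    using L by (simp_all add: L_def L'_def)
  have til: "ip D (tilde D v) (tilde D b) = (L + L') / 8 * (cf v b - cf v (Th D b))" for v
  proof -
    have "ip D (tilde D v) (tilde D b) =
        (ip D v b - ip D v (Th D b) - ip D (Th D v) b + ip D (Th D v) (Th D b)) / 4"
      by (simp add: tilde_def ip_diff_left ip_diff_right field_simps)
    also have "\<dots> = (L + L') / 8 * (cf v b - cf v (Th D b))"
    proof -
      define p where "p = cf v b"
      define r where "r = cf v (Th D b)"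
      have "ip D v b = p * L / 2" "ip D v (Th D b) = r * L' / 2" unfolding p_def r_def by (rule I)+
      moreover have "ip D (Th D v) b = r * L / 2" "ip D (Th D v) (Th D b) = p * L' / 2"
        using I[of "Th D v"] unfolding e p_def[symmetric] r_def[symmetric] .
      ultimately show ?thesis unfolding p_def[symmetric] r_def[symmetric]
        by (simp only:) (simp add: field_simps)
    qed
    finally show ?thesis .
  qed
  have bb: "ip D (tilde D b) (tilde D b) = (L + L') / 8 * (2 - n)"
    unfolding til cbb n_def ..
  have aa: "ip D (tilde D a) (tilde D b) = (L + L') / 8 * (c - d)"
    unfolding til c_def d_def ..
  have "tilde D b \<noteq> 0" using b(2) by (simp add: tilde_def)
  hence "0 < (L + L') / 8 * (2 - n)" using ip_pos bb by metis
  hence n2: "n < 2" using L by (simp add: zero_less_mult_iff)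
  have val: "cf (tilde D a) (tilde D b) = 2 * (c - d) / (2 - n)"
  proof -
    define k where "k = (L + L') / 8"
    have "k \<noteq> 0" using L by (simp add: k_def)
    thus ?thesis unfolding aa bb k_def[symmetric] by simp
  qed
  have sum: "ip D (b + Th D b) (b + Th D b) = (L + L') * (1 + n / 2)"
  proof -
    have "ip D (b + Th D b) (b + Th D b) = L + L' + ip D b (Th D b) + ip D (Th D b) b"
      by (simp add: ip_add_left ip_add_right L_def L'_def)
    also have "\<dots> = (L + L') * (1 + n / 2)"
    proof -
      have 1: "ip D b (Th D b) = n * L' / 2" unfolding n_def by (rule I)
      have 2: "ip D (Th D b) b = n * L / 2" using I(1)[of "Th D b"] unfolding e n_def[symmetric] .
      show ?thesis unfolding 1 2 by (simp add: algebra_simps)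
    qed
    finally show ?thesis .
  qed
  have n1: "n \<noteq> -1" unfolding n_def by (rule cf_Th_neq[OF b(1)])
  obtain m where m: "n = of_int m" using Z(1) by (auto elim: Ints_cases)
  show ?thesis
  proof (cases "b + Th D b = 0")
    case True
    hence eq: "Th D b = - b" by (simp add: add_eq_0_iff)
    have "d = - c" unfolding d_def c_def eq by (rule cf_minus)
    moreover have "n = - cf b b" unfolding n_def eq by (rule cf_minus)
    hence "n = - 2" unfolding cbb .
    ultimately have "cf (tilde D a) (tilde D b) = c" unfolding val by simp
    thus ?thesis using Z(2) by simp
  next
    case False
    hence "0 < (L + L') * (1 + n / 2)" using ip_pos[OF False] sum by simp
    hence "n > -2" using L by (simp add: zero_less_mult_iff)
    have "(of_int (-2) :: rat) < of_int m" "(of_int m :: rat) < of_int 2" using \<open>n > -2\<close> n2 by (simp_all add: m)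
    moreover have "m \<noteq> -1" using n1 m by auto
    ultimately have "m = 0 \<or> m = 1" unfolding of_int_less_iff by linarith
    thus ?thesis using Z unfolding val m by auto
  qed
qed

text \<open>Ensures that multiplication by fractions of C[Q(\<Sigma>)] preserves the fraction field
  of C[P(\<Sigma>)], to which \<open>rop_of\<close> restricts the operators.\<close>

lemma QSigma_PSigma: "QSigma D \<subseteq> PSigma D"
proof -
  have S: "b \<in> PSigma D" if b: "b \<in> Sigma_r D" for b
  proof -
    obtain a where a: "b = tilde D a" "a \<in> roots D" using b by (auto simp: Sigma_r_def)
    have "\<exists>k. b = (\<Sum>c\<in>Sigma_r D. rscale (k c) c)" unfolding span_Sigma a(1) by (rule Th_tilde)
    moreover have "cf b c \<in> \<int>" if "c \<in> Sigma_r D" for c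
      using that restricted_integral[OF a(2)] unfolding a(1) Sigma_r_def by blast
    ultimately show ?thesis by (simp add: PSigma_def)
  qed
  have "rscale (of_int k) b \<in> PSigma D" if "b \<in> PSigma D" for k b
  proof -
    have "Th D (rscale (of_int k) b) = - rscale (of_int k) b" using PSigma_anti[OF that] by (simp add: Th_rscale)
    hence "\<exists>c. rscale (of_int k) b = (\<Sum>b\<in>Sigma_r D. rscale (c b) b)" unfolding span_Sigma .
    moreover have "cf (rscale (of_int k) b) c \<in> \<int>" if "c \<in> Sigma_r D" for c
    proof -
      have "cf b c \<in> \<int>" using \<open>b \<in> PSigma D\<close> that by (simp add: PSigma_def)
      hence "of_int k * cf b c \<in> \<int>" by (intro Ints_mult) simp_all
      thus ?thesis by (simp add: mult_ac)
    qed
    ultimately show ?thesis by (simp add: PSigma_def)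
  qed
  moreover have "(\<Sum>b\<in>I. g b) \<in> PSigma D" if "\<And>b. b \<in> I ==> g b \<in> PSigma D" for I :: "'n wt set" and g
    using that by (induction I rule: infinite_finite_induct) (auto intro: PSigma_add)
  ultimately show ?thesis using S by (auto simp: QSigma_def)
qed

end

section \<open>Sweedler sums and the adjoint actions\<close>

lemma qscale_zero [simp]: "c *\<^sub>q (0::'a::cvec) = 0" "0 *\<^sub>q (a::'a) = 0"
  by (simp_all add: cv.scale_zero_right cv.scale_zero_left)

lemma qscale_minus [simp]: "c *\<^sub>q (- a::'a::cvec) = - (c *\<^sub>q a)" "(- c) *\<^sub>q a = - (c *\<^sub>q a)"
  by (simp_all add: cv.scale_minus_right cv.scale_minus_left)

lemma qscale_diff: "c *\<^sub>q (a - b::'a::cvec) = c *\<^sub>q a - c *\<^sub>q b" "(c - d) *\<^sub>q a = c *\<^sub>q a - d *\<^sub>q a"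
  by (simp_all add: cv.scale_right_diff_distrib cv.scale_left_diff_distrib)

lemmas qscale_simps = qscale_add_right qscale_add_left qscale_diff qscale_qscale qscale_one
  qscale_mult_left qscale_mult_right

lemma qscale_eq_0_iff [simp]: "c *\<^sub>q (a::'a::cvec) = 0 \<longleftrightarrow> c = 0 \<or> a = 0"
  by (rule cv.scale_eq_0_iff)

definition tsum :: "('a => 'b => 'c) => ('a \<times> 'b) list => 'c::comm_monoid_add" where
  "tsum f xs = (\<Sum>(u, v)\<leftarrow>xs. f u v)"

lemma tsum_simps [simp]: "tsum f [] = 0" "tsum f ((u, v) # xs) = f u v + tsum f xs"
  "tsum f (xs @ ys) = tsum f xs + tsum f ys"
  by (simp_all add: tsum_def)

lemma tsum_map: "tsum f (map g xs) = tsum (\<lambda>u v. case g (u, v) of (u', v') => f u' v') xs"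
  by (induction xs) (auto simp: tsum_def split_beta)

lemma tsum_add: "tsum (\<lambda>u v. f u v + g u v) xs = tsum f xs + tsum g xs"
  by (induction xs) (auto simp: add_ac)

lemma tsum_hom:
  assumes "h 0 = 0" "\<And>x y. h (x + y) = h x + h y"
  shows "h (tsum f xs) = tsum (\<lambda>u v. h (f u v)) xs"
  by (induction xs) (auto simp: assms)

lemma tsum_mult_left: "c * tsum f xs = tsum (\<lambda>u v. c * f u v) xs" for c :: "'a::ring_1"
  by (rule tsum_hom) (simp_all add: ring_distribs)

lemma tsum_mult_right: "tsum f xs * c = tsum (\<lambda>u v. f u v * c) xs" for c :: "'a::ring_1"
  by (rule tsum_hom[where h = "\<lambda>x. x * c"]) (simp_all add: ring_distribs)

lemma tsum_scale: "c *\<^sub>q tsum f xs = tsum (\<lambda>u v. c *\<^sub>q f u v) xs"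
  by (rule tsum_hom) (simp_all add: qscale_simps)

lemma tsum_swap: "tsum (\<lambda>u v. tsum (f u v) ys) xs = tsum (\<lambda>u' v'. tsum (\<lambda>u v. f u v u' v') xs) ys"
proof (induction xs)
  case Nil
  show ?case by (induction ys) auto
qed (auto simp: tsum_add)

lemma tsum_cong: "(\<And>u v. (u, v) \<in> set xs ==> f u v = g u v) ==> tsum f xs = tsum g xs"
  by (induction xs) auto

lemma tsum_product:
  "tsum f [(u * u', v * v'). (u, v) \<leftarrow> xs, (u', v') \<leftarrow> ys]
    = tsum (\<lambda>u v. tsum (\<lambda>u' v'. f (u * u') (v * v')) ys) xs"
proof (induction xs)
  case (Cons x xs)
  obtain u v where x: "x = (u, v)" by (cases x)
  have "tsum f (map (\<lambda>(u', v'). (u * u', v * v')) ys) = tsum (\<lambda>u' v'. f (u * u') (v * v')) ys"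
    by (simp add: tsum_map)
  thus ?case using Cons by (simp add: x)
qed simp

lemma tensor_eqD: "tensor_eq xs ys ==> bilin f ==> tsum f xs = tsum f ys"
  by (simp add: tensor_eq_def tsum_def)

lemma tensor_eqI: "(\<And>f. bilin f ==> tsum f xs = tsum f ys) ==> tensor_eq xs ys"
  by (simp add: tensor_eq_def tsum_def)

lemma bilinI:
  assumes "\<And>a b c. f (a + b) c = f a c + f b c" "\<And>a b c. f c (a + b) = f c a + f c b"
    "\<And>k a c. f (k *\<^sub>q a) c = k *\<^sub>q f a c" "\<And>k a c. f c (k *\<^sub>q a) = k *\<^sub>q f c a"
  shows "bilin f"
  using assms by (simp add: bilin_def qlin_def)

lemma bilinD:
  assumes "bilin f"
  shows "f (a + b) c = f a c + f b c" "f c (a + b) = f c a + f c b"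
    "f (k *\<^sub>q a) c = k *\<^sub>q f a c" "f c (k *\<^sub>q a) = k *\<^sub>q f c a"
  using assms by (simp_all add: bilin_def qlin_def)

lemma trilinI:
  assumes "\<And>a b c d. f (a + b) c d = f a c d + f b c d" "\<And>a b c d. f c (a + b) d = f c a d + f c b d"
    "\<And>a b c d. f c d (a + b) = f c d a + f c d b"
    "\<And>k a c d. f (k *\<^sub>q a) c d = k *\<^sub>q f a c d" "\<And>k a c d. f c (k *\<^sub>q a) d = k *\<^sub>q f c a d"
    "\<And>k a c d. f c d (k *\<^sub>q a) = k *\<^sub>q f c d a"
  shows "trilin f"
  using assms by (simp add: trilin_def bilin_def qlin_def)

lemma coassoc_tsum: "trilin f ==> tsum (\<lambda>u v. tsum (\<lambda>u' u''. f u' u'' v) (comul u)) (comul a)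
    = tsum (\<lambda>u v. tsum (\<lambda>v' v''. f u v' v'') (comul v)) (comul a)"
  using coassoc[of f a] by (simp add: tsum_def)

lemma counit_tsum: "tsum (\<lambda>u v. counit u *\<^sub>q v) (comul a) = a" "tsum (\<lambda>u v. counit v *\<^sub>q u) (comul a) = a"
  using counit_left[of a] counit_right[of a] by (simp_all add: tsum_def)

lemma antipode_tsum: "tsum (\<lambda>u v. antipode u * v) (comul a) = counit a *\<^sub>q 1"
  "tsum (\<lambda>u v. u * antipode v) (comul a) = counit a *\<^sub>q 1"
  using antipode_left[of a] antipode_right[of a] by (simp_all add: tsum_def)

lemma antipode_0 [simp]: "antipode 0 = 0"
  using antipode_scale[of 0 0] by simp

lemma counit_0 [simp]: "counit 0 = 0"
  using counit_scale[of 0 0] by simp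

lemma counit_minus [simp]: "counit (- a) = - counit a"
  using counit_scale[of "-1" a] by (simp add: qscale_one)

lemma antipode_minus [simp]: "antipode (- a) = - antipode a"
  using antipode_scale[of "-1" a] by (simp add: qscale_one)

lemma antipode_tsum_hom: "antipode (tsum f xs) = tsum (\<lambda>u v. antipode (f u v)) xs"
  by (rule tsum_hom) (simp_all add: antipode_add)

text \<open>Both arguments are expanded by the counit, and the scalar \<epsilon>(v v') is rewritten
  as v_1 v'_1 S(v_2 v'_2), with S the antipode. Coassociativity lets S(u) cancel against its
  neighbour from a, and S(u') against its neighbour from b, leaving S(ab).\<close>

lemma antipode_mult: "antipode (a * b) = antipode b * antipode a" for a b :: "'a::chopf"
proof -
  have step1: "tsum (\<lambda>u v. tsum (\<lambda>p r. u' * antipode u * p * p' * antipode (r * r')) (comul v)) (comul a)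
      = u' * p' * antipode (a * r')" for u' p' r' :: 'a
  proof -
    have "trilin (\<lambda>u p r. u' * antipode u * p * p' * antipode (r * r'))"
      by (rule trilinI) (simp_all add: antipode_add antipode_scale ring_distribs qscale_simps)
    from coassoc_tsum[OF this, of a]
    have "tsum (\<lambda>u v. tsum (\<lambda>p r. u' * antipode u * p * p' * antipode (r * r')) (comul v)) (comul a)
        = tsum (\<lambda>x r. tsum (\<lambda>u p. u' * antipode u * p * p' * antipode (r * r')) (comul x)) (comul a)"
      by simp
    also have "\<dots> = tsum (\<lambda>x r. u' * tsum (\<lambda>u p. antipode u * p) (comul x) * p' * antipode (r * r')) (comul a)"
      by (simp add: tsum_mult_left tsum_mult_right mult.assoc)
    also have "\<dots> = tsum (\<lambda>x r. u' * p' * antipode ((counit x *\<^sub>q r) * r')) (comul a)"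
      by (simp add: antipode_tsum qscale_simps antipode_scale mult.assoc)
    also have "\<dots> = u' * p' * antipode (tsum (\<lambda>x r. counit x *\<^sub>q r) (comul a) * r')"
      by (simp add: tsum_mult_left tsum_mult_right antipode_tsum_hom)
    finally show ?thesis by (simp add: counit_tsum)
  qed
  have "antipode b * antipode a = tsum (\<lambda>u' v'. tsum (\<lambda>u v. antipode (counit v' *\<^sub>q u') * antipode (counit v *\<^sub>q u))
      (comul a)) (comul b)"
    by (simp add: counit_tsum flip: antipode_tsum_hom tsum_mult_left tsum_mult_right)
  also have "\<dots> = tsum (\<lambda>u' v'. tsum (\<lambda>u v. tsum (\<lambda>p' r'. tsum (\<lambda>p r.
      antipode u' * antipode u * p * p' * antipode (r * r')) (comul v)) (comul v')) (comul a)) (comul b)"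
  proof (intro tsum_cong)
    fix u v u' v' :: 'a
    have bil: "bilin (\<lambda>p r. p * antipode r)"
      by (rule bilinI) (simp_all add: antipode_add antipode_scale ring_distribs qscale_simps)
    have "counit (v * v') *\<^sub>q 1 = tsum (\<lambda>p r. tsum (\<lambda>p' r'. p * p' * antipode (r * r')) (comul v')) (comul v)"
      using tensor_eqD[OF comul_mult[of v v'] bil] by (simp only: tsum_product antipode_tsum)
    hence e: "counit (v * v') *\<^sub>q 1 = tsum (\<lambda>p' r'. tsum (\<lambda>p r. p * p' * antipode (r * r')) (comul v)) (comul v')"
      by (simp add: tsum_swap[of _ "comul v'"])
    have "antipode (counit v' *\<^sub>q u') * antipode (counit v *\<^sub>q u) = antipode u' * antipode u * (counit (v * v') *\<^sub>q 1)"
      by (simp add: antipode_scale qscale_simps counit_mult mult_ac)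
    thus "antipode (counit v' *\<^sub>q u') * antipode (counit v *\<^sub>q u) = tsum (\<lambda>p' r'. tsum (\<lambda>p r.
      antipode u' * antipode u * p * p' * antipode (r * r')) (comul v)) (comul v')"
      unfolding e by (simp add: tsum_mult_left mult.assoc)
  qed
  also have "\<dots> = tsum (\<lambda>u' v'. tsum (\<lambda>p' r'. antipode u' * p' * antipode (a * r')) (comul v')) (comul b)"
    by (subst tsum_swap) (simp add: step1)
  also have "\<dots> = tsum (\<lambda>x r'. tsum (\<lambda>u' p'. antipode u' * p' * antipode (a * r')) (comul x)) (comul b)"
    by (rule coassoc_tsum[symmetric], rule trilinI)
      (simp_all add: antipode_add antipode_scale ring_distribs qscale_simps)
  also have "\<dots> = tsum (\<lambda>x r'. antipode (a * (counit x *\<^sub>q r'))) (comul b)"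
    by (simp add: antipode_tsum qscale_simps antipode_scale flip: tsum_mult_right)
  also have "\<dots> = antipode (a * tsum (\<lambda>x r'. counit x *\<^sub>q r') (comul b))"
    by (simp add: tsum_mult_left antipode_tsum_hom)
  finally show ?thesis by (simp add: counit_tsum)
qed

lemma ad_tsum: "ad a b = tsum (\<lambda>u v. u * b * antipode v) (comul a)"
  and adr_tsum: "adr a b = tsum (\<lambda>u v. antipode u * b * v) (comul a)"
  by (simp_all add: ad_def adr_def tsum_def)

lemma ad_bilin: "bilin (\<lambda>u v. u * b * antipode v)"
  and adr_bilin: "bilin (\<lambda>u v. antipode u * b * v)"
  by (rule bilinI; simp add: antipode_add antipode_scale ring_distribs qscale_simps)+

lemma ad_tensor: "tensor_eq (comul a) xs ==> ad a b = tsum (\<lambda>u v. u * b * antipode v) xs"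
  and adr_tensor: "tensor_eq (comul a) xs ==> adr a b = tsum (\<lambda>u v. antipode u * b * v) xs"
  using tensor_eqD[OF _ ad_bilin] tensor_eqD[OF _ adr_bilin] by (simp_all add: ad_tsum adr_tsum)

lemma ad_add: "ad (a + b) c = ad a c + ad b c"
  and adr_add: "adr (a + b) c = adr a c + adr b c"
  by (simp_all only: ad_tensor[OF comul_add] adr_tensor[OF comul_add] tsum_simps)
    (simp_all add: ad_tsum adr_tsum)

lemma ad_scale: "ad (k *\<^sub>q a) c = k *\<^sub>q ad a c"
  and adr_scale: "adr (k *\<^sub>q a) c = k *\<^sub>q adr a c"
  by (simp_all only: ad_tensor[OF comul_scale] adr_tensor[OF comul_scale])
    (simp_all add: ad_tsum adr_tsum tsum_map tsum_scale antipode_scale qscale_simps)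

lemma ad_one: "ad 1 c = c" and adr_one: "adr 1 c = c" for c :: "'a::chopf"
proof -
  have "antipode 1 = (1::'a)"
    using tensor_eqD[OF comul_one adr_bilin[of "1::'a"]] antipode_tsum(1)[of "1::'a"]
    by (simp add: counit_one qscale_one)
  thus "ad 1 c = c" "adr 1 c = c"
    by (simp_all add: ad_tensor[OF comul_one] adr_tensor[OF comul_one])
qed

lemma ad_add_right: "ad a (b + c) = ad a b + ad a c"
  by (simp add: ad_tsum ring_distribs tsum_add)

lemma ad_scale_right: "ad a (k *\<^sub>q c) = k *\<^sub>q ad a c"
  by (simp add: ad_tsum tsum_scale qscale_simps)

lemma ad_mult: "ad (a * b) c = ad a (ad b c)"
proof -
  have "ad (a * b) c = tsum (\<lambda>u v. tsum (\<lambda>u' v'. (u * u') * c * antipode (v * v')) (comul b)) (comul a)"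
    using ad_tensor[OF comul_mult[of a b]] by (simp only: tsum_product)
  also have "\<dots> = ad a (ad b c)"
    by (simp add: ad_tsum antipode_mult tsum_mult_left tsum_mult_right mult.assoc)
  finally show ?thesis .
qed

lemma adr_mult: "adr (a * b) c = adr b (adr a c)"
proof -
  have "adr (a * b) c = tsum (\<lambda>u v. tsum (\<lambda>u' v'. antipode (u * u') * c * (v * v')) (comul b)) (comul a)"
    using adr_tensor[OF comul_mult[of a b]] by (simp only: tsum_product)
  also have "\<dots> = adr b (adr a c)"
    by (subst tsum_swap) (simp add: adr_tsum antipode_mult tsum_mult_left tsum_mult_right mult.assoc)
  finally show ?thesis .
qed

lemma adr_power: "adr (a ^ n) c = (adr a ^^ n) c"
  by (induction n) (simp_all add: adr_one adr_mult power_commutes[symmetric])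

text \<open>In Sweedler notation, b u = b_1 (ad_r b_2)u = b_1 S(b_2) u b_3 = u b. Only second tensor
  factors act on u, which fits a one-sided coideal.\<close>

lemma adr_invariant_imp_commute:
  assumes xs: "tensor_eq (comul b) xs" and inv: "\<And>p r. (p, r) \<in> set xs ==> adr r u = counit r *\<^sub>q u"
  shows "b * u = u * b"
proof -
  have b1: "bilin (\<lambda>p r. p * adr r u)"
    by (rule bilinI) (simp_all add: adr_add adr_scale ring_distribs qscale_simps)
  have b2: "bilin (\<lambda>p r. (counit r *\<^sub>q p) * u)"
    by (rule bilinI) (simp_all add: counit_add counit_scale ring_distribs qscale_simps mult_ac)
  have "b * u = tsum (\<lambda>p r. (counit r *\<^sub>q p) * u) (comul b)"
    by (simp add: counit_tsum flip: tsum_mult_right)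
  also have "\<dots> = tsum (\<lambda>p r. (counit r *\<^sub>q p) * u) xs" by (rule tensor_eqD[OF xs b2])
  also have "\<dots> = tsum (\<lambda>p r. p * adr r u) xs" by (rule tsum_cong) (simp add: inv qscale_simps)
  also have "\<dots> = tsum (\<lambda>p r. p * adr r u) (comul b)" by (rule tensor_eqD[OF xs b1, symmetric])
  also have "\<dots> = tsum (\<lambda>p r. tsum (\<lambda>x y. p * antipode x * u * y) (comul r)) (comul b)"
    by (simp add: adr_tsum tsum_mult_left mult.assoc)
  also have "\<dots> = tsum (\<lambda>z y. tsum (\<lambda>p x. p * antipode x * u * y) (comul z)) (comul b)"
    by (rule coassoc_tsum[symmetric], rule trilinI)
      (simp_all add: antipode_add antipode_scale ring_distribs qscale_simps)
  also have "\<dots> = tsum (\<lambda>z y. u * (counit z *\<^sub>q y)) (comul b)"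
    by (simp add: antipode_tsum qscale_simps flip: tsum_mult_right)
  also have "\<dots> = u * b" by (simp add: counit_tsum flip: tsum_mult_left)
  finally show ?thesis .
qed

text \<open>The converse computation: S(b_1) u b_2 = S(b_1) b_2 u.\<close>

lemma commute_imp_adr_invariant:
  assumes xs: "tensor_eq (comul b) xs" and comm: "\<And>p r. (p, r) \<in> set xs ==> r * u = u * r"
  shows "adr b u = counit b *\<^sub>q u"
proof -
  have bil: "bilin (\<lambda>p r. antipode p * r * u)"
    by (rule bilinI) (simp_all add: antipode_add antipode_scale ring_distribs qscale_simps)
  have "adr b u = tsum (\<lambda>p r. antipode p * u * r) xs" by (rule adr_tensor[OF xs])
  also have "\<dots> = tsum (\<lambda>p r. antipode p * r * u) xs"
    by (rule tsum_cong) (simp add: comm mult.assoc)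
  also have "\<dots> = tsum (\<lambda>p r. antipode p * r * u) (comul b)" by (rule tensor_eqD[OF xs bil, symmetric])
  also have "\<dots> = counit b *\<^sub>q u" by (simp add: antipode_tsum qscale_simps flip: tsum_mult_right)
  finally show ?thesis .
qed

text \<open>The condition that \<Delta>(b) lies in U \<otimes> B, as a set of elements b, so that it
  can be propagated from generators by \<open>subalg_coideal_in\<close>.\<close>

definition coideal_in :: "'a::chopf set => 'a set => 'a set" where
  "coideal_in U B = {b. \<exists>xs. set xs \<subseteq> U \<times> B \<and> tensor_eq (comul b) xs}"

lemma coideal_inI: "tensor_eq (comul b) xs ==> set xs \<subseteq> U \<times> B ==> b \<in> coideal_in U B"
  by (auto simp: coideal_in_def)

lemma subalgD:
  assumes "subalg A"
  shows "cv.subspace A" "1 \<in> A" "0 \<in> A" "a \<in> A ==> b \<in> A ==> a + b \<in> A"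
    "a \<in> A ==> b \<in> A ==> a * b \<in> A" "a \<in> A ==> c *\<^sub>q a \<in> A" "a \<in> A ==> - a \<in> A"
    "a \<in> A ==> b \<in> A ==> a - b \<in> A" "a \<in> A ==> a ^ n \<in> A"
proof -
  show s: "cv.subspace A" "1 \<in> A" using assms by (auto simp: subalg_def)
  show m: "a \<in> A ==> b \<in> A ==> a * b \<in> A" for a b using assms by (auto simp: subalg_def)
  show "0 \<in> A" by (rule cv.subspace_0[OF s(1)])
  show "a \<in> A ==> b \<in> A ==> a + b \<in> A" by (rule cv.subspace_add[OF s(1)])
  show "a \<in> A ==> c *\<^sub>q a \<in> A" by (rule cv.subspace_scale[OF s(1)])
  show "a \<in> A ==> - a \<in> A" by (rule cv.subspace_neg[OF s(1)])
  show "a \<in> A ==> b \<in> A ==> a - b \<in> A" by (rule cv.subspace_diff[OF s(1)])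
  show "a \<in> A ==> a ^ n \<in> A" by (induction n) (auto simp: s m)
qed

lemma subalg_alg_gen: "subalg (alg_gen S)"
proof (rule hull_in)
  show "subalg (\<Inter> T)" if "\<forall>A\<in>T. subalg A" for T :: "'a set set"
    using that by (auto simp: subalg_def intro!: cv.subspace_Inter)
qed

lemma alg_gen_base: "s \<in> S ==> s \<in> alg_gen S"
  by (rule hull_inc)

lemma alg_gen_minimal: "S \<subseteq> A ==> subalg A ==> alg_gen S \<subseteq> A"
  by (rule hull_minimal)

text \<open>\<rho> is any action of the generated algebra on W. Its laws are required only there,
  which covers adjoint actions and twisted module actions alike.\<close>

lemma alg_gen_stable:
  fixes \<rho> :: "'a::calg => 'b::cvec => 'b"
  assumes W: "cv.subspace W"
    and \<rho>: "\<And>a b w. a \<in> alg_gen G ==> b \<in> alg_gen G ==> w \<in> W ==> \<rho> (a + b) w = \<rho> a w + \<rho> b w"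
      "\<And>a b w. a \<in> alg_gen G ==> b \<in> alg_gen G ==> w \<in> W ==> \<rho> (a * b) w = \<rho> a (\<rho> b w)"
      "\<And>c a w. a \<in> alg_gen G ==> w \<in> W ==> \<rho> (c *\<^sub>q a) w = c *\<^sub>q \<rho> a w" "\<And>w. w \<in> W ==> \<rho> 1 w = w"
    and G: "\<And>a w. a \<in> G ==> w \<in> W ==> \<rho> a w \<in> W" and a: "a \<in> alg_gen G" "w \<in> W"
  shows "\<rho> a w \<in> W"
proof -
  define S where "S = {a \<in> alg_gen G. \<forall>w\<in>W. \<rho> a w \<in> W}"
  note s = subalgD[OF subalg_alg_gen[of G]]
  have 0: "\<rho> 0 w = 0" if "w \<in> W" for w using \<rho>(3)[OF s(3) that, of 0] by simp
  have "subalg S" unfolding subalg_def[of S] cv.subspace_def[of S]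
    by (auto simp: S_def s \<rho> 0 cv.subspace_0[OF W] cv.subspace_add[OF W] cv.subspace_scale[OF W])
  moreover have "G \<subseteq> S" using G by (auto simp: S_def intro: alg_gen_base)
  ultimately have "alg_gen G \<subseteq> S" by (rule alg_gen_minimal[rotated])
  thus ?thesis using a by (auto simp: S_def)
qed

lemma subalg_coideal_in:
  assumes U: "subalg U" and B: "subalg B"
  shows "subalg (coideal_in U B)"
proof -
  have add: "a + b \<in> coideal_in U B" if ab: "a \<in> coideal_in U B" "b \<in> coideal_in U B" for a b
  proof -
    obtain xs ys where xy: "set xs \<subseteq> U \<times> B" "tensor_eq (comul a) xs" "set ys \<subseteq> U \<times> B" "tensor_eq (comul b) ys"
      using ab by (auto simp: coideal_in_def)
    have "tensor_eq (comul (a + b)) (xs @ ys)"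
      by (rule tensor_eqI) (simp add: tensor_eqD[OF comul_add] tensor_eqD[OF xy(2)] tensor_eqD[OF xy(4)])
    thus ?thesis using xy by (intro coideal_inI[of _ "xs @ ys"]) auto
  qed
  have scale: "k *\<^sub>q a \<in> coideal_in U B" if a: "a \<in> coideal_in U B" for a k
  proof -
    obtain xs where xy: "set xs \<subseteq> U \<times> B" "tensor_eq (comul a) xs" using a by (auto simp: coideal_in_def)
    have "tensor_eq (comul (k *\<^sub>q a)) (map (\<lambda>(u, v). (k *\<^sub>q u, v)) xs)"
    proof (rule tensor_eqI)
      fix f :: "'a => 'a => 'a" assume f: "bilin f"
      show "tsum f (comul (k *\<^sub>q a)) = tsum f (map (\<lambda>(u, v). (k *\<^sub>q u, v)) xs)"
        using tensor_eqD[OF xy(2) f]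
        by (simp add: tensor_eqD[OF comul_scale f] tsum_map bilinD[OF f] flip: tsum_scale)
    qed
    thus ?thesis using xy U by (intro coideal_inI[of _ "map (\<lambda>(u, v). (k *\<^sub>q u, v)) xs"]) (auto intro: subalgD)
  qed
  have mult: "a * b \<in> coideal_in U B" if ab: "a \<in> coideal_in U B" "b \<in> coideal_in U B" for a b
  proof -
    obtain xs ys where xy: "set xs \<subseteq> U \<times> B" "tensor_eq (comul a) xs" "set ys \<subseteq> U \<times> B" "tensor_eq (comul b) ys"
      using ab by (auto simp: coideal_in_def)
    have "tensor_eq (comul (a * b)) [(u * u', v * v'). (u, v) \<leftarrow> xs, (u', v') \<leftarrow> ys]"
    proof (rule tensor_eqI)
      fix f :: "'a => 'a => 'a" assume f: "bilin f"
      have f1: "bilin (\<lambda>u' v'. f (u * u') (v * v'))" for u v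
        by (rule bilinI) (simp_all add: bilinD[OF f] ring_distribs qscale_simps)
      have f2: "bilin (\<lambda>u v. tsum (\<lambda>u' v'. f (u * u') (v * v')) ys)"
        by (rule bilinI) (simp_all add: bilinD[OF f] ring_distribs qscale_simps tsum_add tsum_scale)
      show "tsum f (comul (a * b)) = tsum f [(u * u', v * v'). (u, v) \<leftarrow> xs, (u', v') \<leftarrow> ys]"
        unfolding tensor_eqD[OF comul_mult f] tsum_product tensor_eqD[OF xy(4) f1]
        by (rule tensor_eqD[OF xy(2) f2])
    qed
    thus ?thesis using xy U B
      by (intro coideal_inI[of _ "[(u * u', v * v'). (u, v) \<leftarrow> xs, (u', v') \<leftarrow> ys]"]) (auto intro: subalgD)
  qed
  have one: "1 \<in> coideal_in U B"
    using U B by (intro coideal_inI[OF comul_one]) (auto intro: subalgD)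
  have "0 \<in> coideal_in U B" using scale[OF one, of 0] by simp
  thus ?thesis using add scale mult one by (auto simp: subalg_def cv.subspace_def)
qed

section \<open>Evaluation of noncommutative polynomials\<close>

lemma feval_pmext: "feval g p = pmext (\<lambda>w c. c *\<^sub>q prod_list (map g (letters w))) p"
  by (simp add: feval_def pmext_def)

lemma feval_0 [simp]: "feval g 0 = 0"
  by (simp add: feval_pmext)

lemma feval_add: "feval g (p + r) = feval g p + feval g r"
  unfolding feval_pmext by (rule pmext_add) (simp_all add: qscale_simps)

lemma feval_single: "feval g (single w c) = c *\<^sub>q prod_list (map g (letters w))"
  unfolding feval_pmext by (rule pmext_single) simp

lemma feval_mult: "feval g (p * r) = feval g p * feval g r"
proof (induction p rule: pm_induct)
  case (single w c)
  show ?case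
  proof (induction r rule: pm_induct)
    case (single v d)
    show ?case by (simp add: mult_single feval_single plus_word_def qscale_simps mult.commute)
  qed (simp_all add: ring_distribs feval_add)
qed (simp_all add: ring_distribs feval_add)

lemma feval_gen [simp]: "feval g (gen x) = g x"
  by (simp add: gen_def feval_single qscale_one)

lemma feval_fconst [simp]: "feval g (fconst c) = c *\<^sub>q 1"
  by (simp add: fconst_def feval_single zero_word_def)

lemma feval_one [simp]: "feval g 1 = 1"
  using feval_fconst[of g 1] by (simp add: fconst_def qscale_one)

lemma feval_minus [simp]: "feval g (- p) = - feval g p"
proof -
  have "feval g (p + - p) = feval g p + feval g (- p)" by (rule feval_add)
  thus ?thesis by (simp add: eq_neg_iff_add_eq_0 add.commute)
qed

lemma feval_diff: "feval g (p - r) = feval g p - feval g r"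
  using feval_add[of g p "- r"] by simp

lemma feval_power: "feval g (p ^ n) = feval g p ^ n"
  by (induction n) (simp_all add: feval_mult)

lemma feval_sum: "feval g (sum h I) = (\<Sum>i\<in>I. feval g (h i))"
  by (rule pm_hom_sum) (simp_all add: feval_add)

lemma tensor_comul_mult:
  assumes xs: "tensor_eq (comul a) xs" and ys: "tensor_eq (comul b) ys"
  shows "tensor_eq (comul (a * b)) [(u * u', v * v'). (u, v) \<leftarrow> xs, (u', v') \<leftarrow> ys]"
proof (rule tensor_eqI)
  fix f :: "'a => 'a => 'a" assume f: "bilin f"
  have f1: "bilin (\<lambda>u' v'. f (u * u') (v * v'))" for u v
    by (rule bilinI) (simp_all add: bilinD[OF f] ring_distribs qscale_simps)
  have f2: "bilin (\<lambda>u v. tsum (\<lambda>u' v'. f (u * u') (v * v')) ys)"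
    by (rule bilinI) (simp_all add: bilinD[OF f] ring_distribs qscale_simps tsum_add tsum_scale)
  show "tsum f (comul (a * b)) = tsum f [(u * u', v * v'). (u, v) \<leftarrow> xs, (u', v') \<leftarrow> ys]"
    unfolding tensor_eqD[OF comul_mult f] tsum_product tensor_eqD[OF ys f1]
    by (rule tensor_eqD[OF xs f2])
qed

lemma tsum_comul_mult:
  assumes "tensor_eq (comul a) xs" "tensor_eq (comul b) ys" "bilin f"
  shows "tsum f (comul (a * b)) = tsum (\<lambda>u v. tsum (\<lambda>u' v'. f (u * u') (v * v')) ys) xs"
  using tensor_eqD[OF tensor_comul_mult[OF assms(1,2)] assms(3)] by (simp only: tsum_product)

lemma tsum_comul_add: "bilin f ==> tsum f (comul (a + b)) = tsum f (comul a) + tsum f (comul b)"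
  using tensor_eqD[OF comul_add] by simp

lemma tsum_comul_scale: "bilin f ==> tsum f (comul (c *\<^sub>q a)) = c *\<^sub>q tsum f (comul a)"
  by (simp add: tensor_eqD[OF comul_scale] tsum_map bilinD tsum_scale)

lemma tsum_comul_diff: "bilin f ==> tsum f (comul (a - b)) = tsum f (comul a) - tsum f (comul b)"
  using tsum_comul_add[of f a "(-1) *\<^sub>q b"] tsum_comul_scale[of f "-1" b] by (simp add: qscale_one)

section \<open>The quantized enveloping algebra\<close>

locale qgroup = weights D for D :: "('n::{finite,linorder}, 'u::chopf) qsp" +
  assumes qg: "quantum_group D"
begin

abbreviation ev where "ev \<equiv> feval (case_qgen (gx D) (gy D) (tau D))"

lemma rel_0: "p \<in> q_relations D ==> ev p = 0"
  using qg hull_inc[of p "q_relations D" two_sided_ideal] unfolding quantum_group_def presented_by_def by blast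

lemma tau_0 [simp]: "tau D 0 = 1"
proof -
  have "ev (gen (GT 0) - 1) = 0" by (rule rel_0) (simp add: q_relations_def)
  thus ?thesis by (simp add: feval_diff)
qed

lemma tau_add: "tau D u * tau D v = tau D (u + v)"
proof -
  have "ev (gen (GT u) * gen (GT v) - gen (GT (u + v))) = 0" by (rule rel_0) (auto simp: q_relations_def)
  thus ?thesis by (simp add: feval_diff feval_mult)
qed

lemma tau_add_left: "tau D u * (tau D v * a) = tau D (u + v) * a"
  by (simp add: tau_add flip: mult.assoc)

lemma tau_gx: "tau D v * gx D j = qpow (ip D v (sr j)) *\<^sub>q (gx D j * tau D v)"
proof -
  have "ev (gen (GT v) * gen (GX j) - fconst (qpow (ip D v (sr j))) * gen (GX j) * gen (GT v)) = 0"
    by (rule rel_0) (unfold q_relations_def, blast)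
  thus ?thesis by (simp add: feval_diff feval_mult qscale_simps)
qed

lemma tau_gy: "tau D v * gy D j = qpow (- ip D v (sr j)) *\<^sub>q (gy D j * tau D v)"
proof -
  have "ev (gen (GT v) * gen (GY j) - fconst (qpow (- ip D v (sr j))) * gen (GY j) * gen (GT v)) = 0"
    by (rule rel_0) (unfold q_relations_def, blast)
  thus ?thesis by (simp add: feval_diff feval_mult qscale_simps)
qed

definition qdiff :: "'n => cc" where "qdiff i = qroot D i - inverse (qroot D i)"

lemma qdiff_nonzero [simp]: "qdiff i \<noteq> 0"
proof -
  have "qroot D i \<noteq> inverse (qroot D i)"
    using half_len_pos[of i] unfolding qroot_def qpow_minus[symmetric] by (simp add: qpow_eq_iff)
  thus ?thesis by (simp add: qdiff_def)
qed

lemma gx_gy: "gx D i * gy D j = gy D j * gx D i +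
    (if i = j then (1 / qdiff i) *\<^sub>q (tau D (sr i) - tau D (- sr i)) else 0)"
proof -
  have "ev (gen (GX i) * gen (GY j) - gen (GY j) * gen (GX i) -
        (if i = j then fconst (1 / (qroot D i - inverse (qroot D i))) *
                       (gen (GT (sr i)) - gen (GT (- sr i))) else 0)) = 0"
    by (rule rel_0) (unfold q_relations_def, blast)
  hence "gx D i * gy D j - gy D j * gx D i -
      (if i = j then (1 / qdiff i) *\<^sub>q (tau D (sr i) - tau D (- sr i)) else 0) = 0"
    by (cases "i = j") (simp_all add: feval_diff feval_mult qscale_simps qdiff_def)
  thus ?thesis by (simp add: diff_diff_eq)
qed

lemma serre_gx:
  assumes "i \<noteq> j"
  defines "N \<equiv> nat (1 - cart D i j)"
  shows "(\<Sum>m\<le>N. ((- 1) ^ m * qbinom (qroot D i) N m) *\<^sub>q (gx D i ^ (N - m) * gx D j * gx D i ^ m)) = 0"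
proof -
  have "ev (serre D (GX i) (GX j) i j) = 0"
    by (rule rel_0) (use assms(1) in \<open>unfold q_relations_def, blast\<close>)
  thus ?thesis unfolding serre_def Let_def N_def[symmetric]
    by (simp add: feval_sum feval_mult feval_power qscale_simps mult.assoc)
qed

lemma comul_gx: "tensor_eq (comul (gx D i)) [(gx D i, 1), (tau D (sr i), gx D i)]"
  and comul_gy: "tensor_eq (comul (gy D i)) [(gy D i, tau D (- sr i)), (1, gy D i)]"
  and comul_tau: "tensor_eq (comul (tau D v)) [(tau D v, tau D v)]"
  using qg by (auto simp: quantum_group_def)

lemma tau_nonzero [simp]: "tau D v \<noteq> 0"
proof
  assume "tau D v = 0"
  hence "tau D v * tau D (- v) = 0" by simp
  thus False by (simp add: tau_add)
qed

lemma bilin_counit: "bilin (\<lambda>u v. counit u *\<^sub>q v)"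
  by (rule bilinI) (simp_all add: counit_add counit_scale qscale_simps mult_ac)

lemma bilin_antipode: "bilin (\<lambda>u v. antipode u * v)"
  by (rule bilinI) (simp_all add: antipode_add antipode_scale ring_distribs qscale_simps)

lemma counit_tau [simp]: "counit (tau D v) = 1"
proof -
  have "counit (tau D v) *\<^sub>q tau D v = 1 *\<^sub>q tau D v"
    using tensor_eqD[OF comul_tau bilin_counit, of v] by (simp add: counit_tsum qscale_one)
  thus ?thesis by (metis cv.scale_cancel_right tau_nonzero)
qed

lemma antipode_tau [simp]: "antipode (tau D v) = tau D (- v)"
proof -
  have "antipode (tau D v) * tau D v = 1"
    using tensor_eqD[OF comul_tau bilin_antipode, of v] by (simp add: antipode_tsum qscale_one)
  hence "antipode (tau D v) * tau D v * tau D (- v) = tau D (- v)" by simp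
  thus ?thesis by (simp add: mult.assoc tau_add)
qed

lemma counit_gx [simp]: "counit (gx D i) = 0"
proof -
  have "gx D i = counit (gx D i) *\<^sub>q 1 + gx D i"
    using tensor_eqD[OF comul_gx bilin_counit, of i] by (simp add: counit_tsum qscale_one)
  thus ?thesis by simp
qed

lemma counit_gy [simp]: "counit (gy D i) = 0"
proof -
  have "gy D i = counit (gy D i) *\<^sub>q tau D (- sr i) + gy D i"
    using tensor_eqD[OF comul_gy bilin_counit, of i] by (simp add: counit_tsum qscale_one counit_one)
  thus ?thesis by simp
qed

lemma antipode_gx: "antipode (gx D i) = - (tau D (- sr i) * gx D i)"
  and antipode_gy: "antipode (gy D i) = - (gy D i * tau D (sr i))"
  and antipode_one: "antipode 1 = (1::'u)"
proof -
  have "0 = antipode (gx D i) + tau D (- sr i) * gx D i"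
    using tensor_eqD[OF comul_gx bilin_antipode, of i] by (simp add: antipode_tsum)
  thus "antipode (gx D i) = - (tau D (- sr i) * gx D i)" by (simp add: eq_neg_iff_add_eq_0)
  show 1: "antipode 1 = (1::'u)"
    using ad_one[of "1::'u"] by (simp add: ad_tensor[OF comul_one])
  have "0 = antipode (gy D i) * tau D (- sr i) + gy D i"
    using tensor_eqD[OF comul_gy bilin_antipode, of i] by (simp add: antipode_tsum 1)
  hence "antipode (gy D i) * tau D (- sr i) = - gy D i" by (simp add: eq_neg_iff_add_eq_0)
  hence "antipode (gy D i) * (tau D (- sr i) * tau D (sr i)) = - (gy D i * tau D (sr i))"
    by (simp flip: mult.assoc)
  thus "antipode (gy D i) = - (gy D i * tau D (sr i))" by (simp add: tau_add)
qed

lemma adr_gx: "adr (gx D j) b = tau D (- sr j) * b * gx D j - tau D (- sr j) * gx D j * b"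
  by (simp add: adr_tensor[OF comul_gx] antipode_gx)

lemma ad_gx: "ad (gx D j) b = gx D j * b - tau D (sr j) * b * tau D (- sr j) * gx D j"
  by (simp add: ad_tensor[OF comul_gx] antipode_gx antipode_one mult.assoc)

lemma ad_gy: "ad (gy D j) b = (gy D j * b - b * gy D j) * tau D (sr j)"
  by (simp add: ad_tensor[OF comul_gy] antipode_gy ring_distribs mult.assoc)

lemma ad_tau: "ad (tau D v) b = tau D v * b * tau D (- v)"
  by (simp add: ad_tensor[OF comul_tau])

section \<open>The coideal property of B and its centralizer\<close>

lemma subalg_sets [simp]: "subalg (Uq D)" "subalg (Uch D)" "subalg (Mq D)" "subalg (Uplus D)"
  "subalg (Bstd D s d)"
  by (simp_all add: Uq_def Uch_def Mq_def Uplus_def Bstd_def subalg_alg_gen)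

lemma Uq_gens [simp]: "gx D i \<in> Uq D" "gy D i \<in> Uq D" "v \<in> Qpi ==> tau D v \<in> Uq D"
  unfolding Uq_def by (auto intro: alg_gen_base)

lemma Uch_gens [simp]: "gx D i \<in> Uch D" "gy D i \<in> Uch D" "v \<in> Ppi D ==> tau D v \<in> Uch D"
  unfolding Uch_def by (auto intro: alg_gen_base)

lemma Mq_gens [simp]: "i \<in> piTh D ==> gx D i \<in> Mq D" "i \<in> piTh D ==> gy D i \<in> Mq D"
  "i \<in> piTh D ==> tau D (sr i) \<in> Mq D" "i \<in> piTh D ==> tau D (- sr i) \<in> Mq D"
  unfolding Mq_def by (auto intro: alg_gen_base)

lemma Uq_Uch: "Uq D \<subseteq> Uch D"
  unfolding Uq_def by (rule alg_gen_minimal) (auto intro: Qpi_Ppi Uch_gens(3))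

lemma Mq_Uq: "Mq D \<subseteq> Uq D"
  unfolding Mq_def by (rule alg_gen_minimal) auto

lemma Bstd_gens: "m \<in> Mq D ==> m \<in> Bstd D s d" "m \<in> TTh D ==> m \<in> Bstd D s d"
  "i \<notin> piTh D ==> Bgen D s d i \<in> Bstd D s d"
  unfolding Bstd_def by (auto intro: alg_gen_base)

lemma piTh_w0Th: "set (w0Th D) \<subseteq> piTh D"
  using w0Th_reduced by (simp add: reducedTh_def)

text \<open>The shape of the coproduct of the elements \<open>\<theta>~(y\<^sub>i)\<close>.\<close>

definition theta_like :: "'n => 'u set" where
  "theta_like p = {z \<in> Uq D. \<exists>xs. set xs \<subseteq> Uq D \<times> {m * tau D (- sr p) | m. m \<in> Mq D} \<and>
     tensor_eq (comul z) ((1, z) # xs)}"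

lemma theta_like_base: "tau D (- sr p) * gx D p \<in> theta_like p"
proof -
  let ?t = "tau D (- sr p)"
  have "tensor_eq (comul (?t * gx D p)) ((1, ?t * gx D p) # [(?t * gx D p, ?t)])"
    by (rule tensor_eqI) (simp add: tsum_comul_mult[OF comul_tau comul_gx] tau_add)
  moreover have "?t * gx D p \<in> Uq D" by (intro subalgD(5)[of "Uq D"]) auto
  moreover have "?t \<in> {m * ?t | m. m \<in> Mq D}"
    by (rule CollectI, rule exI[of _ 1]) (simp add: subalgD)
  ultimately show ?thesis
    unfolding theta_like_def by (intro CollectI conjI exI[of _ "[(?t * gx D p, ?t)]"]) auto
qed

lemma theta_like_scale: "z \<in> theta_like p ==> c *\<^sub>q z \<in> theta_like p"
proof -
  assume "z \<in> theta_like p"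
  then obtain xs where z: "z \<in> Uq D" and xs: "set xs \<subseteq> Uq D \<times> {m * tau D (- sr p) | m. m \<in> Mq D}"
    "tensor_eq (comul z) ((1, z) # xs)" by (auto simp: theta_like_def)
  let ?ys = "map (\<lambda>(u, v). (c *\<^sub>q u, v)) xs"
  have "tensor_eq (comul (c *\<^sub>q z)) ((1, c *\<^sub>q z) # ?ys)"
    by (rule tensor_eqI) (simp add: tsum_comul_scale tensor_eqD[OF xs(2)] bilinD tsum_map qscale_simps
        tsum_scale)
  moreover have "set ?ys \<subseteq> Uq D \<times> {m * tau D (- sr p) | m. m \<in> Mq D}"
    using xs(1) by (auto intro: subalgD(6)[OF subalg_sets(1)])
  moreover have "c *\<^sub>q z \<in> Uq D" using z by (rule subalgD(6)[OF subalg_sets(1)])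
  ultimately show ?thesis unfolding theta_like_def by blast
qed

text \<open>ad_r(x_j) z is a difference of two products, and the terms
  \<open>Xj \<otimes> t z\<close> of their coproducts cancel. Apart from 1 \<otimes> ad_r(x_j) z,
  all remaining terms have their second factor in M tau(-\<alpha>_p).\<close>

lemma theta_like_adr:
  assumes "z \<in> theta_like p" "j \<in> piTh D"
  shows "adr (gx D j) z \<in> theta_like p"
proof -
  define t where "t = tau D (- sr j)"
  define Xj where "Xj = t * gx D j"
  define L where "L = {m * tau D (- sr p) | m. m \<in> Mq D}"
  obtain xs where z: "z \<in> Uq D" and xs: "set xs \<subseteq> Uq D \<times> L" "tensor_eq (comul z) ((1, z) # xs)"
    using assms(1) unfolding theta_like_def L_def by blast
  have adr: "adr (gx D j) z = (t * z) * gx D j - Xj * z" by (simp add: adr_gx t_def Xj_def)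
  have tU: "t \<in> Uq D" "tau D (sr j) \<in> Uq D" by (simp_all add: t_def)
  have XU: "Xj \<in> Uq D" unfolding Xj_def using tU by (simp add: subalgD)
  have tM: "t \<in> Mq D" "Xj \<in> Mq D" using assms(2) by (simp_all add: t_def Xj_def subalgD)
  have cX: "tensor_eq (comul Xj) [(Xj, t), (1, Xj)]"
    by (rule tensor_eqI) (simp add: Xj_def t_def tsum_comul_mult[OF comul_tau comul_gx] tau_add add.commute)
  \<comment> \<open>The four groups are the surviving terms of \<Delta>(t z x_j) and of -\<Delta>(t
    x_j z).\<close>
  define ys where "ys = map (\<lambda>(u, l). (t * u * gx D j, t * l)) xs
    @ map (\<lambda>(u, l). (t * u * tau D (sr j), t * l * gx D j)) xs
    @ map (\<lambda>(u, l). (- (Xj * u), t * l)) xs @ map (\<lambda>(u, l). (- u, Xj * l)) xs"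
  have neg: "f (- a) b = - f a b" if "bilin f" for f :: "'u => 'u => 'u" and a b
    using bilinD(3)[OF that, of "-1" a b] by (simp add: qscale_one)
  have tneg: "tsum (\<lambda>a b. - f a b) zs = - tsum f zs" for f :: "'u => 'u => 'u" and zs
    by (induction zs) auto
  have "tensor_eq (comul (adr (gx D j) z)) ((1, adr (gx D j) z) # ys)"
  proof (rule tensor_eqI)
    fix f :: "'u => 'u => 'u" assume f: "bilin f"
    have tz: "tensor_eq (comul (t * z)) ((t, t * z) # map (\<lambda>(u, l). (t * u, t * l)) xs)"
      by (rule tensor_eqI) (simp add: t_def tsum_comul_mult[OF comul_tau xs(2)] tsum_map)
    have 1: "tsum f (comul ((t * z) * gx D j)) = f Xj (t * z) + f 1 (t * z * gx D j)
        + (tsum (\<lambda>u l. f (t * u * gx D j) (t * l)) xs + tsum (\<lambda>u l. f (t * u * tau D (sr j)) (t * l * gx D j)) xs)"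
      unfolding tsum_comul_mult[OF tz comul_gx f] by (simp add: tsum_map tsum_add t_def Xj_def tau_add)
    have 2: "tsum f (comul (Xj * z)) = f Xj (t * z) + f 1 (Xj * z)
        + (tsum (\<lambda>u l. f (Xj * u) (t * l)) xs + tsum (\<lambda>u l. f u (Xj * l)) xs)"
      by (simp add: tsum_comul_mult[OF cX xs(2) f] tsum_add)
    have "f 1 (t * z * gx D j - Xj * z) = f 1 (t * z * gx D j) - f 1 (Xj * z)"
      using bilinD(2,4)[OF f] by (metis add_diff_cancel_right' diff_add_cancel)
    thus "tsum f (comul (adr (gx D j) z)) = tsum f ((1, adr (gx D j) z) # ys)"
      by (simp add: adr tsum_comul_diff[OF f] 1 2 ys_def tsum_map neg[OF f] tneg)
  qed
  moreover have "set ys \<subseteq> Uq D \<times> L"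
  proof -
    have L1: "a * l \<in> L" if l: "l \<in> L" "a \<in> Mq D" for a l
    proof -
      obtain m where "m \<in> Mq D" "l = m * tau D (- sr p)" using l unfolding L_def by blast
      hence "a * l = (a * m) * tau D (- sr p)" "a * m \<in> Mq D" using l(2) by (auto simp: mult.assoc intro: subalgD)
      thus ?thesis unfolding L_def by blast
    qed
    have L2: "l * gx D j \<in> L" if l: "l \<in> L" for l
    proof -
      obtain m where m: "m \<in> Mq D" "l = m * tau D (- sr p)" using l unfolding L_def by blast
      define c where "c = qpow (ip D (- sr p) (sr j))"
      have "l * gx D j = (c *\<^sub>q (m * gx D j)) * tau D (- sr p)"
        unfolding m(2) mult.assoc tau_gx by (simp add: c_def qscale_simps mult.assoc)
      moreover have "c *\<^sub>q (m * gx D j) \<in> Mq D" using m(1) assms(2) by (simp add: subalgD)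
      ultimately show ?thesis unfolding L_def by blast
    qed
    show ?thesis using xs(1) tU XU L1 L2 tM
      by (auto simp: ys_def intro!: subalgD(5)[OF subalg_sets(1)] subalgD(7)[OF subalg_sets(1)])
  qed
  moreover have "adr (gx D j) z \<in> Uq D"
    unfolding adr using z tU XU by (intro subalgD[OF subalg_sets(1)]) auto
  ultimately show ?thesis unfolding theta_like_def L_def by blast
qed

lemma theta_like_th_y: "th_y D i \<in> theta_like (prm D i)"
proof -
  have "ad_divided D b (tau D (- sr p) * gx D p) js \<in> theta_like p" if "set js \<subseteq> piTh D" for js b p
    using that
  proof (induction js)
    case (Cons j js)
    have "(adr (gx D j) ^^ n) z \<in> theta_like p" if "z \<in> theta_like p" for n z
      by (induction n) (use that Cons.prems in \<open>auto intro: theta_like_adr\<close>)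
    thus ?case using Cons by (simp add: xdiv_def adr_scale adr_power theta_like_scale)
  qed (simp add: theta_like_base)
  thus ?thesis using piTh_w0Th by (simp add: th_y_def)
qed

lemma th_y_Uq: "th_y D i \<in> Uq D"
  using theta_like_th_y by (auto simp: theta_like_def)

text \<open>Multiplication by t_i turns the second factors in M tau(-\<alpha>_p(i)) into elements of
  M tau(\<alpha>_i - \<alpha>_p(i)), and this torus element lies in T_\<Theta>.\<close>

lemma Bgen_coideal:
  assumes i: "i \<notin> piTh D"
  shows "Bgen D s d i \<in> coideal_in (Uq D) (Bstd D s d)"
proof -
  define t where "t = tau D (sr i)"
  define p where "p = prm D i"
  define z where "z = th_y D i"
  define d' where "d' = (if i \<in> setD D then d else 1)"
  define s' where "s' = (if i \<in> setS D then s else 0)"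
  define b where "b = Bgen D s d i"
  have b: "b = gy D i * t + d' *\<^sub>q (z * t) + s' *\<^sub>q t"
    by (simp add: b_def Bgen_def t_def z_def d'_def s'_def)
  obtain xs where xs: "set xs \<subseteq> Uq D \<times> {m * tau D (- sr p) | m. m \<in> Mq D}"
    "tensor_eq (comul z) ((1, z) # xs)"
    using theta_like_th_y[of i] by (auto simp: theta_like_def z_def p_def)
  define ys where "ys = (t, b) # (gy D i * t, 1) # map (\<lambda>(u, l). (d' *\<^sub>q (u * t), l * t)) xs"
  have "tensor_eq (comul b) ys"
  proof (rule tensor_eqI)
    fix f :: "'u => 'u => 'u" assume f: "bilin f"
    have 1: "tsum f (comul (gy D i * t)) = f (gy D i * t) 1 + f t (gy D i * t)"
      unfolding t_def by (simp add: tsum_comul_mult[OF comul_gy comul_tau f] tau_add)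
    have 2: "tsum f (comul (z * t)) = f t (z * t) + tsum (\<lambda>u l. f (u * t) (l * t)) xs"
      unfolding t_def by (simp add: tsum_comul_mult[OF xs(2) comul_tau f])
    have 3: "tsum f (comul t) = f t t" unfolding t_def by (simp add: tensor_eqD[OF comul_tau f])
    show "tsum f (comul b) = tsum f ys"
      by (simp add: b ys_def tsum_comul_add[OF f] tsum_comul_scale[OF f] 1 2 3 bilinD[OF f] tsum_map
          tsum_scale[symmetric] qscale_simps add_ac)
  qed
  moreover have "set ys \<subseteq> Uq D \<times> Bstd D s d"
  proof -
    have "l * t \<in> Bstd D s d" if l: "l \<in> {m * tau D (- sr p) | m. m \<in> Mq D}" for l
    proof -
      obtain m where m: "m \<in> Mq D" "l = m * tau D (- sr p)" using l by blast
      have "l * t = m * tau D (sr i - sr p)" by (simp add: m(2) t_def mult.assoc tau_add)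
      moreover have "tau D (sr i - sr p) \<in> TTh D"
        unfolding TTh_def p_def using Th_sr_diff[OF i] by (intro imageI) simp
      ultimately show ?thesis using m(1) by (auto intro: Bstd_gens subalgD(5)[OF subalg_sets(5)])
    qed
    hence "l * t \<in> Bstd D s d" if "(u, l) \<in> set xs" for u l using xs(1) that by blast
    moreover have "t \<in> Uq D" by (simp add: t_def)
    ultimately show ?thesis using xs(1) i
      by (auto simp: ys_def b_def intro!: Bstd_gens(3) subalgD(2)[OF subalg_sets(5)]
          subalgD(5)[OF subalg_sets(1)] subalgD(6)[OF subalg_sets(1)])
  qed
  ultimately show ?thesis unfolding b_def by (rule coideal_inI)
qed

lemma TTh_Uq: "TTh D \<subseteq> Uq D"
  by (auto simp: TTh_def)

lemma Bstd_Uq: "Bstd D s d \<subseteq> Uq D"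
  unfolding Bstd_def
proof (rule alg_gen_minimal)
  have "Bgen D s d i \<in> Uq D" for i
    unfolding Bgen_def using th_y_Uq by (intro subalgD[OF subalg_sets(1)]) auto
  thus "Mq D \<union> TTh D \<union> Bgen D s d ` (- piTh D) \<subseteq> Uq D" using Mq_Uq TTh_Uq by auto
qed simp

lemma Bstd_coideal: "Bstd D s d \<subseteq> coideal_in (Uq D) (Bstd D s d)"
proof -
  let ?C = "coideal_in (Uq D) (Bstd D s d)"
  have C: "subalg ?C" by (simp add: subalg_coideal_in)
  have B1: "1 \<in> Bstd D s d" by (simp add: subalgD)
  have M: "Mq D \<subseteq> ?C"
    unfolding Mq_def
  proof (rule alg_gen_minimal[OF _ C], safe)
    fix i assume i: "i \<in> piTh D"
    show "gx D i \<in> ?C" using i B1 by (intro coideal_inI[OF comul_gx]) (auto intro: Bstd_gens)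
    show "gy D i \<in> ?C" using i B1 by (intro coideal_inI[OF comul_gy]) (auto intro: Bstd_gens subalgD(2)[OF subalg_sets(1)])
    show "tau D (sr i) \<in> ?C" using i by (intro coideal_inI[OF comul_tau]) (auto intro: Bstd_gens)
    show "tau D (- sr i) \<in> ?C" using i by (intro coideal_inI[OF comul_tau]) (auto intro: Bstd_gens)
  qed
  have T: "TTh D \<subseteq> ?C"
  proof
    fix a assume a: "a \<in> TTh D"
    then obtain v where "a = tau D v" by (auto simp: TTh_def)
    thus "a \<in> ?C" using a TTh_Uq by (auto intro!: coideal_inI[OF comul_tau] Bstd_gens)
  qed
  show ?thesis
    by (subst (1) Bstd_def, rule alg_gen_minimal[OF _ C]) (use M T Bgen_coideal in auto)
qed

lemma HAutD:
  assumes "\<psi> \<in> HAut D"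
  shows "\<psi> 1 = 1" "a \<in> Uq D ==> \<psi> a \<in> Uq D" "a \<in> Uq D ==> b \<in> Uq D ==> \<psi> (a + b) = \<psi> a + \<psi> b"
    "a \<in> Uq D ==> b \<in> Uq D ==> \<psi> (a * b) = \<psi> a * \<psi> b" "a \<in> Uq D ==> \<psi> (c *\<^sub>q a) = c *\<^sub>q \<psi> a"
    "a \<in> Uq D ==> set xs \<subseteq> Uq D \<times> Uq D ==> tensor_eq (comul a) xs ==>
      tensor_eq (comul (\<psi> a)) (map (map_prod \<psi> \<psi>) xs)"
    "a \<in> Uq D ==> counit (\<psi> a) = counit a" "v \<in> Qpi ==> \<psi> (tau D v) = tau D v"
    "\<psi> ` Uq D = Uq D"
  using assms unfolding HAut_def by (auto simp: bij_betw_def)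

lemma BfamE:
  assumes "B \<in> Bfam R D"
  obtains \<psi> s d where "\<psi> \<in> HAut D" "B = \<psi> ` Bstd D s d" "d \<noteq> 0"
  using assms unfolding Bfam_def by fastforce

lemma Bfam_coideal:
  assumes "B \<in> Bfam R D" "b \<in> B"
  obtains xs where "set xs \<subseteq> UNIV \<times> B" "tensor_eq (comul b) xs"
proof -
  obtain \<psi> s d where \<psi>: "\<psi> \<in> HAut D" "B = \<psi> ` Bstd D s d" using BfamE[OF assms(1)] .
  obtain a where a: "a \<in> Bstd D s d" "b = \<psi> a" using assms(2) \<psi>(2) by blast
  then obtain xs where xs: "set xs \<subseteq> Uq D \<times> Bstd D s d" "tensor_eq (comul a) xs"
    using Bstd_coideal by (force simp: coideal_in_def)
  have "tensor_eq (comul (\<psi> a)) (map (map_prod \<psi> \<psi>) xs)"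
    using xs a(1) Bstd_Uq by (intro HAutD(6)[OF \<psi>(1)]) fast+
  moreover have "set (map (map_prod \<psi> \<psi>) xs) \<subseteq> UNIV \<times> B" using xs(1) \<psi>(2) by auto
  ultimately show ?thesis using a(2) that by blast
qed

lemma Bfam_Uq: "B \<in> Bfam R D ==> B \<subseteq> Uq D"
  by (metis BfamE Bstd_Uq HAutD(9) image_mono)

lemma Bfam_TTh:
  assumes "B \<in> Bfam R D" "v \<in> Qpi" "Th D v = v"
  shows "tau D v \<in> B"
proof -
  obtain \<psi> s d where \<psi>: "\<psi> \<in> HAut D" "B = \<psi> ` Bstd D s d" using BfamE[OF assms(1)] .
  have "tau D v \<in> Bstd D s d" using assms(2,3) by (intro Bstd_gens) (auto simp: TTh_def)
  thus ?thesis using HAutD(8)[OF \<psi>(1) assms(2)] \<psi>(2) by (metis imageI)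
qed

text \<open>The coideal property makes ad_r-invariance and commutation equivalent; the centralizer
  form is the one that shows closure under products.\<close>

lemma UB_iff:
  assumes "B \<in> Bfam R D"
  shows "u \<in> UB D B \<longleftrightarrow> u \<in> Uch D \<and> (\<forall>b\<in>B. b * u = u * b)"
proof
  assume u: "u \<in> UB D B"
  have "b * u = u * b" if b: "b \<in> B" for b
  proof -
    obtain xs where "set xs \<subseteq> UNIV \<times> B" "tensor_eq (comul b) xs" using Bfam_coideal[OF assms b] .
    thus ?thesis using u by (intro adr_invariant_imp_commute) (auto simp: UB_def)
  qed
  thus "u \<in> Uch D \<and> (\<forall>b\<in>B. b * u = u * b)" using u by (simp add: UB_def)
next
  assume u: "u \<in> Uch D \<and> (\<forall>b\<in>B. b * u = u * b)"
  have "adr b u = counit b *\<^sub>q u" if b: "b \<in> B" for b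
  proof -
    obtain xs where "set xs \<subseteq> UNIV \<times> B" "tensor_eq (comul b) xs" using Bfam_coideal[OF assms b] .
    thus ?thesis using u by (intro commute_imp_adr_invariant) auto
  qed
  thus "u \<in> UB D B" using u by (simp add: UB_def)
qed

lemma subalg_UB:
  assumes "B \<in> Bfam R D"
  shows "subalg (UB D B)"
proof -
  note U = subalgD[OF subalg_sets(2)]
  have m: "b * (u * v) = u * v * b" if "b * u = u * b" "b * v = v * b" for b u v :: 'u
    using that by (metis mult.assoc)
  have e: "UB D B = {u \<in> Uch D. \<forall>b\<in>B. b * u = u * b}" using UB_iff[OF assms] by blast
  show ?thesis unfolding subalg_def cv.subspace_def e
  proof (intro conjI ballI allI CollectI)
    fix a b c assume "a \<in> {u \<in> Uch D. \<forall>b\<in>B. b * u = u * b}" "b \<in> {u \<in> Uch D. \<forall>b\<in>B. b * u = u * b}"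
      and c: "c \<in> B"
    thus "c * (a * b) = a * b * c" by (intro m) auto
  qed (auto intro: U simp: ring_distribs qscale_simps)
qed

section \<open>Weights of U and words in the x_i\<close>

definition uwt :: "'n wt => 'u set" where
  "uwt \<beta> = {u. \<forall>\<gamma>\<in>Qpi. tau D \<gamma> * u * tau D (- \<gamma>) = qpow (ip D \<gamma> \<beta>) *\<^sub>q u}"

lemma uwt_subspace: "cv.subspace (uwt \<beta>)"
  by (auto simp: cv.subspace_def uwt_def ring_distribs qscale_simps mult.commute)

lemma uwt_mult:
  assumes "a \<in> uwt \<beta>" "b \<in> uwt \<gamma>"
  shows "a * b \<in> uwt (\<beta> + \<gamma>)"
proof -
  have "tau D v * (a * b) * tau D (- v) = qpow (ip D v (\<beta> + \<gamma>)) *\<^sub>q (a * b)" if "v \<in> Qpi" for v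
  proof -
    have "tau D v * (a * b) * tau D (- v) = (tau D v * a * tau D (- v)) * (tau D v * b * tau D (- v))"
      by (simp add: mult.assoc tau_add_left)
    also have "\<dots> = (qpow (ip D v \<beta>) *\<^sub>q a) * (qpow (ip D v \<gamma>) *\<^sub>q b)"
      using assms that by (simp add: uwt_def)
    finally show ?thesis by (simp add: qscale_simps ip_add_right qpow_add mult.commute)
  qed
  thus ?thesis by (simp add: uwt_def)
qed

lemma uwt_gens: "gx D i \<in> uwt (sr i)" "gy D i \<in> uwt (- sr i)" "tau D v \<in> uwt 0" "1 \<in> uwt 0"
proof -
  have "gx D i * tau D v * tau D (- v) = gx D i" "gy D i * tau D v * tau D (- v) = gy D i" for v
    by (simp_all add: mult.assoc tau_add)
  thus "gx D i \<in> uwt (sr i)" "gy D i \<in> uwt (- sr i)"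
    by (simp_all add: uwt_def tau_gx tau_gy qscale_mult_left)
qed (simp_all add: uwt_def tau_add qscale_one)

definition xword :: "'n list => 'u" where "xword ks = prod_list (map (gx D) ks)"

definition wtl :: "'n list => 'n wt" where "wtl ks = (\<Sum>k\<leftarrow>ks. sr k)"

lemma wtl_simps [simp]: "wtl [] = 0" "wtl (k # ks) = sr k + wtl ks" "wtl (ks @ ls) = wtl ks + wtl ls"
  by (simp_all add: wtl_def)

lemma crd_wtl: "crd (wtl ks) i = of_nat (count_list ks i)"
  by (induction ks) (auto simp: lookup_add crd_sr)

lemma xword_simps [simp]: "xword [] = 1" "xword (k # ks) = gx D k * xword ks"
  "xword (ks @ ls) = xword ks * xword ls"
  by (simp_all add: xword_def)

lemma xword_uwt: "xword ks \<in> uwt (wtl ks)"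
  by (induction ks) (auto simp: uwt_gens uwt_mult)

end

section \<open>Skew derivations of the free algebra\<close>

lemma fconst_mult: "fconst c * fconst d = fconst (c * d)"
  by (simp add: fconst_def mult_single)

lemma fconst_add: "fconst (c + d) = fconst c + fconst d"
  by (simp add: fconst_def single_add)

lemma fconst_1 [simp]: "fconst 1 = 1" and fconst_0 [simp]: "fconst 0 = 0"
  by (simp_all add: fconst_def)

lemma fconst_commute: "f * fconst c = fconst c * f" for f :: "'x free"
proof (induction f rule: pm_induct)
  case (single w d)
  thus ?case by (simp add: fconst_def mult_single mult.commute)
qed (simp_all add: ring_distribs)

lemma fconst_left_commute: "gen j * (fconst c * g) = fconst c * (gen j * g)"
  "fconst d * (fconst c * g) = fconst c * (fconst d * g)" for g :: "'x free"
proof -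
  have "gen j * (fconst c * g) = (gen j * fconst c) * g" by (simp add: mult.assoc)
  thus "gen j * (fconst c * g) = fconst c * (gen j * g)"
    unfolding fconst_commute[of "gen j"] by (simp add: mult.assoc)
  show "fconst d * (fconst c * g) = fconst c * (fconst d * g)"
    by (simp only: mult.assoc[symmetric] fconst_mult mult.commute)
qed

lemma single_Word: "single (Word ks) c = fconst c * prod_list (map gen ks)"
proof (induction ks)
  case Nil
  show ?case by (simp add: fconst_def zero_word_def)
next
  case (Cons k ks)
  have "single (Word (k # ks)) c = gen k * single (Word ks) c"
    by (simp add: gen_def mult_single plus_word_def)
  thus ?case by (simp add: Cons fconst_left_commute)
qed

lemma free_induct [case_names one add scale gen]:
  fixes f :: "'x free"
  assumes "P 1" "\<And>f g. P f ==> P g ==> P (f + g)" "\<And>c f. P f ==> P (fconst c * f)" "\<And>j f. P f ==> P (gen j * f)"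
  shows "P f"
proof (induction f rule: pm_induct)
  case zero
  show ?case using assms(3)[OF assms(1), of 0] by simp
next
  case (single w c)
  obtain ks where w: "w = Word ks" by (cases w)
  have "P (prod_list (map gen ks))" by (induction ks) (simp_all add: assms)
  thus ?case unfolding w single_Word by (rule assms(3))
qed (rule assms(2))

definition fcst :: "'x free => cc" where "fcst f = lookup f 0"

lemma fcst_simps [simp]: "fcst 0 = 0" "fcst 1 = 1" "fcst (f + g) = fcst f + fcst g" "fcst (f - g) = fcst f - fcst g"
  "fcst (fconst c * f) = c * fcst f" "fcst (fconst c) = c" "fcst (- f) = - fcst f"
  by (simp_all add: fcst_def lookup_add lookup_minus fconst_def lookup_single_times lookup_one)

lemma fcst_gen [simp]: "fcst (gen j * f) = 0" "fcst (gen j) = 0"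
proof -
  show "fcst (gen j * f) = 0" for f
  proof (induction f rule: pm_induct)
    case (single w c)
    show ?case by (simp add: fcst_def gen_def mult_single lookup_single plus_word_def zero_word_def when_def)
  qed (simp_all add: ring_distribs)
  from this[of 1] show "fcst (gen j) = 0"
    by (simp add: fcst_def gen_def lookup_single zero_word_def when_def)
qed

lemma fcst_mult: "fcst (f * g) = fcst f * fcst g"
  by (induction f rule: free_induct) (simp_all add: ring_distribs mult.assoc)

context qgroup begin

definition fx :: "'n free => 'u" where "fx = feval (gx D)"

lemma fx_simps [simp]: "fx 0 = 0" "fx 1 = 1" "fx (f + g) = fx f + fx g" "fx (f * g) = fx f * fx g"
  "fx (f - g) = fx f - fx g" "fx (- f) = - fx f" "fx (fconst c) = c *\<^sub>q 1" "fx (gen j) = gx D j"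
  by (simp_all add: fx_def feval_add feval_mult feval_diff)

lemma fx_single: "fx (single (Word ks) c) = c *\<^sub>q xword ks"
  by (simp add: fx_def feval_single xword_def)

lemma fx_sum: "fx (sum h I) = (\<Sum>i\<in>I. fx (h i))"
  unfolding fx_def by (rule feval_sum)

text \<open>Conjugation by tau(v), lifted from U^+ to the free algebra.\<close>

definition kap :: "'n wt => 'n free => 'n free" where
  "kap v f = pmext (\<lambda>w c. single w (qpow (ip D v (wtl (letters w))) * c)) f"

lemma kap_add [simp]: "kap v (f + g) = kap v f + kap v g"
  unfolding kap_def by (rule pmext_add) (simp_all add: ring_distribs single_add)

lemma kap_0 [simp]: "kap v 0 = 0"
  by (simp add: kap_def)

lemma kap_single: "kap v (single w c) = single w (qpow (ip D v (wtl (letters w))) * c)"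
  unfolding kap_def by (rule pmext_single) simp

lemma kap_fconst [simp]: "kap v (fconst c) = fconst c"
  by (simp add: fconst_def kap_single zero_word_def)

lemma kap_1 [simp]: "kap v 1 = 1"
  using kap_fconst[of v 1] by simp

lemma kap_mult [simp]: "kap v (f * g) = kap v f * kap v g"
proof (induction f rule: pm_induct)
  case (single w c)
  show ?case
  proof (induction g rule: pm_induct)
    case (single w' c')
    show ?case by (simp add: mult_single kap_single plus_word_def ip_add_right qpow_add mult_ac)
  qed (simp_all add: ring_distribs)
qed (simp_all add: ring_distribs)

lemma kap_gen [simp]: "kap v (gen j) = fconst (qpow (ip D v (sr j))) * gen j"
  by (simp add: gen_def kap_single fconst_def mult_single)

lemma fcst_kap [simp]: "fcst (kap v f) = fcst f"
  by (induction f rule: free_induct) (simp_all add: mult.assoc)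

lemma tau_fx: "tau D v * fx f = fx (kap v f) * tau D v"
  by (induction f rule: free_induct)
    (simp_all add: ring_distribs qscale_simps tau_gx mult.assoc flip: mult.assoc[of "tau D v" "gx D _"])

primrec dw :: "'n wt => 'n => 'n list => 'n free" where
  "dw v i [] = 0"
| "dw v i (j # ks) = (if i = j then single (Word ks) (qpow (ip D v (wtl ks))) else 0) + gen j * dw v i ks"

text \<open>The skew derivation with \<open>der v i (x\<^sub>i) = 1\<close>, twisted on the right by the automorphism \<open>kap v\<close>.\<close>

definition der :: "'n wt => 'n => 'n free => 'n free" where
  "der v i f = pmext (\<lambda>w c. fconst c * dw v i (letters w)) f"

lemma der_add [simp]: "der v i (f + g) = der v i f + der v i g"
  unfolding der_def by (rule pmext_add) (simp_all add: ring_distribs fconst_add)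

lemma der_0 [simp]: "der v i 0 = 0"
  by (simp add: der_def)

lemma der_single: "der v i (single w c) = fconst c * dw v i (letters w)"
  unfolding der_def by (rule pmext_single) simp

lemma der_scale [simp]: "der v i (fconst c * f) = fconst c * der v i f"
proof (induction f rule: pm_induct)
  case (single w d)
  have "fconst c * single w d = single w (c * d)" by (simp add: fconst_def mult_single)
  thus ?case by (simp add: der_single fconst_mult flip: mult.assoc)
qed (simp_all add: ring_distribs)

lemma der_minus [simp]: "der v i (- f) = - der v i f"
proof -
  have "- g = fconst (-1) * g" for g :: "'n free" using fconst_add[of "-1" 1]
    by (metis add.left_inverse eq_neg_iff_add_eq_0 fconst_0 fconst_1 mult_minus1)
  thus ?thesis by (metis der_scale)
qed

lemma der_diff [simp]: "der v i (f - g) = der v i f - der v i g"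
  using der_add[of v i f "- g"] by simp

lemma der_1 [simp]: "der v i 1 = 0"
proof -
  have "(1 :: 'n free) = single 0 1" by simp
  thus ?thesis by (metis der_single dw.simps(1) word.sel zero_word_def mult_zero_right)
qed

lemma der_fconst [simp]: "der v i (fconst c) = 0"
  using der_scale[of v i c 1] by simp

lemma der_gen_mult [simp]: "der v i (gen j * f) = (if i = j then kap v f else 0) + gen j * der v i f"
proof (induction f rule: pm_induct)
  case (single w c)
  have "gen j * single w c = single (Word (j # letters w)) c"
    by (simp add: gen_def mult_single plus_word_def)
  moreover have "fconst c * single w d = single w (c * d)" for d
    by (simp add: fconst_def mult_single)
  ultimately show ?case
    by (simp add: der_single kap_single ring_distribs fconst_left_commute mult.commute)
qed (simp_all add: ring_distribs)

lemma der_gen [simp]: "der v i (gen j) = (if i = j then 1 else 0)"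
  using der_gen_mult[of v i j 1] by simp

lemma der_mult: "der v i (f * g) = der v i f * kap v g + f * der v i g"
  by (induction f rule: free_induct) (simp_all add: ring_distribs mult.assoc)

lemma der_kap: "der v i (kap w f) = fconst (qpow (ip D w (sr i))) * kap w (der v i f)"
proof (induction f rule: free_induct)
  case (gen j f)
  have kk: "kap v (kap w f) = kap w (kap v f)" for f
    by (induction f rule: pm_induct) (simp_all add: kap_single mult.left_commute)
  show ?case by (simp add: mult.assoc kk gen ring_distribs fconst_left_commute)
qed (simp_all add: ring_distribs mult.assoc fconst_left_commute)

text \<open>Lets all derivations of one kind be moved past those of the other, at the cost of powers
  of q.\<close>

lemma der_commute:
  "der (- sr j) j (der (sr i) i f) = fconst (qpow (ip D (sr i) (sr j))) * der (sr i) i (der (- sr j) j f)"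
proof (induction f rule: free_induct)
  case (gen k f)
  show ?case
    using gen by (simp add: der_kap ring_distribs fconst_left_commute ip_comm[of "sr k" "sr i"] fconst_mult
        flip: mult.assoc qpow_add)
      (simp add: mult.assoc fconst_left_commute)
qed (simp_all add: ring_distribs mult.assoc fconst_left_commute)

text \<open>Derivations with different twists differ only by the automorphisms \<open>kap\<close>,
  which are invisible to the constant term.\<close>

lemma fcst_der: "fcst (der v i f) = fcst (der w i f)"
  by (induction f rule: free_induct) simp_all

text \<open>Each x_i met by y_i leaves a multiple of t_i - t_i^{-1} in its place; carrying these
  torus elements to the right end applies \<open>kap\<close> to the remaining letters, which is the
  twist in the two derivations.\<close>

lemma fx_gy: "fx f * gy D i = gy D i * fx f +
    (1 / qdiff i) *\<^sub>q (fx (der (sr i) i f) * tau D (sr i) - fx (der (- sr i) i f) * tau D (- sr i))"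
proof (induction f rule: free_induct)
  case (gen j f)
  have "fx (gen j * f) * gy D i = gx D j * (fx f * gy D i)" by (simp add: mult.assoc)
  also have "\<dots> = gx D j * gy D i * fx f + (1 / qdiff i) *\<^sub>q (gx D j * fx (der (sr i) i f) * tau D (sr i)
      - gx D j * fx (der (- sr i) i f) * tau D (- sr i))"
    unfolding gen by (simp add: ring_distribs qscale_simps mult.assoc)
  also have "gx D j * gy D i * fx f = gy D i * (gx D j * fx f) + (if i = j then (1 / qdiff i) *\<^sub>q
      (fx (kap (sr i) f) * tau D (sr i) - fx (kap (- sr i) f) * tau D (- sr i)) else 0)"
    unfolding gx_gy by (simp add: ring_distribs qscale_simps mult.assoc tau_fx)
  finally show ?case by (simp add: ring_distribs qscale_simps)
qed (simp_all add: ring_distribs qscale_simps mult.assoc)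

text \<open>The radical, described without the bilinear form.\<close>

abbreviation dop :: "bool \<times> 'n => 'n free => 'n free" where
  "dop o' \<equiv> der (if fst o' then sr (snd o') else - sr (snd o')) (snd o')"

primrec dops :: "(bool \<times> 'n) list => 'n free => 'n free" where
  "dops [] f = f"
| "dops (p # ps) f = dops ps (dop p f)"

text \<open>Taking all mixed products makes stability under both kinds of derivation immediate;
  \<open>fradI\<close> reduces membership to products of one kind.\<close>

definition frad :: "'n free set" where
  "frad = {f. \<forall>ps. fcst (dops ps f) = 0}"

lemma dops_linear [simp]: "dops ps (f + g) = dops ps f + dops ps g" "dops ps 0 = 0"
  "dops ps (f - g) = dops ps f - dops ps g" "dops ps (fconst c * f) = fconst c * dops ps f"
  by (induction ps arbitrary: f g) simp_all

lemma frad_fcst: "f \<in> frad ==> fcst f = 0"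
proof -
  assume "f \<in> frad"
  hence "fcst (dops [] f) = 0" unfolding frad_def by blast
  thus ?thesis by simp
qed

lemma frad_dop: "f \<in> frad ==> dop p f \<in> frad"
proof -
  assume f: "f \<in> frad"
  have "fcst (dops ps (dop p f)) = 0" for ps
  proof -
    have "fcst (dops (p # ps) f) = 0" using f unfolding frad_def by blast
    thus ?thesis by (simp only: dops.simps)
  qed
  thus "dop p f \<in> frad" unfolding frad_def by blast
qed

lemma frad_der: "f \<in> frad ==> der (sr i) i f \<in> frad" "f \<in> frad ==> der (- sr i) i f \<in> frad"
  using frad_dop[of f "(True, i)"] frad_dop[of f "(False, i)"] by simp_all

lemma frad_scale: "f \<in> frad ==> fconst c * f \<in> frad"
  and frad_diff: "f \<in> frad ==> g \<in> frad ==> f - g \<in> frad"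
  by (simp_all add: frad_def)

text \<open>In the twisted product rule both terms again have their left factor in the
  radical.\<close>

lemma frad_mult:
  assumes "f \<in> frad"
  shows "f * g \<in> frad"
proof -
  have "fcst (dops ps (f * g)) = 0" for ps
    using assms
  proof (induction ps arbitrary: f g)
    case Nil
    thus ?case using frad_fcst by (simp add: fcst_mult)
  next
    case (Cons p ps)
    thus ?case using frad_dop[OF Cons.prems, of p] by (simp add: der_mult)
  qed
  thus ?thesis by (simp add: frad_def)
qed

primrec bops :: "'n list => 'n free => 'n free" where
  "bops [] f = f"
| "bops (i # is) f = bops is (der (- sr i) i f)"

lemma bops_linear [simp]: "bops is (f + g) = bops is f + bops is g" "bops is 0 = 0"
  "bops is (f - g) = bops is f - bops is g" "bops is (fconst c * f) = fconst c * bops is f"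
  by (induction "is" arbitrary: f g) simp_all

lemma bops_snoc: "bops (is @ [i]) f = der (- sr i) i (bops is f)"
  by (induction "is" arbitrary: f) simp_all

text \<open>By \<open>der_commute\<close> a derivation of the other kind can be pushed to the end,
  where under the constant term it counts as one of the given kind.\<close>

lemma fradI:
  assumes "\<And>is. fcst (bops is f) = 0"
  shows "f \<in> frad"
proof -
  define K where "K = {f. \<forall>is. fcst (bops is f) = 0}"
  have com: "\<exists>c. bops is (der (sr i) i f) = fconst c * der (sr i) i (bops is f)" for "is" i f
  proof (induction "is" arbitrary: f)
    case Nil
    show ?case by (auto intro: exI[of _ 1])
  next
    case (Cons j js)
    obtain c where c: "bops js (der (sr i) i (der (- sr j) j f)) = fconst c * der (sr i) i (bops js (der (- sr j) j f))"
      using Cons by blast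
    show ?case by (auto simp: der_commute c fconst_mult simp flip: mult.assoc)
  qed
  have "dop p f \<in> K" if "f \<in> K" for p f
  proof (cases "fst p")
    case True
    have "fcst (bops is (der (sr (snd p)) (snd p) f)) = 0" for "is"
    proof -
      obtain c where c: "bops is (der (sr (snd p)) (snd p) f) = fconst c * der (sr (snd p)) (snd p) (bops is f)"
        using com by blast
      have "fcst (der (sr (snd p)) (snd p) (bops is f)) = fcst (bops (is @ [snd p]) f)"
        unfolding bops_snoc by (rule fcst_der)
      thus ?thesis using \<open>f \<in> K\<close> by (simp add: c K_def)
    qed
    thus ?thesis using True by (simp add: K_def)
  next
    case False
    have "fcst (bops (snd p # is) f) = 0" for "is" using \<open>f \<in> K\<close> unfolding K_def by blast
    thus ?thesis using False by (simp add: K_def)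
  qed
  hence "dops ps f \<in> K" if "f \<in> K" for ps f
    using that by (induction ps arbitrary: f) auto
  moreover have "f \<in> K" using assms by (simp add: K_def)
  ultimately have "dops ps f \<in> K" for ps by blast
  hence "fcst (bops [] (dops ps f)) = 0" for ps unfolding K_def by blast
  thus ?thesis by (simp add: frad_def)
qed

section \<open>Degree and weight gradings of the free algebra\<close>

definition fle :: "nat => 'n free set" where
  "fle n = {f. \<forall>w\<in>keys f. length (letters w) \<le> n}"

definition fge :: "nat => 'n free set" where
  "fge n = {f. \<forall>w\<in>keys f. length (letters w) \<ge> n}"

definition fproj :: "('n word => bool) => 'n free => 'n free" where
  "fproj Q f = pmext (\<lambda>w c. if Q w then single w c else 0) f"

lemma fproj_add: "fproj Q (f + g) = fproj Q f + fproj Q g"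
  unfolding fproj_def by (rule pmext_add) (simp_all add: single_add)

lemma fproj_single: "fproj Q (single w c) = (if Q w then single w c else 0)"
  unfolding fproj_def by (rule pmext_single) simp

lemma fproj_0 [simp]: "fproj Q 0 = 0"
  by (simp add: fproj_def)

lemma lookup_fproj: "lookup (fproj Q f) w = (if Q w then lookup f w else 0)"
  by (induction f rule: pm_induct) (simp_all add: fproj_add fproj_single lookup_add lookup_single when_def)

lemma keys_fproj: "keys (fproj Q f) = {w \<in> keys f. Q w}"
  by (auto simp: in_keys_iff lookup_fproj split: if_splits)

lemma dw_keys: "w \<in> keys (dw v i ks) ==> Suc (length (letters w)) = length ks \<and> sr i + wtl (letters w) = wtl ks"
proof (induction ks arbitrary: w)
  case (Cons j ks)
  have "keys (dw v i (j # ks)) \<subseteq>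
    keys (if i = j then single (Word ks) (qpow (ip D v (wtl ks))) else 0) \<union>
    keys (gen j * dw v i ks)"
    unfolding dw.simps(2) by (rule keys_add)
  then consider "i = j" "w = Word ks" | "w \<in> keys (gen j * dw v i ks)"
    using Cons.prems by (auto split: if_splits)
  thus ?case
  proof cases
    case 2
    then obtain w' where "w' \<in> keys (dw v i ks)" "w = Word [j] + w'"
      using keys_mult[of "gen j" "dw v i ks"] by (auto simp: gen_def)
    thus ?thesis using Cons.IH[of w'] by (simp add: plus_word_def algebra_simps)
  qed auto
qed simp

lemma der_keys:
  assumes "w \<in> keys (der v i f)"
  obtains w' where "w' \<in> keys f" "Suc (length (letters w)) = length (letters w')"
    "sr i + wtl (letters w) = wtl (letters w')"
proof -
  have "keys (der v i f) \<subseteq> (\<Union>w'\<in>keys f.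
      keys (fconst (lookup f w') * dw v i (letters w')))"
    unfolding der_def pmext_def by (rule keys_sum)
  then obtain w' where w': "w' \<in> keys f"
    "w \<in> keys (fconst (lookup f w') * dw v i (letters w'))" using assms by blast
  hence "w \<in> keys (dw v i (letters w'))"
    using keys_single_times unfolding fconst_def by blast
  thus ?thesis using w'(1) dw_keys that by blast
qed

lemma keys_0D: "f \<noteq> 0 ==> \<exists>w. w \<in> keys f"
  by (metis empty_iff keys_eq_empty equals0I)

lemma fle_der: "f \<in> fle (Suc n) ==> der v i f \<in> fle n"
  unfolding fle_def by (auto elim!: der_keys)

lemma fle_add: "f \<in> fle n ==> g \<in> fle n ==> f + g \<in> fle n" "f \<in> fle n ==> g \<in> fle n ==> f - g \<in> fle n"
  unfolding fle_def using keys_add[of f g] keys_add[of f "- g"] by (auto simp: keys_def)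

lemma fle_mult: "f \<in> fle n ==> g \<in> fle m ==> f * g \<in> fle (n + m)"
  unfolding fle_def using keys_mult[of f g] by (force simp: plus_word_def)

lemma fge_der: "f \<in> fge (Suc n) ==> der v i f \<in> fge n"
  unfolding fge_def by (auto elim!: der_keys)

lemma fge_fcst: "f \<in> fge (Suc n) ==> fcst f = 0"
  unfolding fge_def fcst_def by (force simp: zero_word_def in_keys_iff)

lemma bops_fge: "f \<in> fge n ==> length is < n ==> fcst (bops is f) = 0"
proof (induction "is" arbitrary: f n)
  case Nil
  thus ?case using fge_fcst by (cases n) auto
next
  case (Cons i "is")
  then obtain m where "n = Suc m" by (cases n) auto
  thus ?case using Cons fge_der[of f m] by auto
qed

lemma fle_0: "f \<in> fle 0 ==> f = fconst (fcst f)"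
proof (rule poly_mapping_eqI)
  fix w assume "f \<in> fle 0"
  thus "lookup f w = lookup (fconst (fcst f)) w"
    unfolding fle_def fconst_def fcst_def by (cases w) (force simp: lookup_single when_def zero_word_def in_keys_iff)
qed

lemma bops_fle: "f \<in> fle n ==> length is > n ==> bops is f = 0"
proof (induction "is" arbitrary: f n)
  case (Cons i "is")
  show ?case
  proof (cases n)
    case 0
    hence "f = fconst (fcst f)" using Cons.prems fle_0 by simp
    hence "der (- sr i) i f = 0" by (metis der_fconst)
    thus ?thesis by simp
  next
    case (Suc m)
    thus ?thesis using Cons.IH[of "der (- sr i) i f" m] Cons.prems fle_der[of f m] by simp
  qed
qed simp

text \<open>Each derivation lowers the weight by its simple root, and only weight 0 has a constant
  term.\<close>

lemma dops_weight:
  assumes "\<And>w. w \<in> keys f ==> wtl (letters w) = \<beta>" "\<beta> \<noteq> (\<Sum>p\<leftarrow>ps. sr (snd p))"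
  shows "fcst (dops ps f) = 0"
  using assms
proof (induction ps arbitrary: f \<beta>)
  case Nil
  thus ?case by (force simp: fcst_def zero_word_def in_keys_iff)
next
  case (Cons p ps)
  have "wtl (letters w) = \<beta> - sr (snd p)" if w: "w \<in> keys (dop p f)" for w
    using w Cons.prems(1) by (elim der_keys) (metis add_diff_cancel_left')
  from Cons.IH[OF this] show ?case using Cons.prems(2) by (auto simp: algebra_simps)
qed

text \<open>A product of derivations sees only the component whose weight is the sum of its simple
  roots, so the radical is graded.\<close>

lemma frad_fproj:
  assumes "f \<in> frad"
  shows "fproj (\<lambda>w. wtl (letters w) = \<beta>) f \<in> frad"
proof -
  have "fcst (dops ps (fproj (\<lambda>w. wtl (letters w) = \<beta>) f)) = 0" for ps
  proof (cases "\<beta> = (\<Sum>p\<leftarrow>ps. sr (snd p))")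
    case False
    thus ?thesis by (intro dops_weight) (auto simp: keys_fproj)
  next
    case True
    have "fcst (dops ps f') = fcst (dops ps (fproj (\<lambda>w. wtl (letters w) = \<beta>) f'))" for f'
    proof (induction f' rule: pm_induct)
      case (single w c)
      show ?case
      proof (cases "wtl (letters w) = \<beta>")
        case False
        have "fcst (dops ps (single w c)) = 0"
          by (rule dops_weight[of _ "wtl (letters w)"]) (use False True in \<open>auto split: if_splits\<close>)
        thus ?thesis using False by (simp add: fproj_single)
      qed (simp add: fproj_single)
    qed (simp_all add: fproj_add)
    from this[of f] show ?thesis using assms unfolding frad_def by simp
  qed
  thus ?thesis by (simp add: frad_def)
qed

lemma fproj_sum: "f = (\<Sum>\<beta>\<in>(\<lambda>w. wtl (letters w)) ` keys f. fproj (\<lambda>w. wtl (letters w) = \<beta>) f)"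
proof (rule poly_mapping_eqI)
  fix w
  have "(\<Sum>\<beta>\<in>(\<lambda>w. wtl (letters w)) ` keys f. if wtl (letters w) = \<beta> then lookup f w else 0)
      = lookup f w"
    by (auto simp: sum.delta' in_keys_iff)
  thus "lookup f w = lookup
     (\<Sum>\<beta>\<in>(\<lambda>w. wtl (letters w)) ` keys f. fproj (\<lambda>w. wtl (letters w) = \<beta>) f) w"
    by (simp add: lookup_sum lookup_fproj)
qed

lemma fx_uwt:
  assumes "\<And>w. w \<in> keys f ==> wtl (letters w) = \<beta>"
  shows "fx f \<in> uwt \<beta>"
proof -
  have "f = (\<Sum>w\<in>keys f. single (Word (letters w)) (lookup f w))"
    by (simp add: pm_sum_singles)
  hence "fx f = (\<Sum>w\<in>keys f. lookup f w *\<^sub>q xword (letters w))"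
    by (metis (no_types, lifting) fx_single fx_sum sum.cong)
  also have "\<dots> \<in> uwt \<beta>"
    using xword_uwt assms by (intro cv.subspace_sum[OF uwt_subspace] cv.subspace_scale[OF uwt_subspace]) metis
  finally show ?thesis .
qed

end

section \<open>Nondegeneracy\<close>

lemma fconst_pull: "h * (fconst c * g) = fconst c * (h * g)" for g h :: "'x free"
proof -
  have "h * (fconst c * g) = (h * fconst c) * g" by (simp only: mult.assoc)
  thus ?thesis by (simp only: fconst_commute[of h] mult.assoc)
qed

lemma funpow_commute: "(f ^^ m) ((f ^^ n) x) = (f ^^ n) ((f ^^ m) x)"
  by (induction m) (simp_all add: funpow_swap1)

text \<open>The numerator of a quantum integer, at a rational argument.\<close>

definition br :: "rat => cc" where "br r = qpow r - qpow (- r)"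

lemma br_eq_0_iff [simp]: "br r = 0 \<longleftrightarrow> r = 0"
  by (simp add: br_def qpow_eq_iff)

lemma br_0 [simp]: "br 0 = 0"
  by simp

lemma br_mult: "br a * br b = (qpow (a + b) + qpow (- a - b)) - (qpow (a - b) + qpow (b - a))"
  by (simp add: br_def ring_distribs flip: qpow_add)

lemma br_add: "br (a + b) = qpow (- a) * br b + qpow b * br a"
  by (simp add: br_def ring_distribs algebra_simps flip: qpow_add)

text \<open>The q-analogue of an arithmetic series, with the denominator \<open>br d\<close> moved
  to the other side. It evaluates the sl2-coefficients, whose nonvanishing can be read off the two
  factors.\<close>

lemma br_sum: "(\<Sum>l<n. br (s + of_nat l * (2 * d))) * br d = br (of_nat n * d) * br (s + (of_nat n - 1) * d)"
proof (induction n)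
  case (Suc n)
  have "(\<Sum>l<Suc n. br (s + of_nat l * (2 * d))) * br d
      = br (of_nat n * d) * br (s + (of_nat n - 1) * d) + br (s + of_nat n * (2 * d)) * br d"
    by (simp add: ring_distribs(2) Suc)
  also have "\<dots> = br (of_nat (Suc n) * d) * br (s + (of_nat (Suc n) - 1) * d)"
  proof -
    let ?n = "of_nat n :: rat"
    have "?n * d + (s + (?n - 1) * d) = s + ?n * (2 * d) - d" "- (?n * d) - (s + (?n - 1) * d) = d - (s + ?n * (2 * d))"
      "?n * d - (s + (?n - 1) * d) = d - s" "s + (?n - 1) * d - ?n * d = s - d"
      "of_nat (Suc n) * d + (s + (of_nat (Suc n) - 1) * d) = s + ?n * (2 * d) + d"
      "- (of_nat (Suc n) * d) - (s + (of_nat (Suc n) - 1) * d) = - (s + ?n * (2 * d)) - d"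
      "of_nat (Suc n) * d - (s + (of_nat (Suc n) - 1) * d) = d - s"
      "s + (of_nat (Suc n) - 1) * d - of_nat (Suc n) * d = s - d"
      by (simp_all add: algebra_simps)
    thus ?thesis by (simp only: br_mult) simp
  qed
  finally show ?case .
qed simp

context qgroup begin

declare half_len_pos [simp]

abbreviation dl :: "'n => rat" where "dl i \<equiv> of_nat (half_len D i)"

lemma dl_pos [simp]: "dl i > 0" "dl i \<noteq> 0"
  using half_len_pos[of i] by simp_all

lemma ip_sr_self: "ip D (sr i) (sr i) = 2 * dl i"
  by (simp add: ip_sr_sr cart_diag)

lemma qroot_power: "qroot D i ^ m = qpow (of_nat m * dl i)" "inverse (qroot D i) ^ m = qpow (- (of_nat m * dl i))"
  by (simp_all add: qroot_def qpow_power power_inverse qpow_minus)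

lemma qdiff_br: "qdiff i = br (dl i)"
  by (simp add: qdiff_def br_def qroot_def qpow_minus)

lemma qint_br: "qint (qroot D i) m = br (of_nat m * dl i) / br (dl i)"
  by (simp add: qint_def qroot_power br_def qdiff_def[symmetric] qdiff_br)

lemma qfact_0 [simp]: "qfact v 0 = 1" and qfact_Suc: "qfact v (Suc m) = qfact v m * qint v (Suc m)"
  by (simp_all add: qfact_def)

lemma qfact_nonzero [simp]: "qfact (qroot D i) m \<noteq> 0"
  by (induction m) (simp_all add: qfact_Suc qint_br)

lemma q_pascal:
  assumes "m < n"
  shows "qbinom (qroot D i) (Suc n) (Suc m) = qpow (- (of_nat (Suc m) * dl i)) * qbinom (qroot D i) n (Suc m)
    + qpow (of_nat (n - m) * dl i) * qbinom (qroot D i) n m"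
proof -
  define v where "v = qroot D i"
  obtain k where n: "n = Suc (m + k)" using assms less_imp_Suc_add by blast
  let ?A = "qfact v (Suc m)" and ?B = "qfact v (Suc k)"
  have nz: "?A \<noteq> 0" "?B \<noteq> 0" "qfact v m \<noteq> 0" "qfact v k \<noteq> 0" "qint v (Suc m) \<noteq> 0" "qint v (Suc k) \<noteq> 0"
    unfolding v_def qint_br by (simp_all del: qfact_Suc)
  have id: "qint v (Suc n) = qpow (- (of_nat (Suc m) * dl i)) * qint v (Suc k)
      + qpow (of_nat (n - m) * dl i) * qint v (Suc m)"
  proof -
    have "of_nat (Suc n) * dl i = of_nat (Suc m) * dl i + of_nat (Suc k) * dl i" "n - m = Suc k"
      by (simp_all add: n algebra_simps)
    thus ?thesis unfolding v_def qint_br by (simp only: br_add) (simp add: add_divide_distrib)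
  qed
  have "qbinom v (Suc n) (Suc m) = qfact v n * qint v (Suc n) / (?A * ?B)"
    by (simp add: qbinom_def n qfact_Suc)
  also have "\<dots> = qpow (- (of_nat (Suc m) * dl i)) * (qfact v n * qint v (Suc k) / (?A * ?B))
      + qpow (of_nat (n - m) * dl i) * (qfact v n * qint v (Suc m) / (?A * ?B))"
    unfolding id by (simp add: ring_distribs add_divide_distrib mult_ac)
  also have "qfact v n * qint v (Suc k) / (?A * ?B) = qbinom v n (Suc m)"
    using nz by (simp add: qbinom_def n qfact_Suc)
  also have "qfact v n * qint v (Suc m) / (?A * ?B) = qbinom v n m"
    using nz by (simp add: qbinom_def n qfact_Suc Suc_diff_le)
  finally show ?thesis by (simp add: v_def)
qed

text \<open>The coefficients of (ad x_i)^n x_j up to sign, given by the recursion that one more ad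
  x_i produces; the power of q is the factor by which conjugation with t_i acts on the current
  weight.\<close>

fun qbe :: "'n => 'n => nat => nat => cc" where
  "qbe i j 0 m = (if m = 0 then 1 else 0)"
| "qbe i j (Suc n) 0 = 1"
| "qbe i j (Suc n) (Suc m) = qbe i j n (Suc m) + qpow (ip D (sr i) (sr j) + of_nat n * (2 * dl i)) * qbe i j n m"

lemma qbe_outside: "m > n ==> qbe i j n m = 0"
  by (induction i j n m rule: qbe.induct) auto

lemma qbe_0 [simp]: "qbe i j n 0 = 1"
  by (cases n) auto

text \<open>Both sides satisfy the same Pascal recursion. For n = 1 - a_ij the exponent of q
  vanishes, which identifies the quantum Serre relation with (ad x_i)^n x_j = 0.\<close>

lemma qbe_qbinom:
  "m \<le> n ==> qbe i j n m = qpow (of_nat m * ((of_nat n - 1) * dl i + ip D (sr i) (sr j))) * qbinom (qroot D i) n m"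
proof (induction n arbitrary: m)
  case 0
  thus ?case by (simp add: qbinom_def)
next
  case (Suc n)
  show ?case
  proof (cases m)
    case 0
    thus ?thesis by (simp add: qbinom_def)
  next
    case (Suc k)
    show ?thesis
    proof (cases "k < n")
      case True
      let ?s = "ip D (sr i) (sr j)"
      define Q where "Q = qpow (of_nat (Suc k) * ((of_nat (Suc n) - 1) * dl i + ?s))"
      have e1: "Q * qpow (- (of_nat (Suc k) * dl i)) = qpow (of_nat (Suc k) * ((of_nat n - 1) * dl i + ?s))"
        unfolding Q_def by (simp add: algebra_simps flip: qpow_add)
      have e2: "Q * qpow (of_nat (n - k) * dl i)
          = qpow (?s + of_nat n * (2 * dl i)) * qpow (of_nat k * ((of_nat n - 1) * dl i + ?s))"
        unfolding Q_def using True by (simp add: of_nat_diff algebra_simps flip: qpow_add)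
      have "qbe i j (Suc n) (Suc k) = Q * qpow (- (of_nat (Suc k) * dl i)) * qbinom (qroot D i) n (Suc k)
          + Q * qpow (of_nat (n - k) * dl i) * qbinom (qroot D i) n k"
        unfolding e1 e2 using Suc.IH[of "Suc k"] Suc.IH[of k] True by (simp add: mult.assoc)
      also have "\<dots> = Q * qbinom (qroot D i) (Suc n) (Suc k)"
        unfolding q_pascal[OF True] by (simp only: distrib_left mult.assoc)
      finally show ?thesis by (simp add: \<open>m = Suc k\<close> Q_def)
    next
      case False
      hence k: "k = n" using Suc.prems \<open>m = Suc k\<close> by simp
      have "qbinom (qroot D i) l l = 1" for l by (simp add: qbinom_def)
      thus ?thesis using Suc.IH[of n]
        by (simp add: \<open>m = Suc k\<close> k qbe_outside algebra_simps flip: qpow_add)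
    qed
  qed
qed

lemma gx_power_uwt: "gx D i ^ k \<in> uwt (rscale (of_nat k) (sr i))"
proof (induction k)
  case (Suc k)
  thus ?case using uwt_mult[OF uwt_gens(1)[of i] Suc] by (simp add: rscale_distribs)
qed (simp add: uwt_gens)

lemma uwt_tau: "u \<in> uwt \<beta> ==> \<gamma> \<in> Qpi ==> tau D \<gamma> * u = qpow (ip D \<gamma> \<beta>) *\<^sub>q (u * tau D \<gamma>)"
proof -
  assume "u \<in> uwt \<beta>" "\<gamma> \<in> Qpi"
  hence "tau D \<gamma> * u * tau D (- \<gamma>) * tau D \<gamma> = (qpow (ip D \<gamma> \<beta>) *\<^sub>q u) * tau D \<gamma>"
    by (simp add: uwt_def)
  thus ?thesis by (simp add: mult.assoc tau_add qscale_mult_left)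
qed

lemma ad_gx_uwt: "u \<in> uwt \<beta> ==> ad (gx D i) u = gx D i * u - qpow (ip D (sr i) \<beta>) *\<^sub>q (u * gx D i)"
  by (simp add: ad_gx uwt_def qscale_mult_left)

lemma ad_gx_in_uwt: "u \<in> uwt \<beta> ==> ad (gx D i) u \<in> uwt (sr i + \<beta>)"
  unfolding ad_gx_uwt using uwt_mult[OF uwt_gens(1)[of i], of u \<beta>] uwt_mult[OF _ uwt_gens(1)[of i], of u \<beta>]
  by (auto simp: add.commute intro!: cv.subspace_diff[OF uwt_subspace] cv.subspace_scale[OF uwt_subspace])

lemma ad_0 [simp]: "ad a 0 = 0"
  using ad_scale_right[of a 0 0] by simp

lemma ad_sum: "ad a (sum f I) = (\<Sum>i\<in>I. ad a (f i))"
  by (induction I rule: infinite_finite_induct) (simp_all add: ad_add_right)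

lemma ad_gx_power:
  "(ad (gx D i) ^^ n) (gx D j) = (\<Sum>m\<le>n. ((-1) ^ m * qbe i j n m) *\<^sub>q (gx D i ^ (n - m) * gx D j * gx D i ^ m))"
proof (induction n)
  case (Suc n)
  let ?x = "gx D i" and ?s = "ip D (sr i) (sr j)"
  let ?F = "qpow (?s + of_nat n * (2 * dl i))"
  let ?T = "\<lambda>n m. gx D i ^ (n - m) * gx D j * gx D i ^ m"
  have step: "ad ?x (?T n m) = ?T (Suc n) m - ?F *\<^sub>q ?T (Suc n) (Suc m)" if "m \<le> n" for m
  proof -
    let ?\<beta> = "rscale (of_nat (n - m)) (sr i) + sr j + rscale (of_nat m) (sr i)"
    have "?T n m \<in> uwt ?\<beta>" by (intro uwt_mult gx_power_uwt uwt_gens)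
    moreover have "ip D (sr i) ?\<beta> = ?s + of_nat n * (2 * dl i)"
      using that by (simp add: ip_add_right ip_sr_self of_nat_diff algebra_simps)
    ultimately show ?thesis
      using that by (simp add: ad_gx_uwt Suc_diff_le mult.assoc power_commutes)
  qed
  have "(ad ?x ^^ Suc n) (gx D j) = (\<Sum>m\<le>n. ((-1) ^ m * qbe i j n m) *\<^sub>q (?T (Suc n) m - ?F *\<^sub>q ?T (Suc n) (Suc m)))"
    by (simp add: Suc ad_sum ad_scale_right step)
  also have "\<dots> = (\<Sum>m\<le>n. ((-1) ^ m * qbe i j n m) *\<^sub>q ?T (Suc n) m)
      + (\<Sum>m\<le>n. ((-1) ^ Suc m * (?F * qbe i j n m)) *\<^sub>q ?T (Suc n) (Suc m))"
    by (simp add: qscale_simps sum_subtractf sum_negf mult_ac)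
  also have "(\<Sum>m\<le>n. ((-1) ^ m * qbe i j n m) *\<^sub>q ?T (Suc n) m) = (\<Sum>m\<le>Suc n. ((-1) ^ m * qbe i j n m) *\<^sub>q ?T (Suc n) m)"
    by (simp add: qbe_outside)
  also have "\<dots> = ?T (Suc n) 0 + (\<Sum>m\<le>n. ((-1) ^ Suc m * qbe i j n (Suc m)) *\<^sub>q ?T (Suc n) (Suc m))"
    by (subst sum.atMost_Suc_shift) (simp add: qscale_one)
  finally have "(ad ?x ^^ Suc n) (gx D j) = ?T (Suc n) 0 + ((\<Sum>m\<le>n. ((-1) ^ Suc m * qbe i j n (Suc m)) *\<^sub>q ?T (Suc n) (Suc m))
      + (\<Sum>m\<le>n. ((-1) ^ Suc m * (?F * qbe i j n m)) *\<^sub>q ?T (Suc n) (Suc m)))"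
    by (simp only: add.assoc)
  also have "\<dots> = ?T (Suc n) 0 + (\<Sum>m\<le>n. ((-1) ^ Suc m * qbe i j (Suc n) (Suc m)) *\<^sub>q ?T (Suc n) (Suc m))"
    by (simp only: sum.distrib[symmetric] qscale_add_left[symmetric] qbe.simps ring_distribs)
  also have "\<dots> = (\<Sum>m\<le>Suc n. ((-1) ^ m * qbe i j (Suc n) m) *\<^sub>q ?T (Suc n) m)"
    by (subst sum.atMost_Suc_shift) (simp add: qscale_one)
  finally show ?case .
qed (simp add: qscale_one)

lemma ad_serre:
  assumes "i \<noteq> j"
  shows "(ad (gx D i) ^^ nat (1 - cart D i j)) (gx D j) = 0"
proof -
  define N where "N = nat (1 - cart D i j)"
  have "rat_of_nat N = of_int (int N)" by simp
  also have "int N = 1 - cart D i j" using cart_nonpos[OF assms] by (simp add: N_def)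
  finally have N: "rat_of_nat N = 1 - of_int (cart D i j)" by simp
  have "(rat_of_nat N - 1) * dl i + ip D (sr i) (sr j) = 0"
    unfolding N by (simp add: ip_sr_sr algebra_simps)
  hence "qbe i j N m = qbinom (qroot D i) N m" if "m \<le> N" for m
    using qbe_qbinom[OF that, of i j] by simp
  thus ?thesis using serre_gx[OF assms] unfolding N_def[symmetric] ad_gx_power by simp
qed

section \<open>Local nilpotence under ad x_i\<close>

definition adnil :: "'n => 'u set" where "adnil i = {u. \<exists>N. (ad (gx D i) ^^ N) u = 0}"

lemma ad_funpow_0 [simp]: "(ad a ^^ n) 0 = 0"
  by (induction n) simp_all

lemma ad_funpow_mono: "(ad a ^^ n) u = 0 ==> n \<le> m ==> (ad a ^^ m) u = 0"
proof -
  assume "(ad a ^^ n) u = 0" "n \<le> m"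
  moreover from this have "(ad a ^^ m) u = (ad a ^^ (m - n)) ((ad a ^^ n) u)"
    by (metis comp_apply funpow_add le_add_diff_inverse2)
  ultimately show ?thesis by simp
qed

lemma ad_funpow_linear: "(ad a ^^ n) (u + v) = (ad a ^^ n) u + (ad a ^^ n) v"
  "(ad a ^^ n) (c *\<^sub>q u) = c *\<^sub>q (ad a ^^ n) u"
  by (induction n) (simp_all add: ad_add_right ad_scale_right)

lemma adnil_add: "u \<in> adnil i ==> v \<in> adnil i ==> u + v \<in> adnil i"
proof -
  assume "u \<in> adnil i" "v \<in> adnil i"
  then obtain n m where "(ad (gx D i) ^^ n) u = 0" "(ad (gx D i) ^^ m) v = 0" by (auto simp: adnil_def)
  hence "(ad (gx D i) ^^ max n m) (u + v) = 0"
    using ad_funpow_mono[of n _ u "max n m"] ad_funpow_mono[of m _ v "max n m"] by (simp add: ad_funpow_linear)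
  thus ?thesis by (auto simp: adnil_def)
qed

text \<open>ad x_i is a skew derivation whose twist, conjugation by t_i, commutes with it up to a
  scalar and so preserves the order of nilpotence; the rest is induction on the sum of the two
  orders.\<close>

lemma adnil_mult:
  assumes "u \<in> adnil i" "v \<in> adnil i"
  shows "u * v \<in> adnil i"
proof -
  let ?X = "ad (gx D i)" and ?t = "tau D (sr i)" and ?t' = "tau D (- sr i)"
  have XK: "?X (?t * a * ?t') = qpow (- 2 * dl i) *\<^sub>q (?t * ?X a * ?t')" for a
  proof -
    have e1: "gx D i * ?t = qpow (- 2 * dl i) *\<^sub>q (?t * gx D i)"
      and e2: "?t' * gx D i = qpow (- 2 * dl i) *\<^sub>q (gx D i * ?t')"
      by (simp_all add: tau_gx qscale_simps ip_sr_self flip: qpow_add)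
    have "gx D i * (?t * a * ?t') = gx D i * ?t * (a * ?t')" by (simp only: mult.assoc)
    hence 1: "gx D i * (?t * a * ?t') = qpow (- 2 * dl i) *\<^sub>q (?t * (gx D i * a) * ?t')"
      by (simp only: e1 qscale_mult_left mult.assoc)
    have "?t * (?t * a * ?t') * ?t' * gx D i = ?t * (?t * a * ?t') * (?t' * gx D i)" by (simp only: mult.assoc)
    also have "\<dots> = qpow (- 2 * dl i) *\<^sub>q (?t * (?t * a * ?t') * (gx D i * ?t'))"
      by (simp only: e2 qscale_mult_right)
    finally have 2: "?t * (?t * a * ?t') * ?t' * gx D i = qpow (- 2 * dl i) *\<^sub>q (?t * (?t * a * ?t' * gx D i) * ?t')"
      by (simp only: mult.assoc)
    show ?thesis unfolding ad_gx 1 2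
      by (simp only: right_diff_distrib left_diff_distrib qscale_diff)
  qed
  have KX: "(?X ^^ p) (?t * a * ?t') = 0" if "(?X ^^ p) a = 0" for p a
  proof -
    have "\<exists>c. (?X ^^ p) (?t * a * ?t') = c *\<^sub>q (?t * (?X ^^ p) a * ?t')" for p
    proof (induction p)
      case 0
      show ?case by (auto intro: exI[of _ 1] simp: qscale_one)
    next
      case (Suc p)
      then obtain c where "(?X ^^ p) (?t * a * ?t') = c *\<^sub>q (?t * (?X ^^ p) a * ?t')" by blast
      thus ?case by (auto simp: ad_scale_right XK qscale_qscale)
    qed
    then obtain c where "(?X ^^ p) (?t * a * ?t') = c *\<^sub>q (?t * (?X ^^ p) a * ?t')" by blast
    thus ?thesis using that by simp
  qed
  have Leib: "?X (a * b) = ?X a * b + (?t * a * ?t') * ?X b" for a b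
  proof -
    have "?t * (a * b) * ?t' = (?t * a * ?t') * (?t * b * ?t')" by (simp add: mult.assoc tau_add_left)
    moreover have "?t * a * ?t' * (?t * b * ?t') * gx D i = (?t * a * ?t') * (?t * b * ?t' * gx D i)"
      by (simp add: mult.assoc)
    ultimately show ?thesis by (simp add: ad_gx ring_distribs mult.assoc[of _ "gx D i" b])
      (simp add: mult.assoc)
  qed
  have "(?X ^^ (p + q)) (a * b) = 0" if "(?X ^^ p) a = 0" "(?X ^^ q) b = 0" for p q a b
    using that
  proof (induction "p + q" arbitrary: p q a b)
    case (Suc n)
    show ?case
    proof (cases "p = 0 \<or> q = 0")
      case False
      then obtain p' q' where pq: "p = Suc p'" "q = Suc q'" by (metis not0_implies_Suc)
      have "(?X ^^ (p' + q)) (?X a * b) = 0"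
        using Suc.prems by (intro Suc.hyps(1)) (use Suc.hyps(2) pq in \<open>auto simp: funpow_swap1\<close>)
      moreover have "(?X ^^ (p + q')) ((?t * a * ?t') * ?X b) = 0"
        using Suc.prems by (intro Suc.hyps(1) KX) (use Suc.hyps(2) pq in \<open>auto simp: funpow_swap1\<close>)
      moreover have "(?X ^^ (p + q)) (a * b) = (?X ^^ (p' + q)) (?X (a * b))" by (simp add: pq funpow_swap1)
      ultimately show ?thesis unfolding Leib ad_funpow_linear by (simp add: pq)
    qed (use Suc.prems in auto)
  qed simp
  thus ?thesis using assms unfolding adnil_def by blast
qed

text \<open>u behaves as a lowest weight vector: commuting w_k = (ad x_i)^k u with y_i returns
  \<open>E k\<close> times w_(k-1) t_i^{-1}. If (\<beta>,\<alpha>_i) were positive, all these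
  factors for k > 0 would be nonzero, hence all w_k, against local nilpotence.\<close>

lemma ad_lowest_weight:
  assumes u: "u \<in> uwt \<beta>" "u * gy D i = gy D i * u" "u \<in> adnil i" "u \<noteq> 0"
  shows "ip D \<beta> (sr i) \<le> 0"
proof (rule ccontr)
  assume "\<not> ip D \<beta> (sr i) \<le> 0"
  define s where "s = ip D (sr i) \<beta>"
  have s: "s > 0" using \<open>\<not> ip D \<beta> (sr i) \<le> 0\<close> by (simp add: s_def ip_comm)
  let ?x = "gx D i" and ?y = "gy D i" and ?t = "tau D (sr i)" and ?t' = "tau D (- sr i)"
  define w where "w k = (ad ?x ^^ k) u" for k
  have w0: "w 0 = u" and wS: "w (Suc k) = ad ?x (w k)" for k by (simp_all add: w_def)
  have ww: "w k \<in> uwt (\<beta> + rscale (of_nat k) (sr i))" for k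
  proof (induction k)
    case (Suc k)
    thus ?case using ad_gx_in_uwt[OF Suc, of i] by (simp add: wS rscale_distribs add_ac)
  qed (simp add: w0 u)
  define c where "c k = qpow (s + of_nat k * (2 * dl i))" for k
  have cw: "ip D (sr i) (\<beta> + rscale (of_nat k) (sr i)) = s + of_nat k * (2 * dl i)" for k
    by (simp add: ip_add_right s_def ip_sr_self)
  have wS': "w (Suc k) = ?x * w k - c k *\<^sub>q (w k * ?x)" for k
    unfolding wS ad_gx_uwt[OF ww] cw c_def ..
  have tw: "?t * w k = c k *\<^sub>q (w k * ?t)" for k
    using uwt_tau[OF ww, of "sr i" k] by (simp add: cw c_def)
  have tw': "?t' * w k = inverse (c k) *\<^sub>q (w k * ?t')" for k
    using uwt_tau[OF ww, of "- sr i" k] by (simp add: cw c_def flip: qpow_minus)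
  have yx: "?y * ?x = ?x * ?y - (1 / qdiff i) *\<^sub>q (?t - ?t')"
    by (simp add: gx_gy)
  \<comment> \<open>The l-th summand comes from moving t_i - t_i^{-1} across w_l, whose weight pairs
    with \<alpha>_i to s + 2 l d_i, with d_i = (\<alpha>_i,\<alpha>_i)/2.\<close>
  define E where "E k = - (\<Sum>l<k. br (s + of_nat l * (2 * dl i))) / qdiff i" for k
  have "?y * w k = w k * ?y + E k *\<^sub>q (if k = 0 then 0 else w (k - 1) * ?t')" for k
  proof (induction k)
    case 0
    show ?case using u(2) by (simp add: w0)
  next
    case (Suc k)
    define b where "b = w k"
    define b' where "b' = (if k = 0 then 0 else w (k - 1) * ?t')"
    have ES: "E (Suc k) = E k - br (s + of_nat k * (2 * dl i)) / qdiff i"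
      by (simp add: E_def diff_divide_distrib)
    have IH: "?y * b = b * ?y + E k *\<^sub>q b'" using Suc by (simp add: b_def b'_def)
    have b'x: "E k *\<^sub>q (?x * b') - (E k * c k) *\<^sub>q (b' * ?x) = E k *\<^sub>q (b * ?t')"
    proof (cases k)
      case 0
      thus ?thesis by (simp add: E_def)
    next
      case (Suc l)
      have "?t' * ?x = qpow (- 2 * dl i) *\<^sub>q (?x * ?t')" by (simp add: tau_gx ip_sr_self)
      moreover have "c (Suc l) * qpow (- 2 * dl i) = c l" by (simp add: c_def algebra_simps flip: qpow_add)
      ultimately have "c (Suc l) *\<^sub>q (w l * ?t' * ?x) = c l *\<^sub>q (w l * ?x * ?t')"
        by (simp add: mult.assoc qscale_mult_right qscale_qscale)
      hence "?x * (w l * ?t') - c (Suc l) *\<^sub>q (w l * ?t' * ?x) = w (Suc l) * ?t'"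
        by (simp add: wS' ring_distribs mult.assoc qscale_mult_left)
      moreover have "E k *\<^sub>q (?x * b') - (E k * c k) *\<^sub>q (b' * ?x) = E k *\<^sub>q (?x * b' - c k *\<^sub>q (b' * ?x))"
        by (simp only: qscale_diff(1) qscale_qscale)
      ultimately show ?thesis using Suc by (simp add: b_def b'_def)
    qed
    have "?y * w (Suc k) = ?y * ?x * b - c k *\<^sub>q (?y * b * ?x)"
      by (simp add: wS' b_def ring_distribs qscale_mult_right mult.assoc)
    also have "?y * ?x * b = ?x * (?y * b) - (1 / qdiff i) *\<^sub>q (?t * b - ?t' * b)"
      unfolding yx by (simp add: ring_distribs qscale_mult_left mult.assoc)
    also have "?y * b * ?x = b * (?y * ?x) + E k *\<^sub>q (b' * ?x)"
      unfolding IH by (simp add: ring_distribs qscale_mult_left mult.assoc)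
    also have "?x * (?y * b) - (1 / qdiff i) *\<^sub>q (?t * b - ?t' * b) - c k *\<^sub>q (b * (?y * ?x) + E k *\<^sub>q (b' * ?x))
      = (?x * b - c k *\<^sub>q (b * ?x)) * ?y + (E k *\<^sub>q (?x * b') - (E k * c k) *\<^sub>q (b' * ?x))
        - (1 / qdiff i) *\<^sub>q (?t * b - ?t' * b - c k *\<^sub>q (b * ?t) + c k *\<^sub>q (b * ?t'))"
      unfolding IH yx by (simp add: ring_distribs qscale_simps mult.assoc mult.commute[of "c k"])
    also have "?t * b - ?t' * b - c k *\<^sub>q (b * ?t) + c k *\<^sub>q (b * ?t') = br (s + of_nat k * (2 * dl i)) *\<^sub>q (b * ?t')"
    proof -
      have "br (s + of_nat k * (2 * dl i)) = c k - inverse (c k)" by (simp only: br_def c_def qpow_minus)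
      thus ?thesis unfolding b_def tw tw' by (simp add: qscale_diff)
    qed
    also have "?x * b - c k *\<^sub>q (b * ?x) = w (Suc k)" by (simp add: wS' b_def)
    also note b'x
    finally show ?case by (simp add: ES b_def qscale_simps)
  qed
  note main = this
  obtain N where "w N = 0" using u(3) by (auto simp: adnil_def w_def)
  moreover have "w k \<noteq> 0" for k
  proof (induction k)
    case (Suc k)
    show ?case
    proof
      assume "w (Suc k) = 0"
      hence "E (Suc k) *\<^sub>q (w k * ?t') = 0" using main[of "Suc k"] by simp
      moreover have "E (Suc k) \<noteq> 0"
      proof -
        have "s + (of_nat (Suc k) - 1) * dl i > 0" "of_nat (Suc k) * dl i > 0"
          using s by (simp_all add: add_pos_nonneg)
        hence "br (of_nat (Suc k) * dl i) * br (s + (of_nat (Suc k) - 1) * dl i) \<noteq> 0"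
          unfolding mult_eq_0_iff[of "br _"] br_eq_0_iff by (metis less_irrefl)
        hence "(\<Sum>l<Suc k. br (s + of_nat l * (2 * dl i))) \<noteq> 0"
          using br_sum[of s "dl i" "Suc k"] by (metis mult_zero_left)
        thus ?thesis unfolding E_def by (simp only: divide_eq_0_iff qdiff_nonzero neg_equal_0_iff_equal simp_thms)
      qed
      ultimately have "w k * ?t' = 0" by simp
      hence "w k * ?t' * ?t = 0" by simp
      thus False using Suc by (simp add: mult.assoc tau_add)
    qed
  qed (simp add: w0 u)
  ultimately show False by blast
qed

end

section \<open>Splitting off powers of x_i, and the vanishing of the radical in U^+\<close>

context qgroup begin

definition adF :: "'n => 'n free => 'n free" where
  "adF i f = gen i * f - kap (sr i) f * gen i"

lemma fx_adF: "fx (adF i f) = ad (gx D i) (fx f)"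
  by (simp add: adF_def ad_gx tau_fx mult.assoc tau_add_left)

lemma der_adF_self: "der (sr i) i f = 0 ==> der (sr i) i (adF i f) = 0"
  by (simp add: adF_def der_mult der_kap)

lemma der_adF_other: "i \<noteq> j ==> der (sr j) j f = 0 ==> der (sr j) j (adF i f) = 0"
  by (simp add: adF_def der_mult der_kap)

lemma kap_adF: "kap v (adF i f) = fconst (qpow (ip D v (sr i))) * adF i (kap v f)"
proof -
  have kk: "kap v (kap w f) = kap w (kap v f)" for w f
    by (induction f rule: pm_induct) (simp_all add: kap_single mult.left_commute)
  have kd: "kap v (f - g) = kap v f - kap v g" for f g
    using kap_add[of v "f - g" g] by simp
  show ?thesis by (simp add: adF_def kd kk right_diff_distrib mult.assoc fconst_pull[of "kap _ _"])
qed

text \<open>A supply of constants of \<open>der (sr i) i\<close>: by \<open>fdec_exists\<close>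
  every polynomial is a sum of products h x_i^k with h in this set, while the Serre relations make
  ad x_i locally nilpotent on the values of its elements.\<close>

inductive_set fcen :: "'n => 'n free set" for i where
  base: "j \<noteq> i ==> (adF i ^^ k) (gen j) \<in> fcen i"
| one: "1 \<in> fcen i"
| add: "f \<in> fcen i ==> g \<in> fcen i ==> f + g \<in> fcen i"
| scale: "f \<in> fcen i ==> fconst c * f \<in> fcen i"
| mult: "f \<in> fcen i ==> g \<in> fcen i ==> f * g \<in> fcen i"

lemma fcen_0: "0 \<in> fcen i"
  using fcen.scale[OF fcen.one, of 0] by simp

lemma fcen_der:
  assumes "f \<in> fcen i"
  shows "der (sr i) i f = 0"
  using assms
proof induction
  case (base j k)
  show ?case by (induction k) (use base in \<open>auto simp: der_adF_self\<close>)
qed (simp_all add: der_mult)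

lemma fcen_kap:
  assumes "f \<in> fcen i"
  shows "kap v f \<in> fcen i"
  using assms
proof induction
  case (base j k)
  have "\<exists>c. kap v ((adF i ^^ k) (gen j)) = fconst c * (adF i ^^ k) (gen j)" for k
  proof (induction k)
    case (Suc k)
    have sc: "adF i (fconst c * f) = fconst c * adF i f" for c f
      by (simp add: adF_def right_diff_distrib fconst_left_commute mult.assoc)
    obtain c where "kap v ((adF i ^^ k) (gen j)) = fconst c * (adF i ^^ k) (gen j)" using Suc by blast
    thus ?case by (auto simp: kap_adF sc fconst_mult simp flip: mult.assoc)
  qed auto
  then obtain c where "kap v ((adF i ^^ k) (gen j)) = fconst c * (adF i ^^ k) (gen j)" by blast
  thus ?case using fcen.scale[OF fcen.base[OF base]] by simp
qed (auto intro: fcen.intros)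

lemma fcen_adF:
  assumes "f \<in> fcen i"
  shows "adF i f \<in> fcen i"
  using assms
proof induction
  case (base j k)
  thus ?case using fcen.base[of j i "Suc k"] by simp
next
  case one
  show ?case by (simp add: adF_def fcen_0)
next
  case (add f g)
  have "adF i (f + g) = adF i f + adF i g" by (simp add: adF_def ring_distribs)
  thus ?case using add by (simp add: fcen.add)
next
  case (scale f c)
  have "adF i (fconst c * f) = fconst c * adF i f"
    by (simp add: adF_def right_diff_distrib fconst_left_commute mult.assoc)
  thus ?case using scale by (simp add: fcen.scale)
next
  case (mult f g)
  have "adF i (f * g) = adF i f * g + kap (sr i) f * adF i g"
    by (simp add: adF_def ring_distribs mult.assoc)
  thus ?case using mult by (simp add: fcen.add fcen.mult fcen_kap)
qed

lemma fcen_adnil: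
  assumes "f \<in> fcen i"
  shows "fx f \<in> adnil i"
  using assms
proof induction
  case (base j k)
  have e: "fx ((adF i ^^ k) (gen j)) = (ad (gx D i) ^^ k) (gx D j)"
    by (induction k) (simp_all add: fx_adF)
  have "(ad (gx D i) ^^ nat (1 - cart D i j)) ((ad (gx D i) ^^ k) (gx D j))
      = (ad (gx D i) ^^ k) ((ad (gx D i) ^^ nat (1 - cart D i j)) (gx D j))"
    by (rule funpow_commute)
  also have "\<dots> = 0" using ad_serre[of i j] base by simp
  finally show ?case unfolding e adnil_def by blast
next
  case one
  have "ad (gx D i) 1 = 0" by (simp add: ad_gx tau_add)
  thus ?case by (auto simp: adnil_def intro: exI[of _ 1])
next
  case (scale f c)
  thus ?case by (auto simp: adnil_def ad_funpow_linear qscale_mult_left)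
qed (simp_all add: adnil_add adnil_mult)

text \<open>Coefficients from N on are required to vanish so that decompositions of different length
  can be added.\<close>

definition fdec :: "'n => 'n free => nat => (nat => 'n free) => bool" where
  "fdec i f N h \<longleftrightarrow> (\<forall>k. h k \<in> fcen i) \<and> (\<forall>k\<ge>N. h k = 0) \<and> f = (\<Sum>k<N. h k * gen i ^ k)"

lemma fdec_mono:
  assumes "fdec i f N h" "N \<le> M"
  shows "fdec i f M h"
proof -
  have "(\<Sum>k<N. h k * gen i ^ k) = (\<Sum>k<M. h k * gen i ^ k)"
    using assms by (intro sum.mono_neutral_left) (auto simp: fdec_def)
  thus ?thesis using assms by (auto simp: fdec_def)
qed

lemma fdec_add:
  assumes "fdec i f N h" "fdec i f' N' h'"
  shows "fdec i (f + f') (max N N') (\<lambda>k. h k + h' k)"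
  using fdec_mono[OF assms(1), of "max N N'"] fdec_mono[OF assms(2), of "max N N'"]
  by (auto simp: fdec_def ring_distribs sum.distrib fcen.add)

text \<open>Left multiplication by x_i is absorbed through x_i h = \<open>adF i h\<close> +
  \<open>kap (sr i) h\<close> x_i, both coefficients staying in \<open>fcen i\<close>.\<close>

lemma fdec_exists: "\<exists>N h. fdec i f N h"
proof (induction f rule: free_induct)
  case one
  show ?case
    by (rule exI[of _ 1], rule exI[of _ "\<lambda>k. if k = 0 then 1 else 0"]) (auto simp: fdec_def fcen.one fcen_0)
next
  case (add f g)
  thus ?case using fdec_add by blast
next
  case (scale c f)
  then obtain N h where "fdec i f N h" by blast
  hence "fdec i (fconst c * f) N (\<lambda>k. fconst c * h k)"
    by (auto simp: fdec_def fcen.scale sum_distrib_left mult.assoc)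
  thus ?case by blast
next
  case (gen j f)
  then obtain N h where h: "fdec i f N h" by blast
  show ?case
  proof (cases "j = i")
    case False
    have "gen j \<in> fcen i" using fcen.base[OF False, of 0] by simp
    hence "fdec i (gen j * f) N (\<lambda>k. gen j * h k)"
      using h by (auto simp: fdec_def fcen.mult sum_distrib_left mult.assoc)
    thus ?thesis by blast
  next
    case True
    have a0: "adF i 0 = 0" by (simp add: adF_def)
    have d1: "fdec i (\<Sum>k<N. adF i (h k) * gen i ^ k) N (\<lambda>k. adF i (h k))"
      using h by (auto simp: fdec_def fcen_adF a0)
    have d2: "fdec i (\<Sum>k<N. kap (sr i) (h k) * gen i ^ Suc k) (Suc N)
        (\<lambda>k. case k of 0 => 0 | Suc k => kap (sr i) (h k))"
      unfolding fdec_def using h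
      by (auto simp: fdec_def fcen_0 fcen_kap sum.lessThan_Suc_shift split: nat.split simp del: sum.lessThan_Suc)
    have eq: "gen j * f = (\<Sum>k<N. adF i (h k) * gen i ^ k) + (\<Sum>k<N. kap (sr i) (h k) * gen i ^ Suc k)"
    proof -
      have "gen i * (h k * gen i ^ k) = adF i (h k) * gen i ^ k + kap (sr i) (h k) * gen i ^ Suc k" for k
        by (simp add: adF_def left_diff_distrib mult.assoc)
      thus ?thesis using h True by (simp add: fdec_def sum_distrib_left sum.distrib)
    qed
    show ?thesis unfolding eq using fdec_add[OF d1 d2] by blast
  qed
qed

text \<open>The factor is a geometric sum in q^{(\<alpha>_i,\<alpha>_i)}, nonzero since this is not
  a root of unity.\<close>

lemma der_gen_power: "\<exists>c. c \<noteq> 0 \<and> der (sr i) i (gen i ^ Suc k) = fconst c * gen i ^ k"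
proof -
  define a where "a = qpow (ip D (sr i) (sr i))"
  have a1: "a ^ n \<noteq> 1" if "n > 0" for n
    using that by (simp add: a_def qpow_power qpow_eq_1_iff ip_sr_self)
  have kp: "kap (sr i) (gen i ^ k) = fconst (a ^ k) * gen i ^ k" for k
  proof (induction k)
    case (Suc k)
    have "kap (sr i) (gen i ^ Suc k) = fconst a * gen i * (fconst (a ^ k) * gen i ^ k)"
      by (simp add: Suc a_def)
    also have "\<dots> = fconst a * (fconst (a ^ k) * (gen i * gen i ^ k))"
      by (simp add: mult.assoc fconst_left_commute)
    finally show ?case by (simp add: fconst_mult flip: mult.assoc)
  qed simp
  have "der (sr i) i (gen i ^ Suc k) = fconst (\<Sum>l\<le>k. a ^ l) * gen i ^ k" for k
  proof (induction k)
    case (Suc k)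
    have "der (sr i) i (gen i ^ Suc (Suc k)) = kap (sr i) (gen i ^ Suc k) + gen i * der (sr i) i (gen i ^ Suc k)"
      by (subst power_Suc) (simp only: der_gen_mult simp_thms if_True)
    also have "\<dots> = fconst (a ^ Suc k) * gen i ^ Suc k + fconst (\<Sum>l\<le>k. a ^ l) * gen i ^ Suc k"
      unfolding Suc kp by (simp add: fconst_left_commute)
    finally show ?case by (simp add: fconst_add ring_distribs add.commute)
  qed simp
  moreover have "(\<Sum>l\<le>k. a ^ l) \<noteq> 0"
  proof
    assume "(\<Sum>l\<le>k. a ^ l) = 0"
    hence "(a - 1) * (\<Sum>l<Suc k. a ^ l) = 0" by (simp add: lessThan_Suc_atMost)
    hence "a ^ Suc k = 1" by (simp only: power_diff_1_eq[symmetric]) simp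
    thus False using a1[of "Suc k"] by simp
  qed
  ultimately show ?thesis by blast
qed

text \<open>Elements of \<open>fcen i\<close> are constants for the derivation, so only the power of
  x_i is differentiated.\<close>

lemma der_funpow_top:
  assumes "h \<in> fcen i"
  shows "\<exists>c. c \<noteq> 0 \<and> (der (sr i) i ^^ m) (h * gen i ^ k) = (if k < m then 0 else fconst c * (h * gen i ^ (k - m)))"
proof (induction m)
  case 0
  show ?case by (auto intro: exI[of _ 1])
next
  case (Suc m)
  then obtain c where c: "c \<noteq> 0"
    "(der (sr i) i ^^ m) (h * gen i ^ k) = (if k < m then 0 else fconst c * (h * gen i ^ (k - m)))" by blast
  have d: "der (sr i) i (h * g) = h * der (sr i) i g" for g
    using fcen_der[OF assms] by (simp add: der_mult)
  consider "k < m" | "k = m" | l where "k - m = Suc l" "k \<ge> Suc m"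
    by (metis Suc_diff_Suc Suc_leI linorder_neqE_nat)
  thus ?case
  proof cases
    case 2
    thus ?thesis using c d[of 1] by (auto intro: exI[of _ 1])
  next
    case 3
    obtain e where e: "e \<noteq> 0" "der (sr i) i (gen i ^ Suc l) = fconst e * gen i ^ l" using der_gen_power by blast
    have "(der (sr i) i ^^ Suc m) (h * gen i ^ k) = der (sr i) i ((der (sr i) i ^^ m) (h * gen i ^ k))" by simp
    also have "(der (sr i) i ^^ m) (h * gen i ^ k) = fconst c * (h * gen i ^ Suc l)"
      unfolding c(2) using 3 by (simp only: if_False not_less) simp
    also have "der (sr i) i \<dots> = fconst c * (fconst e * (h * gen i ^ l))"
      by (simp only: der_scale d e(2) fconst_pull[of h])
    finally have "(der (sr i) i ^^ Suc m) (h * gen i ^ k) = fconst (c * e) * (h * gen i ^ l)"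
      by (simp only: fconst_mult mult.assoc[symmetric])
    moreover have "k - Suc m = l" using 3 by simp
    ultimately show ?thesis using c(1) e(1) 3 by (intro exI[of _ "c * e"]) auto
  qed (use c in \<open>auto intro: exI[of _ 1]\<close>)
qed

lemma der_funpow_linear: "(der v i ^^ m) (f + g) = (der v i ^^ m) f + (der v i ^^ m) g" "(der v i ^^ m) 0 = 0"
  by (induction m) simp_all

lemma fle_gen_power: "gen i ^ k \<in> fle k"
proof (induction k)
  case (Suc k)
  have "gen i \<in> fle 1" by (auto simp: fle_def gen_def)
  from fle_mult[OF this Suc] show ?case by simp
qed (simp add: fle_def zero_word_def)

lemma fle_scale: "f \<in> fle n ==> fconst c * f \<in> fle n"
  unfolding fle_def fconst_def using keys_single_times[of c f] by blast

lemma fle_der': "f \<in> fle n ==> der v i f \<in> fle (n - 1)"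
proof (cases n)
  case 0
  assume "f \<in> fle n"
  hence "der v i f = 0" using fle_0[of f] 0 by (metis der_fconst)
  thus ?thesis by (simp add: fle_def)
qed (use fle_der in auto)

lemma fle_der_funpow: "f \<in> fle n ==> (der v i ^^ m) f \<in> fle (n - m)"
proof (induction m)
  case (Suc m)
  thus ?case using fle_der'[of "(der v i ^^ m) f" "n - m"] by simp
qed simp

lemma fle_der_funpow_0: "f \<in> fle n ==> m > n ==> (der v i ^^ m) f = 0"
proof -
  assume f: "f \<in> fle n" and m: "m > n"
  have "(der v i ^^ n) f \<in> fle 0" using fle_der_funpow[OF f, where m = n and v = v and i = i] by simp
  hence "(der v i ^^ Suc n) f = 0" using fle_0 by (metis comp_apply der_fconst funpow.simps(2))
  moreover have "(der v i ^^ m) f = (der v i ^^ (m - Suc n)) ((der v i ^^ Suc n) f)"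
    using m by (metis Suc_leI comp_apply funpow_add le_add_diff_inverse2)
  ultimately show ?thesis by (simp add: der_funpow_linear)
qed

lemma frad_der_funpow: "f \<in> frad ==> (der (sr i) i ^^ m) f \<in> frad"
  by (induction m) (auto intro: frad_der)

lemma frad_reduce_fcen:
  assumes IH: "\<And>m f. m < n ==> f \<in> frad ==> f \<in> fle m ==> fx f = 0"
    and "f \<in> frad" "f \<in> fle n" "n > 0" "\<And>k. h k \<in> fcen i" "f = (\<Sum>k<Suc N. h k * gen i ^ k)"
  shows "\<exists>g\<in>fcen i. fx f = fx g"
  using assms(2,3,6)
proof (induction N arbitrary: f)
  case 0
  thus ?case using assms(5) by auto
next
  case (Suc N)
  let ?A = "der (sr i) i"
  let ?N = "Suc N"
  have As: "(?A ^^ ?N) (\<Sum>k<M. h k * gen i ^ k) = (\<Sum>k<M. (?A ^^ ?N) (h k * gen i ^ k))" for M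
    by (induction M) (simp_all add: der_funpow_linear(1) del: funpow.simps, simp add: der_funpow_linear(2))
  have low: "(?A ^^ ?N) (h k * gen i ^ k) = 0" if "k < ?N" for k
    using der_funpow_top[OF assms(5)[of k], of ?N k] that by auto
  obtain c where c: "c \<noteq> 0" "(?A ^^ ?N) (h ?N * gen i ^ ?N) = fconst c * h ?N"
    using der_funpow_top[OF assms(5)[of ?N], of ?N ?N] by auto
  have "(?A ^^ ?N) f = fconst c * h ?N"
    unfolding Suc.prems(3) As using low c(2) by simp
  hence hN: "h ?N = fconst (inverse c) * (?A ^^ ?N) f"
    using c(1) by (simp add: fconst_mult del: funpow.simps flip: mult.assoc)
  have hr: "h ?N \<in> frad" unfolding hN by (intro frad_scale frad_der_funpow Suc.prems)
  have hl: "h ?N \<in> fle (n - ?N)" unfolding hN by (intro fle_scale fle_der_funpow Suc.prems)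
  have "fx (h ?N) = 0" by (rule IH[OF _ hr hl]) (use \<open>n > 0\<close> in simp)
  define f' where "f' = f - h ?N * gen i ^ ?N"
  have "f' \<in> frad" unfolding f'_def by (intro frad_diff Suc.prems frad_mult hr)
  moreover have "f' \<in> fle n"
  proof (cases "?N \<le> n")
    case True
    have "h ?N * gen i ^ ?N \<in> fle (n - ?N + ?N)" by (intro fle_mult hl fle_gen_power)
    thus ?thesis unfolding f'_def using True Suc.prems by (intro fle_add) auto
  next
    case False
    \<comment> \<open>With more derivations than the degree, the top coefficient is itself
      0.\<close>
    hence "(?A ^^ ?N) f = 0" by (intro fle_der_funpow_0[OF Suc.prems(2)]) simp
    hence "h ?N = 0" using hN by (simp del: funpow.simps)
    thus ?thesis using Suc.prems by (simp add: f'_def)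
  qed
  moreover have "f' = (\<Sum>k<Suc N. h k * gen i ^ k)" unfolding f'_def Suc.prems(3) by simp
  ultimately obtain g where "g \<in> fcen i" "fx f' = fx g" using Suc.IH by blast
  moreover have "fx f = fx f'" using \<open>fx (h ?N) = 0\<close> by (simp add: f'_def del: power_Suc)
  ultimately show ?case by auto
qed

lemma length_wtl: "of_nat (length ks) = (\<Sum>i\<in>UNIV. crd (wtl ks) i)"
proof (induction ks)
  case (Cons k ks)
  have "(\<Sum>i\<in>UNIV. crd (sr k) i) = (1::rat)" by (simp add: crd_sr)
  thus ?case using Cons by (simp add: lookup_add sum.distrib)
qed simp

text \<open>
  The Serre relations generate the whole radical.  A radical element of minimal degree commutes
  with all \<open>y\<^sub>i\<close>, so its weight \<open>\<beta>\<close> satisfies \<open>(\<beta>, \<alpha>\<^sub>i) \<le> 0\<close> for all \<open>i\<close>, which contradicts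
  positive definiteness.
\<close>

theorem frad_eval: "f \<in> frad ==> fx f = 0"
proof -
  have "\<forall>f. f \<in> frad \<and> f \<in> fle n \<longrightarrow> fx f = 0" for n
  proof (induction n rule: less_induct)
    case (less n)
    have IH: "fx f = 0" if "m < n" "f \<in> frad" "f \<in> fle m" for m f using less that by blast
    have main: "fx f = 0" if f: "f \<in> frad" "f \<in> fle n" and wt: "\<And>w. w \<in> keys f ==> wtl (letters w) = \<beta>"
      for f \<beta>
    proof (rule ccontr)
      assume nz: "fx f \<noteq> 0"
      have npos: "n > 0"
      proof (rule ccontr)
        assume "\<not> n > 0"
        hence "f = fconst (fcst f)" using f(2) fle_0 by simp
        hence "f = 0" using frad_fcst[OF f(1)] by simp
        thus False using nz by simp
      qed
      have le: "ip D \<beta> (sr i) \<le> 0" for i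
      proof (rule ad_lowest_weight[OF fx_uwt[OF wt] _ _ nz])
        have "der (sr i) i f \<in> fle (n - 1)" "der (- sr i) i f \<in> fle (n - 1)" by (rule fle_der'[OF f(2)])+
        hence "fx (der (sr i) i f) = 0" "fx (der (- sr i) i f) = 0"
          using IH[of "n - 1"] frad_der[OF f(1)] npos by auto
        thus "fx f * gy D i = gy D i * fx f" by (simp add: fx_gy)
        \<comment> \<open>f itself need not lie in \<open>fcen i\<close>; it is replaced by an
          element of \<open>fcen i\<close> with the same value in U, and local nilpotence concerns
          only that value.\<close>
        obtain N h where "fdec i f N h" using fdec_exists by blast
        hence "fdec i f (Suc N) h" by (rule fdec_mono) simp
        hence "\<exists>g\<in>fcen i. fx f = fx g"
          by (intro frad_reduce_fcen[OF IH f npos, where h = h and N = N]) (auto simp: fdec_def)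
        thus "fx f \<in> adnil i" using fcen_adnil by auto
      qed
      have "f \<noteq> 0" using nz by auto
      then obtain w where w: "w \<in> keys f" using keys_0D by blast
      have \<beta>: "\<beta> = wtl (letters w)" using wt[OF w] by simp
      have "ip D \<beta> \<beta> = (\<Sum>i\<in>UNIV. crd \<beta> i * ip D \<beta> (sr i))"
        by (subst (2) wt_expand[of \<beta>]) (simp add: ip_sum_right)
      also have "\<dots> \<le> 0" using le by (intro sum_nonpos mult_nonneg_nonpos) (auto simp: \<beta> crd_wtl)
      finally have "\<beta> = 0" using ip_pos[of \<beta>] by (cases "\<beta> = 0") auto
      have "f \<in> fle 0"
        unfolding fle_def
      proof (intro CollectI ballI)
        fix w assume "w \<in> keys f"
        hence "of_nat (length (letters w)) = (0 :: rat)"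
          using length_wtl[of "letters w"] wt \<open>\<beta> = 0\<close> by simp
        thus "length (letters w) \<le> 0" by simp
      qed
      hence "f = fconst (fcst f)" by (rule fle_0)
      hence "f = 0" using frad_fcst[OF f(1)] by simp
      thus False using nz by simp
    qed
    show ?case
    proof (intro allI impI, elim conjE)
      fix f assume f: "f \<in> frad" "f \<in> fle n"
      have "fx (fproj (\<lambda>w. wtl (letters w) = \<beta>) f) = 0" for \<beta>
        by (rule main[where \<beta> = \<beta>]) (use f frad_fproj in \<open>auto simp: keys_fproj fle_def\<close>)
      thus "fx f = 0" by (subst fproj_sum) (simp only: fx_sum, simp)
    qed
  qed
  moreover have "f \<in> fle (Max (insert 0 ((\<lambda>w. length (letters w)) ` keys f)))"
    by (auto simp: fle_def intro!: Max_ge)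
  ultimately show "f \<in> frad ==> fx f = 0" by blast
qed

text \<open>For a homogeneous polynomial of degree r, fewer than r derivations leave positive degree
  and more than r leave nothing, so the words of length r decide.\<close>

lemma bops_eval:
  assumes "f \<in> fle r" "f \<in> fge r" "\<And>is. length is = r ==> fcst (bops is f) = 0"
  shows "fx f = 0"
proof (rule frad_eval, rule fradI)
  fix "is" :: "'n list"
  consider "length is < r" | "length is = r" | "length is > r" by linarith
  thus "fcst (bops is f) = 0"
    by cases (use assms bops_fge bops_fle in auto)
qed

section \<open>The subalgebra \<open>N\<^sup>+\<close>\<close>

text \<open>A condition satisfied by suitable lifts of all elements of N^+ and inherited by their
  truncations. It matters because tilde \<alpha>_j = 0 for j in \<pi>_\<Theta>, so that exponents of
  the restricted torus cannot tell the two derivations for j apart.\<close>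

definition nfree :: "'n free set" where "nfree = {f. \<forall>j\<in>piTh D. der (sr j) j f = 0}"

lemma subalg_fx_nfree: "subalg (fx ` nfree)"
proof -
  have add: "f + g \<in> nfree" "f * g \<in> nfree" if "f \<in> nfree" "g \<in> nfree" for f g
    using that by (auto simp: nfree_def der_mult)
  have scale: "fconst c * f \<in> nfree" if "f \<in> nfree" for f c using that by (auto simp: nfree_def)
  have one: "1 \<in> nfree" by (simp add: nfree_def)
  have "0 \<in> fx ` nfree" by (rule image_eqI[of _ _ 0]) (simp_all add: nfree_def)
  moreover have "1 \<in> fx ` nfree" by (rule image_eqI[of _ _ 1]) (simp_all add: one)
  moreover have "c *\<^sub>q fx f \<in> fx ` nfree" if "f \<in> nfree" for c f
    by (rule image_eqI[of _ _ "fconst c * f"]) (simp_all add: qscale_mult_left scale that)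
  moreover have "fx f + fx g \<in> fx ` nfree" "fx f * fx g \<in> fx ` nfree" if "f \<in> nfree" "g \<in> nfree" for f g
    using add[OF that] by (metis fx_simps(3) imageI, metis fx_simps(4) imageI)
  ultimately show ?thesis unfolding subalg_def cv.subspace_def by blast
qed

lemma nfree_der: "f \<in> nfree ==> der (- sr i) i f \<in> nfree"
proof -
  assume f: "f \<in> nfree"
  have "der (sr j) j (der (- sr i) i f) = 0" if j: "j \<in> piTh D" for j
  proof -
    have "0 = fconst (qpow (ip D (sr j) (sr i))) * der (sr j) j (der (- sr i) i f)"
      using der_commute[of i j f] f j by (simp add: nfree_def)
    hence "fconst (inverse (qpow (ip D (sr j) (sr i)))) * (fconst (qpow (ip D (sr j) (sr i))) * der (sr j) j (der (- sr i) i f)) = 0"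
      by simp
    thus ?thesis by (simp add: fconst_mult flip: mult.assoc)
  qed
  thus ?thesis by (simp add: nfree_def)
qed

text \<open>M^+ is an intersection and not given by generators, so stability of the image of
  \<open>nfree\<close> is shown under ad of all generators of M. For y_j the commutator formula
  leaves only the derivation \<open>der (- sr j) j\<close>, which preserves
  \<open>nfree\<close>.\<close>

lemma Nplus_nfree: "Nplus D \<subseteq> fx ` nfree"
  unfolding Nplus_def
proof (rule alg_gen_minimal[OF _ subalg_fx_nfree], safe)
  fix m c assume m: "m \<in> Mplus D" and c: "c \<in> alg_gen (gx D ` (- piTh D))"
  have "gx D ` (- piTh D) \<subseteq> fx ` nfree"
  proof
    fix x assume "x \<in> gx D ` (- piTh D)"
    then obtain i where "x = fx (gen i)" "i \<notin> piTh D" by auto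
    thus "x \<in> fx ` nfree" by (intro image_eqI[of _ _ "gen i"]) (auto simp: nfree_def)
  qed
  hence c': "c \<in> fx ` nfree" using c alg_gen_minimal[OF _ subalg_fx_nfree] by blast
  define FN where "FN = fx ` nfree"
  note s = subalgD[OF subalg_fx_nfree[folded FN_def]]
  have gen: "ad (gx D j) u \<in> FN" "ad (gy D j) u \<in> FN" "ad (tau D v) u \<in> FN" if "u \<in> FN" and j: "j \<in> piTh D" for j u v
  proof -
    obtain f where f: "f \<in> nfree" "u = fx f" using \<open>u \<in> FN\<close> unfolding FN_def by blast
    show "ad (gx D j) u \<in> FN"
    proof -
      have "der (sr k) k (adF j f) = 0" if k: "k \<in> piTh D" for k
        using f(1) k der_adF_self[of k f] der_adF_other[of j k f] by (cases "j = k") (auto simp: nfree_def)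
      hence "adF j f \<in> nfree" by (simp add: nfree_def)
      thus "ad (gx D j) u \<in> FN" unfolding f(2) FN_def fx_adF[symmetric] by (rule imageI)
    qed
    show "ad (gy D j) u \<in> FN"
    proof -
      have "ad (gy D j) u = (1 / qdiff j) *\<^sub>q fx (der (- sr j) j f)"
        using f(1) j by (simp add: ad_gy f(2) fx_gy nfree_def qscale_mult_left mult.assoc tau_add)
      moreover have "fx (der (- sr j) j f) \<in> FN" using nfree_der[OF f(1)] unfolding FN_def by blast
      ultimately show "ad (gy D j) u \<in> FN" by (simp add: s(6))
    qed
    have "ad (tau D v) u = fx (kap v f)" by (simp add: ad_tau f(2) tau_fx mult.assoc tau_add)
    moreover have "kap v f \<in> nfree" using f(1) by (simp add: nfree_def der_kap)
    ultimately show "ad (tau D v) u \<in> FN" by (simp add: FN_def)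
  qed
  have "m \<in> Mq D" using m by (simp add: Mplus_def)
  thus "ad m c \<in> fx ` nfree"
    unfolding Mq_def
    by (rule alg_gen_stable[OF s(1), of _ "\<lambda>m. ad m", unfolded FN_def, rotated -2])
      (use c' gen in \<open>auto simp: ad_add ad_mult ad_scale ad_one FN_def\<close>)
qed

lemma counit_fx [simp]: "counit (fx f) = fcst f"
  by (induction f rule: free_induct) (simp_all add: counit_one counit_add counit_mult counit_scale)

end

section \<open>Simple highest weight modules\<close>

interpretation cvp: vector_space_pair "qscale :: cc => 'a => 'a::cvec" "qscale :: cc => 'b => 'b::cvec"
  by unfold_locales

locale hwmod = qgroup D for D :: "('n::{finite,linorder}, 'u::chopf) qsp" +
  fixes M :: "'n wt" and V :: "'v::cvec set" and act :: "'u => 'v => 'v"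
  assumes simple_hw: "simple_hw_module D M V act"
begin

lemma V_subspace: "cv.subspace V"
  and act_V: "u \<in> Uch D ==> v \<in> V ==> act u v \<in> V"
  and act_add: "u \<in> Uch D ==> v \<in> V ==> w \<in> V ==> act u (v + w) = act u v + act u w"
  and act_scale: "u \<in> Uch D ==> v \<in> V ==> act u (c *\<^sub>q v) = c *\<^sub>q act u v"
  and act_scale_left: "u \<in> Uch D ==> v \<in> V ==> act (c *\<^sub>q u) v = c *\<^sub>q act u v"
  and act_add_left: "u \<in> Uch D ==> u' \<in> Uch D ==> v \<in> V ==> act (u + u') v = act u v + act u' v"
  and act_mult: "u \<in> Uch D ==> u' \<in> Uch D ==> v \<in> V ==> act (u * u') v = act u (act u' v)"
  and act_one: "v \<in> V ==> act 1 v = v"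
  and simple: "cv.subspace W ==> W \<subseteq> V ==> (\<And>u v. u \<in> Uq D ==> v \<in> W ==> act u v \<in> W) ==> W = {0} \<or> W = V"
  and hv_exists: "\<exists>v\<in>V. v \<noteq> 0 \<and> (\<forall>i. act (gx D i) v = 0) \<and>
        (\<forall>\<gamma>\<in>Ppi D. act (tau D \<gamma>) v = qpow (ip D M \<gamma>) *\<^sub>q v)"
  using simple_hw unfolding simple_hw_module_def by blast+

definition hv :: 'v where
  "hv = (SOME v. v \<in> V \<and> v \<noteq> 0 \<and> (\<forall>i. act (gx D i) v = 0) \<and>
        (\<forall>\<gamma>\<in>Ppi D. act (tau D \<gamma>) v = qpow (ip D M \<gamma>) *\<^sub>q v))"

lemma hv: "hv \<in> V" "hv \<noteq> 0" "act (gx D i) hv = 0" "\<gamma> \<in> Ppi D ==> act (tau D \<gamma>) hv = qpow (ip D M \<gamma>) *\<^sub>q hv"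
proof -
  have "\<exists>v. v \<in> V \<and> v \<noteq> 0 \<and> (\<forall>i. act (gx D i) v = 0) \<and>
        (\<forall>\<gamma>\<in>Ppi D. act (tau D \<gamma>) v = qpow (ip D M \<gamma>) *\<^sub>q v)" using hv_exists by blast
  from someI_ex[OF this] show "hv \<in> V" "hv \<noteq> 0" "act (gx D i) hv = 0"
    "\<gamma> \<in> Ppi D ==> act (tau D \<gamma>) hv = qpow (ip D M \<gamma>) *\<^sub>q hv"
    unfolding hv_def by blast+
qed

lemma VI: "0 \<in> V" "v \<in> V ==> w \<in> V ==> v + w \<in> V" "v \<in> V ==> c *\<^sub>q v \<in> V" "v \<in> V ==> w \<in> V ==> v - w \<in> V"
  using V_subspace by (auto intro: cv.subspace_0 cv.subspace_add cv.subspace_scale cv.subspace_diff)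

lemma Uq_in_Uch: "u \<in> Uq D ==> u \<in> Uch D"
  using Uq_Uch by blast

lemma act_0 [simp]: "u \<in> Uch D ==> act u 0 = 0"
  using act_scale[of u 0 0] VI(1) by simp

lemma act_zero [simp]: "v \<in> V ==> act 0 v = 0"
  using act_scale_left[of 0 v 0] subalgD(3)[OF subalg_sets(2)] by simp

definition wsp :: "'n wt => 'v set" where
  "wsp \<mu> = {v \<in> V. \<forall>\<gamma>\<in>Qpi. act (tau D \<gamma>) v = qpow (ip D \<mu> \<gamma>) *\<^sub>q v}"

lemma wsp_V: "v \<in> wsp \<mu> ==> v \<in> V"
  by (simp add: wsp_def)

lemma tau_Qpi [simp]: "\<gamma> \<in> Qpi ==> tau D \<gamma> \<in> Uch D"
  by (simp add: Qpi_Ppi)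

lemma wsp_subspace: "cv.subspace (wsp \<mu>)"
  unfolding cv.subspace_def wsp_def
  by (auto simp: VI act_add act_scale qscale_simps mult.commute)

lemma hv_wsp: "hv \<in> wsp M"
  using hv by (simp add: wsp_def Qpi_Ppi)

lemma wsp_independent:
  assumes "finite I" "\<And>\<mu>. \<mu> \<in> I ==> w \<mu> \<in> wsp \<mu>" "(\<Sum>\<mu>\<in>I. w \<mu>) = 0" "\<mu> \<in> I"
  shows "w \<mu> = 0"
proof (rule cv.eigenvectors_independent[OF assms(1) V_subspace, where L = Qpi
      and T = "\<lambda>\<gamma>. act (tau D \<gamma>)" and \<chi> = "\<lambda>\<mu> \<gamma>. qpow (ip D \<mu> \<gamma>)"])
  show "\<exists>x\<in>Qpi. qpow (ip D \<beta> x) \<noteq> qpow (ip D \<gamma> x)" if "\<beta> \<noteq> \<gamma>" for \<beta> \<gamma>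
    using ip_nondegenerate[of "\<beta> - \<gamma>"] that by (metis Qpi_simps(2) eq_iff_diff_eq_0 ip_diff_left qpow_eq_iff)
qed (use assms in \<open>auto simp: wsp_def act_add act_scale\<close>)

text \<open>
  Automorphisms of \<open>U\<close> that fix the torus; twisting the action by one of them lets the
  standard coideal subalgebras represent their whole \<open>H\<close>-orbit.
\<close>

definition uauto :: "('u => 'u) => bool" where
  "uauto \<psi> \<longleftrightarrow> \<psi> 1 = 1 \<and> (\<forall>a\<in>Uq D. \<forall>b\<in>Uq D. \<psi> (a + b) = \<psi> a + \<psi> b \<and> \<psi> (a * b) = \<psi> a * \<psi> b) \<and>
     (\<forall>c. \<forall>a\<in>Uq D. \<psi> (c *\<^sub>q a) = c *\<^sub>q \<psi> a) \<and> (\<forall>v\<in>Qpi. \<psi> (tau D v) = tau D v) \<and> \<psi> ` Uq D = Uq D"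

lemma uauto_id: "uauto (\<lambda>x. x)"
  by (simp add: uauto_def)

lemma HAut_uauto: "\<psi> \<in> HAut D ==> uauto \<psi>"
proof -
  assume h: "\<psi> \<in> HAut D"
  note H = HAutD[OF h]
  show "uauto \<psi>" unfolding uauto_def
    by (intro conjI ballI allI) (auto simp: H(1,3,4,5,8,9))
qed

lemma uautoD:
  assumes "uauto \<psi>"
  shows "\<psi> 1 = 1" "a \<in> Uq D ==> b \<in> Uq D ==> \<psi> (a + b) = \<psi> a + \<psi> b"
    "a \<in> Uq D ==> b \<in> Uq D ==> \<psi> (a * b) = \<psi> a * \<psi> b" "a \<in> Uq D ==> \<psi> (c *\<^sub>q a) = c *\<^sub>q \<psi> a"
    "v \<in> Qpi ==> \<psi> (tau D v) = tau D v" "\<psi> ` Uq D = Uq D" "a \<in> Uq D ==> \<psi> a \<in> Uq D" "a \<in> Uq D ==> \<psi> a \<in> Uch D"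
  using assms Uq_in_Uch unfolding uauto_def by blast+

abbreviation (input) tw where "tw \<psi> a \<equiv> act (\<psi> a)"

lemma tw_V: "uauto \<psi> ==> a \<in> Uq D ==> v \<in> V ==> tw \<psi> a v \<in> V"
  by (simp add: act_V uautoD)

lemma tw_mult: "uauto \<psi> ==> a \<in> Uq D ==> b \<in> Uq D ==> v \<in> V ==> tw \<psi> (a * b) v = tw \<psi> a (tw \<psi> b v)"
  by (simp add: uautoD act_mult)

lemma tw_add: "uauto \<psi> ==> a \<in> Uq D ==> b \<in> Uq D ==> v \<in> V ==> tw \<psi> (a + b) v = tw \<psi> a v + tw \<psi> b v"
  by (simp add: uautoD act_add_left)

lemma tw_scale: "uauto \<psi> ==> a \<in> Uq D ==> v \<in> V ==> tw \<psi> (c *\<^sub>q a) v = c *\<^sub>q tw \<psi> a v"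
  by (simp add: uautoD act_scale_left)

lemma tw_diff: "uauto \<psi> ==> a \<in> Uq D ==> b \<in> Uq D ==> v \<in> V ==> tw \<psi> (a - b) v = tw \<psi> a v - tw \<psi> b v"
  using tw_add[of \<psi> a "(-1) *\<^sub>q b" v] tw_scale[of \<psi> b v "-1"] subalgD(6)[OF subalg_sets(1), of b "-1"]
  by (simp add: qscale_one)

lemma tw_tau: "uauto \<psi> ==> \<gamma> \<in> Qpi ==> w \<in> wsp \<mu> ==> tw \<psi> (tau D \<gamma>) w = qpow (ip D \<mu> \<gamma>) *\<^sub>q w"
  by (simp add: uautoD wsp_def)

lemma tw_uwt:
  assumes "uauto \<psi>" "z \<in> uwt \<beta>" "z \<in> Uq D" "w \<in> wsp \<mu>"
  shows "tw \<psi> z w \<in> wsp (\<mu> + \<beta>)"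
proof -
  have wV: "w \<in> V" using assms(4) by (rule wsp_V)
  have "act (tau D \<gamma>) (tw \<psi> z w) = qpow (ip D (\<mu> + \<beta>) \<gamma>) *\<^sub>q tw \<psi> z w" if g: "\<gamma> \<in> Qpi" for \<gamma>
  proof -
    have "act (tau D \<gamma>) (tw \<psi> z w) = tw \<psi> (tau D \<gamma> * z) w"
      using tw_mult[OF assms(1) _ assms(3) wV, of "tau D \<gamma>"] g by (simp add: uautoD(5)[OF assms(1)])
    also have "tau D \<gamma> * z = qpow (ip D \<gamma> \<beta>) *\<^sub>q (z * tau D \<gamma>)" by (rule uwt_tau[OF assms(2) g])
    also have "tw \<psi> \<dots> w = qpow (ip D \<gamma> \<beta>) *\<^sub>q tw \<psi> z (qpow (ip D \<mu> \<gamma>) *\<^sub>q w)"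
      using assms g wV by (simp add: tw_scale tw_mult subalgD tw_tau)
    also have "\<dots> = qpow (ip D (\<mu> + \<beta>) \<gamma>) *\<^sub>q tw \<psi> z w"
      using assms wV by (simp add: act_scale uautoD qscale_simps ip_add_left ip_comm[of \<gamma>] qpow_add mult.commute)
    finally show ?thesis .
  qed
  thus ?thesis using assms(1,3) wV by (simp add: wsp_def tw_V)
qed

lemma tw_gx_wsp: "uauto \<psi> ==> w \<in> wsp \<mu> ==> tw \<psi> (gx D i) w \<in> wsp (\<mu> + sr i)"
  and tw_gy_wsp: "uauto \<psi> ==> w \<in> wsp \<mu> ==> tw \<psi> (gy D i) w \<in> wsp (\<mu> - sr i)"
  using tw_uwt[of \<psi> "gx D i" "sr i" w \<mu>] tw_uwt[of \<psi> "gy D i" "- sr i" w \<mu>] uwt_gens by simp_all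

lemma tw_gx_gy:
  assumes "uauto \<psi>" "w \<in> wsp \<mu>"
  shows "tw \<psi> (gx D i) (tw \<psi> (gy D j) w) = tw \<psi> (gy D j) (tw \<psi> (gx D i) w)
    + (if i = j then (br (ip D \<mu> (sr i)) / qdiff i) *\<^sub>q w else 0)"
proof -
  have wV: "w \<in> V" using assms(2) by (rule wsp_V)
  have T: "tau D (sr i) - tau D (- sr i) \<in> Uq D" by (intro subalgD[OF subalg_sets(1)]) auto
  have "tw \<psi> (gx D i) (tw \<psi> (gy D j) w) = tw \<psi> (gx D i * gy D j) w"
    using assms wV by (simp add: tw_mult)
  also have "\<dots> = tw \<psi> (gy D j) (tw \<psi> (gx D i) w) +
      (if i = j then (1 / qdiff i) *\<^sub>q tw \<psi> (tau D (sr i) - tau D (- sr i)) w else 0)"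
    unfolding gx_gy using assms wV T by (cases "i = j") (auto simp: tw_add tw_mult tw_scale subalgD)
  also have "tw \<psi> (tau D (sr i) - tau D (- sr i)) w = br (ip D \<mu> (sr i)) *\<^sub>q w"
    using assms wV by (simp add: tw_diff tw_tau br_def qscale_diff)
  finally show ?thesis by (simp add: qscale_qscale)
qed

primrec yw :: "('u => 'u) => 'n list => 'v => 'v" where
  "yw \<psi> [] w = w"
| "yw \<psi> (i # is) w = tw \<psi> (gy D i) (yw \<psi> is w)"

lemma yw_wsp: "uauto \<psi> ==> w \<in> wsp \<mu> ==> yw \<psi> is w \<in> wsp (\<mu> - wtl is)"
proof (induction "is")
  case (Cons i "is")
  thus ?case using tw_gy_wsp[of \<psi> "yw \<psi> is w" "\<mu> - wtl is" i] by (simp add: algebra_simps)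
qed simp

lemma span_V: "S \<subseteq> V ==> cv.span S \<subseteq> V"
  by (intro cv.span_minimal V_subspace)

lemma act_span:
  assumes "u \<in> Uch D" "S \<subseteq> V" "\<And>s. s \<in> S ==> act u s \<in> cv.span S'" "w \<in> cv.span S"
  shows "act u w \<in> cv.span S'"
proof -
  have "w \<in> V \<and> act u w \<in> cv.span S'" using assms(4)
  proof (induction rule: cv.span_induct)
    case base
    show ?case unfolding cv.subspace_def using assms(1)
      by (auto simp: VI act_add act_scale cv.span_zero cv.span_add cv.span_scale)
  next
    case (step x)
    thus ?case using assms by blast
  qed
  thus ?thesis by blast
qed

text \<open>Moving x_i to the right through a word in the y_j stays in the span of such words, so
  this span is stable under U and fills the simple module. With a twist \<psi> it serves for the
  vector found in \<open>invariant_top\<close>.\<close>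

lemma singular_generates:
  assumes \<psi>: "uauto \<psi>" and w: "w \<in> wsp \<mu>" "w \<noteq> 0" "\<And>i. tw \<psi> (gx D i) w = 0"
  shows "V = cv.span {yw \<psi> is w | is. True}"
proof -
  define Y where "Y = {yw \<psi> is w | is. True}"
  have YV: "Y \<subseteq> V" using yw_wsp[OF \<psi> w(1)] wsp_V by (auto simp: Y_def)
  have g: "tw \<psi> a s \<in> cv.span Y" if "a \<in> Uq D" "\<And>ls. tw \<psi> a (yw \<psi> ls w) \<in> cv.span Y" "s \<in> cv.span Y" for a s
    by (rule act_span[OF _ YV _ that(3)]) (use that \<psi> in \<open>auto simp: Y_def uautoD\<close>)
  have yY: "yw \<psi> ls w \<in> cv.span Y" for ls by (rule cv.span_base) (auto simp: Y_def)
  have gy: "tw \<psi> (gy D j) s \<in> cv.span Y" if "s \<in> cv.span Y" for j s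
  proof (rule g[OF _ _ that])
    show "tw \<psi> (gy D j) (yw \<psi> ls w) \<in> cv.span Y" for ls using yY[of "j # ls"] by simp
  qed simp
  have gx: "tw \<psi> (gx D i) (yw \<psi> is w) \<in> cv.span Y" for i "is"
  proof (induction "is")
    case (Cons j "is")
    thus ?case using gy yY
      by (cases "i = j") (simp_all add: tw_gx_gy[OF \<psi> yw_wsp[OF \<psi> w(1)]] cv.span_add cv.span_scale)
  qed (simp add: w(3) cv.span_zero)
  have US: "tw \<psi> a s \<in> cv.span Y" if "a \<in> Uq D" "s \<in> cv.span Y" for a s
  proof (rule alg_gen_stable[of "cv.span Y" "range (gx D) \<union> range (gy D) \<union> tau D ` Qpi" "\<lambda>a. tw \<psi> a",
        folded Uq_def, OF cv.subspace_span _ _ _ _ _ that])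
    fix a s assume a: "a \<in> range (gx D) \<union> range (gy D) \<union> tau D ` Qpi" and s: "s \<in> cv.span Y"
    have "tw \<psi> (tau D \<gamma>) (yw \<psi> ls w) \<in> cv.span Y" if "\<gamma> \<in> Qpi" for \<gamma> ls
      using tw_tau[OF \<psi> that yw_wsp[OF \<psi> w(1)]] yY by (simp add: cv.span_scale)
    thus "tw \<psi> a s \<in> cv.span Y" using a gx gy yY by (intro g[OF _ _ s]) auto
  qed (use span_V[OF YV] \<psi> in \<open>auto simp: subset_iff tw_add tw_mult tw_scale uautoD(1) act_one\<close>)
  have "cv.span Y = {0} \<or> cv.span Y = V"
  proof (rule simple[OF cv.subspace_span span_V[OF YV]])
    fix u s assume u: "u \<in> Uq D" and s: "s \<in> cv.span Y"
    obtain a where "a \<in> Uq D" "u = \<psi> a" using u uautoD(6)[OF \<psi>] by blast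
    thus "act u s \<in> cv.span Y" using US s by blast
  qed
  thus ?thesis using w(2) yY[of "[]"] by (auto simp: Y_def)
qed

lemma V_span: "V = cv.span {yw (\<lambda>x. x) is hv | is. True}"
  by (rule singular_generates[OF uauto_id hv_wsp hv(2)]) (simp add: hv)

lemma cyclic:
  assumes "w \<in> V" "w \<noteq> 0" "v \<in> V"
  obtains u where "u \<in> Uq D" "v = act u w"
proof -
  let ?W = "{act u w | u. u \<in> Uq D}"
  have "?W = {0} \<or> ?W = V"
  proof (rule simple)
    have "0 = act 0 w" using assms(1) by simp
    note U = subalgD[OF subalg_sets(1)]
    show "cv.subspace ?W" unfolding cv.subspace_def
    proof (intro conjI ballI allI)
      show "0 \<in> ?W" using \<open>0 = act 0 w\<close> U(3) by blast
      fix x y c assume "x \<in> ?W"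
      then obtain a where a: "a \<in> Uq D" "x = act a w" by blast
      have "c *\<^sub>q x = act (c *\<^sub>q a) w" using a assms(1) by (simp add: act_scale_left Uq_in_Uch)
      thus "c *\<^sub>q x \<in> ?W" using U(6)[OF a(1)] by blast
      assume "y \<in> ?W"
      then obtain b where b: "b \<in> Uq D" "y = act b w" by blast
      have "x + y = act (a + b) w" using a b assms(1) by (simp add: act_add_left Uq_in_Uch)
      thus "x + y \<in> ?W" using U(4)[OF a(1) b(1)] by blast
    qed
    show "?W \<subseteq> V" using assms(1) by (auto intro: act_V Uq_in_Uch)
    fix u v assume "u \<in> Uq D" "v \<in> ?W"
    then obtain a where "a \<in> Uq D" "v = act a w" by blast
    hence "act u v = act (u * a) w" "u * a \<in> Uq D" using \<open>u \<in> Uq D\<close> assms(1)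
      by (auto simp: act_mult Uq_in_Uch subalgD)
    thus "act u v \<in> ?W" by blast
  qed
  moreover have "w = act 1 w" "1 \<in> Uq D" using assms(1) by (simp_all add: act_one subalgD)
  hence "w \<in> ?W" by blast
  ultimately have "v \<in> ?W" using assms(2,3) by blast
  thus ?thesis using that by blast
qed

text \<open>A basis chosen among the words y_I v_\<lambda> consists of weight vectors. The operators
  \<open>prj\<close> and \<open>tact'\<close> are defined on it by linear extension, which yields
  the weight decomposition of the module.\<close>

definition wbasis :: "'v set" where
  "wbasis = (SOME E. E \<subseteq> {yw (\<lambda>x. x) is hv | is. True} \<and> cv.independent E \<and>
     {yw (\<lambda>x. x) is hv | is. True} \<subseteq> cv.span E)"

lemma wbasis: "wbasis \<subseteq> {yw (\<lambda>x. x) is hv | is. True}" "cv.independent wbasis" "cv.span wbasis = V"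
proof -
  let ?Y = "{yw (\<lambda>x. x) is hv | is. True}"
  obtain E where "E \<subseteq> ?Y" "cv.independent E" "?Y \<subseteq> cv.span E" by (rule cv.maximal_independent_subset)
  hence "\<exists>E. E \<subseteq> ?Y \<and> cv.independent E \<and> ?Y \<subseteq> cv.span E" by blast
  from someI_ex[OF this] have E: "wbasis \<subseteq> ?Y" "cv.independent wbasis" "?Y \<subseteq> cv.span wbasis"
    unfolding wbasis_def by blast+
  show "wbasis \<subseteq> ?Y" "cv.independent wbasis" by (rule E)+
  show "cv.span wbasis = V"
    using E V_span by (metis cv.span_mono cv.span_span subset_antisym)
qed

definition ewt :: "'v => 'n wt" where
  "ewt e = (SOME \<mu>. e \<in> wsp \<mu> \<and> (\<exists>is. \<mu> = M - wtl is) \<and>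
     (\<forall>\<gamma>\<in>Ppi D. act (tau D \<gamma>) e = qpow (ip D \<mu> \<gamma>) *\<^sub>q e))"

lemma yw_Ppi: "\<gamma> \<in> Ppi D ==> act (tau D \<gamma>) (yw (\<lambda>x. x) is hv) = qpow (ip D (M - wtl is) \<gamma>) *\<^sub>q yw (\<lambda>x. x) is hv"
proof (induction "is")
  case (Cons i "is")
  let ?w = "yw (\<lambda>x. x) is hv"
  have wV: "?w \<in> V" using yw_wsp[OF uauto_id hv_wsp] by (rule wsp_V)
  have "act (tau D \<gamma>) (act (gy D i) ?w) = act (tau D \<gamma> * gy D i) ?w" using wV Cons by (simp add: act_mult)
  also have "\<dots> = qpow (- ip D \<gamma> (sr i)) *\<^sub>q act (gy D i) (act (tau D \<gamma>) ?w)"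
    using wV Cons by (simp add: tau_gy act_scale_left act_mult subalgD)
  also have "\<dots> = qpow (ip D (M - wtl (i # is)) \<gamma>) *\<^sub>q act (gy D i) ?w"
    using wV Cons by (simp add: act_scale qscale_qscale ip_diff_left ip_add_left ip_comm[of \<gamma>] diff_diff_eq add.commute flip: qpow_add)
  finally show ?case by simp
qed (simp add: hv)

lemma ewt: 
  assumes "e \<in> wbasis"
  shows "e \<in> wsp (ewt e)" "\<exists>is. ewt e = M - wtl is" "\<gamma> \<in> Ppi D ==> act (tau D \<gamma>) e = qpow (ip D (ewt e) \<gamma>) *\<^sub>q e"
proof -
  obtain "is" where e: "e = yw (\<lambda>x. x) is hv" using wbasis(1) assms by blast
  have "\<exists>\<mu>. e \<in> wsp \<mu> \<and> (\<exists>is. \<mu> = M - wtl is) \<and> (\<forall>\<gamma>\<in>Ppi D. act (tau D \<gamma>) e = qpow (ip D \<mu> \<gamma>) *\<^sub>q e)"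
    using yw_wsp[OF uauto_id hv_wsp, of "is"] yw_Ppi[of _ "is"] unfolding e by blast
  from someI_ex[OF this] show "e \<in> wsp (ewt e)" "\<exists>is. ewt e = M - wtl is"
    "\<gamma> \<in> Ppi D ==> act (tau D \<gamma>) e = qpow (ip D (ewt e) \<gamma>) *\<^sub>q e"
    unfolding ewt_def by blast+
qed

definition prj :: "'n wt => 'v => 'v" where
  "prj \<mu> = cvp.construct wbasis (\<lambda>e. if ewt e = \<mu> then e else 0)"

text \<open>The action of tau(\<gamma>) for an arbitrary rational weight \<gamma>; on V it agrees
  with the given action when \<gamma> is in P(\<pi>).\<close>

definition tact' :: "'n wt => 'v => 'v" where
  "tact' \<gamma> = cvp.construct wbasis (\<lambda>e. qpow (ip D (ewt e) \<gamma>) *\<^sub>q e)"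

lemma prj_linear: "prj \<mu> (v + w) = prj \<mu> v + prj \<mu> w" "prj \<mu> (c *\<^sub>q v) = c *\<^sub>q prj \<mu> v" "prj \<mu> 0 = 0"
  "prj \<mu> (sum f I) = (\<Sum>i\<in>I. prj \<mu> (f i))" "prj \<mu> (v - w) = prj \<mu> v - prj \<mu> w"
proof -
  interpret l: Vector_Spaces.linear "(*\<^sub>q)" "(*\<^sub>q)" "prj \<mu>"
    unfolding prj_def by (rule cvp.linear_construct[OF wbasis(2)])
  show "prj \<mu> (v + w) = prj \<mu> v + prj \<mu> w" "prj \<mu> (c *\<^sub>q v) = c *\<^sub>q prj \<mu> v" "prj \<mu> 0 = 0"
    "prj \<mu> (sum f I) = (\<Sum>i\<in>I. prj \<mu> (f i))" "prj \<mu> (v - w) = prj \<mu> v - prj \<mu> w"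
    by (simp_all add: l.add l.scale l.sum l.diff)
qed

lemma tact'_linear: "tact' \<mu> (v + w) = tact' \<mu> v + tact' \<mu> w" "tact' \<mu> (c *\<^sub>q v) = c *\<^sub>q tact' \<mu> v" "tact' \<mu> 0 = 0"
  "tact' \<mu> (sum f I) = (\<Sum>i\<in>I. tact' \<mu> (f i))"
proof -
  interpret l: Vector_Spaces.linear "(*\<^sub>q)" "(*\<^sub>q)" "tact' \<mu>"
    unfolding tact'_def by (rule cvp.linear_construct[OF wbasis(2)])
  show "tact' \<mu> (v + w) = tact' \<mu> v + tact' \<mu> w" "tact' \<mu> (c *\<^sub>q v) = c *\<^sub>q tact' \<mu> v" "tact' \<mu> 0 = 0"
    "tact' \<mu> (sum f I) = (\<Sum>i\<in>I. tact' \<mu> (f i))"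
    by (simp_all add: l.add l.scale l.sum)
qed

lemma prj_basis: "e \<in> wbasis ==> prj \<mu> e = (if ewt e = \<mu> then e else 0)"
  unfolding prj_def by (rule cvp.construct_basis[OF wbasis(2)])

lemma tact'_basis: "e \<in> wbasis ==> tact' \<gamma> e = qpow (ip D (ewt e) \<gamma>) *\<^sub>q e"
  unfolding tact'_def by (rule cvp.construct_basis[OF wbasis(2)])

lemma V_induct [consumes 1, case_names zero add scale basis]:
  assumes "v \<in> V" "P 0" "\<And>v w. v \<in> V ==> w \<in> V ==> P v ==> P w ==> P (v + w)"
    "\<And>c v. v \<in> V ==> P v ==> P (c *\<^sub>q v)" "\<And>e. e \<in> wbasis ==> P e"
  shows "P v"
proof -
  have bV: "e \<in> wbasis ==> e \<in> V" for e using ewt(1) wsp_V by blast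
  have "v \<in> cv.span wbasis" using assms(1) wbasis(3) by simp
  hence "v \<in> V \<and> P v"
  proof (induction rule: cv.span_induct)
    case base
    show ?case unfolding cv.subspace_def using assms(2-4) by (auto intro: VI)
  qed (use assms(5) bV in blast)
  thus ?thesis by blast
qed

lemma prj_wsp: "v \<in> V ==> prj \<mu> v \<in> wsp \<mu>"
proof (induction rule: V_induct)
  case (basis e)
  thus ?case using ewt(1) cv.subspace_0[OF wsp_subspace] by (auto simp: prj_basis)
qed (auto simp: prj_linear cv.subspace_0[OF wsp_subspace] cv.subspace_add[OF wsp_subspace] cv.subspace_scale[OF wsp_subspace])

lemma prj_V: "v \<in> V ==> prj \<mu> v \<in> V"
  using prj_wsp wsp_V by blast

lemma prj_decomp:
  assumes "v \<in> V"
  shows "\<exists>I. finite I \<and> v = (\<Sum>\<mu>\<in>I. prj \<mu> v) \<and> (\<forall>\<mu>. \<mu> \<notin> I \<longrightarrow> prj \<mu> v = 0) \<and> (\<forall>\<mu>\<in>I. \<exists>is. \<mu> = M - wtl is)"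
  using assms
proof (induction rule: V_induct)
  case zero
  show ?case by (intro exI[of _ "{}"]) (simp add: prj_linear)
next
  case (add v w)
  then obtain I J where IJ: "finite I" "v = (\<Sum>\<mu>\<in>I. prj \<mu> v)" "\<forall>\<mu>. \<mu> \<notin> I \<longrightarrow> prj \<mu> v = 0" "\<forall>\<mu>\<in>I. \<exists>is. \<mu> = M - wtl is"
    "finite J" "w = (\<Sum>\<mu>\<in>J. prj \<mu> w)" "\<forall>\<mu>. \<mu> \<notin> J \<longrightarrow> prj \<mu> w = 0" "\<forall>\<mu>\<in>J. \<exists>is. \<mu> = M - wtl is" by blast
  have "v = (\<Sum>\<mu>\<in>I \<union> J. prj \<mu> v)"
    using IJ by (subst IJ(2)) (intro sum.mono_neutral_left, auto)
  moreover have "w = (\<Sum>\<mu>\<in>I \<union> J. prj \<mu> w)"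
    using IJ by (subst IJ(6)) (intro sum.mono_neutral_left, auto)
  ultimately have "v + w = (\<Sum>\<mu>\<in>I \<union> J. prj \<mu> (v + w))" by (simp add: prj_linear(1) sum.distrib)
  moreover have "\<forall>\<mu>. \<mu> \<notin> I \<union> J \<longrightarrow> prj \<mu> (v + w) = 0" using IJ(3,7) by (simp only: prj_linear(1)) simp
  moreover have "finite (I \<union> J)" "\<forall>\<mu>\<in>I \<union> J. \<exists>is. \<mu> = M - wtl is" using IJ(1,4,5,8) by auto
  ultimately show ?case by blast
next
  case (scale c v)
  then obtain I where I: "finite I" "v = (\<Sum>\<mu>\<in>I. prj \<mu> v)" "\<forall>\<mu>. \<mu> \<notin> I \<longrightarrow> prj \<mu> v = 0" "\<forall>\<mu>\<in>I. \<exists>is. \<mu> = M - wtl is"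
    by blast
  have "c *\<^sub>q v = (\<Sum>\<mu>\<in>I. prj \<mu> (c *\<^sub>q v))"
    by (subst I(2)) (simp add: prj_linear(2) cv.scale_sum_right)
  moreover have "\<forall>\<mu>. \<mu> \<notin> I \<longrightarrow> prj \<mu> (c *\<^sub>q v) = 0" using I(3) by (simp only: prj_linear(2)) simp
  ultimately show ?case using I(1,4) by blast
next
  case (basis e)
  thus ?case using ewt(2)[OF basis] by (intro exI[of _ "{ewt e}"]) (auto simp: prj_basis)
qed

text \<open>Independence of weight vectors identifies the decomposition of w along the chosen basis
  with the trivial one.\<close>

lemma prj_on_wsp:
  assumes "w \<in> wsp \<mu>"
  shows "prj \<nu> w = (if \<nu> = \<mu> then w else 0)"
proof -
  have wV: "w \<in> V" using assms by (rule wsp_V)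
  obtain I where I: "finite I" "w = (\<Sum>\<mu>\<in>I. prj \<mu> w)" "\<forall>\<mu>. \<mu> \<notin> I \<longrightarrow> prj \<mu> w = 0" using prj_decomp[OF wV] by blast
  have w1: "w = (\<Sum>\<nu>\<in>insert \<mu> I. prj \<nu> w)"
    using I by (subst I(2)) (intro sum.mono_neutral_left, auto)
  have w2: "w = (\<Sum>\<nu>\<in>insert \<mu> I. if \<nu> = \<mu> then w else 0)" using I(1) by simp
  have "prj \<nu> w - (if \<nu> = \<mu> then w else 0) = 0" if "\<nu> \<in> insert \<mu> I" for \<nu>
  proof (rule wsp_independent[of "insert \<mu> I" "\<lambda>\<nu>. prj \<nu> w - (if \<nu> = \<mu> then w else 0)"])
    show "(\<Sum>\<nu>\<in>insert \<mu> I. prj \<nu> w - (if \<nu> = \<mu> then w else 0)) = 0"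
      unfolding sum_subtractf using w1 w2 by simp
    show "prj \<nu> w - (if \<nu> = \<mu> then w else 0) \<in> wsp \<nu>" for \<nu>
      using prj_wsp[OF wV] assms cv.subspace_0[OF wsp_subspace]
      by (intro cv.subspace_diff[OF wsp_subspace]) auto
  qed (use I(1) that in auto)
  thus ?thesis using I(3) by (cases "\<nu> \<in> insert \<mu> I") auto
qed

lemma wsp_nonzero_weight: "w \<in> wsp \<mu> ==> w \<noteq> 0 ==> \<exists>is. \<mu> = M - wtl is"
  using prj_decomp[of w] prj_on_wsp[of w \<mu> \<mu>] wsp_V[of w \<mu>] by metis

lemma wtl_eq_0_iff: "wtl is = 0 \<longleftrightarrow> is = []"
proof
  assume "wtl is = 0"
  hence "of_nat (length is) = (0::rat)" using length_wtl[of "is"] by simp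
  thus "is = []" by simp
qed simp

lemma wtl_length: "wtl is = wtl js ==> length is = length js"
  using length_wtl[of "is"] length_wtl[of js] by simp

text \<open>Every basis vector is a word y_I v_\<lambda>, and only the empty word has weight
  \<lambda>.\<close>

lemma wsp_top: "w \<in> wsp M ==> \<exists>c. w = c *\<^sub>q hv"
proof -
  have "\<exists>c. prj M v = c *\<^sub>q hv" if "v \<in> V" for v
    using that
  proof (induction rule: V_induct)
    case zero
    show ?case by (auto simp: prj_linear intro: exI[of _ 0])
  next
    case (add v w)
    then obtain c d where "prj M v = c *\<^sub>q hv" "prj M w = d *\<^sub>q hv" by blast
    hence "prj M (v + w) = (c + d) *\<^sub>q hv" by (simp add: prj_linear qscale_add_left)
    thus ?case by blast
  next
    case (scale c v)
    thus ?case by (auto simp: prj_linear qscale_qscale)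
  next
    case (basis e)
    obtain "is" where e: "e = yw (\<lambda>x. x) is hv" using wbasis(1) basis by blast
    have "prj M e = (if M = M - wtl is then e else 0)"
      unfolding e by (rule prj_on_wsp[OF yw_wsp[OF uauto_id hv_wsp]])
    moreover have "M = M - wtl is \<longleftrightarrow> is = []" using wtl_eq_0_iff[of "is"] by (auto simp: algebra_simps)
    ultimately show ?case by (auto simp: e intro: exI[of _ 0] exI[of _ 1] simp: qscale_one)
  qed
  thus "w \<in> wsp M ==> \<exists>c. w = c *\<^sub>q hv" using prj_on_wsp[of w M M] wsp_V by metis
qed

lemma tact'_wsp: "w \<in> wsp \<mu> ==> tact' \<gamma> w = qpow (ip D \<mu> \<gamma>) *\<^sub>q w"
proof -
  have "tact' \<gamma> (prj \<mu> v) = qpow (ip D \<mu> \<gamma>) *\<^sub>q prj \<mu> v" if "v \<in> V" for v \<mu>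
    using that
  proof (induction rule: V_induct)
    case (basis e)
    thus ?case by (simp add: prj_basis tact'_basis tact'_linear)
  qed (simp_all add: prj_linear tact'_linear qscale_simps mult.commute)
  thus "w \<in> wsp \<mu> ==> tact' \<gamma> w = qpow (ip D \<mu> \<gamma>) *\<^sub>q w" using prj_on_wsp[of w \<mu> \<mu>] wsp_V by metis
qed

lemma tact'_Ppi: "v \<in> V ==> \<gamma> \<in> Ppi D ==> tact' \<gamma> v = act (tau D \<gamma>) v"
proof (induction rule: V_induct)
  case (basis e)
  thus ?case using ewt(3) by (simp add: tact'_basis)
qed (simp_all add: tact'_linear act_add act_scale)

lemma tact'_V: "v \<in> V ==> tact' \<gamma> v \<in> V"
proof (induction rule: V_induct)
  case (basis e)
  hence "e \<in> V" using ewt(1) wsp_V by blast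
  thus ?case using basis by (simp add: tact'_basis VI)
qed (simp_all add: tact'_linear VI)

end

section \<open>Extension of the action to the whole ambient algebra\<close>

context hwmod begin

text \<open>
  The presentation extends the action to the torus elements \<open>\<tau>(v)\<close> for all rational weights \<open>v\<close>.
\<close>

fun gop :: "'n qgen => 'v => 'v" where
  "gop (GX i) w = act (gx D i) w"
| "gop (GY i) w = act (gy D i) w"
| "gop (GT v) w = tact' v w"

definition fact' :: "'n qgen free => 'v => 'v" where
  "fact' p w = pmext (\<lambda>l c. c *\<^sub>q foldr gop (letters l) w) p"

lemma gop_V: "w \<in> V ==> gop x w \<in> V"
  by (cases x) (auto simp: act_V tact'_V)

lemma gop_linear: "v \<in> V ==> w \<in> V ==> gop x (v + w) = gop x v + gop x w" "v \<in> V ==> gop x (c *\<^sub>q v) = c *\<^sub>q gop x v"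
  by (cases x; simp add: act_add act_scale tact'_linear)+

lemma gops_V: "w \<in> V ==> foldr gop xs w \<in> V"
  by (induction xs) (auto simp: gop_V)

lemma gops_linear: "v \<in> V ==> w \<in> V ==> foldr gop xs (v + w) = foldr gop xs v + foldr gop xs w"
  "v \<in> V ==> foldr gop xs (c *\<^sub>q v) = c *\<^sub>q foldr gop xs v"
  by (induction xs) (auto simp: gop_linear gops_V)

lemma fact'_0 [simp]: "fact' 0 w = 0"
  by (simp add: fact'_def)

lemma fact'_add: "fact' (p + r) w = fact' p w + fact' r w"
  unfolding fact'_def by (rule pmext_add) (simp_all add: qscale_add_left)

lemma fact'_single: "fact' (single l c) w = c *\<^sub>q foldr gop (letters l) w"
  unfolding fact'_def by (rule pmext_single) simp

lemma fact'_diff: "fact' (p - r) w = fact' p w - fact' r w"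
  using fact'_add[of "p - r" r w] by simp

lemma fact'_V: "w \<in> V ==> fact' p w \<in> V"
  by (induction p rule: pm_induct) (simp_all add: fact'_add fact'_single VI gops_V)

lemma fact'_linear: "v \<in> V ==> w \<in> V ==> fact' p (v + w) = fact' p v + fact' p w"
  "v \<in> V ==> fact' p (c *\<^sub>q v) = c *\<^sub>q fact' p v"
  by (induction p rule: pm_induct)
    (simp_all add: fact'_add fact'_single gops_linear qscale_add_right qscale_qscale mult.commute)

lemma fact'_mult: "w \<in> V ==> fact' (p * r) w = fact' p (fact' r w)"
proof (induction p rule: pm_induct)
  case (single l c)
  thus ?case
  proof (induction r rule: pm_induct)
    case zero
    thus ?case using gops_linear(2)[OF VI(1), of "letters l" 0] by (simp add: fact'_single)
  next
    case (single k d)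
    show ?case using single
      by (simp add: mult_single fact'_single plus_word_def gops_linear gops_V qscale_qscale)
  next
    case (add p r)
    thus ?case by (simp add: ring_distribs fact'_add fact'_linear fact'_V)
  qed
qed (simp_all add: ring_distribs fact'_add)

lemma fact'_gen [simp]: "fact' (gen x) w = gop x w"
  by (simp add: gen_def fact'_single qscale_one)

lemma fact'_fconst [simp]: "fact' (fconst c) w = c *\<^sub>q w"
  by (simp add: fconst_def fact'_single zero_word_def)

lemma fact'_one [simp]: "fact' 1 w = w"
  using fact'_fconst[of 1 w] by (simp add: qscale_one)

text \<open>A relation of this kind needs no verification on the module: its value in U is 0, hence
  it acts as 0.\<close>

definition fgood :: "'n qgen free set" where
  "fgood = {p. ev p \<in> Uch D \<and> (\<forall>w\<in>V. fact' p w = act (ev p) w)}"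

lemma fgood_ops: "p \<in> fgood ==> r \<in> fgood ==> p + r \<in> fgood" "p \<in> fgood ==> r \<in> fgood ==> p * r \<in> fgood"
  "p \<in> fgood ==> r \<in> fgood ==> p - r \<in> fgood" "fconst c \<in> fgood" "0 \<in> fgood" "1 \<in> fgood"
  "gen (GX i) \<in> fgood" "gen (GY i) \<in> fgood" "v \<in> Ppi D ==> gen (GT v) \<in> fgood"
proof -
  note U = subalgD[OF subalg_sets(2)]
  show 1: "p + r \<in> fgood" if "p \<in> fgood" "r \<in> fgood" for p r
    using that by (auto simp: fgood_def feval_add fact'_add act_add_left U)
  show 2: "p * r \<in> fgood" if "p \<in> fgood" "r \<in> fgood" for p r
    using that by (auto simp: fgood_def feval_mult fact'_mult act_mult U act_V)
  show 3: "fconst c \<in> fgood" for c by (auto simp: fgood_def U act_scale_left act_one)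
  have e: "p - r = p + fconst (-1) * r" for p r :: "'n qgen free"
    by (simp add: fconst_def single_uminus)
  show "p - r \<in> fgood" if "p \<in> fgood" "r \<in> fgood" for p r
    unfolding e by (intro 1 2 3 that)
  show "0 \<in> fgood" "1 \<in> fgood" using 3[of 0] 3[of 1] by simp_all
qed (auto simp: fgood_def tact'_Ppi)

lemma fgood_power: "p \<in> fgood ==> p ^ n \<in> fgood"
  by (induction n) (auto intro: fgood_ops)

lemma fgood_sum: "(\<And>i. i \<in> I ==> p i \<in> fgood) ==> sum p I \<in> fgood"
  by (induction I rule: infinite_finite_induct) (auto intro: fgood_ops)

lemma fgood_zero: "p \<in> fgood ==> ev p = 0 ==> w \<in> V ==> fact' p w = 0"
  by (simp add: fgood_def)

text \<open>The commutator and Serre relations involve only torus elements from the root lattice and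
  hold through \<open>fgood\<close>. Those containing an arbitrary \<open>GT v\<close> are checked
  on weight vectors, where \<open>tact'\<close> is a scalar.\<close>

lemma relations_act:
  assumes p: "p \<in> q_relations D" and w: "w \<in> V"
  shows "fact' p w = 0"
proof -
  have sr: "sr i \<in> Ppi D" "- sr i \<in> Ppi D" for i by (simp_all add: Qpi_Ppi)
  have wt: "fact' p w = 0" if "\<And>e \<mu>. e \<in> wsp \<mu> ==> fact' p e = 0"
    using w
  proof (induction rule: V_induct)
    case zero
    show ?case using fact'_linear(2)[OF VI(1), of p 0] by simp
  next
    case (basis e)
    thus ?case using that ewt(1) by blast
  qed (simp_all add: fact'_linear)
  have X: "act (gx D j) e \<in> wsp (\<mu> + sr j)" if "e \<in> wsp \<mu>" for e \<mu> j
    using tw_gx_wsp[OF uauto_id that] .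
  have Y: "act (gy D j) e \<in> wsp (\<mu> - sr j)" if "e \<in> wsp \<mu>" for e \<mu> j
    using tw_gy_wsp[OF uauto_id that] .
  have serre: "serre D a b i j \<in> fgood" if "gen a \<in> fgood" "gen b \<in> fgood" for a b i j
    unfolding serre_def Let_def using that by (intro fgood_sum fgood_ops(2) fgood_power fgood_ops(4))
  consider "p = gen (GT 0) - 1" | u v where "p = gen (GT u) * gen (GT v) - gen (GT (u + v))"
    | v j where "p = gen (GT v) * gen (GX j) - fconst (qpow (ip D v (sr j))) * gen (GX j) * gen (GT v)"
    | v j where "p = gen (GT v) * gen (GY j) - fconst (qpow (- ip D v (sr j))) * gen (GY j) * gen (GT v)"
    | i j where "p = gen (GX i) * gen (GY j) - gen (GY j) * gen (GX i) -
        (if i = j then fconst (1 / (qroot D i - inverse (qroot D i))) *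
                       (gen (GT (sr i)) - gen (GT (- sr i))) else 0)"
    | a b i j where "p = serre D (GX a) (GX b) i j" | a b i j where "p = serre D (GY a) (GY b) i j"
    using p unfolding q_relations_def by blast
  thus ?thesis
  proof cases
    case 1
    show ?thesis by (rule wt) (simp add: 1 fact'_diff tact'_wsp qscale_one)
  next
    case (2 u v)
    show ?thesis
      by (rule wt) (simp add: 2 fact'_diff fact'_mult wsp_V tact'_wsp tact'_linear qscale_qscale ip_add_right qpow_add mult.commute)
  next
    case (3 v j)
    show ?thesis
    proof (rule wt)
      fix e \<mu> assume e: "e \<in> wsp \<mu>"
      show "fact' p e = 0"
        unfolding 3 using e wsp_V[OF e]
        by (simp add: fact'_diff fact'_mult tact'_wsp[OF X[OF e]] tact'_wsp[OF e] act_scale qscale_qscale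
            ip_add_left ip_comm[of v] act_V VI flip: qpow_add) (simp add: add.commute)
    qed
  next
    case (4 v j)
    show ?thesis
    proof (rule wt)
      fix e \<mu> assume e: "e \<in> wsp \<mu>"
      show "fact' p e = 0"
        unfolding 4 using e wsp_V[OF e]
        by (simp add: fact'_diff fact'_mult tact'_wsp[OF Y[OF e]] tact'_wsp[OF e] act_scale qscale_qscale
            ip_diff_left ip_comm[of v] act_V VI flip: qpow_add)
    qed
  next
    case (5 i j)
    have "p \<in> fgood" unfolding 5 using sr by (cases "i = j") (auto intro!: fgood_ops)
    thus ?thesis using fgood_zero rel_0[OF p] w by blast
  next
    case (6 a b i j)
    have "p \<in> fgood" unfolding 6 by (intro serre fgood_ops)
    thus ?thesis using fgood_zero rel_0[OF p] w by blast
  next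
    case (7 a b i j)
    have "p \<in> fgood" unfolding 7 by (intro serre fgood_ops)
    thus ?thesis using fgood_zero rel_0[OF p] w by blast
  qed
qed

lemma fact'_wd:
  assumes "ev p = ev r" "w \<in> V"
  shows "fact' p w = fact' r w"
proof -
  define A where "A = {p. \<forall>w\<in>V. fact' p w = 0}"
  have z: "fact' p 0 = 0" for p using fact'_linear(2)[OF VI(1), of p 0] by simp
  have "two_sided_ideal A"
    unfolding two_sided_ideal_def A_def by (auto simp: fact'_add fact'_mult fact'_V z)
  moreover have "q_relations D \<subseteq> A" using relations_act by (auto simp: A_def)
  ultimately have "two_sided_ideal hull q_relations D \<subseteq> A" by (intro hull_minimal)
  moreover have "p - r \<in> two_sided_ideal hull q_relations D"
    using qg assms(1) unfolding quantum_group_def presented_by_def by (auto simp: feval_diff)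
  ultimately have "fact' (p - r) w = 0" using assms(2) by (auto simp: A_def)
  thus ?thesis by (simp add: fact'_diff)
qed

definition rep :: "'u => 'v => 'v" where "rep u = fact' (SOME p. ev p = u)"

lemma rep_ev: "w \<in> V ==> rep (ev p) w = fact' p w"
  unfolding rep_def using someI[of "\<lambda>r. ev r = ev p" p] by (intro fact'_wd) auto

lemma ev_surj: "\<exists>p. u = ev p"
  using qg unfolding quantum_group_def presented_by_def by (metis rangeE UNIV_I)

lemma rep_V: "w \<in> V ==> rep u w \<in> V"
  by (simp add: rep_def fact'_V)

lemma rep_linear: "v \<in> V ==> w \<in> V ==> rep u (v + w) = rep u v + rep u w" "v \<in> V ==> rep u (c *\<^sub>q v) = c *\<^sub>q rep u v"
  by (simp_all add: rep_def fact'_linear)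

lemma rep_mult: "w \<in> V ==> rep (a * b) w = rep a (rep b w)"
proof -
  assume w: "w \<in> V"
  obtain p r where "a = ev p" "b = ev r" using ev_surj by metis
  thus ?thesis using w by (simp add: rep_ev fact'_mult fact'_V flip: feval_mult)
qed

lemma rep_add: "w \<in> V ==> rep (a + b) w = rep a w + rep b w"
proof -
  assume w: "w \<in> V"
  obtain p r where "a = ev p" "b = ev r" using ev_surj by metis
  thus ?thesis using w by (simp add: rep_ev fact'_add flip: feval_add)
qed

lemma rep_scale: "w \<in> V ==> rep (c *\<^sub>q a) w = c *\<^sub>q rep a w"
proof -
  assume w: "w \<in> V"
  obtain p where p: "a = ev p" using ev_surj by metis
  have "c *\<^sub>q a = ev (fconst c * p)" by (simp add: p feval_mult qscale_mult_left)
  thus ?thesis using w by (simp add: p rep_ev fact'_mult)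
qed

lemma rep_one: "w \<in> V ==> rep 1 w = w"
  using rep_ev[of w 1] by simp

lemma rep_zero [simp]: "w \<in> V ==> rep 0 w = 0"
  using rep_ev[of w 0] by simp

lemma rep_gens: "w \<in> V ==> rep (gx D i) w = act (gx D i) w" "w \<in> V ==> rep (gy D i) w = act (gy D i) w"
  "w \<in> V ==> rep (tau D v) w = tact' v w"
  using rep_ev[of w "gen (GX i)"] rep_ev[of w "gen (GY i)"] rep_ev[of w "gen (GT v)"] by simp_all

lemma rep_tau: "w \<in> wsp \<mu> ==> rep (tau D v) w = qpow (ip D \<mu> v) *\<^sub>q w"
  by (simp add: rep_gens wsp_V tact'_wsp)

lemma rep_diff: "w \<in> V ==> rep (a - b) w = rep a w - rep b w"
  using rep_add[of w "a - b" b] by simp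

lemma rep_sum: "w \<in> V ==> rep (sum f I) w = (\<Sum>i\<in>I. rep (f i) w)"
  by (induction I rule: infinite_finite_induct) (simp_all add: rep_add)

lemma rep_linear_sum: "(\<And>i. i \<in> I ==> f i \<in> V) ==> rep u (sum f I) = (\<Sum>i\<in>I. rep u (f i))"
proof (induction I rule: infinite_finite_induct)
  case (insert i I)
  have "sum f I \<in> V" using insert by (intro cv.subspace_sum[OF V_subspace]) auto
  thus ?case using insert by (simp add: rep_linear)
qed (use rep_linear(2)[OF VI(1), of u 0] in simp_all)

lemma rep_act: "u \<in> Uch D ==> w \<in> V ==> rep u w = act u w"
proof -
  define S where "S = {u \<in> Uch D. \<forall>w\<in>V. rep u w = act u w}"
  note U = subalgD[OF subalg_sets(2)]
  have "subalg S" unfolding subalg_def cv.subspace_def S_def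
    by (auto simp: U rep_add act_add_left rep_scale act_scale_left rep_mult act_mult act_V rep_one act_one)
  moreover have "range (gx D) \<union> range (gy D) \<union> tau D ` Ppi D \<subseteq> S"
    by (auto simp: S_def rep_gens tact'_Ppi)
  ultimately have "Uch D \<subseteq> S" unfolding Uch_def[of D] by (intro alg_gen_minimal)
  thus "u \<in> Uch D ==> w \<in> V ==> rep u w = act u w" by (auto simp: S_def)
qed

lemma rep_fx_hv: "rep (fx f) hv = fcst f *\<^sub>q hv"
proof (induction f rule: free_induct)
  case (gen j f)
  have "rep (fx (gen j * f)) hv = rep (gx D j) (rep (fx f) hv)" by (simp add: rep_mult hv)
  also have "\<dots> = 0" unfolding gen using hv by (simp add: rep_linear rep_gens)
  finally show ?case by simp
qed (simp_all add: rep_one rep_add rep_mult rep_scale qscale_simps hv)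

lemma rep_fx_wsp: "w \<in> wsp \<mu> ==> rep (xword ks) w \<in> wsp (\<mu> + wtl ks)"
proof (induction ks)
  case (Cons k ks)
  have "rep (xword ks) w \<in> wsp (\<mu> + wtl ks)" using Cons by blast
  from tw_gx_wsp[OF uauto_id this, of k] have "act (gx D k) (rep (xword ks) w) \<in> wsp (\<mu> + wtl (k # ks))"
    by (simp add: add_ac)
  thus ?case using Cons.prems by (simp add: rep_mult rep_gens rep_V wsp_V)
qed (simp add: rep_one wsp_V)

text \<open>Two expansions of a into elements tau(v) act on v_\<lambda> by the same scalar, which
  makes the definite description in \<open>zchar\<close> well defined.\<close>

lemma zchar_rep:
  assumes "a \<in> cv.span (range (tau D))"
  shows "rep a hv = zchar D M a *\<^sub>q hv"
proof -
  define tv where "tv p = (\<Sum>v\<in>keys p. lookup p v *\<^sub>q tau D v)" for p :: "'n wt \<Rightarrow>\<^sub>0 cc"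
  define cv where "cv p = (\<Sum>v\<in>keys p. lookup p v * qpow (ip D M v))" for p :: "'n wt \<Rightarrow>\<^sub>0 cc"
  have r: "rep (tv p) hv = cv p *\<^sub>q hv" for p
    unfolding tv_def cv_def using hv_wsp hv(1)
    by (simp add: rep_sum rep_scale rep_tau qscale_qscale cv.scale_sum_left)
  have add: "tv (p + r) = tv p + tv r" for p r
    unfolding tv_def using setsum_keys_plus_distrib[of "\<lambda>v c. c *\<^sub>q tau D v" p r]
    by (simp add: qscale_add_left)
  have "\<exists>p. a = tv p" using assms
  proof (induction rule: cv.span_induct_alt)
    case base
    show ?case by (intro exI[of _ 0]) (simp add: tv_def)
  next
    case (step c x y)
    then obtain v p where "x = tau D v" "y = tv p" by blast
    moreover have "c *\<^sub>q tau D v = tv (single v c)" by (simp add: tv_def)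
    ultimately have "c *\<^sub>q x + y = tv (single v c + p)" by (simp only: add)
    thus ?case by blast
  qed
  then obtain p where p: "a = tv p" by blast
  have "zchar D M a = cv p"
    unfolding zchar_def tv_def[symmetric] cv_def[symmetric]
  proof (rule the_equality)
    show "\<exists>q. a = tv q \<and> cv p = cv q" using p by blast
    fix c assume "\<exists>q. a = tv q \<and> c = cv q"
    then obtain q where q: "a = tv q" "c = cv q" by blast
    hence "cv p *\<^sub>q hv = cv q *\<^sub>q hv" using r p by metis
    thus "c = cv p" using q hv(2) by simp
  qed
  thus ?thesis using r p by simp
qed

lemma zchar_0: "zchar D M 0 = 0"
  using zchar_rep[of 0] hv by (simp add: cv.span_zero)

section \<open>Invariant functionals and the Harish-Chandra map\<close>

definition binv :: "'u set => ('v => cc) => bool" where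
  "binv B \<eta> \<longleftrightarrow> (\<forall>v\<in>V. \<forall>w\<in>V. \<eta> (v + w) = \<eta> v + \<eta> w) \<and> (\<forall>c. \<forall>v\<in>V. \<eta> (c *\<^sub>q v) = c * \<eta> v) \<and>
     (\<forall>b\<in>B. \<forall>v\<in>V. \<eta> (act b v) = counit b * \<eta> v)"

lemma binvD: "binv B \<eta> ==> v \<in> V ==> w \<in> V ==> \<eta> (v + w) = \<eta> v + \<eta> w" "binv B \<eta> ==> v \<in> V ==> \<eta> (c *\<^sub>q v) = c * \<eta> v"
  "binv B \<eta> ==> b \<in> B ==> v \<in> V ==> \<eta> (act b v) = counit b * \<eta> v"
  by (auto simp: binv_def)

lemma binv_0: "binv B \<eta> ==> \<eta> 0 = 0"
  using binvD(2)[of B \<eta> 0 0] VI(1) by simp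

text \<open>A multiple of \<gamma> lies in the root lattice, so its torus element belongs to B and
  has counit 1; the functional can be nonzero only on weight spaces where it acts by 1.\<close>

lemma binv_fixed_weight:
  assumes B: "B \<in> Bfam R D" and \<eta>: "binv B \<eta>" and w: "w \<in> wsp \<mu>" "\<eta> w \<noteq> 0" and \<gamma>: "Th D \<gamma> = \<gamma>"
  shows "ip D \<mu> \<gamma> = 0"
proof -
  obtain N :: nat where N: "N > 0" "rscale (of_nat N) \<gamma> \<in> Qpi" using multiple_in_Qpi .
  have "tau D (rscale (of_nat N) \<gamma>) \<in> B" using B N(2) \<gamma> by (intro Bfam_TTh) (auto simp: Th_rscale)
  hence "\<eta> (act (tau D (rscale (of_nat N) \<gamma>)) w) = \<eta> w"
    using binvD(3)[OF \<eta> _ wsp_V[OF w(1)]] by simp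
  moreover have "act (tau D (rscale (of_nat N) \<gamma>)) w = qpow (of_nat N * ip D \<mu> \<gamma>) *\<^sub>q w"
    using tw_tau[OF uauto_id N(2) w(1)] by simp
  ultimately have "qpow (of_nat N * ip D \<mu> \<gamma>) * \<eta> w = \<eta> w"
    using binvD(2)[OF \<eta> wsp_V[OF w(1)]] by metis
  hence "qpow (of_nat N * ip D \<mu> \<gamma>) = 1" using w(2) by simp
  thus ?thesis using N(1) by (simp add: qpow_eq_1_iff)
qed

lemma binv_sum: "binv B \<eta> ==> (\<And>i. i \<in> I ==> f i \<in> V) ==> \<eta> (sum f I) = (\<Sum>i\<in>I. \<eta> (f i))"
proof (induction I rule: infinite_finite_induct)
  case (insert i I)
  have "sum f I \<in> V" using insert by (intro cv.subspace_sum[OF V_subspace]) auto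
  thus ?case using insert by (simp add: binvD)
qed (simp_all add: binv_0)

text \<open>Extends invariance from T_\<Theta> to all rational weights fixed by \<Theta>, including
  the half weights in \<open>TThch\<close>: the functional lives only on weights orthogonal to
  \<gamma>.\<close>

lemma binv_tau:
  assumes B: "B \<in> Bfam R D" and \<eta>: "binv B \<eta>" and w: "w \<in> V" and \<gamma>: "Th D \<gamma> = \<gamma>"
  shows "\<eta> (rep (tau D \<gamma>) w) = \<eta> w"
proof -
  obtain I where I: "finite I" "w = (\<Sum>\<mu>\<in>I. prj \<mu> w)" using prj_decomp[OF w] by blast
  have V: "prj \<mu> w \<in> V" "rep (tau D \<gamma>) (prj \<mu> w) \<in> V" for \<mu> using w by (simp_all add: prj_V rep_V)
  have "\<eta> (rep (tau D \<gamma>) (prj \<mu> w)) = \<eta> (prj \<mu> w)" for \<mu>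
    using binv_fixed_weight[OF B \<eta> prj_wsp[OF w] _ \<gamma>, of \<mu>] V(1) w
    by (cases "\<eta> (prj \<mu> w) = 0") (auto simp: rep_tau[OF prj_wsp] binvD(2)[OF \<eta>])
  hence "(\<Sum>\<mu>\<in>I. \<eta> (rep (tau D \<gamma>) (prj \<mu> w))) = (\<Sum>\<mu>\<in>I. \<eta> (prj \<mu> w))" by simp
  hence "\<eta> (rep (tau D \<gamma>) (\<Sum>\<mu>\<in>I. prj \<mu> w)) = \<eta> (\<Sum>\<mu>\<in>I. prj \<mu> w)"
    using V by (simp add: rep_linear_sum binv_sum[OF \<eta>])
  thus ?thesis using I(2) by simp
qed

text \<open>Under the functional, elements of \<open>span_prod B (TThch D)\<close> act through the
  counit, so augmentation elements in the leftmost position give 0.\<close>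

lemma binv_BTplusU:
  assumes B: "B \<in> Bfam R D" and \<eta>: "binv B \<eta>" and a: "a \<in> BTplusU D B" and w: "w \<in> V"
  shows "\<eta> (rep a w) = 0"
proof -
  have BT: "\<eta> (rep x v) = counit x * \<eta> v" if "x \<in> span_prod B (TThch D)" "v \<in> V" for x v
    using that(1) unfolding span_prod_def
  proof (induction rule: cv.span_induct_alt)
    case base
    show ?case using that(2) by (simp add: binv_0[OF \<eta>])
  next
    case (step c x y)
    then obtain b t where bt: "x = b * t" "b \<in> B" "t \<in> TThch D" by blast
    then obtain \<nu> where t: "t = tau D (rscale (1/2) (\<nu> + Th D \<nu>))" by (auto simp: TThch_def)
    have bU: "b \<in> Uch D" using bt(2) B Bfam_Uq Uq_in_Uch by blast
    have tv: "rep t v \<in> V" using that(2) by (rule rep_V)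
    have "\<eta> (rep x v) = \<eta> (act b (rep t v))" using that(2) tv bU by (simp add: bt rep_mult rep_act)
    also have "\<dots> = counit b * \<eta> v"
      using binvD(3)[OF \<eta> bt(2) tv] binv_tau[OF B \<eta> that(2) fixed_plus_tilde] by (simp add: t)
    finally have "\<eta> (rep x v) = counit x * \<eta> v" by (simp add: bt t counit_mult)
    thus ?case using step that(2)
      by (simp add: rep_add rep_scale binvD[OF \<eta>] rep_V VI counit_add counit_scale ring_distribs)
  qed
  show ?thesis using a unfolding BTplusU_def span_prod_def[of "aug _"]
  proof (induction rule: cv.span_induct_alt)
    case base
    show ?case using w by (simp add: binv_0[OF \<eta>])
  next
    case (step c x y)
    then obtain b u where "x = b * u" "b \<in> aug (span_prod B (TThch D))" by blast
    hence "\<eta> (rep x w) = 0" using BT[of b "rep u w"] w by (simp add: rep_mult rep_V aug_def)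
    thus ?case using step w by (simp add: rep_add rep_scale binvD[OF \<eta>] rep_V VI)
  qed
qed

lemma Nplus_hv:
  assumes "a \<in> span_prod (aug (Nplus D)) (Ach D)"
  shows "rep a hv = 0"
  using assms unfolding span_prod_def
proof (induction rule: cv.span_induct_alt)
  case base
  show ?case using hv by simp
next
  case (step c x y)
  then obtain n t where nt: "x = n * t" "n \<in> aug (Nplus D)" "t \<in> Ach D" by blast
  then obtain v where t: "t = tau D v" by (auto simp: Ach_def)
  obtain f where f: "n = fx f" using nt(2) Nplus_nfree by (auto simp: aug_def)
  have "fcst f = 0" using nt(2) f counit_fx[of f] by (simp add: aug_def)
  hence "rep x hv = 0" using hv hv_wsp
    by (simp add: nt(1) t f rep_mult rep_tau[OF hv_wsp] rep_linear rep_fx_hv)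
  thus ?case using step hv by (simp add: rep_add rep_scale)
qed

lemma Ach_span: "cv.span (Ach D) \<subseteq> cv.span (range (tau D))"
  by (rule cv.span_mono) (auto simp: Ach_def)

text \<open>Of the three parts of u, the one in \<open>BTplusU D B\<close> is annihilated by \<eta>
  and the one in N^+_+ A kills v_\<lambda>; only the torus part remains.\<close>

lemma HC_functional:
  assumes B: "B \<in> Bfam R D" and \<eta>: "binv B \<eta>" and hc: "harish_chandra D B P" and u: "u \<in> Uch D"
  shows "\<eta> (rep u hv) = zchar D M (P u) * \<eta> hv"
proof -
  have P: "P u \<in> cv.span (Ach D)" "u - P u \<in> HC_complement D B" using hc u by (auto simp: harish_chandra_def)
  then obtain a b where ab: "u - P u = a + b" "a \<in> BTplusU D B" "b \<in> span_prod (aug (Nplus D)) (Ach D)"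
    by (auto simp: HC_complement_def)
  have "u = P u + (a + b)" using ab(1) by (metis add_diff_cancel_left' diff_add_cancel add.commute)
  hence "rep u hv = rep (P u) hv + (rep a hv + rep b hv)" using hv(1) by (metis rep_add)
  also have "\<dots> = zchar D M (P u) *\<^sub>q hv + rep a hv"
    using zchar_rep[of "P u"] P(1) Ach_span Nplus_hv[OF ab(3)] by auto
  finally show ?thesis
    using binv_BTplusU[OF B \<eta> ab(2) hv(1)] hv(1) by (simp add: binvD[OF \<eta>] VI rep_V)
qed

text \<open>All of V is reached from v_\<lambda>, and \<open>HC_functional\<close> expresses each
  value through the one at v_\<lambda>.\<close>

lemma binv_eq_0:
  assumes B: "B \<in> Bfam R D" and \<eta>: "binv B \<eta>" and hc: "harish_chandra D B P" and 0: "\<eta> hv = 0" and w: "w \<in> V"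
  shows "\<eta> w = 0"
proof -
  obtain u where u: "u \<in> Uq D" "w = act u hv" using cyclic[OF hv(1,2) w] .
  hence "w = rep u hv" using rep_act Uq_in_Uch hv(1) by metis
  thus ?thesis using HC_functional[OF B \<eta> hc Uq_in_Uch[OF u(1)]] 0 by simp
qed

text \<open>\<open>\<eta>\<close> is determined by its value at \<open>hv\<close>, so the centralizer of \<open>B\<close> acts on it by scalars.\<close>

lemma binv_scalar:
  assumes B: "B \<in> Bfam R D" and \<eta>: "binv B \<eta>" and hc: "harish_chandra D B P"
    and c: "c \<in> UB D B" and w: "w \<in> V"
  shows "\<eta> (rep c w) = zchar D M (P c) * \<eta> w"
proof -
  have cU: "c \<in> Uch D" and comm: "\<And>b. b \<in> B ==> b * c = c * b" using c unfolding UB_iff[OF B] by auto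
  have BU: "b \<in> Uch D" if "b \<in> B" for b using that B Bfam_Uq Uq_in_Uch by blast
  \<comment> \<open>The difference is again B-invariant, since c commutes with B, and it vanishes at
    v_\<lambda>.\<close>
  define \<eta>' where "\<eta>' w = \<eta> (rep c w) - zchar D M (P c) * \<eta> w" for w
  have "binv B \<eta>'"
    unfolding binv_def
  proof (intro conjI ballI allI)
    fix b v assume b: "b \<in> B" and v: "v \<in> V"
    have "rep c (act b v) = act b (rep c v)"
      using v BU[OF b] cU comm[OF b] by (simp add: rep_act act_V flip: act_mult)
    thus "\<eta>' (act b v) = counit b * \<eta>' v"
      using binvD(3)[OF \<eta> b] rep_V v by (simp add: \<eta>'_def ring_distribs mult_ac)
  qed (simp_all add: \<eta>'_def rep_linear binvD[OF \<eta>] rep_V ring_distribs mult_ac)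
  moreover have "\<eta>' hv = 0" using HC_functional[OF B \<eta> hc cU] by (simp add: \<eta>'_def)
  ultimately have "\<eta>' w = 0" by (rule binv_eq_0[OF B _ hc _ w])
  thus ?thesis by (simp add: \<eta>'_def)
qed

end

section \<open>Evaluation at highest weights\<close>

lemma lookup_single_shift:
  fixes p :: "'k::group_add \<Rightarrow>\<^sub>0 'c::semiring_0"
  shows "lookup (single k c * p) (k + v) = c * lookup p v"
proof (induction p rule: pm_induct)
  case (single k' d)
  show ?case by (simp add: mult_single lookup_single when_def)
qed (simp_all add: lookup_add ring_distribs)

lemma keys_single_shift:
  "v \<in> keys (single k c * p) ==> \<exists>w\<in>keys p. v = k + w"
  using keys_mult[of "single k c" p] by (auto split: if_splits)

lemma zval_pmext: "zval D p \<beta> = pmext (\<lambda>v c. c * qpow (ip D v \<beta>)) p"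
  by (simp add: zval_def pmext_def)

lemma zval_0 [simp]: "zval D 0 \<beta> = 0"
  by (simp add: zval_pmext)

lemma zval_add: "zval D (p + r) \<beta> = zval D p \<beta> + zval D r \<beta>"
  unfolding zval_pmext by (rule pmext_add) (simp_all add: ring_distribs)

lemma zval_single: "zval D (single v c) \<beta> = c * qpow (ip D v \<beta>)"
  unfolding zval_pmext by (rule pmext_single) simp

lemma zval_diff: "zval D (p - r) \<beta> = zval D p \<beta> - zval D r \<beta>"
  using zval_add[of D "p - r" r \<beta>] by simp

lemma zval_mult: "zval D (p * r) \<beta> = zval D p \<beta> * zval D r \<beta>"
proof (induction p rule: pm_induct)
  case (single w c)
  show ?case
  proof (induction r rule: pm_induct)
    case (single v d)
    show ?case by (simp add: mult_single zval_single ip_add_left qpow_add)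
  qed (simp_all add: ring_distribs zval_add)
qed (simp_all add: ring_distribs zval_add)

lemma zval_sum: "zval D (sum f I) \<beta> = (\<Sum>i\<in>I. zval D (f i) \<beta>)"
  by (induction I rule: infinite_finite_induct) (simp_all add: zval_add)

context qgroup begin

text \<open>
  The coefficient of the highest weight vector in \<open>f(x) y\<^sub>i\<^sub>1 \<dots> y\<^sub>i\<^sub>r v\<^sub>\<lambda>\<close>, as a Laurent
  polynomial in the \<open>q\<^sup>(\<^sup>\<lambda>\<^sup>,\<^sup>\<mu>\<^sup>)\<close>.
\<close>

primrec ep :: "'n list => 'n free => 'n zalg" where
  "ep [] f = single 0 (fcst f)"
| "ep (i # is) f =
     single (tilde D (sr i)) (qpow (- ip D (sr i) (wtl is)) / qdiff i) * ep is (der (sr i) i f)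
   - single (- tilde D (sr i)) (qpow (ip D (sr i) (wtl is)) / qdiff i) * ep is (der (- sr i) i f)"

lemma ep_0 [simp]: "ep is 0 = 0"
  by (induction "is") simp_all

lemma ep_fge: "f \<in> fge n ==> length is < n ==> ep is f = 0"
proof (induction "is" arbitrary: f n)
  case Nil
  thus ?case using fge_fcst by (cases n) auto
next
  case (Cons i "is")
  then obtain m where m: "n = Suc m" by (cases n) auto
  have "der (sr i) i f \<in> fge m" "der (- sr i) i f \<in> fge m" using Cons.prems m fge_der by auto
  thus ?case using Cons.IH[of _ m] Cons.prems m by simp
qed

lemma keys_diff': "keys (a - b) \<subseteq> keys a \<union> keys b"
  for a b :: "'k \<Rightarrow>\<^sub>0 'c::ab_group_add"
  by (auto simp: in_keys_iff lookup_minus)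

lemma tilde_sr_nonneg: "tilde D (sr i) \<ge> 0"
  using tilde_piTh[of i] tilde_sr_pos[of i] by (cases "i \<in> piTh D") (auto intro: less_imp_le)

lemma ep_keys:
  "v \<in> keys (ep is f) ==> v \<ge> - tilde D (wtl is) \<and> Th D v = - v"
proof (induction "is" arbitrary: f v)
  case Nil
  thus ?case by (auto split: if_splits)
next
  case (Cons i "is")
  consider "v \<in> keys (single (tilde D (sr i)) (qpow (- ip D (sr i) (wtl is)) / qdiff i) * ep is (der (sr i) i f))"
    | "v \<in> keys (single (- tilde D (sr i)) (qpow (ip D (sr i) (wtl is)) / qdiff i) * ep is (der (- sr i) i f))"
    by (rule UnE[OF subsetD[OF keys_diff' Cons.prems[unfolded ep.simps(2)]]])
  thus ?case
  proof cases
    case 1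
    obtain w where 1: "w \<in> keys (ep is (der (sr i) i f))" "v = tilde D (sr i) + w"
      using keys_single_shift[OF 1] by blast
    have "- tilde D (sr i) \<le> 0" "0 \<le> tilde D (sr i)" using tilde_sr_nonneg[of i] by simp_all
    hence "- tilde D (sr i) + - tilde D (wtl is) \<le> tilde D (sr i) + w"
      using Cons.IH[OF 1(1)] by (intro add_mono) auto
    thus ?thesis using Cons.IH[OF 1(1)] by (simp add: 1(2) tilde_add Th_add Th_tilde)
  next
    case 2
    obtain w where 2: "w \<in> keys (ep is (der (- sr i) i f))" "v = - tilde D (sr i) + w"
      using keys_single_shift[OF 2] by blast
    have "- tilde D (sr i) + - tilde D (wtl is) \<le> - tilde D (sr i) + w"
      using Cons.IH[OF 2(1)] by (intro add_mono) auto
    thus ?thesis using Cons.IH[OF 2(1)] by (simp add: 2(2) tilde_add Th_add Th_diff Th_tilde Th_minus)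
  qed
qed

text \<open>The extreme exponent arises only from taking \<open>der (- sr i) i\<close> at every
  letter. For i outside \<pi>_\<Theta> the other choice raises the exponent strictly, as tilde
  \<alpha>_i > 0; for i in \<pi>_\<Theta> the exponents coincide, but the other derivative vanishes
  by membership in \<open>nfree\<close>.\<close>

lemma ep_bottom:
  "f \<in> nfree ==> \<exists>c. c \<noteq> 0 \<and> lookup (ep is f) (- tilde D (wtl is)) = c * fcst (bops is f)"
proof (induction "is" arbitrary: f)
  case Nil
  show ?case by (auto intro: exI[of _ 1])
next
  case (Cons i "is")
  let ?t = "tilde D (sr i)" and ?T = "tilde D (wtl is)"
  obtain c where c: "c \<noteq> 0" "lookup (ep is (der (- sr i) i f)) (- ?T) = c * fcst (bops is (der (- sr i) i f))"
    using Cons.IH[OF nfree_der[OF Cons.prems, of i]] by blast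
  define c1 where "c1 = qpow (- ip D (sr i) (wtl is)) / qdiff i"
  define c2 where "c2 = qpow (ip D (sr i) (wtl is)) / qdiff i"
  have "lookup (single ?t c1 * ep is (der (sr i) i f)) (- tilde D (wtl (i # is))) = 0"
  proof (cases "i \<in> piTh D")
    case True
    hence "der (sr i) i f = 0" using Cons.prems by (simp add: nfree_def)
    thus ?thesis by simp
  next
    case False
    show ?thesis
    proof (rule ccontr)
      assume "lookup (single ?t c1 * ep is (der (sr i) i f)) (- tilde D (wtl (i # is))) \<noteq> 0"
      then obtain w where w: "w \<in> keys (ep is (der (sr i) i f))" "- tilde D (wtl (i # is)) = ?t + w"
        using keys_single_shift[of "- tilde D (wtl (i # is))" ?t c1] by (force simp: in_keys_iff)
      have "- ?T \<le> w" using ep_keys[OF w(1)] by blast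
      moreover have "- ?t < ?t" using tilde_sr_pos[OF False] by (meson neg_less_0_iff_less order_less_trans)
      ultimately have "- ?t + - ?T < ?t + w" by (intro add_less_le_mono)
      moreover have "- ?t + - ?T = ?t + w" using w(2) by (simp add: tilde_add)
      ultimately show False by (metis less_irrefl)
    qed
  qed
  moreover have "- tilde D (wtl (i # is)) = - ?t + - ?T" by (simp add: tilde_add)
  hence "lookup (single (- ?t) c2 * ep is (der (- sr i) i f)) (- tilde D (wtl (i # is)))
      = c2 * lookup (ep is (der (- sr i) i f)) (- ?T)"
    by (simp only: lookup_single_shift)
  ultimately have "lookup (ep (i # is) f) (- tilde D (wtl (i # is))) = (- c2 * c) * fcst (bops (i # is) f)"
    unfolding ep.simps(2) c1_def[symmetric] c2_def[symmetric] by (simp add: lookup_minus c(2))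
  moreover have "- c2 * c \<noteq> 0" using c(1) by (simp add: c2_def)
  ultimately show ?case by blast
qed

text \<open>Derivations lower the degree by exactly one, so truncation from below commutes with them
  after a shift.\<close>

lemma fproj_der:
  "der v j (fproj (\<lambda>w. Suc r \<le> length (letters w)) f) = fproj (\<lambda>w. r \<le> length (letters w)) (der v j f)"
proof (induction f rule: pm_induct)
  case (single w c)
  let ?d = "der v j (single w c)"
  have len: "Suc (length (letters w')) = length (letters w)" if "w' \<in> keys ?d" for w'
    using that by (elim der_keys) (auto split: if_splits)
  have "fproj (\<lambda>w. r \<le> length (letters w)) ?d = (if Suc r \<le> length (letters w) then ?d else 0)"
  proof (rule poly_mapping_eqI)
    fix w'
    show "lookup (fproj (\<lambda>w. r \<le> length (letters w)) ?d) w' =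
        lookup (if Suc r \<le> length (letters w) then ?d else 0) w'"
      using len[of w'] by (cases "w' \<in> keys ?d") (auto simp: lookup_fproj in_keys_iff)
  qed
  thus ?case by (simp add: fproj_single)
qed (simp_all add: fproj_add)

lemma fproj_ge_0: "fproj (\<lambda>w. 0 \<le> length (letters w)) f = f"
  by (rule poly_mapping_eqI) (simp add: lookup_fproj)

lemma nfree_fproj: "f \<in> nfree ==> fproj (\<lambda>w. r \<le> length (letters w)) f \<in> nfree"
proof (cases r)
  case 0
  thus "f \<in> nfree ==> ?thesis" using fproj_ge_0[of f] by simp
qed (simp add: nfree_def fproj_der)

lemma Nplus_Ach_form:
  assumes "b \<in> span_prod (aug (Nplus D)) (Ach D)"
  shows "\<exists>\<Gamma> F. finite \<Gamma> \<and> (\<forall>\<gamma>\<in>\<Gamma>. Th D \<gamma> = - \<gamma>) \<and> (\<forall>\<gamma>. F \<gamma> \<in> nfree) \<and> b = (\<Sum>\<gamma>\<in>\<Gamma>. fx (F \<gamma>) * tau D \<gamma>)"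
  using assms unfolding span_prod_def
proof (induction rule: cv.span_induct_alt)
  case base
  show ?case by (intro exI[of _ "{}"] exI[of _ "\<lambda>_. 0"]) (simp add: nfree_def)
next
  case (step c x y)
  then obtain \<Gamma> F where F: "finite \<Gamma>" "\<forall>\<gamma>\<in>\<Gamma>. Th D \<gamma> = - \<gamma>" "\<forall>\<gamma>. F \<gamma> \<in> nfree" "y = (\<Sum>\<gamma>\<in>\<Gamma>. fx (F \<gamma>) * tau D \<gamma>)"
    by blast
  obtain n t where nt: "x = n * t" "n \<in> aug (Nplus D)" "t \<in> Ach D" using step by blast
  obtain \<beta> where t: "t = tau D \<beta>" "Th D \<beta> = - \<beta>" using nt(3) by (auto simp: Ach_def Th_tilde)
  obtain f where f: "n = fx f" "f \<in> nfree" using nt(2) Nplus_nfree by (auto simp: aug_def)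
  define F' where "F' \<gamma> = (if \<gamma> = \<beta> then fconst c * f else 0) + (if \<gamma> \<in> \<Gamma> then F \<gamma> else 0)" for \<gamma>
  have nz: "g + h \<in> nfree" "fconst c * g \<in> nfree" "0 \<in> nfree" if "g \<in> nfree" "h \<in> nfree" for g h
    using that by (auto simp: nfree_def)
  have "F' \<gamma> \<in> nfree" for \<gamma> using f(2) F(3) nz by (auto simp: F'_def)
  moreover have "c *\<^sub>q x + y = (\<Sum>\<gamma>\<in>insert \<beta> \<Gamma>. fx (F' \<gamma>) * tau D \<gamma>)"
  proof -
    have "(\<Sum>\<gamma>\<in>insert \<beta> \<Gamma>. fx (F' \<gamma>) * tau D \<gamma>) =
      (\<Sum>\<gamma>\<in>insert \<beta> \<Gamma>. if \<gamma> = \<beta> then c *\<^sub>q (fx f * tau D \<beta>) else 0) + (\<Sum>\<gamma>\<in>insert \<beta> \<Gamma>. if \<gamma> \<in> \<Gamma> then fx (F \<gamma>) * tau D \<gamma> else 0)"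
      unfolding sum.distrib[symmetric] by (intro sum.cong) (auto simp: F'_def ring_distribs qscale_mult_left)
    also have "(\<Sum>\<gamma>\<in>insert \<beta> \<Gamma>. if \<gamma> = \<beta> then c *\<^sub>q (fx f * tau D \<beta>) else 0) = c *\<^sub>q x"
      using F(1) by (simp add: nt(1) t f)
    also have "(\<Sum>\<gamma>\<in>insert \<beta> \<Gamma>. if \<gamma> \<in> \<Gamma> then fx (F \<gamma>) * tau D \<gamma> else 0) = y"
      unfolding F(4) using F(1) by (intro sum.mono_neutral_cong_right) auto
    finally show ?thesis by simp
  qed
  ultimately show ?case using F(1,2) t(2) by (intro exI[of _ "insert \<beta> \<Gamma>"] exI[of _ F']) auto
qed

text \<open>
  An element of \<open>N\<^sup>+\<A>\<close> that the invariant functionals of all \<open>L(\<lambda>)\<close> annihilate is zero: look at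
  the lowest degree, and there at the lowest exponent of the torus.
\<close>

lemma kernel_zero:
  assumes fin: "finite \<Gamma>" and anti: "\<And>\<gamma>. \<gamma> \<in> \<Gamma> ==> Th D \<gamma> = - \<gamma>" and nf: "\<And>\<gamma>. F \<gamma> \<in> nfree"
    and b: "b = (\<Sum>\<gamma>\<in>\<Gamma>. fx (F \<gamma>) * tau D \<gamma>)"
    and ann: "\<And>M G is. M \<in> Pplus2Sigma D ==> (\<And>\<gamma>. G \<gamma> \<in> fge (length is)) ==> b = (\<Sum>\<gamma>\<in>\<Gamma>. fx (G \<gamma>) * tau D \<gamma>) ==>
       zval D (\<Sum>\<gamma>\<in>\<Gamma>. single \<gamma> (qpow (- ip D \<gamma> (wtl is))) * ep is (G \<gamma>)) M = 0"
  shows "b = 0"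
proof (rule ccontr)
  assume "b \<noteq> 0"
  define fr where "fr r f = fproj (\<lambda>w. length (letters w) = r) f" for r :: nat and f :: "'n free"
  define fu where "fu r f = fproj (\<lambda>w. r \<le> length (letters w)) f" for r :: nat and f :: "'n free"
  have fu_step: "fu r f = fr r f + fu (Suc r) f" for r f
    by (rule poly_mapping_eqI) (auto simp: fu_def fr_def lookup_fproj lookup_add)
  have fu0: "fu 0 f = f" for f by (simp add: fu_def fproj_ge_0[simplified])
  have fuN: "\<exists>N. fu N f = 0" for f
  proof -
    define N where "N = Suc (Max (insert 0 ((\<lambda>w. length (letters w)) ` keys f)))"
    have "length (letters w) < N" if "w \<in> keys f" for w
      using that by (auto simp: N_def less_Suc_eq_le intro!: Max_ge)
    hence "keys (fu N f) = {}" by (force simp: fu_def keys_fproj)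
    thus ?thesis by auto
  qed
  have fx_fu: "fx (fu r f) = fx f" if "\<And>s. s < r ==> fx (fr s f) = 0" for r f
    using that
  proof (induction r)
    case (Suc r)
    hence "fx (fu r f) = fx f" by simp
    thus ?case using Suc.prems[of r] by (simp add: fu_step[of r])
  qed (simp add: fu0)
  have "\<exists>r. \<exists>\<gamma>\<in>\<Gamma>. fx (fr r (F \<gamma>)) \<noteq> 0"
  proof (rule ccontr)
    assume "\<nexists>r. \<exists>\<gamma>\<in>\<Gamma>. fx (fr r (F \<gamma>)) \<noteq> 0"
    hence "fx (F \<gamma>) = 0" if "\<gamma> \<in> \<Gamma>" for \<gamma>
      using that fuN[of "F \<gamma>"] fx_fu[of _ "F \<gamma>"] by (metis fx_simps(1))
    thus False using \<open>b \<noteq> 0\<close> b by simp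
  qed
  \<comment> \<open>r is the lowest degree in which some F \<gamma> has a part of nonzero value;
    below, \<open>\<gamma>0\<close> is the least \<gamma> for which this happens in degree
    r.\<close>
  then obtain r where r: "\<exists>\<gamma>\<in>\<Gamma>. fx (fr r (F \<gamma>)) \<noteq> 0" "\<And>s. s < r ==> \<not> (\<exists>\<gamma>\<in>\<Gamma>. fx (fr s (F \<gamma>)) \<noteq> 0)"
    using exists_least_iff[of "\<lambda>r. \<exists>\<gamma>\<in>\<Gamma>. fx (fr r (F \<gamma>)) \<noteq> 0"] by blast
  define \<Gamma>0 where "\<Gamma>0 = {\<gamma> \<in> \<Gamma>. fx (fr r (F \<gamma>)) \<noteq> 0}"
  have G0: "finite \<Gamma>0" "\<Gamma>0 \<noteq> {}" using fin r(1) by (auto simp: \<Gamma>0_def)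
  define \<gamma>0 where "\<gamma>0 = Min \<Gamma>0"
  have \<gamma>0: "\<gamma>0 \<in> \<Gamma>0" "\<And>\<gamma>. \<gamma> \<in> \<Gamma>0 ==> \<gamma>0 \<le> \<gamma>" using G0 by (auto simp: \<gamma>0_def)
  \<comment> \<open>Replaces F \<gamma> by a truncation with the same value: all parts below degree
    r evaluate to 0, and outside \<open>\<Gamma>0\<close> the part of degree r does as well. This
    supplies the degree bound in \<open>ann\<close> for words of length r.\<close>
  define G where "G \<gamma> = (if \<gamma> \<in> \<Gamma>0 then fu r (F \<gamma>) else fu (Suc r) (F \<gamma>))" for \<gamma>
  have fxG: "fx (G \<gamma>) = fx (F \<gamma>)" if "\<gamma> \<in> \<Gamma>" for \<gamma>
  proof -
    have 1: "fx (fu r (F \<gamma>)) = fx (F \<gamma>)" using r(2) that by (intro fx_fu) blast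
    show ?thesis
    proof (cases "\<gamma> \<in> \<Gamma>0")
      case False
      hence "fx (fr r (F \<gamma>)) = 0" using that by (simp add: \<Gamma>0_def)
      thus ?thesis using 1 False by (simp add: G_def fu_step[of r])
    qed (use 1 in \<open>simp add: G_def\<close>)
  qed
  have bG: "b = (\<Sum>\<gamma>\<in>\<Gamma>. fx (G \<gamma>) * tau D \<gamma>)" unfolding b by (intro sum.cong) (auto simp: fxG)
  have fuge: "fu s f \<in> fge s" for s f by (simp add: fge_def fu_def keys_fproj)
  have Gge: "G \<gamma> \<in> fge r" for \<gamma> using fuge[of r "F \<gamma>"] fuge[of "Suc r" "F \<gamma>"] by (force simp: G_def fge_def)
  have "fcst (bops is (fr r (F \<gamma>0))) = 0" if len: "length is = r" for "is"
  proof -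
    define c where "c \<gamma> = qpow (- ip D \<gamma> (wtl is))" for \<gamma>
    define Q where "Q = (\<Sum>\<gamma>\<in>\<Gamma>. single \<gamma> (c \<gamma>) * ep is (G \<gamma>))"
    have anti_keys: "Th D v = - v" if "v \<in> keys Q" for v
    proof -
      have "v \<in> (\<Union>\<gamma>\<in>\<Gamma>. keys (single \<gamma> (c \<gamma>) * ep is (G \<gamma>)))"
        using that unfolding Q_def by (rule subsetD[OF keys_sum])
      then obtain \<gamma> w where "\<gamma> \<in> \<Gamma>" "w \<in> keys (ep is (G \<gamma>))" "v = \<gamma> + w"
        using keys_single_shift by (elim UN_E) blast
      thus ?thesis using anti[of \<gamma>] ep_keys[of w "is" "G \<gamma>"] by (simp add: Th_add)
    qed
    have Z: "zval D Q M = 0" if "M \<in> Pplus2Sigma D" for M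
      unfolding Q_def c_def using ann[OF that _ bG] Gge len by simp
    have "lookup Q v = 0" if "v \<in> keys Q" for v
    proof (rule qchars_independent[OF _ _ _ that])
      fix M assume L: "M \<in> Pplus2Sigma D"
      have "(\<Sum>v\<in>keys Q. lookup Q v * qpow (ip D M v)) = zval D Q M"
        unfolding zval_def by (intro sum.cong) (simp_all add: ip_comm[of M])
      thus "(\<Sum>v\<in>keys Q. lookup Q v * qpow (ip D M v)) = 0" using Z[OF L] by simp
    qed (use anti_keys in auto)
    hence Q0: "lookup Q v = 0" for v by (cases "v \<in> keys Q") (auto simp: in_keys_iff)
    let ?T = "tilde D (wtl is)"
    \<comment> \<open>No other \<gamma> reaches this exponent: outside \<open>\<Gamma>0\<close> the
      polynomial has degree above the number of letters, and inside it \<gamma> exceeds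
      \<open>\<gamma>0\<close> while the exponents of \<open>ep\<close> are bounded below.\<close>
    have z: "lookup (single \<gamma> (c \<gamma>) * ep is (G \<gamma>)) (\<gamma>0 + - ?T) = 0"
      if "\<gamma> \<in> \<Gamma>" "\<gamma> \<noteq> \<gamma>0" for \<gamma>
    proof (cases "\<gamma> \<in> \<Gamma>0")
      case False
      hence "G \<gamma> \<in> fge (Suc r)" using fuge by (simp add: G_def)
      hence "ep is (G \<gamma>) = 0" using len by (intro ep_fge) auto
      thus ?thesis by simp
    next
      case True
      hence lt: "\<gamma>0 < \<gamma>" using \<gamma>0(2)[OF True] that(2) by simp
      show ?thesis
      proof (rule ccontr)
        assume "lookup (single \<gamma> (c \<gamma>) * ep is (G \<gamma>)) (\<gamma>0 + - ?T) \<noteq> 0"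
        then obtain w where w: "w \<in> keys (ep is (G \<gamma>))" "\<gamma>0 + - ?T = \<gamma> + w"
          using keys_single_shift[of "\<gamma>0 + - ?T" \<gamma> "c \<gamma>"] by (force simp: in_keys_iff)
        have "- ?T \<le> w" using ep_keys[OF w(1)] by blast
        hence "\<gamma>0 + - ?T < \<gamma> + w" using lt by (rule add_less_le_mono[rotated])
        thus False using w(2) by simp
      qed
    qed
    have "0 = lookup Q (\<gamma>0 + - ?T)" by (simp add: Q0)
    also have "\<dots> = (\<Sum>\<gamma>\<in>\<Gamma>. lookup (single \<gamma> (c \<gamma>) * ep is (G \<gamma>)) (\<gamma>0 + - ?T))"
      by (simp add: Q_def lookup_sum)
    also have "\<dots> = (\<Sum>\<gamma>\<in>\<Gamma>. if \<gamma> = \<gamma>0 then lookup (single \<gamma> (c \<gamma>) * ep is (G \<gamma>)) (\<gamma>0 + - ?T) else 0)"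
      using z by (intro sum.cong) auto
    also have "\<dots> = c \<gamma>0 * lookup (ep is (G \<gamma>0)) (- ?T)"
      using \<gamma>0(1) fin by (simp add: sum.delta \<Gamma>0_def lookup_single_shift del: add_uminus_conv_diff)
    finally have "lookup (ep is (G \<gamma>0)) (- ?T) = 0" by (simp add: c_def)
    moreover have "G \<gamma>0 \<in> nfree" unfolding G_def fu_def by (auto intro: nfree_fproj nf)
    ultimately have "fcst (bops is (G \<gamma>0)) = 0" using ep_bottom[of "G \<gamma>0" "is"] by auto
    moreover have "G \<gamma>0 = fr r (F \<gamma>0) + fu (Suc r) (F \<gamma>0)" using \<gamma>0(1) by (simp add: G_def fu_step[of r])
    moreover have "fcst (bops is (fu (Suc r) (F \<gamma>0))) = 0" using len by (intro bops_fge[OF fuge]) simp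
    ultimately show ?thesis by simp
  qed
  \<comment> \<open>All products of r derivations have constant term 0 on this homogeneous
    polynomial of degree r, so its value is 0, contrary to the choice of
    \<open>\<gamma>0\<close>.\<close>
  hence "fx (fr r (F \<gamma>0)) = 0"
    by (intro bops_eval[of _ r]) (auto simp: fle_def fge_def fr_def keys_fproj)
  thus False using \<gamma>0(1) by (simp add: \<Gamma>0_def)
qed

end

section \<open>Matrix entries at the highest weight vector\<close>

context hwmod begin

abbreviation yh :: "'n list => 'v" where "yh is \<equiv> yw (\<lambda>x. x) is hv"

lemma yh_wsp: "yh is \<in> wsp (M - wtl is)"
  by (rule yw_wsp[OF uauto_id hv_wsp])

lemma prj_gy: "w \<in> V ==> prj M (act (gy D i) w) = 0"
proof (induction rule: V_induct)
  case (basis e)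
  obtain ls where ls: "ewt e = M - wtl ls" using ewt(2)[OF basis] by blast
  have "act (gy D i) e \<in> wsp (ewt e - sr i)" using tw_gy_wsp[OF uauto_id ewt(1)[OF basis]] .
  moreover have "M \<noteq> ewt e - sr i"
  proof
    assume "M = ewt e - sr i"
    hence "wtl (i # ls) = 0" using ls by (simp add: algebra_simps)
    thus False unfolding wtl_eq_0_iff by simp
  qed
  ultimately show ?case using prj_on_wsp by metis
qed (simp_all add: prj_linear act_add act_scale)

text \<open>y_i is commuted to the left, where its image has no component of weight \<lambda>; the
  two torus terms give the two summands of \<open>ep\<close>. Orthogonality of \<lambda> to the
  weights fixed by \<Theta> replaces (\<alpha>_i,\<lambda>) by (tilde \<alpha>_i,\<lambda>).\<close>

lemma ep_eval:
  assumes fixed: "\<And>\<gamma>. Th D \<gamma> = \<gamma> ==> ip D M \<gamma> = 0"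
  shows "prj M (rep (fx f) (yh is)) = zval D (ep is f) M *\<^sub>q hv"
proof (induction "is" arbitrary: f)
  case Nil
  show ?case using prj_on_wsp[OF hv_wsp] by (simp add: rep_fx_hv prj_linear zval_single)
next
  case (Cons i "is")
  let ?z = "yh is"
  have zV: "?z \<in> V" using yh_wsp by (rule wsp_V)
  have tl: "ip D (tilde D (sr i)) M = ip D (sr i) M"
  proof -
    have "sr i = tilde D (sr i) + rscale (1/2) (sr i + Th D (sr i))"
      by (rule wt_eqI) (simp add: tilde_def lookup_add lookup_minus field_simps)
    hence "ip D M (sr i) = ip D M (tilde D (sr i)) + ip D M (rscale (1/2) (sr i + Th D (sr i)))"
      using ip_add_right by metis
    thus ?thesis using fixed[OF fixed_plus_tilde] by (simp add: ip_comm[of _ M])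
  qed
  have t: "rep (tau D (sr i)) ?z = qpow (ip D (sr i) M - ip D (sr i) (wtl is)) *\<^sub>q ?z"
    "rep (tau D (- sr i)) ?z = qpow (ip D (sr i) (wtl is) - ip D (sr i) M) *\<^sub>q ?z"
    by (simp_all add: rep_tau[OF yh_wsp] ip_comm[of _ "sr i"] ip_diff_right)
  have "rep (fx f) (yh (i # is)) = rep (fx f * gy D i) ?z" using zV by (simp add: rep_mult rep_gens)
  also have "\<dots> = act (gy D i) (rep (fx f) ?z) + (1 / qdiff i) *\<^sub>q
      (rep (fx (der (sr i) i f)) (rep (tau D (sr i)) ?z) - rep (fx (der (- sr i) i f)) (rep (tau D (- sr i)) ?z))"
    unfolding fx_gy using zV by (simp add: rep_add rep_mult rep_scale rep_diff rep_gens rep_V)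
  finally have "prj M (rep (fx f) (yh (i # is))) = (1 / qdiff i) *\<^sub>q
      (qpow (ip D (sr i) M - ip D (sr i) (wtl is)) *\<^sub>q (zval D (ep is (der (sr i) i f)) M *\<^sub>q hv) -
       qpow (ip D (sr i) (wtl is) - ip D (sr i) M) *\<^sub>q (zval D (ep is (der (- sr i) i f)) M *\<^sub>q hv))"
    unfolding t using zV by (simp add: prj_linear prj_gy rep_V rep_linear Cons)
  also have "\<dots> = zval D (ep (i # is) f) M *\<^sub>q hv"
    by (simp add: zval_diff zval_mult zval_single tl qscale_qscale qscale_diff qpow_diff qpow_minus field_simps
        flip: qscale_diff(2))
  finally show ?case .
qed

text \<open>A word ks of at least as many x as there are y gives 0 or a weight \<lambda> - wt(ls)
  with wt(is) = wt(ks) + wt(ls). Comparing lengths, ls is empty.\<close>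

lemma top_vector:
  assumes "f \<in> fge (length is)"
  shows "rep (fx f) (yh is) \<in> wsp M"
proof -
  have yV: "yh is \<in> V" using yh_wsp by (rule wsp_V)
  have "f = (\<Sum>w\<in>keys f. single (Word (letters w)) (lookup f w))"
    by (simp add: pm_sum_singles)
  hence e: "fx f = (\<Sum>w\<in>keys f. lookup f w *\<^sub>q xword (letters w))"
    by (metis (no_types, lifting) fx_single fx_sum sum.cong)
  have "rep (xword ks) (yh is) \<in> wsp M" if "length ks \<ge> length is" for ks
  proof (cases "rep (xword ks) (yh is) = 0")
    case True
    thus ?thesis by (simp add: cv.subspace_0[OF wsp_subspace])
  next
    case False
    have w: "rep (xword ks) (yh is) \<in> wsp (M - wtl is + wtl ks)" by (rule rep_fx_wsp[OF yh_wsp])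
    then obtain ls where "M - wtl is + wtl ks = M - wtl ls" using wsp_nonzero_weight[OF w False] by blast
    hence e: "wtl is = wtl (ks @ ls)" by (simp add: algebra_simps)
    hence "length is = length (ks @ ls)" by (rule wtl_length)
    hence "ls = []" using that by simp
    thus ?thesis using w e by simp
  qed
  thus ?thesis unfolding e using assms yV
    by (auto simp: rep_sum rep_scale fge_def intro!: cv.subspace_sum[OF wsp_subspace] cv.subspace_scale[OF wsp_subspace])
qed

text \<open>b y_I v_\<lambda> is a multiple of v_\<lambda>, and \<eta>, which annihilates it but not
  v_\<lambda>, shows that the multiple is 0; its coefficient is the Laurent polynomial evaluated at
  \<lambda>.\<close>

lemma annihilator_zval:
  assumes fixed: "\<And>\<gamma>. Th D \<gamma> = \<gamma> ==> ip D M \<gamma> = 0"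
    and \<eta>: "\<And>c. \<eta> (c *\<^sub>q hv) = c * \<eta> hv" "\<eta> hv \<noteq> (0::cc)" "\<And>w. w \<in> V ==> \<eta> (rep b w) = 0"
    and G: "\<And>\<gamma>. G \<gamma> \<in> fge (length is)" and b: "b = (\<Sum>\<gamma>\<in>\<Gamma>. fx (G \<gamma>) * tau D \<gamma>)"
  shows "zval D (\<Sum>\<gamma>\<in>\<Gamma>. single \<gamma> (qpow (- ip D \<gamma> (wtl is))) * ep is (G \<gamma>)) M = 0"
proof -
  have yV: "yh is \<in> V" using yh_wsp by (rule wsp_V)
  have e: "rep b (yh is) = (\<Sum>\<gamma>\<in>\<Gamma>. qpow (ip D (M - wtl is) \<gamma>) *\<^sub>q rep (fx (G \<gamma>)) (yh is))"
    unfolding b using yV by (simp add: rep_sum rep_mult rep_tau[OF yh_wsp] rep_linear)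
  have W: "rep b (yh is) \<in> wsp M"
    unfolding e using top_vector[OF G] by (intro cv.subspace_sum[OF wsp_subspace] cv.subspace_scale[OF wsp_subspace])
  then obtain c where c: "rep b (yh is) = c *\<^sub>q hv" using wsp_top by blast
  have "c = 0" using \<eta>(3)[OF yV] \<eta>(2) by (simp add: c \<eta>(1))
  hence "0 = prj M (rep b (yh is))" by (simp add: c prj_linear)
  also have "\<dots> = (\<Sum>\<gamma>\<in>\<Gamma>. qpow (ip D (M - wtl is) \<gamma>) * zval D (ep is (G \<gamma>)) M) *\<^sub>q hv"
    unfolding e by (simp add: prj_linear ep_eval[OF fixed] qscale_qscale cv.scale_sum_left)
  finally have "(\<Sum>\<gamma>\<in>\<Gamma>. qpow (ip D (M - wtl is) \<gamma>) * zval D (ep is (G \<gamma>)) M) = 0" using hv(2) by simp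
  moreover have "qpow (ip D (M - wtl is) \<gamma>) = qpow (- ip D \<gamma> (wtl is)) * qpow (ip D \<gamma> M)" for \<gamma>
    by (simp add: ip_comm[of _ \<gamma>] ip_diff_right flip: qpow_add)
  ultimately show ?thesis by (simp add: zval_sum zval_mult zval_single)
qed

end

section \<open>Invariant vectors and zonal spherical functions\<close>

context qgroup begin

text \<open>In \<Theta>(\<Theta> \<alpha>_i) = \<alpha>_i compare a coordinate outside
  \<pi>_\<Theta>, where the corrections from Q^+(\<pi>_\<Theta>) vanish.\<close>

lemma prm_prm:
  assumes i: "i \<notin> piTh D"
  shows "prm D (prm D i) = i"
proof -
  define p where "p = prm D i"
  have p: "p \<notin> piTh D" "prm D p \<notin> piTh D" using prm_notin[OF i] prm_notin[of p] by (auto simp: p_def)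
  obtain \<eta> where \<eta>: "Th D (sr i) = - sr p - \<eta>" "\<eta> \<in> QplusTh D" using Th_sr[OF i] unfolding p_def by blast
  obtain \<eta>' where \<eta>': "Th D (sr p) = - sr (prm D p) - \<eta>'" "\<eta>' \<in> QplusTh D" using Th_sr[OF p(1)] by blast
  have "sr i = Th D (- sr p - \<eta>)" using Th_Th[of "sr i"] by (simp add: \<eta>(1))
  also have "\<dots> = sr (prm D p) + \<eta>' - \<eta>" by (simp add: Th_diff Th_minus \<eta>'(1) Th_QplusTh[OF \<eta>(2)])
  finally have "crd (sr i) (prm D p) = crd (sr (prm D p) + \<eta>' - \<eta>) (prm D p)" by simp
  moreover have "crd \<eta> (prm D p) = 0" "crd \<eta>' (prm D p) = 0" using \<eta>(2) \<eta>'(2) p(2) by (auto simp: QplusTh_def)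
  ultimately show ?thesis by (simp add: lookup_add lookup_minus crd_sr p_def split: if_splits)
qed

lemma adr_gx_uwt:
  assumes "z \<in> uwt \<beta>"
  shows "adr (gx D j) z \<in> uwt (\<beta> + sr j)"
proof -
  have "tau D (- sr j) * z * gx D j \<in> uwt (0 + \<beta> + sr j)" "tau D (- sr j) * gx D j * z \<in> uwt (0 + sr j + \<beta>)"
    by (intro uwt_mult uwt_gens assms)+
  thus ?thesis unfolding adr_gx by (auto simp: add.commute intro: cv.subspace_diff[OF uwt_subspace])
qed

lemma adr_gx_Uq: "z \<in> Uq D ==> adr (gx D j) z \<in> Uq D"
  unfolding adr_gx by (intro subalgD(8)[OF subalg_sets(1)] subalgD(5)[OF subalg_sets(1)]) simp_all

lemma adr_xdiv: "adr (xdiv D j m) z = (1 / qfact (qroot D j) m) *\<^sub>q (adr (gx D j) ^^ m) z"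
  by (simp add: xdiv_def adr_scale adr_power)

lemma adr_funpow_uwt: "z \<in> uwt \<beta> ==> (adr (gx D j) ^^ m) z \<in> uwt (\<beta> + rscale (of_nat m) (sr j))"
proof (induction m)
  case (Suc m)
  have "\<beta> + rscale (of_nat m) (sr j) + sr j = \<beta> + rscale (of_nat (Suc m)) (sr j)" by (simp add: rscale_distribs add_ac)
  with adr_gx_uwt[OF Suc.IH[OF Suc.prems], of j] show ?case by (simp only: funpow.simps comp_apply)
qed simp

lemma adr_funpow_Uq: "z \<in> Uq D ==> (adr (gx D j) ^^ m) z \<in> Uq D"
  by (induction m) (simp_all add: adr_gx_Uq)

lemma wtl_replicate: "wtl (replicate m j) = rscale (of_nat m) (sr j)"
  by (induction m) (simp_all add: rscale_distribs)

lemma ad_divided_uwt: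
  assumes "a \<in> uwt \<beta>"
  shows "\<exists>ks. ad_divided D b a js \<in> uwt (\<beta> + wtl ks)"
proof (induction js)
  case Nil
  show ?case using assms by (auto intro: exI[of _ "[]"])
next
  case (Cons j js)
  then obtain ks where "ad_divided D b a js \<in> uwt (\<beta> + wtl ks)" by blast
  from adr_funpow_uwt[OF this, of _ j]
  have "ad_divided D b a (j # js) \<in> uwt (\<beta> + wtl ks + rscale (of_nat m) (sr j))"
    if "m = nat \<lfloor>- 2 * ip D (sr j) (sword D js b) / ip D (sr j) (sr j)\<rfloor>" for m
    unfolding that ad_divided.simps adr_xdiv by (intro cv.subspace_scale[OF uwt_subspace])
  hence "ad_divided D b a (j # js) \<in> uwt (\<beta> + wtl (ks @ replicate m j))"
    if "m = nat \<lfloor>- 2 * ip D (sr j) (sword D js b) / ip D (sr j) (sr j)\<rfloor>" for m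
    using that by (simp add: wtl_replicate add.assoc)
  thus ?case by blast
qed

lemma ad_divided_Uq: "a \<in> Uq D ==> ad_divided D b a js \<in> Uq D"
  by (induction js) (auto simp: adr_xdiv intro: subalgD(6)[OF subalg_sets(1)] adr_funpow_Uq)

lemma th_y_base: "tau D (- sr p) * gx D p \<in> uwt (sr p)" "tau D (- sr p) * gx D p \<in> Uq D"
  using uwt_mult[OF uwt_gens(3)[of "- sr p"] uwt_gens(1)[of p]] by (auto intro: subalgD(5)[OF subalg_sets(1)])

lemma th_y_uwt: "\<exists>ks. th_y D i \<in> uwt (wtl (prm D i # ks))"
  using ad_divided_uwt[OF th_y_base(1)] by (simp add: th_y_def)

lemma wtl_pos: "0 < wtl (k # ks)"
proof (rule pm_pos)
  show "wtl (k # ks) \<noteq> 0"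
  proof
    assume "wtl (k # ks) = 0"
    hence "crd (wtl (k # ks)) k = 0" by (simp only: lookup_zero)
    thus False unfolding crd_wtl by simp
  qed
qed (simp add: crd_wtl del: wtl_simps)

end

section \<open>Highest weight components of invariant vectors\<close>

context hwmod begin

lemma tw_funpow_wsp: "uauto \<psi> ==> w \<in> wsp \<mu> ==> (tw \<psi> (gx D j) ^^ n) w \<in> wsp (\<mu> + rscale (of_nat n) (sr j))"
proof (induction n)
  case (Suc n)
  have "\<mu> + rscale (of_nat n) (sr j) + sr j = \<mu> + rscale (of_nat (Suc n)) (sr j)" by (simp add: rscale_distribs add_ac)
  with tw_gx_wsp[OF Suc.prems(1) Suc.IH[OF Suc.prems], of j] show ?case by (simp only: funpow.simps comp_apply)
qed simp

lemma gxgy_Uch: "uauto \<psi> ==> \<psi> (gx D j) \<in> Uch D" "uauto \<psi> ==> \<psi> (gy D j) \<in> Uch D"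
  by (auto intro: uautoD(8))

lemma gx_power_gy:
  assumes \<psi>: "uauto \<psi>" and z: "z \<in> wsp \<nu>"
  shows "(tw \<psi> (gx D j) ^^ Suc n) (tw \<psi> (gy D j) z) = tw \<psi> (gy D j) ((tw \<psi> (gx D j) ^^ Suc n) z)
    + ((\<Sum>l<Suc n. br (ip D \<nu> (sr j) + of_nat l * (2 * dl j))) / qdiff j) *\<^sub>q (tw \<psi> (gx D j) ^^ n) z"
proof (induction n)
  case 0
  show ?case using tw_gx_gy[OF \<psi> z, of j j] by simp
next
  case (Suc n)
  let ?X = "tw \<psi> (gx D j)" and ?Y = "tw \<psi> (gy D j)"
  define c where "c = (\<Sum>l<Suc n. br (ip D \<nu> (sr j) + of_nat l * (2 * dl j))) / qdiff j"
  define r where "r = (?X ^^ Suc n) z"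
  have r: "r \<in> wsp (\<nu> + rscale (of_nat (Suc n)) (sr j))" unfolding r_def by (rule tw_funpow_wsp[OF \<psi> z])
  have X: "(?X ^^ n) z \<in> V" using tw_funpow_wsp[OF \<psi> z, of n j] by (rule wsp_V)
  have Y: "?Y r \<in> V" using tw_gy_wsp[OF \<psi> r] by (rule wsp_V)
  have "(?X ^^ Suc (Suc n)) (?Y z) = ?X ((?X ^^ Suc n) (?Y z))" by simp
  also have "\<dots> = ?X (?Y r + c *\<^sub>q (?X ^^ n) z)" by (simp only: Suc r_def c_def)
  also have "\<dots> = ?X (?Y r) + c *\<^sub>q r"
    using X Y gxgy_Uch[OF \<psi>] by (simp add: act_add act_scale VI r_def)
  also have "?X (?Y r) = ?Y (?X r) + (br (ip D (\<nu> + rscale (of_nat (Suc n)) (sr j)) (sr j)) / qdiff j) *\<^sub>q r"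
    using tw_gx_gy[OF \<psi> r, of j j] by simp
  finally have "(?X ^^ Suc (Suc n)) (?Y z) = ?Y (?X r)
      + (br (ip D (\<nu> + rscale (of_nat (Suc n)) (sr j)) (sr j)) / qdiff j + c) *\<^sub>q r"
    by (simp add: qscale_add_left add_ac)
  moreover have "br (ip D (\<nu> + rscale (of_nat (Suc n)) (sr j)) (sr j)) / qdiff j + c =
      (\<Sum>l<Suc (Suc n). br (ip D \<nu> (sr j) + of_nat l * (2 * dl j))) / qdiff j"
    by (simp add: c_def add_divide_distrib ip_add_left ip_sr_self)
  ultimately show ?case by (simp add: r_def)
qed

text \<open>Induction on the nilpotency order of y_j. By \<open>gx_power_gy\<close>, y_j z satisfies
  the hypotheses with m + 2 and a + 1, so it is 0. Then z is a lowest weight vector of sl2-weight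
  -m, on which the powers of x_j up to the m-th have no kernel.\<close>

lemma sl2_injective:
  assumes \<psi>: "uauto \<psi>"
  shows "z \<in> wsp \<nu> ==> ip D \<nu> (sr j) = - (of_nat m * dl j) ==> a \<le> m ==>
    (tw \<psi> (gx D j) ^^ a) z = 0 ==> (tw \<psi> (gy D j) ^^ K) z = 0 ==> z = 0"
proof (induction K arbitrary: z \<nu> m a)
  case (Suc K)
  let ?X = "tw \<psi> (gx D j)" and ?Y = "tw \<psi> (gy D j)"
  have X0: "?X 0 = 0" and Y0: "?Y 0 = 0" using gxgy_Uch[OF \<psi>] by simp_all
  have Yz: "?Y z = 0"
  proof (rule Suc.IH)
    show "?Y z \<in> wsp (\<nu> - sr j)" by (rule tw_gy_wsp[OF \<psi> Suc.prems(1)])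
    show "ip D (\<nu> - sr j) (sr j) = - (of_nat (m + 2) * dl j)"
      using Suc.prems(2) by (simp add: ip_diff_left ip_sr_self algebra_simps)
    show "Suc a \<le> m + 2" using Suc.prems(3) by simp
    show "(?X ^^ Suc a) (?Y z) = 0"
      unfolding gx_power_gy[OF \<psi> Suc.prems(1)] using Suc.prems(4) X0 Y0 by simp
    show "(?Y ^^ K) (?Y z) = 0" using Suc.prems(5) by (simp add: funpow_swap1)
  qed
  have "z = 0" if "(?X ^^ a) z = 0" "a \<le> m" for a
    using that
  proof (induction a)
    case (Suc a)
    have "(?X ^^ n) 0 = 0" for n by (induction n) (simp_all add: X0)
    hence nil: "(?X ^^ Suc a) 0 = 0" .
    have "((\<Sum>l<Suc a. br (ip D \<nu> (sr j) + of_nat l * (2 * dl j))) / qdiff j) *\<^sub>q (?X ^^ a) z = (?X ^^ Suc a) (?Y z)"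
      unfolding gx_power_gy[OF \<psi> \<open>z \<in> wsp \<nu>\<close>, of a j] Suc.prems(1) Y0 by (rule add_0_left[symmetric])
    also have "\<dots> = 0" unfolding Yz by (rule nil)
    finally have "((\<Sum>l<Suc a. br (ip D \<nu> (sr j) + of_nat l * (2 * dl j))) / qdiff j) *\<^sub>q (?X ^^ a) z = 0" .
    moreover have "(\<Sum>l<Suc a. br (ip D \<nu> (sr j) + of_nat l * (2 * dl j))) \<noteq> 0"
    proof
      assume "(\<Sum>l<Suc a. br (ip D \<nu> (sr j) + of_nat l * (2 * dl j))) = 0"
      hence "br (of_nat (Suc a) * dl j) * br (ip D \<nu> (sr j) + (of_nat (Suc a) - 1) * dl j) = 0"
        using br_sum[where n = "Suc a" and s = "ip D \<nu> (sr j)" and d = "dl j"] by simp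
      hence "of_nat (Suc a) * dl j = 0 \<or> ip D \<nu> (sr j) + (of_nat (Suc a) - 1) * dl j = 0"
        by (simp only: mult_eq_0_iff br_eq_0_iff)
      hence "ip D \<nu> (sr j) + (of_nat (Suc a) - 1) * dl j = 0"
        using dl_pos(2)[of j] by (metis mult_eq_0_iff of_nat_eq_0_iff nat.distinct(2))
      moreover have "ip D \<nu> (sr j) + (of_nat (Suc a) - 1) * dl j = (of_nat a - of_nat m) * dl j"
        using \<open>ip D \<nu> (sr j) = _\<close> by (simp add: algebra_simps)
      ultimately have "of_nat a = (of_nat m :: rat)" using half_len_pos[of j] by auto
      thus False using Suc.prems(2) by simp
    qed
    ultimately have "(?X ^^ a) z = 0" unfolding qscale_eq_0_iff divide_eq_0_iff using qdiff_nonzero by blast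
    thus ?case using Suc.IH Suc.prems(2) by simp
  qed simp
  thus ?case using Suc.prems(3,4) by blast
qed simp

primrec xw :: "('u => 'u) => 'n list => 'v => 'v" where
  "xw \<psi> [] u = u"
| "xw \<psi> (k # ks) u = tw \<psi> (gx D k) (xw \<psi> ks u)"

lemma xw_wsp: "uauto \<psi> ==> u \<in> wsp \<mu> ==> xw \<psi> ks u \<in> wsp (\<mu> + wtl ks)"
proof (induction ks)
  case (Cons k ks)
  have "\<mu> + wtl ks + sr k = \<mu> + wtl (k # ks)" by (simp add: add_ac)
  with tw_gx_wsp[OF Cons.prems(1) Cons.IH[OF Cons.prems], of k] show ?case by (simp only: xw.simps)
qed simp

lemma xw_append: "xw \<psi> (ks @ ls) u = xw \<psi> ks (xw \<psi> ls u)"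
  by (induction ks) simp_all

lemma xw_replicate: "xw \<psi> (replicate n k) u = (tw \<psi> (gx D k) ^^ n) u"
  by (induction n) simp_all

text \<open>y_j kills u, and its commutators with the x_k are torus elements, so it lowers the
  filtration by the number of x-letters.\<close>

lemma gy_nilpotent:
  assumes \<psi>: "uauto \<psi>" and u: "u \<in> wsp \<mu>" and 0: "tw \<psi> (gy D j) u = 0"
  shows "(tw \<psi> (gy D j) ^^ Suc (length ks)) (xw \<psi> ks u) = 0"
proof -
  let ?Y = "tw \<psi> (gy D j)"
  define S where "S n = cv.span {xw \<psi> ks u | ks. length ks < n}" for n
  have SV: "{xw \<psi> ks u | ks. length ks < n} \<subseteq> V" for n using wsp_V xw_wsp[OF \<psi> u] by blast
  have base: "length ks < n ==> xw \<psi> ks u \<in> S n" for ks n unfolding S_def by (rule cv.span_base) blast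
  have Suc_S: "tw \<psi> (gx D k) w \<in> S (Suc n)" if "w \<in> S n" for w n k
    unfolding S_def
  proof (rule act_span[OF gxgy_Uch(1)[OF \<psi>] SV _ that[unfolded S_def]])
    fix s assume "s \<in> {xw \<psi> ks u | ks. length ks < n}"
    then obtain ks where ks: "s = xw \<psi> ks u" "length ks < n" by blast
    have "tw \<psi> (gx D k) s = xw \<psi> (k # ks) u" using ks by simp
    thus "tw \<psi> (gx D k) s \<in> cv.span {xw \<psi> ks u | ks. length ks < Suc n}" using base[of "k # ks" "Suc n"] ks(2)
      by (simp add: S_def)
  qed
  have word: "?Y (xw \<psi> ks u) \<in> S (length ks)" for ks
  proof (induction ks)
    case (Cons k ks)
    have "?Y (tw \<psi> (gx D k) (xw \<psi> ks u)) = tw \<psi> (gx D k) (?Y (xw \<psi> ks u))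
        - (if k = j then (br (ip D (\<mu> + wtl ks) (sr k)) / qdiff k) *\<^sub>q xw \<psi> ks u else 0)"
      using tw_gx_gy[OF \<psi> xw_wsp[OF \<psi> u, of ks], of k j] by simp
    also have "\<dots> \<in> S (Suc (length ks))"
      unfolding S_def
    proof (rule cv.span_diff)
      show "tw \<psi> (gx D k) (?Y (xw \<psi> ks u)) \<in> cv.span {xw \<psi> ls u | ls. length ls < Suc (length ks)}"
        using Suc_S[OF Cons] unfolding S_def .
      have "xw \<psi> ks u \<in> cv.span {xw \<psi> ls u | ls. length ls < Suc (length ks)}" by (rule cv.span_base) blast
      thus "(if k = j then (br (ip D (\<mu> + wtl ks) (sr k)) / qdiff k) *\<^sub>q xw \<psi> ks u else 0)
          \<in> cv.span {xw \<psi> ls u | ls. length ls < Suc (length ks)}"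
        by (simp add: cv.span_scale cv.span_zero)
    qed
    finally show ?case by simp
  qed (simp add: 0 S_def cv.span_zero)
  have step: "?Y w \<in> S n" if "w \<in> S (Suc n)" for w n
    unfolding S_def
  proof (rule act_span[OF gxgy_Uch(2)[OF \<psi>] SV _ that[unfolded S_def]])
    fix s assume "s \<in> {xw \<psi> ks u | ks. length ks < Suc n}"
    then obtain ks where ks: "s = xw \<psi> ks u" "length ks \<le> n" by auto
    have "S (length ks) \<subseteq> S n" unfolding S_def using ks(2) by (intro cv.span_mono) auto
    thus "?Y s \<in> cv.span {xw \<psi> ks u | ks. length ks < n}" using word[of ks] ks(1) unfolding S_def by blast
  qed
  have "(?Y ^^ n) w = 0" if "w \<in> S n" for w n
    using that
  proof (induction n arbitrary: w)
    case 0
    thus ?case by (simp add: S_def)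
  next
    case (Suc n)
    show ?case using Suc.IH[OF step[OF Suc.prems]] by (simp add: funpow_swap1)
  qed
  thus ?thesis using base by blast
qed

lemma tw_prj:
  assumes "uauto \<psi>" "z \<in> uwt \<beta>" "z \<in> Uq D" and "v \<in> V"
  shows "prj (\<nu> + \<beta>) (tw \<psi> z v) = tw \<psi> z (prj \<nu> v)"
  using assms(4)
proof (induction rule: V_induct)
  case (basis e)
  have "tw \<psi> z e \<in> wsp (ewt e + \<beta>)" by (rule tw_uwt[OF assms(1-3) ewt(1)[OF basis]])
  thus ?case using uautoD(8)[OF assms(1,3)] by (auto simp: prj_on_wsp prj_basis[OF basis])
qed (use uautoD(8)[OF assms(1,3)] in \<open>simp_all add: prj_linear act_add act_scale prj_V\<close>)

text \<open>As x_j kills w, only the summand -tau(-\<alpha>_j) x_j z of ad_r(x_j) z acts, and the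
  torus element contributes a nonzero scalar.\<close>

lemma tw_adr_gx:
  assumes \<psi>: "uauto \<psi>" and w: "w \<in> wsp \<mu>" "tw \<psi> (gx D j) w = 0"
    and z: "z \<in> Uq D" "z \<in> uwt \<beta>" "tw \<psi> z w = c *\<^sub>q u" "c \<noteq> 0" and u: "u \<in> wsp (\<mu> + \<beta>)"
  shows "\<exists>c'. c' \<noteq> 0 \<and> tw \<psi> (adr (gx D j) z) w = c' *\<^sub>q tw \<psi> (gx D j) u"
proof -
  let ?t = "tau D (- sr j)"
  have wV: "w \<in> V" and uV: "u \<in> V" using w(1) u by (auto intro: wsp_V)
  have Uq: "?t * z * gx D j \<in> Uq D" "?t * gx D j * z \<in> Uq D" "?t * z \<in> Uq D" "?t * gx D j \<in> Uq D" "?t \<in> Uq D"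
    using z(1) by (auto intro!: subalgD(5)[OF subalg_sets(1)])
  have Xu: "tw \<psi> (gx D j) u \<in> wsp (\<mu> + \<beta> + sr j)" by (rule tw_gx_wsp[OF \<psi> u])
  have "tw \<psi> (adr (gx D j) z) w = tw \<psi> (?t * z * gx D j) w - tw \<psi> (?t * gx D j * z) w"
    unfolding adr_gx by (rule tw_diff[OF \<psi> Uq(1,2) wV])
  also have "tw \<psi> (?t * z * gx D j) w = 0"
    using tw_mult[OF \<psi> Uq(3) _ wV, of "gx D j"] w(2) uautoD(8)[OF \<psi> Uq(3)] by simp
  also have "tw \<psi> (?t * gx D j * z) w = tw \<psi> ?t (tw \<psi> (gx D j) (c *\<^sub>q u))"
    using tw_mult[OF \<psi> Uq(4) z(1) wV] tw_mult[OF \<psi> Uq(5) _ tw_V[OF \<psi> z(1) wV], of "gx D j"] by (simp add: z(3))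
  also have "\<dots> = c *\<^sub>q tw \<psi> ?t (tw \<psi> (gx D j) u)"
    using gxgy_Uch(1)[OF \<psi>] uautoD(8)[OF \<psi> Uq(5)] uV wsp_V[OF Xu] by (simp add: act_scale)
  also have "\<dots> = (c * qpow (ip D (\<mu> + \<beta> + sr j) (- sr j))) *\<^sub>q tw \<psi> (gx D j) u"
    using tw_tau[OF \<psi> _ Xu, of "- sr j"] by (simp add: qscale_qscale)
  finally have "tw \<psi> (adr (gx D j) z) w = (- (c * qpow (ip D (\<mu> + \<beta> + sr j) (- sr j)))) *\<^sub>q tw \<psi> (gx D j) u"
    by simp
  thus ?thesis using z(4) by (intro exI[of _ "- (c * qpow (ip D (\<mu> + \<beta> + sr j) (- sr j)))"]) auto
qed

lemma tw_adr_funpow: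
  assumes \<psi>: "uauto \<psi>" and w: "w \<in> wsp \<mu>" "tw \<psi> (gx D j) w = 0"
    and z: "z \<in> Uq D" "z \<in> uwt \<beta>" "tw \<psi> z w = c *\<^sub>q u" "c \<noteq> 0" and u: "u \<in> wsp (\<mu> + \<beta>)"
  shows "\<exists>c'. c' \<noteq> 0 \<and> tw \<psi> ((adr (gx D j) ^^ m) z) w = c' *\<^sub>q (tw \<psi> (gx D j) ^^ m) u"
proof (induction m)
  case (Suc m)
  then obtain c' where c': "c' \<noteq> 0" "tw \<psi> ((adr (gx D j) ^^ m) z) w = c' *\<^sub>q (tw \<psi> (gx D j) ^^ m) u" by blast
  have "(tw \<psi> (gx D j) ^^ m) u \<in> wsp (\<mu> + (\<beta> + rscale (of_nat m) (sr j)))"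
    using tw_funpow_wsp[OF \<psi> u, of m j] by (simp only: add.assoc)
  from tw_adr_gx[OF \<psi> w adr_funpow_Uq[OF z(1)] adr_funpow_uwt[OF z(2)] c'(2,1) this]
  show ?case by simp
qed (use z in auto)

text \<open>As \<mu> is orthogonal to \<pi>_\<Theta>, the exponent m of each divided power is minus
  the pairing of the current weight with the coroot of j. Hence x_j^m is injective by
  \<open>sl2_injective\<close>; nilpotency of y_j comes from y_j x_p w = 0.\<close>

lemma ad_divided_injective:
  assumes \<psi>: "uauto \<psi>" and w: "w \<in> wsp \<mu>" "\<And>j. j \<in> piTh D ==> tw \<psi> (gx D j) w = 0"
      "\<And>j. j \<in> piTh D ==> tw \<psi> (gy D j) w = 0" "\<And>j. j \<in> piTh D ==> ip D \<mu> (sr j) = 0"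
    and p: "p \<notin> piTh D" and js: "reducedTh D js"
  defines "u \<equiv> tw \<psi> (gx D p) w" and "z \<equiv> \<lambda>js. ad_divided D (sr p) (tau D (- sr p) * gx D p) js"
  shows "\<exists>ks c. c \<noteq> 0 \<and> tw \<psi> (z js) w = c *\<^sub>q xw \<psi> ks u \<and> z js \<in> uwt (sword D js (sr p)) \<and>
    xw \<psi> ks u \<in> wsp (\<mu> + sword D js (sr p)) \<and> (xw \<psi> ks u = 0 \<longrightarrow> u = 0)"
  using js
proof (induction js)
  case Nil
  have u: "u \<in> wsp (\<mu> + sr p)" unfolding u_def by (rule tw_gx_wsp[OF \<psi> w(1)])
  have "tw \<psi> (tau D (- sr p) * gx D p) w = qpow (ip D (\<mu> + sr p) (- sr p)) *\<^sub>q u"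
    using tw_mult[OF \<psi> _ _ wsp_V[OF w(1)], of "tau D (- sr p)" "gx D p"] tw_tau[OF \<psi> _ u, of "- sr p"]
    by (simp add: u_def)
  thus ?case using u th_y_base(1)
    by (intro exI[of _ "[]"] exI[of _ "qpow (ip D (\<mu> + sr p) (- sr p))"]) (simp add: z_def)
next
  case (Cons j js)
  have j: "j \<in> piTh D" using Cons.prems by (simp add: reducedTh_def)
  obtain m :: nat where m: "- 2 * ip D (sr j) (sword D js (sr p)) / ip D (sr j) (sr j) = of_nat m"
    using reduced_exponent[OF Cons.prems p] .
  define x where "x = sword D js (sr p)"
  obtain ks c where ih: "c \<noteq> 0" "tw \<psi> (z js) w = c *\<^sub>q xw \<psi> ks u" "z js \<in> uwt x"
    "xw \<psi> ks u \<in> wsp (\<mu> + x)" "xw \<psi> ks u = 0 \<longrightarrow> u = 0"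
    using Cons.IH[OF reducedTh_tl[OF Cons.prems]] unfolding x_def by blast
  have zU: "z js \<in> Uq D" unfolding z_def by (rule ad_divided_Uq[OF th_y_base(2)])
  obtain c' where c': "c' \<noteq> 0" "tw \<psi> ((adr (gx D j) ^^ m) (z js)) w = c' *\<^sub>q (tw \<psi> (gx D j) ^^ m) (xw \<psi> ks u)"
    using tw_adr_funpow[OF \<psi> w(1) w(2)[OF j] zU ih(3,2,1,4)] by blast
  have zj: "z (j # js) = (1 / qfact (qroot D j) m) *\<^sub>q (adr (gx D j) ^^ m) (z js)"
    unfolding z_def ad_divided.simps adr_xdiv m by simp
  have ipx: "ip D x (sr j) = - (of_nat m * dl j)"
    using m by (simp add: x_def[symmetric] ip_sr_self ip_comm[of _ x] field_simps)
  have x': "sword D (j # js) (sr p) = x + rscale (of_nat m) (sr j)"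
    by (simp add: sword_Cons x_def[symmetric] refl_def ipx ip_sr_self rscale_simps)
  have e: "xw \<psi> (replicate m j @ ks) u = (tw \<psi> (gx D j) ^^ m) (xw \<psi> ks u)"
    by (simp add: xw_append xw_replicate)
  have wsp': "xw \<psi> (replicate m j @ ks) u \<in> wsp (\<mu> + sword D (j # js) (sr p))"
    unfolding e x' add.assoc[symmetric] by (rule tw_funpow_wsp[OF \<psi> ih(4)])
  have "u = 0" if "xw \<psi> (replicate m j @ ks) u = 0"
  proof -
    have jp: "p \<noteq> j" using j p by blast
    have yu: "tw \<psi> (gy D j) u = 0"
      using tw_gx_gy[OF \<psi> w(1), of p j] jp w(3)[OF j] gxgy_Uch[OF \<psi>] by (simp add: u_def)
    have "xw \<psi> ks u = 0"
    proof (rule sl2_injective[OF \<psi> ih(4)])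
      show "ip D (\<mu> + x) (sr j) = - (of_nat m * dl j)" by (simp add: ip_add_left ipx w(4)[OF j])
      show "(tw \<psi> (gx D j) ^^ m) (xw \<psi> ks u) = 0" using that e by simp
      show "(tw \<psi> (gy D j) ^^ Suc (length ks)) (xw \<psi> ks u) = 0"
        by (rule gy_nilpotent[OF \<psi> _ yu]) (unfold u_def, rule tw_gx_wsp[OF \<psi> w(1)])
    qed simp
    thus ?thesis using ih(5) by blast
  qed
  moreover have "tw \<psi> (z (j # js)) w = (1 / qfact (qroot D j) m * c') *\<^sub>q xw \<psi> (replicate m j @ ks) u"
    unfolding zj e using c'(2) tw_scale[OF \<psi> adr_funpow_Uq[OF zU] wsp_V[OF w(1)]] by (simp add: qscale_qscale)
  moreover have "z (j # js) \<in> uwt (sword D (j # js) (sr p))"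
    unfolding zj x' by (intro cv.subspace_scale[OF uwt_subspace] adr_funpow_uwt ih(3))
  moreover have "1 / qfact (qroot D j) m * c' \<noteq> 0" using c'(1) by simp
  ultimately show ?case using wsp' by blast
qed

text \<open>
  The component of highest weight \<open>\<mu>\<close> (in the linear order of the weights) of a \<open>B\<close>-invariant
  vector is killed by the \<open>\<theta>(y\<^sub>i)\<close>, hence by all \<open>x\<^sub>i\<close>: it is a highest weight vector.
\<close>

lemma invariant_top:
  assumes \<psi>: "uauto \<psi>" and v: "v \<in> V" "v \<noteq> 0" and d: "d \<noteq> 0"
    and inv: "\<And>b. b \<in> Bstd D s d ==> act (\<psi> b) v = counit b *\<^sub>q v"
  shows "prj M v \<noteq> 0"
proof -
  obtain I where I: "finite I" "v = (\<Sum>\<nu>\<in>I. prj \<nu> v)" "\<forall>\<nu>. \<nu> \<notin> I \<longrightarrow> prj \<nu> v = 0"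
    using prj_decomp[OF v(1)] by blast
  define S where "S = {\<nu>. prj \<nu> v \<noteq> 0}"
  have "S \<subseteq> I" using I(3) by (auto simp: S_def)
  hence finS: "finite S" using I(1) finite_subset by blast
  have "S \<noteq> {}"
  proof
    assume "S = {}"
    hence "(\<Sum>\<nu>\<in>I. prj \<nu> v) = 0" by (simp add: S_def)
    thus False using I(2) v(2) by simp
  qed
  define \<mu> where "\<mu> = Max S"
  define w where "w = prj \<mu> v"
  have \<mu>: "w \<noteq> 0" "\<And>\<nu>. \<mu> < \<nu> ==> prj \<nu> v = 0"
  proof -
    have "\<mu> \<in> S" unfolding \<mu>_def by (rule Max_in[OF finS \<open>S \<noteq> {}\<close>])
    thus "w \<noteq> 0" by (simp add: S_def w_def)
    fix \<nu> assume "\<mu> < \<nu>"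
    hence "\<nu> \<notin> S" using Max_ge[OF finS, of \<nu>] unfolding \<mu>_def by auto
    thus "prj \<nu> v = 0" by (simp add: S_def)
  qed
  have w: "w \<in> wsp \<mu>" unfolding w_def by (rule prj_wsp[OF v(1)])
  have M: "tw \<psi> z w = 0" if "z \<in> Mq D" "z \<in> uwt \<beta>" "counit z = 0" for z \<beta>
  proof -
    have "tw \<psi> z w = prj (\<mu> + \<beta>) (tw \<psi> z v)"
      unfolding w_def using tw_prj[OF \<psi> that(2) _ v(1)] that(1) Mq_Uq by auto
    thus ?thesis using inv[OF Bstd_gens(1)[OF that(1)]] that(3) by (simp add: prj_linear)
  qed
  have X: "tw \<psi> (gx D j) w = 0" and Y: "tw \<psi> (gy D j) w = 0" if "j \<in> piTh D" for j
    using M[OF Mq_gens(1)[OF that] uwt_gens(1)] M[OF Mq_gens(2)[OF that] uwt_gens(2)] by simp_all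
  have ort: "ip D \<mu> (sr j) = 0" if "j \<in> piTh D" for j
  proof -
    have "tau D (sr j) \<in> TTh D" using that by (auto simp: TTh_def piTh_def)
    from inv[OF Bstd_gens(2)[OF this]] have "tw \<psi> (tau D (sr j)) v = v" by (simp add: qscale_one)
    hence "tw \<psi> (tau D (sr j)) w = w"
      using tw_prj[OF \<psi> uwt_gens(3) _ v(1), of "sr j" \<mu>] by (simp add: w_def)
    hence "(qpow (ip D \<mu> (sr j)) - 1) *\<^sub>q w = 0"
      using tw_tau[OF \<psi> _ w, of "sr j"] by (simp add: qscale_simps)
    thus ?thesis using \<mu>(1) by (simp add: qpow_eq_1_iff)
  qed
  \<comment> \<open>Compare components of weight \<mu> + \<eta>, with \<eta> the weight of
    \<theta>~(y_i), in B_i v = \<epsilon>(B_i) v: v, t_i v and y_i t_i v have none, so only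
    \<theta>~(y_i) t_i acting on the top component contributes.\<close>
  have th: "tw \<psi> (th_y D i) w = 0" if i: "i \<notin> piTh D" for i
  proof -
    define t where "t = tau D (sr i)"
    define d' where "d' = (if i \<in> setD D then d else 1)"
    define s' where "s' = (if i \<in> setS D then s else 0)"
    obtain ks where ks: "th_y D i \<in> uwt (wtl (prm D i # ks))" using th_y_uwt by blast
    define \<eta> where "\<eta> = wtl (prm D i # ks)"
    have \<eta>: "\<eta> > 0" unfolding \<eta>_def by (rule wtl_pos)
    have U: "t \<in> Uq D" "gy D i * t \<in> Uq D" "th_y D i * t \<in> Uq D" "th_y D i \<in> Uq D"
      unfolding t_def by (auto intro!: subalgD(5)[OF subalg_sets(1)] th_y_Uq)
    have W: "t \<in> uwt 0" "gy D i * t \<in> uwt (- sr i)" "th_y D i * t \<in> uwt \<eta>"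
      using uwt_mult[OF uwt_gens(2)[of i] uwt_gens(3)[of "sr i"]] uwt_mult[OF ks uwt_gens(3)[of "sr i"]]
      by (simp_all add: t_def uwt_gens \<eta>_def)
    have b: "Bgen D s d i = gy D i * t + d' *\<^sub>q (th_y D i * t) + s' *\<^sub>q t"
      by (simp add: Bgen_def t_def d'_def s'_def)
    have U': "d' *\<^sub>q (th_y D i * t) \<in> Uq D" "s' *\<^sub>q t \<in> Uq D" "gy D i * t + d' *\<^sub>q (th_y D i * t) \<in> Uq D"
      using U by (auto intro!: subalgD(4)[OF subalg_sets(1)] subalgD(6)[OF subalg_sets(1)])
    have "tw \<psi> (Bgen D s d i) v = tw \<psi> (gy D i * t) v + d' *\<^sub>q tw \<psi> (th_y D i * t) v + s' *\<^sub>q tw \<psi> t v"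
      unfolding b by (simp only: tw_add[OF \<psi> U'(3,2) v(1)] tw_add[OF \<psi> U(2) U'(1) v(1)]
          tw_scale[OF \<psi> U(3) v(1)] tw_scale[OF \<psi> U(1) v(1)])
    hence "prj (\<mu> + \<eta>) (counit (Bgen D s d i) *\<^sub>q v) = prj (\<mu> + \<eta>) (tw \<psi> (gy D i * t) v)
        + d' *\<^sub>q prj (\<mu> + \<eta>) (tw \<psi> (th_y D i * t) v) + s' *\<^sub>q prj (\<mu> + \<eta>) (tw \<psi> t v)"
      using inv[OF Bstd_gens(3)[OF i]] by (simp add: prj_linear)
    moreover have "prj (\<mu> + \<eta>) v = 0" using \<eta> by (intro \<mu>(2)) simp
    moreover have "prj (\<mu> + \<eta>) (tw \<psi> (th_y D i * t) v) = tw \<psi> (th_y D i * t) w"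
      unfolding w_def by (rule tw_prj[OF \<psi> W(3) U(3) v(1)])
    moreover have "prj (\<mu> + \<eta>) (tw \<psi> t v) = 0"
      using tw_prj[OF \<psi> W(1) U(1) v(1), of "\<mu> + \<eta>"] \<open>prj (\<mu> + \<eta>) v = 0\<close> uautoD(8)[OF \<psi> U(1)] by simp
    moreover have "prj (\<mu> + \<eta>) (tw \<psi> (gy D i * t) v) = 0"
    proof -
      have "sr i > 0" using wtl_pos[of i "[]"] by simp
      hence "\<mu> < \<mu> + \<eta> + sr i" using \<eta> by (metis add.assoc add_pos_pos less_add_same_cancel1)
      thus ?thesis using tw_prj[OF \<psi> W(2) U(2) v(1), of "\<mu> + \<eta> + sr i"] \<mu>(2) uautoD(8)[OF \<psi> U(2)] by simp
    qed
    ultimately have "d' *\<^sub>q tw \<psi> (th_y D i * t) w = 0" by (simp add: prj_linear)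
    hence "tw \<psi> (th_y D i * t) w = 0" using d by (simp add: d'_def split: if_splits)
    moreover have "tw \<psi> (th_y D i * t) w = qpow (ip D \<mu> (sr i)) *\<^sub>q tw \<psi> (th_y D i) w"
      using tw_mult[OF \<psi> U(4,1) wsp_V[OF w]] tw_tau[OF \<psi> _ w, of "sr i"] uautoD(8)[OF \<psi> U(4)] wsp_V[OF w]
      by (simp add: t_def act_scale)
    ultimately show ?thesis by simp
  qed
  have sing: "tw \<psi> (gx D p) w = 0" for p
  proof (cases "p \<in> piTh D")
    case False
    have pp: "prm D (prm D p) = p" "prm D p \<notin> piTh D" using prm_prm[OF False] prm_notin[OF False] by auto
    obtain ks c where "c \<noteq> 0" "tw \<psi> (th_y D (prm D p)) w = c *\<^sub>q xw \<psi> ks (tw \<psi> (gx D p) w)"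
      "xw \<psi> ks (tw \<psi> (gx D p) w) = 0 \<longrightarrow> tw \<psi> (gx D p) w = 0"
      using ad_divided_injective[OF \<psi> w X Y ort False w0Th_reduced] unfolding th_y_def pp(1) by blast
    thus ?thesis using th[OF pp(2)] by simp
  qed (rule X)
  have gen: "V = cv.span {yw \<psi> is w | is. True}" by (rule singular_generates[OF \<psi> w \<mu>(1) sing])
  \<comment> \<open>v_\<lambda> lies in the module generated by w, so \<lambda> is \<mu> lowered by
    a word. As \<mu> is also \<lambda> lowered by a word, both words are empty.\<close>
  have "\<exists>is. M = \<mu> - wtl is"
  proof (rule ccontr)
    assume no: "\<nexists>is. M = \<mu> - wtl is"
    have "prj M x = 0" if "x \<in> cv.span {yw \<psi> is w | is. True}" for x
      using that
    proof (induction rule: cv.span_induct_alt)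
      case (step c x y)
      then obtain "is" where "x = yw \<psi> is w" by blast
      hence "prj M x = 0" using no prj_on_wsp[OF yw_wsp[OF \<psi> w, of "is"], of M] by auto
      thus ?case using step by (simp add: prj_linear)
    qed (simp add: prj_linear)
    hence "prj M hv = 0" using hv(1) gen by blast
    thus False using prj_on_wsp[OF hv_wsp, of M] hv(2) by simp
  qed
  then obtain "is" where 1: "M = \<mu> - wtl is" ..
  obtain js where 2: "\<mu> = M - wtl js" using wsp_nonzero_weight[OF w \<mu>(1)] ..
  have "wtl (is @ js) = 0" using 1 2 by (simp add: algebra_simps)
  hence "js = []" by (simp only: wtl_eq_0_iff) simp
  thus ?thesis using 2 \<mu>(1) by (simp add: w_def)
qed

text \<open>A presentation with the fewest terms is taken: a linear relation among its functionals
  on V would allow one term to be eliminated.\<close>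

lemma mat_coeff_card:
  assumes "g \<in> mat_coeffs D V act"
  obtains K :: "nat set" and v \<xi> where "finite K" "\<And>k. k \<in> K ==> v k \<in> V"
    "\<And>k. k \<in> K ==> Vector_Spaces.linear (*\<^sub>q) (*) (\<xi> k)" "\<And>u. u \<in> Uch D ==> g u = (\<Sum>k\<in>K. \<xi> k (act u (v k)))"
    "\<And>c k. k \<in> K ==> (\<And>w. w \<in> V ==> (\<Sum>k\<in>K. c k * \<xi> k w) = 0) ==> c k = 0"
proof -
  define Q where "Q K \<xi> v \<longleftrightarrow> finite K \<and> (\<forall>k\<in>K. v k \<in> V \<and> Vector_Spaces.linear (*\<^sub>q) (*) (\<xi> k)) \<and>
    (\<forall>u\<in>Uch D. g u = (\<Sum>k\<in>K. \<xi> k (act u (v k))))" for K :: "nat set" and \<xi> :: "nat => 'v => cc" and v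
  obtain vs where vs: "g = (\<lambda>u. if u \<in> Uch D then (\<Sum>(v, \<xi>)\<leftarrow>vs. \<xi> (act u v)) else 0)"
    "\<forall>(v, \<xi>)\<in>set vs. v \<in> V \<and> Vector_Spaces.linear (*\<^sub>q) (*) \<xi>"
    using assms unfolding mat_coeffs_def by blast
  have "Q {..<length vs} (\<lambda>k. snd (vs ! k)) (\<lambda>k. fst (vs ! k))"
    unfolding Q_def
  proof (intro conjI ballI)
    fix k assume "k \<in> {..<length vs}"
    hence "vs ! k \<in> set vs" by simp
    thus "fst (vs ! k) \<in> V" "Vector_Spaces.linear (*\<^sub>q) (*) (snd (vs ! k))" using vs(2) by (auto simp: case_prod_beta)
  next
    fix u assume "u \<in> Uch D"
    hence "g u = (\<Sum>p\<leftarrow>vs. snd p (act u (fst p)))" by (simp add: vs(1) case_prod_beta')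
    thus "g u = (\<Sum>k<length vs. snd (vs ! k) (act u (fst (vs ! k))))"
      by (simp add: sum_list_sum_nth atLeast0LessThan)
  qed simp
  hence "\<exists>n K \<xi> v. card K = n \<and> Q K \<xi> v" by blast
  from LeastI_ex[OF this] obtain K \<xi> v where K: "card K = (LEAST n. \<exists>K \<xi> v. card K = n \<and> Q K \<xi> v)" "Q K \<xi> v" by blast
  have min: "card K \<le> card K'" if "Q K' \<xi>' v'" for K' \<xi>' v' unfolding K(1) using that by (intro Least_le) blast
  have fin: "finite K" and Kv: "\<And>k. k \<in> K ==> v k \<in> V"
    and lin: "\<And>k. k \<in> K ==> Vector_Spaces.linear (*\<^sub>q) (*) (\<xi> k)"
    and g: "\<And>u. u \<in> Uch D ==> g u = (\<Sum>k\<in>K. \<xi> k (act u (v k)))" using K(2) by (auto simp: Q_def)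
  have indep: "c j = 0" if j: "j \<in> K" and c: "\<And>w. w \<in> V ==> (\<Sum>k\<in>K. c k * \<xi> k w) = 0" for c j
  proof (rule ccontr)
    assume cj: "c j \<noteq> 0"
    \<comment> \<open>This change subtracts from g(u) a multiple of the vanishing sum of the c_k
      \<xi>_k(u v_j), and it turns v_j into 0, so that one term drops out.\<close>
    define v' where "v' k = v k - (c k / c j) *\<^sub>q v j" for k
    have "Q (K - {j}) \<xi> v'"
      unfolding Q_def
    proof (intro conjI ballI)
      fix k assume "k \<in> K - {j}"
      thus "v' k \<in> V" "Vector_Spaces.linear (*\<^sub>q) (*) (\<xi> k)" using Kv lin j by (auto simp: v'_def intro!: VI)
    next
      fix u assume u: "u \<in> Uch D"
      have "\<xi> k (act u (v' k)) = \<xi> k (act u (v k)) - (c k / c j) * \<xi> k (act u (v j))" if "k \<in> K" for k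
      proof -
        interpret l: Vector_Spaces.linear "(*\<^sub>q)" "(*)" "\<xi> k" by (rule lin[OF that])
        have "act u (v' k) = act u (v k) - (c k / c j) *\<^sub>q act u (v j)"
          using act_add[OF u Kv[OF that] VI(3)[OF Kv[OF j]], of "- (c k / c j)"] act_scale[OF u Kv[OF j], of "- (c k / c j)"]
          by (simp add: v'_def)
        thus ?thesis by (simp add: l.diff l.scale)
      qed
      hence "(\<Sum>k\<in>K. \<xi> k (act u (v' k))) = g u - (\<Sum>k\<in>K. (c k / c j) * \<xi> k (act u (v j)))"
        by (simp add: g[OF u] sum_subtractf)
      also have "(\<Sum>k\<in>K. (c k / c j) * \<xi> k (act u (v j))) = 0"
      proof -
        have "(\<Sum>k\<in>K. (c k / c j) * \<xi> k (act u (v j))) = (\<Sum>k\<in>K. c k * \<xi> k (act u (v j))) / c j"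
          by (simp add: sum_divide_distrib)
        thus ?thesis using c[OF act_V[OF u Kv[OF j]]] by simp
      qed
      finally have "g u = \<xi> j (act u (v' j)) + (\<Sum>k\<in>K - {j}. \<xi> k (act u (v' k)))"
        using sum.remove[OF fin j, of "\<lambda>k. \<xi> k (act u (v' k))"] by simp
      moreover have "\<xi> j (act u (v' j)) = 0"
        using \<open>\<And>k. k \<in> K ==> \<xi> k (act u (v' k)) = _ k\<close>[OF j] cj by simp
      ultimately show "g u = (\<Sum>k\<in>K - {j}. \<xi> k (act u (v' k)))" by simp
    qed (use fin in simp)
    from min[OF this] show False using card_Diff1_less[OF fin j] by simp
  qed
  show ?thesis by (rule that[of K v \<xi>]) (fact fin Kv lin g indep)+
qed

text \<open>Some u0 carries z_j to v_\<lambda>. Multiplying by tau(\<beta>) and separating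
  characters keeps only the components of weight \<lambda>, which are multiples c_k v_\<lambda>. The
  sum of the c_k \<xi>_k is then 0 on V, hence c_j = 0, whereas c_j v_\<lambda> =
  v_\<lambda>.\<close>

lemma mat_coeff_separates:
  assumes fin: "finite (K :: nat set)" and lin: "\<And>k. k \<in> K ==> Vector_Spaces.linear (*\<^sub>q) (*) (\<xi> k)"
    and indep: "\<And>c k. k \<in> K ==> (\<And>w. w \<in> V ==> (\<Sum>k\<in>K. c k * \<xi> k w) = 0) ==> c k = 0"
    and z: "\<And>k. k \<in> K ==> z k \<in> V" "\<And>u. u \<in> Uch D ==> (\<Sum>k\<in>K. \<xi> k (act u (z k))) = 0" and j: "j \<in> K"
  shows "z j = 0"
proof (rule ccontr)
  assume zj: "z j \<noteq> 0"
  obtain u0 where u0: "u0 \<in> Uq D" "hv = act u0 (z j)" using cyclic[OF z(1)[OF j] zj hv(1)] by blast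
  have u0': "u0 \<in> Uch D" using u0(1) by (rule Uq_in_Uch)
  define y where "y k = act u0 (z k)" for k
  have yV: "y k \<in> V" if "k \<in> K" for k unfolding y_def using act_V[OF u0' z(1)[OF that]] .
  have y0: "(\<Sum>k\<in>K. \<xi> k (act u (y k))) = 0" if "u \<in> Uch D" for u
    using z(2)[OF subalgD(5)[OF subalg_sets(2) that u0']] act_mult[OF that u0'] z(1) by (simp add: y_def)
  have "\<exists>c. prj M (y k) = c *\<^sub>q hv" if "k \<in> K" for k using wsp_top[OF prj_wsp[OF yV[OF that]]] .
  then obtain c where c: "\<And>k. k \<in> K ==> prj M (y k) = c k *\<^sub>q hv" by metis
  have "\<forall>k\<in>K. \<exists>I. finite I \<and> y k = (\<Sum>\<nu>\<in>I. prj \<nu> (y k)) \<and> (\<forall>\<nu>. \<nu> \<notin> I \<longrightarrow> prj \<nu> (y k) = 0)"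
    using prj_decomp[OF yV] by blast
  then obtain I where I: "\<And>k. k \<in> K ==> finite (I k)" "\<And>k. k \<in> K ==> y k = (\<Sum>\<nu>\<in>I k. prj \<nu> (y k))"
    "\<And>k \<nu>. k \<in> K ==> \<nu> \<notin> I k ==> prj \<nu> (y k) = 0" by metis
  define J where "J = insert M (\<Union>k\<in>K. I k)"
  have finJ: "finite J" using fin I(1) by (simp add: J_def)
  have yJ: "y k = (\<Sum>\<nu>\<in>J. prj \<nu> (y k))" if "k \<in> K" for k
  proof -
    have "(\<Sum>\<nu>\<in>I k. prj \<nu> (y k)) = (\<Sum>\<nu>\<in>J. prj \<nu> (y k))"
      using I(3)[OF that] that finJ by (intro sum.mono_neutral_left) (auto simp: J_def)
    thus ?thesis using I(2)[OF that] by simp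
  qed
  have "(\<Sum>k\<in>K. c k * \<xi> k w) = 0" if w: "w \<in> V" for w
  proof -
    obtain u where u: "u \<in> Uq D" "w = act u hv" using cyclic[OF hv(1,2) w] by blast
    have u': "u \<in> Uch D" using u(1) by (rule Uq_in_Uch)
    have "(\<Sum>k\<in>K. \<xi> k (act u (prj M (y k)))) = 0"
    proof (rule qchars_Qpi_independent[OF finJ, where c = "\<lambda>\<nu>. \<Sum>k\<in>K. \<xi> k (act u (prj \<nu> (y k)))"])
      fix \<beta> :: "'n wt" assume \<beta>: "\<beta> \<in> Qpi"
      have "\<xi> k (act (u * tau D \<beta>) (y k)) = (\<Sum>\<nu>\<in>J. \<xi> k (act u (prj \<nu> (y k))) * qpow (ip D \<nu> \<beta>))" if k: "k \<in> K" for k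
      proof -
        interpret l: Vector_Spaces.linear "(*\<^sub>q)" "(*)" "\<xi> k" by (rule lin[OF k])
        have tV: "prj \<nu> (y k) \<in> V" for \<nu> by (rule prj_V[OF yV[OF k]])
        have "act (u * tau D \<beta>) (y k) = rep u (rep (tau D \<beta>) (y k))"
          using u' \<beta> yV[OF k] by (simp add: rep_act act_mult act_V)
        also have "rep (tau D \<beta>) (y k) = (\<Sum>\<nu>\<in>J. qpow (ip D \<nu> \<beta>) *\<^sub>q prj \<nu> (y k))"
          by (subst yJ[OF k]) (simp add: rep_linear_sum tV rep_tau[OF prj_wsp[OF yV[OF k]]])
        also have "rep u \<dots> = (\<Sum>\<nu>\<in>J. qpow (ip D \<nu> \<beta>) *\<^sub>q act u (prj \<nu> (y k)))"
          using tV u' by (simp add: rep_linear_sum VI rep_act act_scale)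
        finally show ?thesis by (simp add: l.sum l.scale mult.commute)
      qed
      hence "(\<Sum>k\<in>K. \<xi> k (act (u * tau D \<beta>) (y k))) =
          (\<Sum>\<nu>\<in>J. (\<Sum>k\<in>K. \<xi> k (act u (prj \<nu> (y k)))) * qpow (ip D \<nu> \<beta>))"
        unfolding sum_distrib_right by (subst sum.swap) (rule sum.cong, simp_all)
      thus "(\<Sum>\<nu>\<in>J. (\<Sum>k\<in>K. \<xi> k (act u (prj \<nu> (y k)))) * qpow (ip D \<nu> \<beta>)) = 0"
        using y0[OF subalgD(5)[OF subalg_sets(2) u' tau_Qpi[OF \<beta>]]] by simp
    qed (simp add: J_def)
    moreover have "\<xi> k (act u (prj M (y k))) = c k * \<xi> k w" if k: "k \<in> K" for k
    proof -
      interpret l: Vector_Spaces.linear "(*\<^sub>q)" "(*)" "\<xi> k" by (rule lin[OF k])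
      show ?thesis using u' hv(1) by (simp add: c[OF k] act_scale u(2) l.scale)
    qed
    ultimately show ?thesis by simp
  qed
  hence "c j = 0" by (rule indep[OF j])
  moreover have "prj M (y j) = hv" using prj_on_wsp[OF hv_wsp, of M] by (simp add: y_def u0(2)[symmetric])
  ultimately show False using c[OF j] hv(2) by simp
qed

text \<open>In a shortest presentation, right invariance under B' passes to each vector v_k. By
  \<open>invariant_top\<close> such invariants are determined by their highest weight component, so
  all v_k are multiples of one v_j and g(u) = \<eta>(u v_j); cyclicity of v_j turns left invariance
  of g into that of \<eta>.\<close>

lemma zonal_form:
  assumes B: "B \<in> Bfam R D" and B': "B' \<in> Bfam R D" and hc: "harish_chandra D B P"
    and g: "g \<in> biinvariants D B B' V act" "g \<noteq> (\<lambda>u. 0)"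
  obtains \<eta> v where "binv B \<eta>" "\<eta> hv \<noteq> 0" "v \<in> V" "prj M v \<noteq> 0" "\<And>u. u \<in> Uch D ==> g u = \<eta> (act u v)"
proof -
  have gm: "g \<in> mat_coeffs D V act"
    and gB: "\<And>b u. b \<in> B ==> u \<in> Uch D ==> g (b * u) = counit b * g u"
    and gB': "\<And>b u. b \<in> B' ==> u \<in> Uch D ==> g (u * b) = counit b * g u"
    using g(1) by (auto simp: biinvariants_def)
  obtain K :: "nat set" and v \<xi> where K: "finite K" "\<And>k. k \<in> K ==> v k \<in> V"
    "\<And>k. k \<in> K ==> Vector_Spaces.linear (*\<^sub>q) (*) (\<xi> k)" "\<And>u. u \<in> Uch D ==> g u = (\<Sum>k\<in>K. \<xi> k (act u (v k)))"
    "\<And>c k. k \<in> K ==> (\<And>w. w \<in> V ==> (\<Sum>k\<in>K. c k * \<xi> k w) = 0) ==> c k = 0"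
  proof (rule mat_coeff_card[OF gm], goal_cases)
    case (1 K v \<xi>)
    show ?case by (rule 1(1)) (fact 1)+
  qed
  have BU: "b \<in> Uch D" if "b \<in> B \<union> B'" for b
    using that Bfam_Uq[OF B] Bfam_Uq[OF B'] Uq_Uch by blast
  have inv: "act b (v j) = counit b *\<^sub>q v j" if b: "b \<in> B'" and j: "j \<in> K" for b j
  proof -
    have bU: "b \<in> Uch D" using BU b by blast
    have "act b (v j) - counit b *\<^sub>q v j = 0"
    proof (rule mat_coeff_separates[where K = K and \<xi> = \<xi> and z = "\<lambda>k. act b (v k) - counit b *\<^sub>q v k"])
      show "c k = 0" if "k \<in> K" "\<And>w. w \<in> V ==> (\<Sum>k\<in>K. c k * \<xi> k w) = 0" for c k
        using that by (rule K(5))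
    next
      fix u assume u: "u \<in> Uch D"
      have "\<xi> k (act u (act b (v k) - counit b *\<^sub>q v k)) = \<xi> k (act (u * b) (v k)) - counit b * \<xi> k (act u (v k))"
        if k: "k \<in> K" for k
      proof -
        interpret l: Vector_Spaces.linear "(*\<^sub>q)" "(*)" "\<xi> k" by (rule K(3)[OF k])
        have "act u (act b (v k) + (- counit b) *\<^sub>q v k) = act u (act b (v k)) + (- counit b) *\<^sub>q act u (v k)"
          using u act_V[OF bU K(2)[OF k]] K(2)[OF k] by (simp only: act_add act_scale VI)
        thus ?thesis using act_mult[OF u bU K(2)[OF k]] by (simp add: l.diff l.scale)
      qed
      hence "(\<Sum>k\<in>K. \<xi> k (act u (act b (v k) - counit b *\<^sub>q v k))) = g (u * b) - counit b * g u"
        by (simp add: K(4)[OF u] K(4)[OF subalgD(5)[OF subalg_sets(2) u bU]] sum_subtractf sum_distrib_left)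
      thus "(\<Sum>k\<in>K. \<xi> k (act u (act b (v k) - counit b *\<^sub>q v k))) = 0" using gB'[OF b u] by simp
    qed (use K(1,2,3) j act_V[OF bU] in \<open>auto intro!: VI\<close>)
    thus ?thesis by simp
  qed
  obtain \<psi> s d where \<psi>: "\<psi> \<in> HAut D" "B' = \<psi> ` Bstd D s d" "d \<noteq> 0" using BfamE[OF B'] .
  have top: "prj M w \<noteq> 0" if w: "w \<in> V" "w \<noteq> 0" "\<And>b. b \<in> B' ==> act b w = counit b *\<^sub>q w" for w
  proof (rule invariant_top[OF HAut_uauto[OF \<psi>(1)] w(1,2) \<psi>(3)])
    fix b assume b: "b \<in> Bstd D s d"
    hence "counit (\<psi> b) = counit b" using HAutD(7)[OF \<psi>(1)] Bstd_Uq by blast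
    thus "act (\<psi> b) w = counit b *\<^sub>q w" using w(3)[of "\<psi> b"] b \<psi>(2) by simp
  qed
  have "\<exists>j\<in>K. v j \<noteq> 0"
  proof (rule ccontr)
    assume 0: "\<not> (\<exists>j\<in>K. v j \<noteq> 0)"
    have "g u = 0" for u
    proof (cases "u \<in> Uch D")
      case True
      have "\<xi> k (act u (v k)) = 0" if k: "k \<in> K" for k
      proof -
        interpret l: Vector_Spaces.linear "(*\<^sub>q)" "(*)" "\<xi> k" by (rule K(3)[OF k])
        show ?thesis using 0 k True by (simp add: l.zero)
      qed
      thus ?thesis by (simp add: K(4)[OF True])
    qed (use gm in \<open>auto simp: mat_coeffs_def\<close>)
    thus False using g(2) by blast
  qed
  then obtain j where j: "j \<in> K" "v j \<noteq> 0" by blast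
  have prjj: "prj M (v j) \<noteq> 0" by (rule top[OF K(2)[OF j(1)] j(2) inv[OF _ j(1)]])
  obtain x where x: "prj M (v j) = x *\<^sub>q hv" using wsp_top[OF prj_wsp[OF K(2)[OF j(1)]]] by blast
  have "\<exists>a. v k = a *\<^sub>q v j" if k: "k \<in> K" for k
  proof -
    obtain y where y: "prj M (v k) = y *\<^sub>q hv" using wsp_top[OF prj_wsp[OF K(2)[OF k]]] by blast
    \<comment> \<open>The highest weight components cancel, so the invariant vector w must be
      0.\<close>
    define w where "w = v k + (- (y / x)) *\<^sub>q v j"
    have wV: "w \<in> V" unfolding w_def using K(2)[OF k] K(2)[OF j(1)] by (intro VI)
    have "prj M w = 0" using prjj by (simp only: w_def prj_linear x y) (simp add: qscale_qscale)
    moreover have "act b w = counit b *\<^sub>q w" if b: "b \<in> B'" for b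
    proof -
      have "act b w = act b (v k) + (- (y / x)) *\<^sub>q act b (v j)"
        unfolding w_def using BU[of b] b K(2)[OF k] K(2)[OF j(1)] by (simp only: act_add act_scale VI Un_iff simp_thms)
      also have "\<dots> = counit b *\<^sub>q v k + (counit b * - (y / x)) *\<^sub>q v j"
        unfolding inv[OF b k] inv[OF b j(1)] by (simp add: qscale_qscale mult.commute)
      also have "\<dots> = counit b *\<^sub>q w" by (simp only: w_def qscale_add_right qscale_qscale)
      finally show ?thesis .
    qed
    ultimately have "w = 0" using top[OF wV] by blast
    hence "v k = (y / x) *\<^sub>q v j" by (simp add: w_def)
    thus ?thesis ..
  qed
  then obtain a where a: "\<And>k. k \<in> K ==> v k = a k *\<^sub>q v j" by metis
  define \<eta> where "\<eta> w = (\<Sum>k\<in>K. a k * \<xi> k w)" for w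
  have ge: "g u = \<eta> (act u (v j))" if u: "u \<in> Uch D" for u
  proof -
    have "\<xi> k (act u (v k)) = a k * \<xi> k (act u (v j))" if k: "k \<in> K" for k
    proof -
      interpret l: Vector_Spaces.linear "(*\<^sub>q)" "(*)" "\<xi> k" by (rule K(3)[OF k])
      show ?thesis by (subst a[OF k]) (simp add: act_scale[OF u K(2)[OF j(1)]] l.scale)
    qed
    thus ?thesis by (simp add: K(4)[OF u] \<eta>_def)
  qed
  have lin: "\<eta> (w + w') = \<eta> w + \<eta> w'" "\<eta> (c *\<^sub>q w) = c * \<eta> w" for w w' c
  proof -
    have "\<xi> k (w + w') = \<xi> k w + \<xi> k w'" "\<xi> k (c *\<^sub>q w) = c * \<xi> k w" if "k \<in> K" for k
    proof -
      interpret l: Vector_Spaces.linear "(*\<^sub>q)" "(*)" "\<xi> k" by (rule K(3)[OF that])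
      show "\<xi> k (w + w') = \<xi> k w + \<xi> k w'" "\<xi> k (c *\<^sub>q w) = c * \<xi> k w" by (rule l.add l.scale)+
    qed
    thus "\<eta> (w + w') = \<eta> w + \<eta> w'" "\<eta> (c *\<^sub>q w) = c * \<eta> w"
      by (simp_all add: \<eta>_def ring_distribs sum.distrib sum_distrib_left mult_ac)
  qed
  have bi: "binv B \<eta>"
    unfolding binv_def
  proof (intro conjI ballI allI lin)
    fix b w assume b: "b \<in> B" and w: "w \<in> V"
    obtain u where u: "u \<in> Uq D" "w = act u (v j)" using cyclic[OF K(2)[OF j(1)] j(2) w] .
    have U: "u \<in> Uch D" "b \<in> Uch D" using u(1) b BU by (auto intro: Uq_in_Uch)
    show "\<eta> (act b w) = counit b * \<eta> w"
      using gB[OF b U(1)] ge[OF U(1)] ge[OF subalgD(5)[OF subalg_sets(2) U(2,1)]] act_mult[OF U(2,1) K(2)[OF j(1)]]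
      by (simp add: u(2))
  qed
  have "\<eta> hv \<noteq> 0"
  proof
    assume 0: "\<eta> hv = 0"
    have "g u = 0" for u
    proof (cases "u \<in> Uch D")
      case True
      show ?thesis unfolding ge[OF True] by (rule binv_eq_0[OF B bi hc 0 act_V[OF True K(2)[OF j(1)]]])
    qed (use gm in \<open>auto simp: mat_coeffs_def\<close>)
    thus False using g(2) by blast
  qed
  from that[OF bi this K(2)[OF j(1)] prjj ge] show ?thesis .
qed

text \<open>Independence of the characters of the root lattice identifies the coefficient of \<phi>
  at \<nu> with \<eta> of the component of v of weight \<nu>.\<close>

lemma zonal_leading:
  assumes \<eta>: "binv B \<eta>" "\<eta> hv \<noteq> 0" and v: "v \<in> V" "prj M v \<noteq> 0" and g: "\<And>u. u \<in> Uch D ==> g u = \<eta> (act u v)"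
    and \<phi>: "\<And>\<gamma>. \<gamma> \<in> Ppi D ==> g (tau D \<gamma>) = zval D \<phi> \<gamma>"
  shows "lookup \<phi> M \<noteq> 0" "\<nu> \<in> keys \<phi> ==> \<nu> \<le> M"
proof -
  obtain I where I: "finite I" "v = (\<Sum>\<nu>\<in>I. prj \<nu> v)" "\<forall>\<nu>. \<nu> \<notin> I \<longrightarrow> prj \<nu> v = 0"
    using prj_decomp[OF v(1)] by blast
  have pV: "prj \<nu> v \<in> V" for \<nu> by (rule prj_V[OF v(1)])
  have lookup: "lookup \<phi> \<nu> = \<eta> (prj \<nu> v)" for \<nu>
  proof -
    define J where "J = insert \<nu> (I \<union> keys \<phi>)"
    have finJ: "finite J" using I(1) by (simp add: J_def)
    have "lookup \<phi> \<nu> - \<eta> (prj \<nu> v) = 0"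
    proof (rule qchars_Qpi_independent[OF finJ, where c = "\<lambda>\<nu>. lookup \<phi> \<nu> - \<eta> (prj \<nu> v)"])
      fix \<beta> :: "'n wt" assume \<beta>: "\<beta> \<in> Qpi"
      have "zval D \<phi> \<beta> = (\<Sum>\<nu>\<in>J. lookup \<phi> \<nu> * qpow (ip D \<nu> \<beta>))"
        unfolding zval_def using finJ by (intro sum.mono_neutral_left) (auto simp: J_def in_keys_iff)
      moreover have "g (tau D \<beta>) = (\<Sum>\<nu>\<in>J. \<eta> (prj \<nu> v) * qpow (ip D \<nu> \<beta>))"
      proof -
        have "v = (\<Sum>\<nu>\<in>J. prj \<nu> v)"
          by (subst I(2)) (use I(3) finJ in \<open>intro sum.mono_neutral_left, auto simp: J_def\<close>)
        hence "rep (tau D \<beta>) v = rep (tau D \<beta>) (\<Sum>\<nu>\<in>J. prj \<nu> v)" by simp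
        also have "\<dots> = (\<Sum>\<nu>\<in>J. qpow (ip D \<nu> \<beta>) *\<^sub>q prj \<nu> v)"
          by (simp add: rep_linear_sum pV rep_tau[OF prj_wsp[OF v(1)]])
        finally have "act (tau D \<beta>) v = (\<Sum>\<nu>\<in>J. qpow (ip D \<nu> \<beta>) *\<^sub>q prj \<nu> v)" using rep_act[OF tau_Qpi[OF \<beta>] v(1)] by simp
        thus ?thesis using g[OF tau_Qpi[OF \<beta>]] by (simp add: binv_sum[OF \<eta>(1)] VI pV binvD(2)[OF \<eta>(1)] mult.commute)
      qed
      ultimately show "(\<Sum>\<nu>\<in>J. (lookup \<phi> \<nu> - \<eta> (prj \<nu> v)) * qpow (ip D \<nu> \<beta>)) = 0"
        using \<phi>[OF Qpi_Ppi[OF \<beta>]] by (simp add: left_diff_distrib sum_subtractf)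
    qed (simp add: J_def)
    thus ?thesis by simp
  qed
  obtain x where x: "prj M v = x *\<^sub>q hv" using wsp_top[OF prj_wsp[OF v(1)]] by blast
  show "lookup \<phi> M \<noteq> 0"
    using v(2) \<eta>(2) by (simp add: lookup x binvD(2)[OF \<eta>(1) hv(1)])
  show "\<nu> \<le> M" if "\<nu> \<in> keys \<phi>"
  proof -
    have "prj \<nu> v \<noteq> 0" using that by (auto simp: in_keys_iff lookup binv_0[OF \<eta>(1)])
    then obtain ks where ks: "\<nu> = M - wtl ks" using wsp_nonzero_weight[OF prj_wsp[OF v(1)]] by blast
    have "wtl ks \<ge> 0" by (cases ks) (auto intro: less_imp_le wtl_pos simp del: wtl_simps(2))
    thus ?thesis by (simp add: ks)
  qed
qed

end

section \<open>Difference operators\<close>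

lemma galg_ops: "0 \<in> galg H" "p \<in> galg H ==> r \<in> galg H ==> p + r \<in> galg H"
  "0 \<in> H ==> single 0 c \<in> galg H" "H \<subseteq> H' ==> p \<in> galg H ==> p \<in> galg H'"
  using keys_add[of p r] by (auto simp: galg_def)

lemma galg_mult: "(\<And>u v. u \<in> H ==> v \<in> H ==> u + v \<in> H) ==> p \<in> galg H ==> r \<in> galg H ==> p * r \<in> galg H"
  using keys_mult[of p r] by (fastforce simp: galg_def)

lemma tact_pmext: "tact D \<beta> p = pmext (\<lambda>v c. single v (qpow (ip D v \<beta>) * c)) p"
  by (simp add: tact_def pmext_def)

lemma tact_0 [simp]: "tact D \<beta> 0 = 0"
  by (simp add: tact_pmext)

lemma tact_single: "tact D \<beta> (single v c) = single v (qpow (ip D v \<beta>) * c)"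
  unfolding tact_pmext by (rule pmext_single) simp

lemma tact_add: "tact D \<beta> (p + r) = tact D \<beta> p + tact D \<beta> r"
  unfolding tact_pmext by (rule pmext_add) (simp_all add: ring_distribs single_add)

lemma lookup_tact: "lookup (tact D \<beta> p) v = qpow (ip D v \<beta>) * lookup p v"
proof (induction p rule: pm_induct)
  case (single k c)
  show ?case by (simp add: tact_single lookup_single when_def)
qed (simp_all add: tact_add lookup_add ring_distribs)

lemma keys_tact: "keys (tact D \<beta> p) = keys p"
  by (auto simp: in_keys_iff lookup_tact)

lemma tact_eq_0_iff [simp]: "tact D \<beta> p = 0 \<longleftrightarrow> p = 0"
  using keys_tact[of D \<beta> p] by (metis keys_eq_empty)

lemma tact_mult: "tact D \<beta> (p * r) = tact D \<beta> p * tact D \<beta> r"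
proof (induction p rule: pm_induct)
  case (single w c)
  show ?case
  proof (induction r rule: pm_induct)
    case (single v d)
    show ?case by (simp add: mult_single tact_single ip_add_left qpow_add mult_ac)
  qed (simp_all add: ring_distribs tact_add)
qed (simp_all add: ring_distribs tact_add)

lemma tact_1 [simp]: "tact D \<beta> 1 = 1"
  by (simp add: tact_single flip: single_one)

lemma tact_tact: "tact D \<beta> (tact D \<gamma> p) = tact D (\<beta> + \<gamma>) p"
  by (rule poly_mapping_eqI) (simp add: lookup_tact ip_add_right qpow_add)

lemma tact_zero: "tact D 0 p = p"
  by (rule poly_mapping_eqI) (simp add: lookup_tact)

text \<open>Multiplicativity and injectivity of \<open>tact\<close> make the value independent of
  the chosen fraction.\<close>

lemma fext_tact:
  assumes "b \<noteq> 0"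
  shows "fext (tact D \<beta>) (Fract a b) = Fract (tact D \<beta> a) (tact D \<beta> b)"
  unfolding fext_def
proof (rule the_equality)
  show "\<exists>a' b'. b' \<noteq> 0 \<and> Fract a b = Fract a' b' \<and> Fract (tact D \<beta> a) (tact D \<beta> b) = Fract (tact D \<beta> a') (tact D \<beta> b')"
    using assms by blast
  fix y assume "\<exists>a' b'. b' \<noteq> 0 \<and> Fract a b = Fract a' b' \<and> y = Fract (tact D \<beta> a') (tact D \<beta> b')"
  then obtain a' b' where *: "b' \<noteq> 0" "Fract a b = Fract a' b'" "y = Fract (tact D \<beta> a') (tact D \<beta> b')" by blast
  have "a * b' = a' * b" using *(1,2) assms by (simp add: eq_fract)
  hence "tact D \<beta> a * tact D \<beta> b' = tact D \<beta> a' * tact D \<beta> b" by (metis tact_mult)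
  thus "y = Fract (tact D \<beta> a) (tact D \<beta> b)" using *(1,3) assms by (simp add: eq_fract)
qed

lemma fext_tact_add: "fext (tact D \<beta>) (x + y) = fext (tact D \<beta>) x + fext (tact D \<beta>) y"
  and fext_tact_mult: "fext (tact D \<beta>) (x * y) = fext (tact D \<beta>) x * fext (tact D \<beta>) y"
  by (cases x; cases y; simp add: fext_tact tact_add tact_mult)+

lemma fext_tact_tact: "fext (tact D \<beta>) (fext (tact D \<gamma>) x) = fext (tact D (\<beta> + \<gamma>)) x"
  by (cases x) (simp add: fext_tact tact_tact)

lemma fext_tact_zero: "fext (tact D 0) x = x"
  by (cases x) (simp add: fext_tact tact_zero)

lemma fext_tact_0: "fext (tact D \<beta>) 0 = 0"
  using fext_tact_add[of D \<beta> 0 0] add_cancel_right_right by (metis add_0)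

section \<open>Normal forms of difference operators\<close>

context weights begin

lemma PSigma_galg: "p \<in> galg (PSigma D) ==> r \<in> galg (PSigma D) ==> p * r \<in> galg (PSigma D)"
  by (rule galg_mult[OF PSigma_add])

lemma gfracI: "a \<in> galg H ==> b \<in> galg H ==> b \<noteq> 0 ==> Fract a b \<in> gfrac H"
  by (auto simp: gfrac_def)

lemma gfrac_ops: "x \<in> gfrac (PSigma D) ==> y \<in> gfrac (PSigma D) ==> x + y \<in> gfrac (PSigma D)"
  "x \<in> gfrac (PSigma D) ==> y \<in> gfrac (PSigma D) ==> x * y \<in> gfrac (PSigma D)" "0 \<in> gfrac (PSigma D)" "1 \<in> gfrac (PSigma D)"
  "x \<in> gfrac (PSigma D) ==> fext (tact D \<beta>) x \<in> gfrac (PSigma D)"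
proof -
  have 1: "1 \<in> galg (PSigma D)" using galg_ops(3)[of "PSigma D" 1] by (simp add: single_one)
  show "0 \<in> gfrac (PSigma D)" unfolding Zero_fract_def by (rule gfracI[OF galg_ops(1) 1]) simp
  show "1 \<in> gfrac (PSigma D)" unfolding One_fract_def by (rule gfracI[OF 1 1]) simp
  show "x + y \<in> gfrac (PSigma D)" "x * y \<in> gfrac (PSigma D)" if xy: "x \<in> gfrac (PSigma D)" "y \<in> gfrac (PSigma D)"
  proof -
    obtain a b where a: "x = Fract a b" "a \<in> galg (PSigma D)" "b \<in> galg (PSigma D)" "b \<noteq> 0"
      using xy(1) unfolding gfrac_def by blast
    obtain c d where c: "y = Fract c d" "c \<in> galg (PSigma D)" "d \<in> galg (PSigma D)" "d \<noteq> 0"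
      using xy(2) unfolding gfrac_def by blast
    have "Fract (a * d + c * b) (b * d) \<in> gfrac (PSigma D)" "Fract (a * c) (b * d) \<in> gfrac (PSigma D)"
      using a c by (auto intro!: gfracI PSigma_galg galg_ops(2))
    thus "x + y \<in> gfrac (PSigma D)" "x * y \<in> gfrac (PSigma D)" using a c by simp_all
  qed
  show "fext (tact D \<beta>) x \<in> gfrac (PSigma D)" if x: "x \<in> gfrac (PSigma D)"
  proof -
    obtain a b where a: "x = Fract a b" "a \<in> galg (PSigma D)" "b \<in> galg (PSigma D)" "b \<noteq> 0"
      using x unfolding gfrac_def by blast
    have "tact D \<beta> a \<in> galg (PSigma D)" "tact D \<beta> b \<in> galg (PSigma D)" using a(2,3) by (simp_all add: galg_def keys_tact)
    thus ?thesis using a(4) by (simp add: a(1) fext_tact gfracI)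
  qed
qed

text \<open>Sums of shifts followed by multiplications. In the applications the coefficients lie in
  the fraction field of C[P(\<Sigma>)], on which the operators act.\<close>

definition nform :: "('n wt \<times> 'n zfrac) list => 'n rop" where
  "nform ps = rop_of D (\<lambda>x. \<Sum>(\<mu>, a)\<leftarrow>ps. a * fext (tact D \<mu>) x)"

lemma nform_gfrac:
  assumes "set ps \<subseteq> P2Sigma D \<times> gfrac (PSigma D)" "x \<in> gfrac (PSigma D)"
  shows "(\<Sum>(\<mu>, a)\<leftarrow>ps. a * fext (tact D \<mu>) x) \<in> gfrac (PSigma D)"
  using assms by (induction ps) (auto intro!: gfrac_ops)

lemma P2Sigma_ops: "0 \<in> P2Sigma D" "u \<in> P2Sigma D ==> v \<in> P2Sigma D ==> u + v \<in> P2Sigma D"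
proof -
  show "0 \<in> P2Sigma D" unfolding P2Sigma_def by (rule image_eqI[of _ _ 0]) simp_all
  assume "u \<in> P2Sigma D" "v \<in> P2Sigma D"
  then obtain u' v' where "u = rscale 2 u'" "v = rscale 2 v'" "u' \<in> PSigma D" "v' \<in> PSigma D"
    by (auto simp: P2Sigma_def)
  thus "u + v \<in> P2Sigma D" unfolding P2Sigma_def using PSigma_add
    by (intro image_eqI[of _ _ "u' + v'"]) (simp_all add: rscale_distribs)
qed

text \<open>A fraction is moved past a shift by applying \<open>fext (tact D \<nu>)\<close> to it,
  so normal forms are closed under composition. The cut-off in \<open>rop_of\<close> is compatible
  with this because normal forms preserve the field.\<close>

lemma diffops_nform:
  assumes Q: "QSigma D \<subseteq> PSigma D" and S: "S \<in> diffops D"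
  shows "\<exists>ps. set ps \<subseteq> P2Sigma D \<times> gfrac (PSigma D) \<and> S = nform ps"
  using S
proof induction
  case (mult_op a)
  have "a \<in> gfrac (PSigma D)" using mult_op galg_ops(4)[OF Q] by (auto simp: gfrac_def)
  thus ?case using P2Sigma_ops(1)
    by (intro exI[of _ "[(0, a)]"]) (simp add: nform_def fext_tact_zero mult.commute)
next
  case (shift_op \<beta>)
  thus ?case using gfrac_ops(4) by (intro exI[of _ "[(\<beta>, 1)]"]) (simp add: nform_def)
next
  case (add_op S T)
  then obtain ps rs where "set ps \<subseteq> P2Sigma D \<times> gfrac (PSigma D)" "S = nform ps"
    "set rs \<subseteq> P2Sigma D \<times> gfrac (PSigma D)" "T = nform rs" by blast
  thus ?case by (intro exI[of _ "ps @ rs"]) (auto simp: nform_def rop_add_def rop_of_def)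
next
  case (comp_op S T)
  then obtain ps rs where *: "set ps \<subseteq> P2Sigma D \<times> gfrac (PSigma D)" "S = nform ps"
    "set rs \<subseteq> P2Sigma D \<times> gfrac (PSigma D)" "T = nform rs" by blast
  define ts where "ts = [(\<nu> + \<mu>, b * fext (tact D \<nu>) a). (\<nu>, b) \<leftarrow> rs, (\<mu>, a) \<leftarrow> ps]"
  have "(\<Sum>(\<mu>, a)\<leftarrow>ts. a * fext (tact D \<mu>) x) =
      (\<Sum>(\<nu>, b)\<leftarrow>rs. b * fext (tact D \<nu>) (\<Sum>(\<mu>, a)\<leftarrow>ps. a * fext (tact D \<mu>) x))" for x
  proof -
    have inner: "(\<Sum>(\<mu>, a)\<leftarrow>[(\<nu> + \<mu>, b * fext (tact D \<nu>) a). (\<mu>, a) \<leftarrow> ps]. a * fext (tact D \<mu>) x) =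
        b * fext (tact D \<nu>) (\<Sum>(\<mu>, a)\<leftarrow>ps. a * fext (tact D \<mu>) x)" for \<nu> b
      by (induction ps) (auto simp: fext_tact_0 fext_tact_add fext_tact_mult fext_tact_tact ring_distribs mult_ac)
    show ?thesis unfolding ts_def
    proof (induction rs)
      case (Cons r rs)
      obtain \<nu> b where r: "r = (\<nu>, b)" by (cases r)
      show ?case using Cons inner[of \<nu> b] by (simp add: r)
    qed simp
  qed
  hence "rop_mult S T = nform ts"
    using nform_gfrac[OF *(1)] by (auto simp: rop_mult_def *(2,4) nform_def rop_of_def fun_eq_iff)
      (simp add: gfrac_ops(3) fext_tact_0 case_prod_beta')
  moreover have "set ts \<subseteq> P2Sigma D \<times> gfrac (PSigma D)"
    using *(1,3) by (auto simp: ts_def intro!: P2Sigma_ops gfrac_ops)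
  ultimately show ?case by blast
qed

lemma collect_terms:
  assumes "finite M" "fst ` set ps \<subseteq> M"
  shows "(\<Sum>(\<mu>, a)\<leftarrow>ps. a * g \<mu>) = (\<Sum>\<mu>\<in>M. (\<Sum>(\<nu>, a)\<leftarrow>ps. if \<nu> = \<mu> then a else 0) * (g \<mu> :: 'r::comm_ring_1))"
  using assms(2)
proof (induction ps)
  case (Cons p ps)
  obtain \<nu> a where p: "p = (\<nu>, a)" by (cases p)
  have "\<nu> \<in> M" using Cons.prems p by simp
  hence "(\<Sum>\<mu>\<in>M. (if \<nu> = \<mu> then a else 0) * g \<mu>) = a * g \<nu>"
    using assms(1) by (subst sum.remove[of M \<nu>]) (auto intro!: sum.neutral split: if_splits)
  thus ?case using Cons by (simp add: p ring_distribs sum.distrib)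
qed simp

lemma common_denominator_fract:
  assumes "finite M"
  shows "\<exists>d p. d \<noteq> 0 \<and> (\<forall>\<mu>\<in>M. F \<mu> = Fract (p \<mu>) (d :: 'r::idom))"
  using assms
proof induction
  case empty
  show ?case by (auto intro: exI[of _ 1])
next
  case (insert \<nu> M)
  then obtain d p where d: "d \<noteq> 0" "\<forall>\<mu>\<in>M. F \<mu> = Fract (p \<mu>) d" by blast
  obtain a b where ab: "F \<nu> = Fract a b" "b \<noteq> 0" by (cases "F \<nu>")
  have "\<forall>\<mu>\<in>insert \<nu> M. F \<mu> = Fract (if \<mu> = \<nu> then a * d else p \<mu> * b) (d * b)"
    using d ab insert.hyps by (auto simp: eq_fract)
  thus ?case using d(1) ab(2) by (intro exI[of _ "d * b"] exI[of _ "\<lambda>\<mu>. if \<mu> = \<nu> then a * d else p \<mu> * b"]) auto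
qed

text \<open>Compare the coefficients at the leading exponent.\<close>

lemma diffop_eq_zero:
  assumes Q: "QSigma D \<subseteq> PSigma D" and S: "S \<in> diffops D"
    and \<phi>: "\<And>M. M \<in> Pplus2Sigma D ==> \<phi> M \<in> galg (P2Sigma D)"
      "\<And>M. M \<in> Pplus2Sigma D ==> lookup (\<phi> M) M \<noteq> 0"
      "\<And>M \<nu>. M \<in> Pplus2Sigma D ==> \<nu> \<in> keys (\<phi> M) ==> \<nu> \<le> M"
    and 0: "\<And>M. M \<in> Pplus2Sigma D ==> S (Fract (\<phi> M) 1) = 0"
  shows "S = rop_zero"
proof -
  obtain ps where ps: "set ps \<subseteq> P2Sigma D \<times> gfrac (PSigma D)" "S = nform ps"
    using diffops_nform[OF Q S] by blast
  define A where "A = fst ` set ps"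
  define F where "F \<mu> = (\<Sum>(\<nu>, a)\<leftarrow>ps. if \<nu> = \<mu> then a else 0)" for \<mu>
  have A: "finite A" "A \<subseteq> P2Sigma D" using ps(1) by (auto simp: A_def)
  have coll: "(\<Sum>(\<mu>, a)\<leftarrow>ps. a * fext (tact D \<mu>) x) = (\<Sum>\<mu>\<in>A. F \<mu> * fext (tact D \<mu>) x)" for x
    unfolding F_def by (rule collect_terms[OF A(1)]) (simp add: A_def)
  obtain d p where d: "d \<noteq> 0" "\<And>\<mu>. \<mu> \<in> A ==> F \<mu> = Fract (p \<mu>) d"
    using common_denominator_fract[OF A(1), of F] by blast
  have "p \<mu> = 0" if "\<mu> \<in> A" for \<mu>
  proof (rule ccontr)
    assume "p \<mu> \<noteq> 0"
    define K where "K = (\<Union>\<mu>\<in>A. keys (p \<mu>))"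
    have K: "finite K" "K \<noteq> {}" using A(1) that \<open>p \<mu> \<noteq> 0\<close> by (auto simp: K_def)
    \<comment> \<open>The greatest exponent among all numerators p \<mu>. At \<kappa> + M only the
      coefficients of p \<mu> at \<kappa> and of \<phi> M at M meet, since shifts change
      coefficients but no exponents.\<close>
    define \<kappa> where "\<kappa> = Max K"
    have \<kappa>: "\<kappa> \<in> K" "\<And>v. v \<in> K ==> v \<le> \<kappa>" using K by (auto simp: \<kappa>_def)
    have "(\<Sum>\<mu>\<in>A. lookup (p \<mu>) \<kappa> * qpow (ip D M \<mu>)) = 0" if L: "M \<in> Pplus2Sigma D" for M
    proof -
      have "\<phi> M \<in> galg (PSigma D)" using \<phi>(1)[OF L] galg_ops(4)[of "P2Sigma D" "PSigma D"] P2Sigma_PSigma by blast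
      hence "Fract (\<phi> M) 1 \<in> gfrac (PSigma D)"
        using galg_ops(3)[of "PSigma D" 1] by (intro gfracI) (simp_all add: single_one)
      hence "(\<Sum>\<mu>\<in>A. F \<mu> * fext (tact D \<mu>) (Fract (\<phi> M) 1)) = 0"
        using 0[OF L] coll by (simp add: ps(2) nform_def rop_of_def)
      moreover have "F \<mu> * fext (tact D \<mu>) (Fract (\<phi> M) 1) = Fract (p \<mu> * tact D \<mu> (\<phi> M)) d" if "\<mu> \<in> A" for \<mu>
        using d that by (simp add: fext_tact)
      moreover have "(\<Sum>\<mu>\<in>I. Fract (g \<mu>) d) = Fract (\<Sum>\<mu>\<in>I. g \<mu>) d" for g and I :: "'n wt set"
        using d(1) by (induction I rule: infinite_finite_induct)
          (simp_all add: Zero_fract_def eq_fract ring_distribs mult_ac)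
      ultimately have "Fract (\<Sum>\<mu>\<in>A. p \<mu> * tact D \<mu> (\<phi> M)) d = 0" by simp
      hence "(\<Sum>\<mu>\<in>A. p \<mu> * tact D \<mu> (\<phi> M)) = 0" using d(1) by (simp add: Zero_fract_def eq_fract)
      hence "lookup (\<Sum>\<mu>\<in>A. p \<mu> * tact D \<mu> (\<phi> M)) (\<kappa> + M) = 0" by (simp only: lookup_zero)
      hence "(\<Sum>\<mu>\<in>A. lookup (p \<mu> * tact D \<mu> (\<phi> M)) (\<kappa> + M)) = 0"
        by (simp only: lookup_sum)
      moreover have "lookup (p \<mu> * tact D \<mu> (\<phi> M)) (\<kappa> + M) =
          lookup (p \<mu>) \<kappa> * qpow (ip D M \<mu>) * lookup (\<phi> M) M" if "\<mu> \<in> A" for \<mu>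
        using \<kappa>(2) \<phi>(3)[OF L] that by (subst lookup_mult_max) (auto simp: K_def keys_tact lookup_tact)
      ultimately have "(\<Sum>\<mu>\<in>A. lookup (p \<mu>) \<kappa> * qpow (ip D M \<mu>)) * lookup (\<phi> M) M = 0"
        by (simp add: sum_distrib_right)
      thus ?thesis using \<phi>(2)[OF L] by simp
    qed
    hence "lookup (p \<nu>) \<kappa> = 0" if "\<nu> \<in> A" for \<nu>
      using A P2Sigma_anti that by (intro qchars_independent[of A "\<lambda>\<mu>. lookup (p \<mu>) \<kappa>"]) auto
    thus False using \<kappa>(1) by (auto simp: K_def in_keys_iff)
  qed
  hence "F \<mu> = 0" if "\<mu> \<in> A" for \<mu> using d that by (simp add: Zero_fract_def eq_fract)
  thus ?thesis by (auto simp: ps(2) nform_def rop_of_def coll rop_zero_def)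
qed

end

section \<open>The kernel of the Harish-Chandra map\<close>

lemma (in qgroup) hwmodI: "simple_hw_module D M V act ==> hwmod D M V act"
  by (intro hwmod.intro qgroup_axioms hwmod_axioms.intro)

locale radial = qgroup D for D :: "('n::{finite,linorder}, 'u::chopf) qsp" +
  fixes R :: "cc set" and B B' :: "'u set" and P :: "'u => 'u"
    and V :: "'n wt => 'v::cvec set" and act :: "'n wt => 'u => 'v => 'v"
    and g :: "'n wt => 'u => cc" and \<phi> :: "'n wt => 'n zalg" and \<X> :: "'u => 'n rop"
  assumes Q: "QSigma D \<subseteq> PSigma D" and B: "B \<in> Bfam R D" and B': "B' \<in> Bfam R D"
    and hc: "harish_chandra D B P" and zf: "zonal_family D B B' V act g \<phi>"
    and rc: "radial_component D B P g \<phi> \<X>"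
begin

lemma UB: "subalg (UB D B)" "u \<in> UB D B ==> u \<in> Uch D"
  using subalg_UB[OF B] UB_iff[OF B] by auto

lemma zonal:
  assumes L: "M \<in> Pplus2Sigma D"
  shows "hwmod D M (V M) (act M)" "g M \<noteq> (\<lambda>u. 0)" "g M \<in> biinvariants D B B' (V M) (act M)"
    "\<phi> M \<in> galg (P2Sigma D)" "\<gamma> \<in> Ppi D ==> g M (tau D \<gamma>) = zval D (\<phi> M) \<gamma>"
proof -
  have z: "simple_hw_module D M (V M) (act M)" "g M \<noteq> (\<lambda>u. 0)"
    "biinvariants D B B' (V M) (act M) = {(\<lambda>u. c * g M u) | c. True}" "\<phi> M \<in> galg (P2Sigma D)"
    "\<forall>\<gamma>\<in>Ppi D. g M (tau D \<gamma>) = zval D (\<phi> M) \<gamma>"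
    using zf L unfolding zonal_family_def by blast+
  have "g M = (\<lambda>u. 1 * g M u)" by simp
  hence "g M \<in> {(\<lambda>u. c * g M u) | c. True}" by blast
  thus "hwmod D M (V M) (act M)" "g M \<noteq> (\<lambda>u. 0)" "g M \<in> biinvariants D B B' (V M) (act M)"
    "\<phi> M \<in> galg (P2Sigma D)" "\<gamma> \<in> Ppi D ==> g M (tau D \<gamma>) = zval D (\<phi> M) \<gamma>"
    using z hwmodI by auto
qed

lemma phi_leading:
  assumes L: "M \<in> Pplus2Sigma D"
  shows "lookup (\<phi> M) M \<noteq> 0" "\<nu> \<in> keys (\<phi> M) ==> \<nu> \<le> M"
proof -
  interpret m: hwmod D M "V M" "act M" by (rule zonal(1)[OF L])
  obtain \<eta> v where z: "m.binv B \<eta>" "\<eta> m.hv \<noteq> 0" "v \<in> V M" "m.prj M v \<noteq> 0" "\<And>u. u \<in> Uch D ==> g M u = \<eta> (act M u v)"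
    using m.zonal_form[OF B B' hc zonal(3)[OF L] zonal(2)[OF L]] by blast
  show "lookup (\<phi> M) M \<noteq> 0" "\<nu> \<in> keys (\<phi> M) ==> \<nu> \<le> M"
    using m.zonal_leading[OF z zonal(5)[OF L]] by blast+
qed

lemma spherical_functional:
  assumes L: "M \<in> Pplus2Sigma D"
  obtains \<eta> where "hwmod.binv (V M) (act M) B \<eta>" "\<eta> (hwmod.hv D M (V M) (act M)) \<noteq> 0"
proof -
  interpret m: hwmod D M "V M" "act M" by (rule zonal(1)[OF L])
  show ?thesis using m.zonal_form[OF B B' hc zonal(3)[OF L] zonal(2)[OF L]] that by blast
qed

lemma BTplusU_subspace: "cv.subspace (BTplusU D B)"
  by (simp add: BTplusU_def span_prod_def cv.subspace_span)

lemma HC_subspace: "cv.subspace (HC_complement D B)"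
proof -
  have "cv.subspace (span_prod (aug (Nplus D)) (Ach D))" by (simp add: span_prod_def cv.subspace_span)
  from cv.subspace_sums[OF BTplusU_subspace this] show ?thesis unfolding HC_complement_def
    by (simp add: conj_commute conj_left_commute)
qed

lemma BTplusU_HC: "a \<in> BTplusU D B ==> a \<in> HC_complement D B"
proof -
  assume "a \<in> BTplusU D B"
  moreover have "a = a + 0" "0 \<in> span_prod (aug (Nplus D)) (Ach D)" by (simp_all add: span_prod_def cv.span_zero)
  ultimately show ?thesis unfolding HC_complement_def by blast
qed

lemma HC: "u \<in> Uch D ==> P u \<in> cv.span (Ach D)" "u \<in> Uch D ==> u - P u \<in> HC_complement D B"
  "a \<in> HC_complement D B ==> a \<in> cv.span (Ach D) ==> a = 0"
  using hc unfolding harish_chandra_def by blast+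

lemma P_eqI:
  assumes "u \<in> Uch D" "a \<in> cv.span (Ach D)" "u - a \<in> HC_complement D B"
  shows "P u = a"
proof -
  have "P u - a = (u - a) - (u - P u)" by simp
  hence "P u - a \<in> HC_complement D B" using cv.subspace_diff[OF HC_subspace assms(3) HC(2)[OF assms(1)]] by simp
  hence "P u - a = 0" using cv.span_diff[OF HC(1)[OF assms(1)] assms(2)] by (rule HC(3))
  thus ?thesis by simp
qed

lemma P_linear: "u \<in> Uch D ==> u' \<in> Uch D ==> P (u + u') = P u + P u'" "u \<in> Uch D ==> P (c *\<^sub>q u) = c *\<^sub>q P u"
proof -
  assume u: "u \<in> Uch D"
  show "P (c *\<^sub>q u) = c *\<^sub>q P u"
  proof (rule P_eqI)
    show "c *\<^sub>q u - c *\<^sub>q P u \<in> HC_complement D B"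
      using cv.subspace_scale[OF HC_subspace HC(2)[OF u], of c] by (simp add: qscale_diff)
  qed (use u HC(1)[OF u] in \<open>auto intro: cv.span_scale subalgD(6)[OF subalg_sets(2)]\<close>)
  assume u': "u' \<in> Uch D"
  show "P (u + u') = P u + P u'"
  proof (rule P_eqI)
    show "u + u' - (P u + P u') \<in> HC_complement D B"
      using cv.subspace_add[OF HC_subspace HC(2)[OF u] HC(2)[OF u']] by (simp add: algebra_simps)
  qed (use u u' HC(1) in \<open>auto intro: cv.span_add subalgD(4)[OF subalg_sets(2)]\<close>)
qed

lemma Ach_one: "1 \<in> Ach D"
proof -
  have "0 \<in> Ppi D" using Qpi_Ppi[of 0] by simp
  thus ?thesis unfolding Ach_def using tilde_0 tau_0 by (metis (mono_tags, lifting) mem_Collect_eq)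
qed

lemma P_one: "P 1 = 1"
  by (rule P_eqI)
    (auto intro: cv.span_base Ach_one subalgD(2)[OF subalg_sets(2)] simp: cv.subspace_0[OF HC_subspace])

lemma Ach_mult:
  assumes "a \<in> cv.span (Ach D)" "b \<in> cv.span (Ach D)"
  shows "a * b \<in> cv.span (Ach D)"
  using assms(1)
proof (induction rule: cv.span_induct_alt)
  case (step c x y)
  have "x * b \<in> cv.span (Ach D)"
    using assms(2)
  proof (induction rule: cv.span_induct_alt)
    case (step d z w)
    obtain u v where uv: "x = tau D (tilde D u)" "u \<in> Ppi D" "z = tau D (tilde D v)" "v \<in> Ppi D"
      using \<open>x \<in> Ach D\<close> step(1) by (auto simp: Ach_def)
    have "u + v \<in> Ppi D"
      using uv(2,4) by (auto simp: Ppi_def ip_add_left add_divide_distrib ring_distribs intro: Ints_add)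
    hence "x * z \<in> Ach D" unfolding Ach_def uv(1,3) tau_add tilde_add[symmetric] by blast
    thus ?case using step(2) by (simp add: ring_distribs qscale_mult_right cv.span_add cv.span_scale cv.span_base)
  qed (simp add: cv.span_zero)
  thus ?case using step(2) by (simp add: ring_distribs qscale_mult_left cv.span_add cv.span_scale)
qed (simp add: cv.span_zero)

text \<open>An element of the span of \<open>Ach D\<close> is a combination of tau(\<gamma>) with
  \<Theta> \<gamma> = -\<gamma>, on which the dominant characters are independent; the modules serve
  to evaluate \<open>zchar\<close>.\<close>

lemma zchar_separates:
  assumes a: "a \<in> cv.span (Ach D)" and 0: "\<And>M. M \<in> Pplus2Sigma D ==> zchar D M a = 0"
  shows "a = 0"
proof -
  obtain T r where T: "finite T" "T \<subseteq> Ach D" "a = (\<Sum>x\<in>T. r x *\<^sub>q x)"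
    using a unfolding cv.span_explicit by blast
  have "\<forall>x\<in>T. \<exists>v. x = tau D v \<and> Th D v = - v" using T(2) Th_tilde by (fastforce simp: Ach_def)
  then obtain \<gamma> where \<gamma>: "\<And>x. x \<in> T ==> x = tau D (\<gamma> x)" "\<And>x. x \<in> T ==> Th D (\<gamma> x) = - \<gamma> x" by metis
  have inj: "inj_on \<gamma> T" using \<gamma>(1) by (metis inj_onI)
  have "r x = 0" if x: "x \<in> T" for x
  proof -
    have "r (tau D (\<gamma> x)) = 0"
    proof (rule qchars_independent[where \<Gamma> = "\<gamma> ` T" and c = "\<lambda>v. r (tau D v)"])
      fix M assume L: "M \<in> Pplus2Sigma D"
      interpret m: hwmod D M "V M" "act M" by (rule zonal(1)[OF L])
      have "m.rep a m.hv = (\<Sum>x\<in>T. r x * qpow (ip D M (\<gamma> x))) *\<^sub>q m.hv"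
        unfolding T(3) cv.scale_sum_left m.rep_sum[OF m.hv(1)]
        by (intro sum.cong refl, subst (2) \<gamma>(1)) (simp_all add: m.rep_scale m.hv(1) m.rep_tau[OF m.hv_wsp] qscale_qscale)
      moreover have "m.rep a m.hv = 0" using m.zchar_rep[of a] a m.Ach_span 0[OF L] by auto
      ultimately have "(\<Sum>x\<in>T. r x * qpow (ip D M (\<gamma> x))) = 0" using m.hv(2) by simp
      moreover have "(\<Sum>x\<in>T. r x * qpow (ip D M (\<gamma> x))) = (\<Sum>x\<in>T. r (tau D (\<gamma> x)) * qpow (ip D M (\<gamma> x)))"
        by (intro sum.cong refl) (simp flip: \<gamma>(1))
      ultimately show "(\<Sum>v\<in>\<gamma> ` T. r (tau D v) * qpow (ip D M v)) = 0" by (simp add: sum.reindex[OF inj])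
    qed (use T(1) \<gamma>(2) x in auto)
    thus ?thesis using \<gamma>(1)[OF x] by simp
  qed
  thus ?thesis using T(3) by simp
qed

lemma zchar_linear:
  assumes L: "M \<in> Pplus2Sigma D" and a: "a \<in> cv.span (Ach D)" "b \<in> cv.span (Ach D)"
  shows "zchar D M (a - b) = zchar D M a - zchar D M b" "zchar D M (a * b) = zchar D M a * zchar D M b"
proof -
  interpret m: hwmod D M "V M" "act M" by (rule zonal(1)[OF L])
  have s: "a \<in> cv.span (range (tau D))" "b \<in> cv.span (range (tau D))" "a - b \<in> cv.span (range (tau D))"
    "a * b \<in> cv.span (range (tau D))"
    using a cv.span_diff[OF a] Ach_mult[OF a] m.Ach_span by auto
  have "zchar D M (a - b) *\<^sub>q m.hv = (zchar D M a - zchar D M b) *\<^sub>q m.hv"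
    unfolding m.zchar_rep[OF s(3), symmetric] m.rep_diff[OF m.hv(1)] m.zchar_rep[OF s(1)] m.zchar_rep[OF s(2)]
    by (simp add: qscale_diff)
  thus "zchar D M (a - b) = zchar D M a - zchar D M b" using m.hv(2) by (simp add: cv.scale_cancel_right)
  have "zchar D M (a * b) *\<^sub>q m.hv = (zchar D M a * zchar D M b) *\<^sub>q m.hv"
    unfolding m.zchar_rep[OF s(4), symmetric] m.rep_mult[OF m.hv(1)] m.zchar_rep[OF s(2)] m.rep_linear(2)[OF m.hv(1)]
      m.zchar_rep[OF s(1)] by (simp add: qscale_qscale mult.commute)
  thus "zchar D M (a * b) = zchar D M a * zchar D M b" using m.hv(2) by (simp add: cv.scale_cancel_right)
qed

text \<open>A product acts on the invariant functional by the product of the scalars, and dominant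
  characters separate the values of P.\<close>

lemma P_mult:
  assumes u: "u \<in> UB D B" and u': "u' \<in> UB D B"
  shows "P (u * u') = P u * P u'"
proof -
  note U = UB(2)[OF u] UB(2)[OF u']
  have uu: "u * u' \<in> Uch D" using U by (rule subalgD(5)[OF subalg_sets(2)])
  have s: "P (u * u') \<in> cv.span (Ach D)" "P u * P u' \<in> cv.span (Ach D)" using HC(1) uu U Ach_mult by auto
  have "P (u * u') - P u * P u' = 0"
  proof (rule zchar_separates[OF cv.span_diff[OF s]])
    fix M assume L: "M \<in> Pplus2Sigma D"
    interpret m: hwmod D M "V M" "act M" by (rule zonal(1)[OF L])
    obtain \<eta> where \<eta>: "m.binv B \<eta>" "\<eta> m.hv \<noteq> 0" using spherical_functional[OF L] by blast
    have "zchar D M (P (u * u')) * \<eta> m.hv = zchar D M (P u) * zchar D M (P u') * \<eta> m.hv"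
      using m.binv_scalar[OF B \<eta>(1) hc subalgD(5)[OF UB(1) u u'] m.hv(1)] m.binv_scalar[OF B \<eta>(1) hc u m.rep_V[OF m.hv(1)], of u']
        m.binv_scalar[OF B \<eta>(1) hc u' m.hv(1)] by (auto simp: m.rep_mult m.hv(1))
    hence "zchar D M (P (u * u')) = zchar D M (P u) * zchar D M (P u')"
      using \<eta>(2) by simp
    hence "zchar D M (P (u * u')) = zchar D M (P u * P u')"
      using zchar_linear(2)[OF L HC(1)[OF U(1)] HC(1)[OF U(2)]] by simp
    thus "zchar D M (P (u * u') - P u * P u') = 0" using zchar_linear(1)[OF L s] by simp
  qed
  thus ?thesis by simp
qed

lemma P_kernel: "{u \<in> UB D B. P u = 0} = UB D B \<inter> BTplusU D B"
proof (intro equalityI subsetI)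
  fix u assume "u \<in> UB D B \<inter> BTplusU D B"
  hence u: "u \<in> UB D B" "u \<in> BTplusU D B" by auto
  have "P u = 0"
    by (rule P_eqI[OF UB(2)[OF u(1)] cv.span_zero]) (use BTplusU_HC[OF u(2)] in simp)
  thus "u \<in> {u \<in> UB D B. P u = 0}" using u by simp
next
  fix u assume "u \<in> {u \<in> UB D B. P u = 0}"
  hence u: "u \<in> UB D B" "P u = 0" by auto
  have "u \<in> HC_complement D B" using HC(2)[OF UB(2)[OF u(1)]] u(2) by simp
  then obtain a b where ab: "u = a + b" "a \<in> BTplusU D B" "b \<in> span_prod (aug (Nplus D)) (Ach D)"
    unfolding HC_complement_def by blast
  obtain \<Gamma> F where F: "finite \<Gamma>" "\<And>\<gamma>. \<gamma> \<in> \<Gamma> ==> Th D \<gamma> = - \<gamma>" "\<And>\<gamma>. F \<gamma> \<in> nfree" "b = (\<Sum>\<gamma>\<in>\<Gamma>. fx (F \<gamma>) * tau D \<gamma>)"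
    using Nplus_Ach_form[OF ab(3)] by blast
  \<comment> \<open>As P u = 0, the invariant functionals annihilate both u and a on every
    L(\<lambda>), hence also b.\<close>
  have "b = 0"
  proof (rule kernel_zero[OF F])
    fix M and G :: "'n wt => 'n free" and "is" :: "'n list"
    assume L: "M \<in> Pplus2Sigma D" and G: "\<And>\<gamma>. G \<gamma> \<in> fge (length is)" "b = (\<Sum>\<gamma>\<in>\<Gamma>. fx (G \<gamma>) * tau D \<gamma>)"
    interpret m: hwmod D M "V M" "act M" by (rule zonal(1)[OF L])
    obtain \<eta> where \<eta>: "m.binv B \<eta>" "\<eta> m.hv \<noteq> 0" using spherical_functional[OF L] by blast
    show "zval D (\<Sum>\<gamma>\<in>\<Gamma>. single \<gamma> (qpow (- ip D \<gamma> (wtl is))) * ep is (G \<gamma>)) M = 0"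
    proof (rule m.annihilator_zval[of \<eta> b G "is" \<Gamma>])
      show "ip D M \<gamma> = 0" if "Th D \<gamma> = \<gamma>" for \<gamma>
        by (rule m.binv_fixed_weight[OF B \<eta>(1) m.hv_wsp \<eta>(2) that])
      show "\<eta> (c *\<^sub>q m.hv) = c * \<eta> m.hv" for c by (rule m.binvD(2)[OF \<eta>(1) m.hv(1)])
      show "\<eta> (m.rep b w) = 0" if w: "w \<in> V M" for w
      proof -
        have "m.rep u w = m.rep a w + m.rep b w" using w by (simp add: ab(1) m.rep_add)
        hence "\<eta> (m.rep u w) = \<eta> (m.rep a w) + \<eta> (m.rep b w)"
          using m.binvD(1)[OF \<eta>(1)] m.rep_V[OF w] by simp
        thus ?thesis using m.binv_scalar[OF B \<eta>(1) hc u(1) w] u(2) m.zchar_0 m.binv_BTplusU[OF B \<eta>(1) ab(2) w] by simp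
      qed
    qed (use \<eta> G in auto)
  qed
  thus "u \<in> UB D B \<inter> BTplusU D B" using u(1) ab by simp
qed

text \<open>Both conditions amount to z^\<lambda>(P u) = 0 for all dominant \<lambda>: the
  \<phi>_\<lambda>, with their nonzero leading coefficients, detect both the scalar and the
  difference operator.\<close>

lemma X_kernel:
  assumes u: "u \<in> UB D B"
  shows "\<X> u = rop_zero \<longleftrightarrow> P u = 0"
proof -
  have X: "\<X> u \<in> diffops D" using rc u by (simp add: radial_component_def diffops_inv_def)
  have e: "\<X> u (Fract (\<phi> M) 1) = Fract (single 0 (zchar D M (P u)) * \<phi> M) 1"
    if "M \<in> Pplus2Sigma D" for M using rc u that unfolding radial_component_def by blast
  show ?thesis
  proof
    assume "P u = 0"
    have "zchar D M 0 = 0" if "M \<in> Pplus2Sigma D" for M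
      using hwmod.zchar_0[OF zonal(1)[OF that]] .
    hence 0: "\<X> u (Fract (\<phi> M) 1) = 0" if "M \<in> Pplus2Sigma D" for M
      using e[OF that] that \<open>P u = 0\<close> by (simp add: Zero_fract_def)
    show "\<X> u = rop_zero" by (rule diffop_eq_zero[OF Q X zonal(4) phi_leading 0])
  next
    assume X0: "\<X> u = rop_zero"
    show "P u = 0"
    proof (rule zchar_separates[OF HC(1)[OF UB(2)[OF u]]])
      fix M assume L: "M \<in> Pplus2Sigma D"
      have "single 0 (zchar D M (P u)) * \<phi> M = 0"
        using e[OF L] by (simp add: X0 rop_zero_def Zero_fract_def eq_fract)
      hence "lookup (single 0 (zchar D M (P u)) * \<phi> M) M = 0" by (simp only: lookup_zero)
      thus "zchar D M (P u) = 0" using phi_leading(1)[OF L] by (simp add: lookup_single_times)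
    qed
  qed
qed

lemma X_hom: "u \<in> UB D B ==> u' \<in> UB D B ==> \<X> (u + u') = rop_add (\<X> u) (\<X> u')"
  "u \<in> UB D B ==> u' \<in> UB D B ==> \<X> (u * u') = rop_mult (\<X> u) (\<X> u')"
  "u \<in> UB D B ==> \<X> (c *\<^sub>q u) = rop_scale c (\<X> u)"
  using rc unfolding radial_component_def by blast+

lemma X_eq_iff:
  assumes u: "u \<in> UB D B" and u': "u' \<in> UB D B"
  shows "\<X> u = \<X> u' \<longleftrightarrow> P u = P u'"
proof -
  have m: "(-1) *\<^sub>q u' \<in> UB D B" using u' by (rule subalgD(6)[OF UB(1)])
  have d: "u + (-1) *\<^sub>q u' \<in> UB D B" by (rule subalgD(4)[OF UB(1) u m])
  have "\<X> (u + (-1) *\<^sub>q u') = rop_add (\<X> u) (rop_scale (-1) (\<X> u'))"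
    unfolding X_hom(1)[OF u m] X_hom(3)[OF u'] ..
  also have "\<dots> = (\<lambda>x. \<X> u x - \<X> u' x)"
  proof -
    have "Fract (single 0 (- 1)) 1 = (- 1 :: 'n zfrac)"
      by (simp add: single_uminus single_one One_fract_def)
    thus ?thesis by (simp add: rop_add_def rop_scale_def)
  qed
  finally have "\<X> (u + (-1) *\<^sub>q u') = rop_zero \<longleftrightarrow> \<X> u = \<X> u'" by (auto simp: rop_zero_def fun_eq_iff)
  moreover have "P (u + (-1) *\<^sub>q u') = P u - P u'"
    using P_linear(1)[OF UB(2)[OF u] UB(2)[OF m]] P_linear(2)[OF UB(2)[OF u'], of "-1"] by (simp add: qscale_one)
  ultimately show ?thesis using X_kernel[OF d] by auto
qed

lemma radial_iso:
  "(\<exists>\<Psi>. (\<forall>u\<in>UB D B. \<Psi> (\<X> u) = P u) \<and> rop_alg_iso D \<Psi> (\<X> ` UB D B) (P ` UB D B)) \<and>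
   {u \<in> UB D B. \<X> u = rop_zero} = UB D B \<inter> BTplusU D B \<and>
   {u \<in> UB D B. P u = 0} = UB D B \<inter> BTplusU D B"
proof (intro conjI)
  \<comment> \<open>P of an arbitrary preimage; \<open>X_eq_iff\<close> makes the choice
    irrelevant.\<close>
  define \<Psi> where "\<Psi> S = P (SOME u. u \<in> UB D B \<and> \<X> u = S)" for S
  have \<Psi>: "\<Psi> (\<X> u) = P u" if "u \<in> UB D B" for u
  proof -
    have "(SOME u'. u' \<in> UB D B \<and> \<X> u' = \<X> u) \<in> UB D B \<and> \<X> (SOME u'. u' \<in> UB D B \<and> \<X> u' = \<X> u) = \<X> u"
      by (rule someI[of _ u]) (use that in simp)
    thus ?thesis unfolding \<Psi>_def using X_eq_iff that by blast
  qed
  have "rop_alg_iso D \<Psi> (\<X> ` UB D B) (P ` UB D B)"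
    unfolding rop_alg_iso_def
  proof (intro conjI ballI allI)
    have "\<Psi> ` \<X> ` UB D B = P ` UB D B" using \<Psi> by (simp add: image_image cong: image_cong)
    moreover have "inj_on \<Psi> (\<X> ` UB D B)" using \<Psi> X_eq_iff by (auto intro!: inj_onI)
    ultimately show "bij_betw \<Psi> (\<X> ` UB D B) (P ` UB D B)" by (simp add: bij_betw_def)
    show "\<Psi> (rop_one D) = 1"
      using \<Psi>[OF subalgD(2)[OF UB(1)]] P_one rc by (simp add: radial_component_def)
  next
    fix S S' assume "S \<in> \<X> ` UB D B" "S' \<in> \<X> ` UB D B"
    then obtain u u' where *: "u \<in> UB D B" "u' \<in> UB D B" "S = \<X> u" "S' = \<X> u'" by blast
    show "\<Psi> (rop_add S S') = \<Psi> S + \<Psi> S'"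
      using \<Psi>[OF subalgD(4)[OF UB(1) *(1,2)]] \<Psi> * P_linear(1) UB(2) X_hom(1) by simp
    show "\<Psi> (rop_mult S S') = \<Psi> S * \<Psi> S'"
      using \<Psi>[OF subalgD(5)[OF UB(1) *(1,2)]] \<Psi> * P_mult X_hom(2) by simp
  next
    fix c S assume "S \<in> \<X> ` UB D B"
    then obtain u where *: "u \<in> UB D B" "S = \<X> u" by blast
    show "\<Psi> (rop_scale c S) = c *\<^sub>q \<Psi> S"
      using \<Psi>[OF subalgD(6)[OF UB(1) *(1)], of c] \<Psi>[OF *(1)] *(2) P_linear(2)[OF UB(2)[OF *(1)]] X_hom(3)[OF *(1)] by simp
  qed
  thus "\<exists>\<Psi>. (\<forall>u\<in>UB D B. \<Psi> (\<X> u) = P u) \<and> rop_alg_iso D \<Psi> (\<X> ` UB D B) (P ` UB D B)" using \<Psi> by blast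
  show "{u \<in> UB D B. P u = 0} = UB D B \<inter> BTplusU D B" by (rule P_kernel)
  thus "{u \<in> UB D B. \<X> u = rop_zero} = UB D B \<inter> BTplusU D B" using X_kernel by auto
qed

end

theorem corollary4p2:
  fixes h :: "'g::complex_lie set"
    and \<alpha> :: "'n::{finite,linorder} \<Rightarrow> 'g \<Rightarrow> complex"
    and e f :: "'n \<Rightarrow> 'g"
    and \<theta> :: "'g \<Rightarrow> 'g"
    and D :: "('n, 'u::chopf) qsp"
    and R :: "cc set"
    and B B' :: "'u set"
    and P :: "'u \<Rightarrow> 'u"
    and V :: "'n wt \<Rightarrow> 'v::cvec set"
    and act :: "'n wt \<Rightarrow> 'u \<Rightarrow> 'v \<Rightarrow> 'v"
    and g :: "'n wt \<Rightarrow> 'u \<Rightarrow> cc"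
    and \<phi> :: "'n wt \<Rightarrow> 'n zalg"
    and \<X> :: "'u \<Rightarrow> 'n rop"
  assumes "symmetric_pair h \<alpha> e f \<theta> D"
    and "quantum_group D"
    and "is_real_closure R"
    and "B \<in> Bfam R D"
    and "B' \<in> Bfam R D"
    and "harish_chandra D B P"
    and "zonal_family D B B' V act g \<phi>"
    and "radial_component D B P g \<phi> \<X>"
  shows "(\<exists>\<Psi>. (\<forall>u\<in>UB D B. \<Psi> (\<X> u) = P u) \<and> rop_alg_iso D \<Psi> (\<X> ` UB D B) (P ` UB D B)) \<and>
         {u \<in> UB D B. \<X> u = rop_zero} = UB D B \<inter> BTplusU D B \<and>
         {u \<in> UB D B. P u = 0} = UB D B \<inter> BTplusU D B"
  proof -
  interpret s: sym_pair h \<alpha> e f \<theta> D by unfold_locales (rule assms)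
  interpret q: qgroup D by unfold_locales (rule assms)
  interpret r: radial D R B B' P V act g \<phi> \<X> by unfold_locales (rule s.QSigma_PSigma assms)+
  show ?thesis by (rule r.radial_iso)
qed

end
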